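(* Let $m\in\mathbb{R}$, $\gamma\in(0,1)$, and let the prior be the normal distribution $\mu=\mathcal{N}(m,\gamma^2)$ with mean $m$ and variance $\gamma^2$. Let $\mathcal{C}$ be the continuation region of the problem of optimally stopping a Brownian bridge with unknown pinning point with prior $\mu$. Then there exists a decreasing continuous function $b:[0,1]\to\mathbb{R}$ with $b(1)=\frac{m}{1-\gamma^2}$ such that $\mathcal{C}=\{(t,z)\in[0,1)\times\mathbb{R}:z<b(t)\}$. Moreover, $b$ is the unique continuous solution of the integral equation $$b(t)=h(t,b(t))-\int_0^{1-t}\mathbb{E}\left[\frac{h(t+u,Z^{t,b(t)}_{t+u})-Z^{t,b(t)}_{t+u}}{1-t-u}\,\mathbf{1}_{\{Z^{t,b(t)}_{t+u}>b(t+u)\}}\right]du,\qquad t\in[0,1),$$ satisfying $b(t)\ge\frac{m}{1-\gamma^2}$ for all $t\in[0,1]$.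
   Context: "Decreasing" is understood in the weak sense. For $(t,z)\in[0,1)\times\mathbb{R}$, $$\mu_{t,z}(du):=\frac{e^{\frac{uz}{1-t}-\frac{tu^2}{2(1-t)}}\,\mu(du)}{\int_{\mathbb{R}}e^{\frac{uz}{1-t}-\frac{tu^2}{2(1-t)}}\,\mu(du)},\qquad h(t,z):=\int_{\mathbb{R}}u\,\mu_{t,z}(du);$$ for the normal prior, $\frac{h(t,z)-z}{1-t}=\frac{m-z(1-\gamma^2)}{1-t(1-\gamma^2)}$. The process $Z^{t,z}$ is the solution of $$dZ_{t+s}=\frac{h(t+s,Z_{t+s})-Z_{t+s}}{1-(t+s)}\,ds+d\hat W_{t+s},\quad0\le s<1-t,\qquad Z_t=z,$$ with $\hat W$ a standard Brownian motion, extended to time $1$ by its a.s. limit; equivalently, in law, it is a Brownian bridge started at time $t$ from $z$ whose (unknown) pinning point at time $1$ has distribution $\mu_{t,z}$. The value function is $$v(t,z)=\sup_{\tau\in\mathcal{T}^Z_{1-t}}\mathbb{E}[Z^{t,z}_{t+\tau}],\qquad(t,z)\in[0,1)\times\mathbb{R},$$ where $\mathcal{T}^Z_{1-t}$ is the set of $[0,1-t]$-valued stopping times with respect to the filtration generated by $s\mapsto Z^{t,z}_{t+s}$. The continuation region is $\mathcal{C}:=\{(t,z)\in[0,1)\times\mathbb{R}:v(t,z)>z\}$. Uniqueness is among continuous functions $b:[0,1]\to\mathbb{R}$ satisfying the stated lower bound. *)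

theory Defs
  imports "HOL-Probability.Probability"
begin

definition normal_prior :: "real \<Rightarrow> real \<Rightarrow> real measure" where
  "normal_prior m \<gamma> = density lborel (\<lambda>x. ennreal (normal_density m \<gamma> x))"

definition posterior_weight :: "real \<Rightarrow> real \<Rightarrow> real \<Rightarrow> real" where
  "posterior_weight t z u = exp (u * z / (1 - t) - t * u\<^sup>2 / (2 * (1 - t)))"

definition posterior :: "real measure \<Rightarrow> real \<Rightarrow> real \<Rightarrow> real measure" where
  "posterior \<mu> t z =
     density \<mu> (\<lambda>u. ennreal (posterior_weight t z u / (\<integral>y. posterior_weight t z y \<partial>\<mu>)))"

definition posterior_mean :: "real measure \<Rightarrow> real \<Rightarrow> real \<Rightarrow> real" where
  "posterior_mean \<mu> t z = (\<integral>u. u \<partial>posterior \<mu> t z)"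

definition drift :: "real measure \<Rightarrow> real \<Rightarrow> real \<Rightarrow> real" where
  "drift \<mu> t z = (posterior_mean \<mu> t z - z) / (1 - t)"

definition standard_brownian_motion_on ::
  "'a measure \<Rightarrow> real set \<Rightarrow> (real \<Rightarrow> 'a \<Rightarrow> real) \<Rightarrow> bool" where
  "standard_brownian_motion_on M I W \<longleftrightarrow>
     (\<forall>s\<in>I. W s \<in> borel_measurable M) \<and>
     (AE \<omega> in M. W 0 \<omega> = 0) \<and>
     (AE \<omega> in M. continuous_on I (\<lambda>s. W s \<omega>)) \<and>
     (\<forall>r\<in>I. \<forall>s\<in>I. r < s \<longrightarrow>
        distributed M lborel (\<lambda>\<omega>. W s \<omega> - W r \<omega>) (normal_density 0 (sqrt (s - r)))) \<and>
     (\<forall>(n::nat) ts. ts ` {..n} \<subseteq> I \<and> strict_mono_on {..n} ts \<longrightarrow>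
        prob_space.indep_vars M (\<lambda>_. borel)
          (\<lambda>i \<omega>. W (ts (Suc i)) \<omega> - W (ts i) \<omega>) {..<n})"

(* Since the noise is additive, the stochastic differential equation for Z on [t,1), with driving
   Brownian motion W, is a pathwise integral equation.  All paths (not only almost all) are taken
   continuous on [t,1); this keeps Z measurable when it is evaluated at a stopping time. *)
definition is_solution_from ::
  "real measure \<Rightarrow> real \<Rightarrow> real \<Rightarrow> 'a measure \<Rightarrow> (real \<Rightarrow> 'a \<Rightarrow> real) \<Rightarrow> (real \<Rightarrow> 'a \<Rightarrow> real) \<Rightarrow> bool" where
  "is_solution_from \<mu> t z M W Z \<longleftrightarrow>
     prob_space M \<and>
     standard_brownian_motion_on M {0..<1} W \<and>
     (\<forall>s\<in>{t..1}. Z s \<in> borel_measurable M) \<and>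
     (\<forall>\<omega>\<in>space M. continuous_on {t..<1} (\<lambda>s. Z s \<omega>)) \<and>
     (AE \<omega> in M. \<forall>s\<in>{0..<1 - t}.
        set_integrable lborel {0..s} (\<lambda>r. drift \<mu> (t + r) (Z (t + r) \<omega>)) \<and>
        Z (t + s) \<omega> = z + (LINT r:{0..s}|lborel. drift \<mu> (t + r) (Z (t + r) \<omega>))
                         + (W (t + s) \<omega> - W t \<omega>)) \<and>
     (AE \<omega> in M. ((\<lambda>s. Z s \<omega>) \<longlongrightarrow> Z 1 \<omega>) (at_left 1))"

(* Indexed by the time s elapsed since t: generated by Z (t + r) for 0 <= r <= min s (1 - t). *)
definition natural_filtration_from ::
  "'a measure \<Rightarrow> real \<Rightarrow> (real \<Rightarrow> 'a \<Rightarrow> real) \<Rightarrow> real \<Rightarrow> 'a measure" where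
  "natural_filtration_from M t Z s =
     sigma (space M)
       {Z (t + r) -` A \<inter> space M | r A. r \<in> {0..min s (1 - t)} \<and> A \<in> sets borel}"

definition stopping_times_from ::
  "'a measure \<Rightarrow> real \<Rightarrow> (real \<Rightarrow> 'a \<Rightarrow> real) \<Rightarrow> ('a \<Rightarrow> real) set" where
  "stopping_times_from M t Z =
     {\<tau>. stopping_time (natural_filtration_from M t Z) \<tau> \<and> (\<forall>\<omega>\<in>space M. \<tau> \<omega> \<in> {0..1 - t})}"

(* Here, and below, M t z and Z t z are the probability space and the process started at time t
   from z, both indexed by absolute time: Z t z s is the value at time s, for s in [t,1]. *)
definition value_fun ::
  "(real \<Rightarrow> real \<Rightarrow> 'a measure) \<Rightarrow> (real \<Rightarrow> real \<Rightarrow> real \<Rightarrow> 'a \<Rightarrow> real) \<Rightarrow> real \<Rightarrow> real \<Rightarrow> real" where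
  "value_fun M Z t z =
     (SUP \<tau>\<in>stopping_times_from (M t z) t (Z t z). \<integral>\<omega>. Z t z (t + \<tau> \<omega>) \<omega> \<partial>M t z)"

definition continuation_region ::
  "(real \<Rightarrow> real \<Rightarrow> 'a measure) \<Rightarrow> (real \<Rightarrow> real \<Rightarrow> real \<Rightarrow> 'a \<Rightarrow> real) \<Rightarrow> (real \<times> real) set" where
  "continuation_region M Z = {(t, z). t \<in> {0..<1} \<and> value_fun M Z t z > z}"

definition boundary_equation ::
  "real measure \<Rightarrow> (real \<Rightarrow> real \<Rightarrow> 'a measure) \<Rightarrow> (real \<Rightarrow> real \<Rightarrow> real \<Rightarrow> 'a \<Rightarrow> real) \<Rightarrow>
   (real \<Rightarrow> real) \<Rightarrow> bool" where
  "boundary_equation \<mu> M Z b \<longleftrightarrow>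
     (\<forall>t\<in>{0..<1}.
        b t = posterior_mean \<mu> t (b t) -
          (LINT u:{0..<1 - t}|lborel.
             (\<integral>\<omega>. drift \<mu> (t + u) (Z t (b t) (t + u) \<omega>) *
                   indicator {y. y > b (t + u)} (Z t (b t) (t + u) \<omega>) \<partial>M t (b t))))"

end

theory Submission
  imports Defs
begin

text \<open>
  Put \<open>\<alpha> = 1 - \<gamma>\<^sup>2\<close> and \<open>\<kappa> = m / \<alpha>\<close>. For the normal prior the drift is
  \<open>- \<alpha> (z - \<kappa>) / (1 - \<alpha> s)\<close>, so \<open>(Z s - \<kappa>) / (1 - \<alpha> s)\<close> has independent centred Gaussian
  increments, and in the time to maturity \<open>\<rho> = ln ((1 - \<alpha> s) / \<gamma>\<^sup>2) / 2\<close> the rescaled process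
  \<open>\<xi> = sqrt (\<alpha> / (1 - \<alpha> s)) (Z - \<kappa>)\<close> is a stationary Ornstein-Uhlenbeck process. The reward
  becomes \<open>\<xi>\<close> killed at rate 1, a time-homogeneous problem with horizon \<open>\<rho>\<close>.

  Its value is the limit of Bellman iterations along dyadic time steps. Since the value minus \<open>x\<close>
  decreases in \<open>x\<close> and increases in \<open>\<rho>\<close>, the continuation region is the set below an increasing
  boundary; left and right limits of the boundary agree. The value along the semigroup flow has
  a right derivative given by the killed generator applied to the identity, \<open>- 2 x\<close>, above the
  boundary; integrating it gives the early exercise premium formula, which at the boundary is the
  integral equation.

  For uniqueness, the premium function of another solution \<open>b\<close> equals \<open>x\<close> above \<open>b\<close> and is bounded
  by the value. Hence \<open>b\<close> lies below the optimal boundary, and comparing the two premiums along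
  the flow forces equality.
\<close>

section \<open>The killed Ornstein-Uhlenbeck semigroup\<close>

text \<open>The bridge lives on an arbitrary probability space, possibly a different one for each
  starting point, and only its raw natural filtration is available. So the value is constructed
  independently of that space, as a function of \<open>\<rho>\<close> and \<open>x\<close>, and is
  identified with the supremum over stopping times afterwards: composed with the process on a time
  grid it gives supermartingales, and every dyadic approximation is the exact reward of one stopping
  time. The killing at rate 1 comes from the rescaling: \<open>Z s - \<kappa>\<close> is a constant
  times \<open>exp (- (elapsed clock)) * \<xi>\<close>, so the discount turns \<open>\<xi>\<close>
  back into the bridge.

  All local information is extracted from the semigroup \<open>ou\<close> over a short step
  \<open>h\<close>. Near a point off the boundary a function is replaced by zero or by the identity,
  on which \<open>ou\<close> is explicit; a Chebyshev bound with the fourth moment makes the error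
  \<open>O(h^2)\<close>. Being of smaller order than \<open>h\<close>, it disappears in the right
  derivative along the flow, in the exclusion of a jump of the boundary, and in the maximum
  principle, where the strict gain \<open>1 - exp (- h)\<close> is of order
  \<open>h\<close>.\<close>

abbreviation gauss :: "real measure" where
  "gauss \<equiv> std_normal_distribution"

interpretation gauss: real_distribution gauss
  by (rule real_dist_normal_dist)

text \<open>The transition operator of \<open>d\<xi> = - \<xi> d\<rho> + sqrt 2 dB\<close>, whose
  stationary law is standard normal, killed at rate 1; the prefactor \<open>exp (- h)\<close> is the
  survival probability.\<close>

definition ou :: "real \<Rightarrow> (real \<Rightarrow> real) \<Rightarrow> real \<Rightarrow> real" where
  "ou h g x = exp (- h) * (\<integral>y. g (exp (- h) * x + sqrt (1 - exp (- 2 * h)) * y) \<partial>gauss)"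

section \<open>Measurable functions of quartic growth\<close>

text \<open>Order 4 and not linear growth, because the error estimates feed
  \<open>(\<xi> - x)^4\<close> into the semigroup.\<close>

definition quartic_growth :: "(real \<Rightarrow> real) \<Rightarrow> bool" where
  "quartic_growth g \<longleftrightarrow> g \<in> borel_measurable borel \<and> (\<exists>C. \<forall>x. \<bar>g x\<bar> \<le> C * (1 + x ^ 4))"

lemma quartic_growthI:
  assumes "g \<in> borel_measurable borel" "\<And>x. \<bar>g x\<bar> \<le> C * (1 + x ^ 4)"
  shows "quartic_growth g"
  using assms by (auto simp: quartic_growth_def)

lemma quartic_growth_measurable [measurable_dest]: "quartic_growth g \<Longrightarrow> g \<in> borel_measurable borel"
  by (simp add: quartic_growth_def)

lemma sum_pow4_le: "(a + b :: real) ^ 4 \<le> 8 * (a ^ 4 + b ^ 4)"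
proof -
  have 1: "(a + b)\<^sup>2 \<le> 2 * (a\<^sup>2 + b\<^sup>2)"
    using zero_le_power2[of "a - b"] by (simp add: power2_eq_square algebra_simps)
  have "(a + b) ^ 4 = ((a + b)\<^sup>2)\<^sup>2" by simp
  also have "\<dots> \<le> (2 * (a\<^sup>2 + b\<^sup>2))\<^sup>2" using 1 by (intro power_mono) auto
  also have "\<dots> = 4 * (a\<^sup>2 + b\<^sup>2)\<^sup>2" by (simp only: power_mult_distrib) simp
  also have "(a\<^sup>2 + b\<^sup>2)\<^sup>2 \<le> 2 * (a ^ 4 + b ^ 4)"
    using zero_le_power2[of "a\<^sup>2 - b\<^sup>2"] by (simp add: power2_eq_square algebra_simps power4_eq_xxxx)
  finally show ?thesis by simp
qed

lemma abs_le_one_plus_pow4: "\<bar>x :: real\<bar> \<le> 1 + x ^ 4"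
proof -
  have "2 * \<bar>x\<bar> \<le> 1 + x\<^sup>2"
    using zero_le_power2[of "\<bar>x\<bar> - 1"] by (simp add: power2_eq_square algebra_simps)
  moreover have "2 * x\<^sup>2 \<le> 1 + x ^ 4"
    using zero_le_power2[of "x\<^sup>2 - 1"] by (simp add: power2_eq_square algebra_simps power4_eq_xxxx)
  moreover have "0 \<le> x ^ 4" by simp
  ultimately show ?thesis by linarith
qed

lemma quartic_growth_linear:
  assumes "g \<in> borel_measurable borel" "\<And>x. \<bar>g x\<bar> \<le> C * (1 + \<bar>x\<bar>)"
  shows "quartic_growth g"
proof (rule quartic_growthI[OF assms(1)])
  fix x :: real
  have C: "0 \<le> C" using assms(2)[of 0] by simp
  have "\<bar>g x\<bar> \<le> C * (1 + \<bar>x\<bar>)" by (rule assms)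
  also have "\<dots> \<le> C * (2 * (1 + x ^ 4))"
  proof (rule mult_left_mono[OF _ C])
    have "0 \<le> x ^ 4" by simp
    then show "1 + \<bar>x\<bar> \<le> 2 * (1 + x ^ 4)" using abs_le_one_plus_pow4[of x] by (simp only: distrib_left)
  qed
  finally show "\<bar>g x\<bar> \<le> (2 * C) * (1 + x ^ 4)" by (simp add: algebra_simps)
qed

lemma quartic_growth_bound:
  assumes "quartic_growth g"
  obtains C where "0 \<le> C" "\<And>x. \<bar>g x\<bar> \<le> C * (1 + x ^ 4)"
proof -
  obtain C where C: "\<And>x. \<bar>g x\<bar> \<le> C * (1 + x ^ 4)"
    using assms by (auto simp: quartic_growth_def)
  moreover from C[of 0] have "0 \<le> C" by simp
  ultimately show ?thesis using that by blast
qed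

lemma quartic_growth_add:
  assumes "quartic_growth f" "quartic_growth g" shows "quartic_growth (\<lambda>x. f x + g x)"
proof -
  obtain C D where "\<And>x. \<bar>f x\<bar> \<le> C * (1 + x ^ 4)" "\<And>x. \<bar>g x\<bar> \<le> D * (1 + x ^ 4)"
    using assms by (meson quartic_growth_bound)
  then have "\<bar>f x + g x\<bar> \<le> (C + D) * (1 + x ^ 4)" for x
    by (simp add: distrib_right) (smt (verit))
  then show ?thesis using assms by (intro quartic_growthI) auto
qed

lemma quartic_growth_cmult:
  assumes "quartic_growth f" shows "quartic_growth (\<lambda>x. c * f x)"
proof -
  obtain C where C: "\<And>x. \<bar>f x\<bar> \<le> C * (1 + x ^ 4)"
    using assms by (meson quartic_growth_bound)
  have "\<bar>c * f x\<bar> \<le> (\<bar>c\<bar> * C) * (1 + x ^ 4)" for x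
    using mult_left_mono[OF C[of x], of "\<bar>c\<bar>"] by (simp add: abs_mult mult.assoc)
  then show ?thesis using assms by (intro quartic_growthI) auto
qed

lemma quartic_growth_diff:
  assumes "quartic_growth f" "quartic_growth g" shows "quartic_growth (\<lambda>x. f x - g x)"
  using quartic_growth_add[OF assms(1) quartic_growth_cmult[OF assms(2), of "-1"]] by simp

lemma quartic_growth_const [simp]: "quartic_growth (\<lambda>x. c)"
  by (rule quartic_growth_linear[where C="\<bar>c\<bar>"]) (auto simp: algebra_simps)

lemma quartic_growth_id [simp]: "quartic_growth (\<lambda>x. x)"
  by (rule quartic_growth_linear[where C=1]) auto

lemma quartic_growth_shift_pow4: "quartic_growth (\<lambda>\<xi>. (\<xi> - x) ^ 4)"
proof (rule quartic_growthI)
  fix \<xi> :: real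
  have "(\<xi> - x) ^ 4 \<le> 8 * (\<xi> ^ 4 + x ^ 4)" using sum_pow4_le[of \<xi> "-x"] by simp
  also have "\<dots> \<le> (8 + 8 * x ^ 4) * (1 + \<xi> ^ 4)"
    by (simp add: algebra_simps)
  finally show "\<bar>(\<xi> - x) ^ 4\<bar> \<le> (8 + 8 * x ^ 4) * (1 + \<xi> ^ 4)" by simp
qed auto

section \<open>Gaussian moments, convergence and sums\<close>

lemma integrable_gauss_pow [simp]: "integrable gauss (\<lambda>y. y ^ k)"
  by (rule integrable_std_normal_distribution_moment)

lemma integrable_gauss_id [simp]: "integrable gauss (\<lambda>y. y)"
  using integrable_gauss_pow[of 1] by simp

lemma integral_gauss_id [simp]: "(\<integral>y. y \<partial>gauss) = 0"
  using integral_std_normal_distribution_moment_odd[of 1] by simp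

lemma integral_gauss_pow2 [simp]: "(\<integral>y. y\<^sup>2 \<partial>gauss) = 1"
  using std_normal_distribution_even_moments(1)[of 1] by simp

lemma integral_gauss_pow4 [simp]: "(\<integral>y. y ^ 4 \<partial>gauss) = 3"
  using std_normal_distribution_even_moments(1)[of 2] by (simp add: fact_numeral)

lemma measure_gauss_UNIV [simp]: "measure gauss UNIV = 1"
  using gauss.prob_space by simp

lemma integrable_gauss_abs [simp]: "integrable gauss (\<lambda>y. \<bar>y\<bar>)"
  by (intro integrable_abs) simp

lemma integral_gauss_abs_le: "(\<integral>y. \<bar>y\<bar> \<partial>gauss) \<le> 1"
proof -
  have "\<bar>y\<bar> \<le> 1/2 + 1/2 * y\<^sup>2" for y :: real
    using zero_le_power2[of "\<bar>y\<bar> - 1"] by (simp add: power2_eq_square algebra_simps)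
  then have "(\<integral>y. \<bar>y\<bar> \<partial>gauss) \<le> (\<integral>y. 1/2 + 1/2 * y\<^sup>2 \<partial>gauss)"
    by (intro integral_mono) auto
  also have "\<dots> = 1" by simp
  finally show ?thesis .
qed

lemma sets_gauss [simp, measurable_cong]: "sets gauss = sets borel" by simp

lemma quartic_growth_integrable:
  assumes "quartic_growth g" shows "integrable gauss (\<lambda>y. g (a + b * y))"
proof -
  obtain C where C: "0 \<le> C" "\<And>x. \<bar>g x\<bar> \<le> C * (1 + x ^ 4)"
    using assms by (meson quartic_growth_bound)
  have m[measurable]: "g \<in> borel_measurable borel" using assms by (rule quartic_growth_measurable)
  show ?thesis
  proof (rule Bochner_Integration.integrable_bound)
    show "integrable gauss (\<lambda>y. C * (1 + 8 * (a ^ 4 + b ^ 4 * y ^ 4)))" by simp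
    show "AE y in gauss. norm (g (a + b * y)) \<le> norm (C * (1 + 8 * (a ^ 4 + b ^ 4 * y ^ 4)))"
    proof (rule AE_I2)
      fix y
      have "\<bar>g (a + b * y)\<bar> \<le> C * (1 + (a + b * y) ^ 4)" by (rule C)
      also have "\<dots> \<le> C * (1 + 8 * (a ^ 4 + b ^ 4 * y ^ 4))"
        using sum_pow4_le[of a "b * y"] C(1) by (intro mult_left_mono) (auto simp: power_mult_distrib)
      finally show "norm (g (a + b * y)) \<le> norm (C * (1 + 8 * (a ^ 4 + b ^ 4 * y ^ 4)))" by simp
    qed
  qed measurable
qed

text \<open>Convergence of the integrands is asked only almost everywhere, since later ones jump
  across the boundary. The affine coefficients converge and are therefore bounded, which turns the
  common quartic bound into a single integrable polynomial.\<close>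

lemma gauss_dominated_convergence:
  assumes [measurable]: "\<And>n. g n \<in> borel_measurable borel" "L \<in> borel_measurable borel"
    and C: "\<And>n x. \<bar>g n x\<bar> \<le> C * (1 + x ^ 4)"
    and a: "a \<longlonglongrightarrow> a0" and b: "b \<longlonglongrightarrow> b0"
    and lim: "AE y in gauss. (\<lambda>n. g n (a n + b n * y)) \<longlonglongrightarrow> L y"
  shows "(\<lambda>n. \<integral>y. g n (a n + b n * y) \<partial>gauss) \<longlonglongrightarrow> (\<integral>y. L y \<partial>gauss)"
proof -
  obtain A where A: "\<And>n. \<bar>a n\<bar> \<le> A"
    using convergent_imp_Bseq[OF convergentI[OF a]] by (metis Bseq_def real_norm_def)
  obtain B where B: "\<And>n. \<bar>b n\<bar> \<le> B"
    using convergent_imp_Bseq[OF convergentI[OF b]] by (metis Bseq_def real_norm_def)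
  have C0: "0 \<le> C" using C[of 0 0] by simp
  show ?thesis
  proof (rule integral_dominated_convergence)
    show "integrable gauss (\<lambda>y. C * (1 + 8 * (A ^ 4 + B ^ 4 * y ^ 4)))" by simp
    show "AE y in gauss. norm (g n (a n + b n * y)) \<le> C * (1 + 8 * (A ^ 4 + B ^ 4 * y ^ 4))" for n
    proof (rule AE_I2)
      fix y
      have "\<bar>a n\<bar> ^ 4 \<le> A ^ 4" "\<bar>b n\<bar> ^ 4 \<le> B ^ 4" by (rule power_mono[OF A abs_ge_zero], rule power_mono[OF B abs_ge_zero])
      then have ab: "a n ^ 4 \<le> A ^ 4" "b n ^ 4 * y ^ 4 \<le> B ^ 4 * y ^ 4"
        by (auto intro!: mult_right_mono simp: power_even_abs)
      have "\<bar>g n (a n + b n * y)\<bar> \<le> C * (1 + (a n + b n * y) ^ 4)" by (rule C)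
      also have "\<dots> \<le> C * (1 + 8 * (A ^ 4 + B ^ 4 * y ^ 4))"
        using sum_pow4_le[of "a n" "b n * y"] C0 ab
        by (intro mult_left_mono) (auto simp: power_mult_distrib)
      finally show "norm (g n (a n + b n * y)) \<le> C * (1 + 8 * (A ^ 4 + B ^ 4 * y ^ 4))" by simp
    qed
    show "L \<in> borel_measurable gauss" by measurable
    show "(\<lambda>y. g n (a n + b n * y)) \<in> borel_measurable gauss" for n by measurable
  qed (rule lim)
qed

lemma char_gauss_scale:
  "char (distr gauss borel (\<lambda>y. c * y)) t = complex_of_real (exp (- (c * t)\<^sup>2 / 2))"
proof -
  have "char (distr gauss borel (\<lambda>y. c * y)) t = char gauss (c * t)"
    unfolding char_def by (subst integral_distr) (auto simp: mult_ac)
  then show ?thesis by (simp add: char_std_normal_distribution)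
qed

text \<open>Both sides have the characteristic function \<open>exp (- (a^2 + b^2) t^2 / 2)\<close>,
  the left one by Fubini as a product of two.\<close>

lemma distr_gauss_pair:
  "distr (gauss \<Otimes>\<^sub>M gauss) borel (\<lambda>(y, z). a * y + b * z)
     = distr gauss borel (\<lambda>y. sqrt (a\<^sup>2 + b\<^sup>2) * y)"
proof (rule Levy_uniqueness)
  interpret pair_prob_space gauss gauss ..
  show "real_distribution (distr (gauss \<Otimes>\<^sub>M gauss) borel (\<lambda>(y, z). a * y + b * z))"
    by (rule real_distribution_distr) measurable
  show "real_distribution (distr gauss borel (\<lambda>y. sqrt (a\<^sup>2 + b\<^sup>2) * y))"
    by (rule gauss.real_distribution_distr) measurable
  show "char (distr (gauss \<Otimes>\<^sub>M gauss) borel (\<lambda>(y, z). a * y + b * z))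
      = char (distr gauss borel (\<lambda>y. sqrt (a\<^sup>2 + b\<^sup>2) * y))"
  proof
    fix t
    have int: "integrable (gauss \<Otimes>\<^sub>M gauss) (\<lambda>(y, z). iexp (t * (a * y + b * z)))"
      by (rule integrable_const_bound[where B=1]) (auto simp: split_beta)
    have "char (distr (gauss \<Otimes>\<^sub>M gauss) borel (\<lambda>(y, z). a * y + b * z)) t
        = (\<integral>p. (\<lambda>(y, z). iexp (t * (a * y + b * z))) p \<partial>(gauss \<Otimes>\<^sub>M gauss))"
      unfolding char_def by (subst integral_distr) (auto simp: case_prod_beta')
    also have "\<dots> = (\<integral>y. \<integral>z. iexp (t * (a * y + b * z)) \<partial>gauss \<partial>gauss)"
      using integral_fst'[OF int] by simp
    also have "\<dots> = (\<integral>y. \<integral>z. iexp ((a * t) * y) * iexp ((b * t) * z) \<partial>gauss \<partial>gauss)"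
      by (simp add: exp_add[symmetric] algebra_simps)
    also have "\<dots> = char gauss (a * t) * char gauss (b * t)"
      unfolding char_def by simp
    also have "\<dots> = complex_of_real (exp (- ((sqrt (a\<^sup>2 + b\<^sup>2)) * t)\<^sup>2 / 2))"
      unfolding char_std_normal_distribution
      by (simp add: exp_add[symmetric] power_mult_distrib field_simps flip: of_real_mult)
    also have "\<dots> = char (distr gauss borel (\<lambda>y. sqrt (a\<^sup>2 + b\<^sup>2) * y)) t"
      by (rule char_gauss_scale[symmetric])
    finally show "char (distr (gauss \<Otimes>\<^sub>M gauss) borel (\<lambda>(y, z). a * y + b * z)) t
      = char (distr gauss borel (\<lambda>y. sqrt (a\<^sup>2 + b\<^sup>2) * y)) t" .
  qed
qed

lemma gauss_gauss_integral:
  assumes g: "quartic_growth g"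
  shows "(\<integral>y. \<integral>z. g (c + a * y + b * z) \<partial>gauss \<partial>gauss) = (\<integral>y. g (c + sqrt (a\<^sup>2 + b\<^sup>2) * y) \<partial>gauss)"
proof -
  interpret pair_prob_space gauss gauss ..
  have [measurable]: "g \<in> borel_measurable borel" using g by (rule quartic_growth_measurable)
  have "integrable (distr (gauss \<Otimes>\<^sub>M gauss) borel (\<lambda>(y, z). a * y + b * z)) (\<lambda>u. g (c + u))"
    unfolding distr_gauss_pair
    using quartic_growth_integrable[OF g, of c "sqrt (a\<^sup>2 + b\<^sup>2)"] by (subst integrable_distr_eq) auto
  then have int: "integrable (gauss \<Otimes>\<^sub>M gauss) (\<lambda>(y, z). g (c + (a * y + b * z)))"
    by (subst (asm) integrable_distr_eq) (auto simp: case_prod_beta')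
  have "(\<integral>y. \<integral>z. g (c + a * y + b * z) \<partial>gauss \<partial>gauss)
      = (\<integral>p. (\<lambda>(y, z). g (c + (a * y + b * z))) p \<partial>(gauss \<Otimes>\<^sub>M gauss))"
    by (subst integral_fst'[OF int, symmetric]) (simp add: add.assoc)
  also have "\<dots> = (\<integral>u. g (c + u) \<partial>distr (gauss \<Otimes>\<^sub>M gauss) borel (\<lambda>(y, z). a * y + b * z))"
    by (subst integral_distr) (auto simp: case_prod_beta')
  also have "\<dots> = (\<integral>y. g (c + sqrt (a\<^sup>2 + b\<^sup>2) * y) \<partial>gauss)"
    unfolding distr_gauss_pair by (subst integral_distr) auto
  finally show ?thesis .
qed

section \<open>Semigroup law, order and growth of the killed semigroup\<close>

text \<open>The noise of the first step shrinks by \<open>exp (- k)\<close> before that of the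
  second is added, and \<open>exp (- 2 k) (1 - exp (- 2 h)) + (1 - exp (- 2 k)) = 1 - exp (- 2 (h +
  k))\<close>.\<close>

lemma ou_ou:
  assumes g: "quartic_growth g" and "0 \<le> h" "0 \<le> k"
  shows "ou h (ou k g) x = ou (h + k) g x"
proof -
  let ?s = "\<lambda>h. sqrt (1 - exp (- 2 * h))"
  have "sqrt ((exp (- k) * ?s h)\<^sup>2 + (?s k)\<^sup>2) = ?s (h + k)"
    using assms(2,3) by (simp add: power_mult_distrib algebra_simps flip: exp_add exp_of_nat_mult)
  then have "(\<integral>y. g (exp (- (h + k)) * x + ?s (h + k) * y) \<partial>gauss)
     = (\<integral>y. \<integral>z. g (exp (- (h + k)) * x + (exp (- k) * ?s h) * y + ?s k * z) \<partial>gauss \<partial>gauss)"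
    using gauss_gauss_integral[OF g, of "exp (- (h + k)) * x" "exp (- k) * ?s h" "?s k"] by simp
  then show ?thesis
    unfolding ou_def by (simp add: algebra_simps flip: exp_add)
qed

lemma ou_0 [simp]: "ou 0 g x = g x"
  by (simp add: ou_def)

lemma ou_integrable: "quartic_growth g \<Longrightarrow> integrable gauss (\<lambda>y. g (exp (- h) * x + s * y))"
  by (rule quartic_growth_integrable)

lemma ou_mono:
  assumes "quartic_growth f" "quartic_growth g" "\<And>x. f x \<le> g x"
  shows "ou h f x \<le> ou h g x"
  unfolding ou_def using assms
  by (intro mult_left_mono integral_mono ou_integrable) auto

lemma ou_add:
  assumes "quartic_growth f" "quartic_growth g"
  shows "ou h (\<lambda>x. f x + g x) x = ou h f x + ou h g x"
  unfolding ou_def using assms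
  by (subst Bochner_Integration.integral_add) (auto intro!: ou_integrable simp: distrib_left right_diff_distrib)

lemma ou_diff:
  assumes "quartic_growth f" "quartic_growth g"
  shows "ou h (\<lambda>x. f x - g x) x = ou h f x - ou h g x"
  unfolding ou_def using assms
  by (subst Bochner_Integration.integral_diff) (auto intro!: ou_integrable simp: distrib_left right_diff_distrib)

lemma ou_cmult: "ou h (\<lambda>x. c * f x) x = c * ou h f x"
  unfolding ou_def by simp

lemma ou_const: "ou h (\<lambda>x. c) x = exp (- h) * c"
  unfolding ou_def by simp

text \<open>One factor \<open>exp (- h)\<close> is the mean reversion, the other the
  killing.\<close>

lemma ou_id: "ou h (\<lambda>x. x) x = exp (- 2 * h) * x"
  unfolding ou_def by (simp add: mult.assoc[symmetric] flip: exp_add)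

lemma ou_nonneg:
  assumes "\<And>x. 0 \<le> f x" shows "0 \<le> ou h f x"
  unfolding ou_def using assms by (auto intro!: integral_nonneg_AE)

lemma ou_abs_le:
  assumes "quartic_growth f" "quartic_growth g" "\<And>x. \<bar>f x\<bar> \<le> g x"
  shows "\<bar>ou h f x\<bar> \<le> ou h g x"
proof -
  have "ou h f x \<le> ou h g x"
    by (rule ou_mono) (use assms abs_le_D1 in auto)
  moreover have "ou h (\<lambda>x. - 1 * f x) x \<le> ou h g x"
    using abs_le_D2[OF assms(3)] by (intro ou_mono quartic_growth_cmult assms) auto
  ultimately show ?thesis unfolding ou_cmult by simp
qed

lemma ou_linear_bound:
  assumes g: "g \<in> borel_measurable borel" "\<And>x. \<bar>g x\<bar> \<le> C * (1 + \<bar>x\<bar>)" and h: "0 \<le> h"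
  shows "\<bar>ou h g x\<bar> \<le> C * (2 + \<bar>x\<bar>)"
proof -
  let ?s = "sqrt (1 - exp (- 2 * h))"
  have q: "quartic_growth g" using g by (rule quartic_growth_linear)
  have C: "0 \<le> C" using g(2)[of 0] by simp
  have s: "0 \<le> ?s" "?s \<le> 1" using h by auto
  have "\<bar>\<integral>y. g (exp (- h) * x + ?s * y) \<partial>gauss\<bar> \<le> (\<integral>y. \<bar>g (exp (- h) * x + ?s * y)\<bar> \<partial>gauss)"
    by (rule integral_abs_bound)
  also have "\<dots> \<le> (\<integral>y. C * (1 + \<bar>x\<bar> + \<bar>y\<bar>) \<partial>gauss)"
  proof (rule integral_mono)
    show "integrable gauss (\<lambda>y. \<bar>g (exp (- h) * x + ?s * y)\<bar>)"
      by (intro integrable_abs ou_integrable q)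
    fix y :: real
    have "\<bar>exp (- h) * x + ?s * y\<bar> \<le> \<bar>exp (- h) * x\<bar> + \<bar>?s * y\<bar>" by (rule abs_triangle_ineq)
    also have "\<dots> \<le> \<bar>x\<bar> + \<bar>y\<bar>"
      using s h by (auto simp: abs_mult intro!: add_mono mult_left_le_one_le)
    finally show "\<bar>g (exp (- h) * x + ?s * y)\<bar> \<le> C * (1 + \<bar>x\<bar> + \<bar>y\<bar>)"
      using C by (intro order_trans[OF g(2)] mult_left_mono) auto
  qed simp
  also have "\<dots> = C * (1 + \<bar>x\<bar> + (\<integral>y. \<bar>y\<bar> \<partial>gauss))" by simp
  also have "\<dots> \<le> C * (2 + \<bar>x\<bar>)"
    using integral_gauss_abs_le C by (intro mult_left_mono) auto
  finally have "\<bar>\<integral>y. g (exp (- h) * x + ?s * y) \<partial>gauss\<bar> \<le> C * (2 + \<bar>x\<bar>)" .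
  moreover have "exp (- h) * \<bar>\<integral>y. g (exp (- h) * x + ?s * y) \<partial>gauss\<bar> \<le> 1 * \<bar>\<integral>y. g (exp (- h) * x + ?s * y) \<partial>gauss\<bar>"
    using h by (intro mult_right_mono) auto
  ultimately show ?thesis unfolding ou_def by (simp add: abs_mult)
qed

lemma ou_measurable [measurable]:
  assumes [measurable]: "g \<in> borel_measurable borel" shows "ou h g \<in> borel_measurable borel"
  unfolding ou_def by measurable

lemma ou_quartic_growth:
  assumes g: "quartic_growth g" and h: "0 \<le> h" shows "quartic_growth (ou h g)"
proof -
  obtain C where C: "0 \<le> C" "\<And>x. \<bar>g x\<bar> \<le> C * (1 + x ^ 4)"
    using g by (meson quartic_growth_bound)
  let ?s = "sqrt (1 - exp (- 2 * h))"
  have s: "0 \<le> ?s" "?s \<le> 1" using h by auto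
  show ?thesis
  proof (rule quartic_growthI)
    show "ou h g \<in> borel_measurable borel" using g by (intro ou_measurable quartic_growth_measurable)
    fix x :: real
    have "\<bar>\<integral>y. g (exp (- h) * x + ?s * y) \<partial>gauss\<bar> \<le> (\<integral>y. \<bar>g (exp (- h) * x + ?s * y)\<bar> \<partial>gauss)"
      by (rule integral_abs_bound)
    also have "\<dots> \<le> (\<integral>y. C * (1 + 8 * (x ^ 4 + y ^ 4)) \<partial>gauss)"
    proof (rule integral_mono)
      show "integrable gauss (\<lambda>y. \<bar>g (exp (- h) * x + ?s * y)\<bar>)"
        by (intro integrable_abs ou_integrable g)
      fix y :: real
      have "exp (- h) ^ 4 \<le> 1" "?s ^ 4 \<le> 1" using s h by (auto intro!: power_le_one)
      then have 1: "(exp (- h) * x) ^ 4 \<le> x ^ 4" "(?s * y) ^ 4 \<le> y ^ 4"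
        unfolding power_mult_distrib by (auto intro!: mult_left_le_one_le simp del: exp_le_one_iff)
      have "\<bar>g (exp (- h) * x + ?s * y)\<bar> \<le> C * (1 + (exp (- h) * x + ?s * y) ^ 4)" by (rule C)
      also have "\<dots> \<le> C * (1 + 8 * (x ^ 4 + y ^ 4))"
        using 1 sum_pow4_le[of "exp (- h) * x" "?s * y"] C(1) by (intro mult_left_mono) auto
      finally show "\<bar>g (exp (- h) * x + ?s * y)\<bar> \<le> C * (1 + 8 * (x ^ 4 + y ^ 4))" .
    qed simp
    also have "\<dots> \<le> (25 * C) * (1 + x ^ 4)" using C(1) mult_nonneg_nonneg[OF C(1), of "x ^ 4"] by (simp add: algebra_simps)
    finally have "\<bar>\<integral>y. g (exp (- h) * x + ?s * y) \<partial>gauss\<bar> \<le> (25 * C) * (1 + x ^ 4)" .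
    moreover have "exp (- h) * \<bar>\<integral>y. g (exp (- h) * x + ?s * y) \<partial>gauss\<bar> \<le> 1 * \<bar>\<integral>y. g (exp (- h) * x + ?s * y) \<partial>gauss\<bar>"
      using h by (intro mult_right_mono) auto
    ultimately show "\<bar>ou h g x\<bar> \<le> (25 * C) * (1 + x ^ 4)" unfolding ou_def by (simp add: abs_mult)
  qed
qed

lemma ou_monotone:
  assumes g: "quartic_growth g" and "mono g" shows "mono (ou h g)"
  unfolding ou_def
  by (intro monoI mult_left_mono integral_mono ou_integrable g monoD[OF \<open>mono g\<close>]) auto

lemma ou_antimono:
  assumes g: "quartic_growth g" and "antimono g" shows "antimono (ou h g)"
  unfolding ou_def
  by (intro antimonoI mult_left_mono integral_mono ou_integrable g antimonoD[OF \<open>antimono g\<close>]) auto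

section \<open>An excessive quadratic and short-time error bounds\<close>

text \<open>The killed generator sends \<open>1 + x^2 / 4\<close> to
  \<open>- 1 / 2 - 3 x^2 / 4\<close>, which is negative, so this function is excessive. It bounds
  the value from above, penalises the maximum principle at infinity and controls the second moments
  of stopped rewards.\<close>

lemma ou_quadratic_le:
  assumes "0 \<le> h"
  shows "ou h (\<lambda>x. 1 + x\<^sup>2 / 4) x \<le> 1 + x\<^sup>2 / 4"
proof -
  let ?s = "sqrt (1 - exp (- 2 * h))" and ?e = "exp (- h)"
  have s2: "?s\<^sup>2 = 1 - ?e\<^sup>2" using assms by (simp flip: exp_of_nat_mult)
  have e: "0 < ?e" "?e \<le> 1" using assms by auto
  have "1 + (?e * x + ?s * y)\<^sup>2 / 4 = (1 + (?e * x)\<^sup>2 / 4) + (?e * x * ?s / 2) * y + (?s\<^sup>2 / 4) * y\<^sup>2" for y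
    by (simp add: power2_eq_square algebra_simps add_divide_distrib)
  then have "(\<integral>y. 1 + (?e * x + ?s * y)\<^sup>2 / 4 \<partial>gauss)
      = (\<integral>y. (1 + (?e * x)\<^sup>2 / 4) + (?e * x * ?s / 2) * y + (?s\<^sup>2 / 4) * y\<^sup>2 \<partial>gauss)" by presburger
  also have "\<dots> = 1 + (?e * x)\<^sup>2 / 4 + ?s\<^sup>2 / 4" by (simp del: real_sqrt_pow2_iff)
  finally have "ou h (\<lambda>x. 1 + x\<^sup>2 / 4) x = ?e * (1 + ?e\<^sup>2 * x\<^sup>2 / 4 + (1 - ?e\<^sup>2) / 4)"
    unfolding ou_def s2 by (simp add: power_mult_distrib)
  also have "\<dots> = ?e * (1 + (1 - ?e\<^sup>2) / 4) + ?e ^ 3 * (x\<^sup>2 / 4)"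
    by (simp add: power2_eq_square power3_eq_cube algebra_simps)
  also have "?e * (1 + (1 - ?e\<^sup>2) / 4) \<le> 1"
  proof -
    have "1 - ?e * (1 + (1 - ?e\<^sup>2) / 4) = (1 - ?e) * (1 - ?e * (1 + ?e) / 4)"
      by (simp add: power2_eq_square field_simps)
    moreover have "?e * (1 + ?e) \<le> 1 * 2" using e by (intro mult_mono) auto
    ultimately show ?thesis using e by (smt (verit) mult_nonneg_nonneg divide_le_eq_1)
  qed
  also have "?e ^ 3 * (x\<^sup>2 / 4) \<le> 1 * (x\<^sup>2 / 4)"
    using e by (intro mult_right_mono power_le_one) auto
  finally show ?thesis by simp
qed

text \<open>The drift moves the process by \<open>O(h)\<close> and the noise by
  \<open>O(sqrt h)\<close>, so the fourth power is \<open>O(h^2)\<close>. The 96 is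
  \<open>8 * 3 * 4\<close>: the factor of \<open>sum_pow4_le\<close>, the fourth Gaussian moment,
  and \<open>?s ^ 4 <= 4 h^2\<close>.\<close>

lemma ou_centred_pow4_le:
  assumes "0 \<le> h" "h \<le> 1"
  shows "ou h (\<lambda>\<xi>. (\<xi> - x) ^ 4) x \<le> (8 * x ^ 4 + 96) * h\<^sup>2"
proof -
  let ?s = "sqrt (1 - exp (- 2 * h))" and ?e = "exp (- h)"
  have e: "0 < ?e" "?e \<le> 1" "1 - h \<le> ?e" using assms exp_ge_add_one_self[of "-h"] by auto
  have s2: "?s\<^sup>2 \<le> 2 * h" "0 \<le> ?s\<^sup>2" using assms exp_ge_add_one_self[of "-2 * h"] by auto
  have s4: "?s ^ 4 \<le> 4 * h\<^sup>2"
  proof -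
    have "?s ^ 4 = (?s\<^sup>2)\<^sup>2" by (simp only: power_mult[symmetric]) simp
    also have "\<dots> \<le> (2 * h)\<^sup>2" using s2 by (intro power_mono) auto
    finally show ?thesis by (simp add: power_mult_distrib)
  qed
  have "(\<integral>y. (?e * x + ?s * y - x) ^ 4 \<partial>gauss) \<le> (\<integral>y. 8 * ((?e * x - x) ^ 4) + 8 * ?s ^ 4 * y ^ 4 \<partial>gauss)"
  proof (rule integral_mono)
    show "integrable gauss (\<lambda>y. (?e * x + ?s * y - x) ^ 4)"
      using quartic_growth_integrable[OF quartic_growth_shift_pow4] .
    fix y :: real
    have "(?e * x + ?s * y - x) ^ 4 = ((?e * x - x) + ?s * y) ^ 4" by (simp add: algebra_simps)
    also have "\<dots> \<le> 8 * ((?e * x - x) ^ 4) + 8 * ?s ^ 4 * y ^ 4"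
      using sum_pow4_le[of "?e * x - x" "?s * y"] unfolding power_mult_distrib by simp
    finally show "(?e * x + ?s * y - x) ^ 4 \<le> 8 * ((?e * x - x) ^ 4) + 8 * ?s ^ 4 * y ^ 4" .
  qed simp
  also have "\<dots> = 8 * ((1 - ?e) ^ 4 * x ^ 4) + 24 * ?s ^ 4"
  proof -
    have "(?e * x - x) ^ 4 = (1 - ?e) ^ 4 * x ^ 4"
    proof -
      have "?e * x - x = - ((1 - ?e) * x)" by (simp add: algebra_simps)
      then show ?thesis by (simp only: power_minus_even even_numeral power_mult_distrib)
    qed
    then show ?thesis by simp
  qed
  also have "\<dots> \<le> 8 * (h\<^sup>2 * x ^ 4) + 24 * (4 * h\<^sup>2)"
  proof -
    have "(1 - ?e) ^ 4 \<le> h ^ 4" using e by (intro power_mono) auto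
    also have "h ^ 4 \<le> h\<^sup>2" using assms by (intro power_decreasing) auto
    finally show ?thesis using s4 by (intro add_mono mult_left_mono mult_right_mono) auto
  qed
  also have "\<dots> = (8 * x ^ 4 + 96) * h\<^sup>2" by (simp add: algebra_simps)
  finally have 1: "(\<integral>y. (?e * x + ?s * y - x) ^ 4 \<partial>gauss) \<le> (8 * x ^ 4 + 96) * h\<^sup>2" .
  have "ou h (\<lambda>\<xi>. (\<xi> - x) ^ 4) x \<le> 1 * (\<integral>y. (?e * x + ?s * y - x) ^ 4 \<partial>gauss)"
    unfolding ou_def using e by (intro mult_right_mono integral_nonneg_AE) auto
  with 1 show ?thesis by simp
qed

text \<open>The first two factors bound \<open>C (1 + |\<xi>|)\<close> by a multiple of
  \<open>(\<xi> - x)^4\<close> once \<open>|\<xi> - x| >= d\<close>; the last is the constant of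
  \<open>ou_centred_pow4_le\<close>.\<close>

definition local_const :: "real \<Rightarrow> real \<Rightarrow> real \<Rightarrow> real" where
  "local_const C x d = C * ((1 + \<bar>x\<bar>) / d ^ 4 + 1 / d ^ 3) * (8 * x ^ 4 + 96)"

lemma local_const_nonneg: "0 \<le> C \<Longrightarrow> 0 < d \<Longrightarrow> 0 \<le> local_const C x d"
  by (simp add: local_const_def)

text \<open>A Chebyshev bound: a function of linear growth that vanishes near \<open>x\<close> lies
  below a multiple of \<open>(\<xi> - x)^4\<close>. With the square in place of the fourth power the
  result would only be of order \<open>h\<close>, the order of the generator terms against which it
  has to be negligible.\<close>

lemma ou_local:
  assumes e: "e \<in> borel_measurable borel" "\<And>\<xi>. \<bar>e \<xi>\<bar> \<le> C * (1 + \<bar>\<xi>\<bar>)"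
    and zero: "\<And>\<xi>. \<bar>\<xi> - x\<bar> < d \<Longrightarrow> e \<xi> = 0" and d: "0 < d" and h: "0 \<le> h" "h \<le> 1"
  shows "\<bar>ou h e x\<bar> \<le> local_const C x d * h\<^sup>2"
proof -
  define K where "K = C * ((1 + \<bar>x\<bar>) / d ^ 4 + 1 / d ^ 3)"
  have C: "0 \<le> C" using e(2)[of 0] by simp
  have K: "0 \<le> K" using C d by (simp add: K_def)
  have "\<bar>e \<xi>\<bar> \<le> K * (\<xi> - x) ^ 4" for \<xi>
  proof (cases "\<bar>\<xi> - x\<bar> < d")
    case True then show ?thesis using zero K by simp
  next
    case False
    define r where "r = \<bar>\<xi> - x\<bar> / d"
    have r: "1 \<le> r" using False d by (simp add: r_def)
    have "1 \<le> r ^ 4" using r by simp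
    moreover have "r ^ 1 \<le> r ^ 4" using r by (intro power_increasing) auto
    ultimately have "(1 + \<bar>x\<bar>) * 1 + d * r \<le> (1 + \<bar>x\<bar>) * r ^ 4 + d * r ^ 4"
      using d by (intro add_mono mult_left_mono) auto
    moreover have "1 + \<bar>\<xi>\<bar> \<le> (1 + \<bar>x\<bar>) * 1 + d * r" using d by (simp add: r_def)
    ultimately have "C * (1 + \<bar>\<xi>\<bar>) \<le> C * ((1 + \<bar>x\<bar>) * r ^ 4 + d * r ^ 4)" using C by (intro mult_left_mono) auto
    also have "\<dots> = K * (\<xi> - x) ^ 4"
      using d by (simp add: K_def r_def power_divide power_even_abs field_simps power_eq_if)
    finally show ?thesis using e(2)[of \<xi>] by linarith
  qed
  then have "\<bar>ou h e x\<bar> \<le> ou h (\<lambda>\<xi>. K * (\<xi> - x) ^ 4) x"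
    by (intro ou_abs_le quartic_growth_linear[OF e] quartic_growth_cmult quartic_growth_shift_pow4)
  also have "\<dots> \<le> K * ((8 * x ^ 4 + 96) * h\<^sup>2)"
    unfolding ou_cmult using K ou_centred_pow4_le[OF h] by (intro mult_left_mono) auto
  finally show ?thesis by (simp add: local_const_def K_def mult.assoc)
qed

lemma ou_tendsto:
  assumes "\<And>n. g n \<in> borel_measurable borel" "g0 \<in> borel_measurable borel"
    and "\<And>n x. \<bar>g n x\<bar> \<le> C * (1 + x ^ 4)"
    and h: "h \<longlonglongrightarrow> h0" and x: "x \<longlonglongrightarrow> x0"
    and "AE y in gauss. (\<lambda>n. g n (exp (- h n) * x n + sqrt (1 - exp (- 2 * h n)) * y))
           \<longlonglongrightarrow> g0 (exp (- h0) * x0 + sqrt (1 - exp (- 2 * h0)) * y)"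
  shows "(\<lambda>n. ou (h n) (g n) (x n)) \<longlonglongrightarrow> ou h0 g0 x0"
  unfolding ou_def
proof (intro tendsto_mult gauss_dominated_convergence[where C=C])
  note [measurable] = assms(2)
  show "(\<lambda>y. g0 (exp (- h0) * x0 + sqrt (1 - exp (- 2 * h0)) * y)) \<in> borel_measurable borel" by measurable
  show "(\<lambda>n. exp (- h n) * x n) \<longlonglongrightarrow> exp (- h0) * x0" by (intro tendsto_intros h x)
  show "(\<lambda>n. sqrt (1 - exp (- 2 * h n))) \<longlonglongrightarrow> sqrt (1 - exp (- 2 * h0))" by (intro tendsto_intros h)
  show "(\<lambda>n. exp (- h n)) \<longlonglongrightarrow> exp (- h0)" by (intro tendsto_intros h)
qed (fact assms)+

section \<open>The value function\<close>

definition bellman :: "real \<Rightarrow> (real \<Rightarrow> real) \<Rightarrow> real \<Rightarrow> real" where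
  "bellman h g x = max x (ou h g x)"

text \<open>The excessive majorant of the identity that fits \<open>1 + x\<^sup>2 / 4\<close> smoothly to \<open>x\<close> at \<open>2\<close>.\<close>

definition upper_value :: "real \<Rightarrow> real" where
  "upper_value x = (if x \<le> 2 then 1 + x\<^sup>2 / 4 else x)"

section \<open>The shape preserved by Bellman steps\<close>

text \<open>Properties preserved by Bellman steps and by limits. Monotonicity together with the
  decreasing excess \<open>g x - x\<close> makes \<open>g\<close> 1-Lipschitz; the decreasing excess
  also makes the set \<open>x < g x\<close> a lower half-line; \<open>upper_value\<close> gives a
  bound uniform in the number of steps.\<close>

definition payoff_like :: "(real \<Rightarrow> real) \<Rightarrow> bool" where
  "payoff_like g \<longleftrightarrow> mono g \<and> antimono (\<lambda>x. g x - x) \<and> (\<forall>x. x \<le> g x) \<and> (\<forall>x. g x \<le> upper_value x)"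

lemma le_upper_value: "x \<le> upper_value x"
  using zero_le_power2[of "x - 2"] by (simp add: upper_value_def power2_eq_square algebra_simps)

lemma upper_value_le: "upper_value x \<le> 1 + x\<^sup>2 / 4"
  using zero_le_power2[of "x - 2"] by (simp add: upper_value_def power2_eq_square algebra_simps)

lemma upper_value_excess_antimono: "antimono (\<lambda>x. upper_value x - x)"
proof (rule antimonoI)
  have eq: "upper_value x - x = (min (x - 2) 0)\<^sup>2 / 4" for x
    by (auto simp: upper_value_def power2_eq_square min_def field_simps)
  fix x y :: real assume "x \<le> y"
  then have "(- min (y - 2) 0)\<^sup>2 \<le> (- min (x - 2) 0)\<^sup>2" by (intro power_mono) auto
  then show "upper_value y - y \<le> upper_value x - x" unfolding eq by simp
qed

lemma upper_value_measurable [measurable]: "upper_value \<in> borel_measurable borel"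
  unfolding upper_value_def by measurable

lemma quadratic_quartic_growth: "quartic_growth (\<lambda>x. 1 + x\<^sup>2 / 4)"
proof (rule quartic_growthI[where C=2])
  fix x :: real
  have "2 * x\<^sup>2 \<le> 1 + x ^ 4"
    using zero_le_power2[of "x\<^sup>2 - 1"] by (simp add: power2_eq_square algebra_simps power4_eq_xxxx)
  moreover have "0 \<le> x ^ 4" "0 \<le> x\<^sup>2" by simp_all
  ultimately show "\<bar>1 + x\<^sup>2 / 4\<bar> \<le> 2 * (1 + x ^ 4)" unfolding distrib_left by linarith
qed measurable

lemma upper_value_nonneg: "0 \<le> upper_value x"
  by (simp add: upper_value_def)

lemma upper_value_quartic_growth: "quartic_growth upper_value"
proof -
  obtain C where C: "\<And>x :: real. \<bar>1 + x\<^sup>2 / 4\<bar> \<le> C * (1 + x ^ 4)"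
    using quartic_growth_bound[OF quadratic_quartic_growth] by metis
  have "\<bar>upper_value x\<bar> \<le> C * (1 + x ^ 4)" for x
    using upper_value_le[of x] upper_value_nonneg[of x] C[of x] by linarith
  then show ?thesis by (intro quartic_growthI) auto
qed

text \<open>Up to 2 the quadratic bound suffices. Beyond 2 the excess over the identity decreases,
  so the bound at 2 extends to \<open>x\<close> with slope \<open>exp (- 2 h) <= 1\<close>.\<close>

lemma ou_upper_value_le:
  assumes h: "0 \<le> h" shows "ou h upper_value x \<le> upper_value x"
proof -
  have *: "ou h upper_value x \<le> 1 + x\<^sup>2 / 4" for x
  proof -
    have "ou h upper_value x \<le> ou h (\<lambda>x. 1 + x\<^sup>2 / 4) x"
      by (intro ou_mono upper_value_quartic_growth quadratic_quartic_growth upper_value_le)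
    also have "\<dots> \<le> 1 + x\<^sup>2 / 4" by (rule ou_quadratic_le[OF h])
    finally show ?thesis .
  qed
  show ?thesis
  proof (cases "x \<le> 2")
    case True then show ?thesis using *[of x] by (simp add: upper_value_def)
  next
    case False
    have eq: "ou h (\<lambda>x. upper_value x - x) x = ou h upper_value x - exp (- 2 * h) * x" for x
      by (subst ou_diff[OF upper_value_quartic_growth quartic_growth_id]) (simp only: ou_id)
    have "ou h (\<lambda>x. upper_value x - x) x \<le> ou h (\<lambda>x. upper_value x - x) 2"
      using False by (intro antimonoD[OF ou_antimono[OF _ upper_value_excess_antimono]]
          quartic_growth_diff upper_value_quartic_growth quartic_growth_id) auto
    then have "ou h upper_value x \<le> ou h upper_value 2 + exp (- 2 * h) * (x - 2)"
      unfolding eq by (simp add: algebra_simps)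
    also have "\<dots> \<le> 2 + 1 * (x - 2)"
      using *[of 2] False h by (intro add_mono mult_right_mono) auto
    finally show ?thesis using False by (simp add: upper_value_def)
  qed
qed

lemma payoff_like_ge: "payoff_like g \<Longrightarrow> x \<le> g x"
  and payoff_like_le: "payoff_like g \<Longrightarrow> g x \<le> upper_value x"
  and payoff_like_mono: "payoff_like g \<Longrightarrow> x \<le> y \<Longrightarrow> g x \<le> g y"
  and payoff_like_excess: "payoff_like g \<Longrightarrow> x \<le> y \<Longrightarrow> g y - y \<le> g x - x"
  unfolding payoff_like_def mono_def antimono_def by blast+

lemma payoff_like_measurable [measurable_dest]: "payoff_like g \<Longrightarrow> g \<in> borel_measurable borel"
  unfolding payoff_like_def by (auto intro: borel_measurable_mono)

lemma payoff_like_lipschitz: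
  assumes "payoff_like g" shows "\<bar>g x - g y\<bar> \<le> \<bar>x - y\<bar>"
proof (cases "x \<le> y")
  case True then show ?thesis
    using payoff_like_mono[OF assms True] payoff_like_excess[OF assms True] by linarith
next
  case False then have "y \<le> x" by simp
  then show ?thesis
    using payoff_like_mono[OF assms \<open>y \<le> x\<close>] payoff_like_excess[OF assms \<open>y \<le> x\<close>] by linarith
qed

lemma payoff_like_bound:
  assumes "payoff_like g" shows "\<bar>g x\<bar> \<le> 1 * (1 + \<bar>x\<bar>)"
proof -
  have "g 0 \<le> 1" using payoff_like_le[OF assms, of 0] by (simp add: upper_value_def)
  moreover have "0 \<le> g 0" using payoff_like_ge[OF assms, of 0] .
  moreover have "\<bar>g x - g 0\<bar> \<le> \<bar>x\<bar>" using payoff_like_lipschitz[OF assms, of x 0] by simp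
  ultimately show ?thesis by simp
qed

lemma payoff_like_quartic_growth: "payoff_like g \<Longrightarrow> quartic_growth g"
  using payoff_like_bound payoff_like_measurable by (intro quartic_growth_linear) blast+

lemma payoff_like_bound4:
  assumes "payoff_like g" shows "\<bar>g x\<bar> \<le> 2 * (1 + x ^ 4)"
proof -
  have "\<bar>g x\<bar> \<le> 1 + \<bar>x\<bar>" using payoff_like_bound[OF assms, of x] by simp
  moreover have "0 \<le> x ^ 4" by simp
  ultimately show ?thesis using abs_le_one_plus_pow4[of x] unfolding distrib_left by linarith
qed

lemma payoff_like_tendsto: "payoff_like g \<Longrightarrow> x \<longlonglongrightarrow> x0 \<Longrightarrow> (\<lambda>n. g (x n)) \<longlonglongrightarrow> g x0"
  by (rule LIM_zero_cancel, rule Lim_null_comparison[where g="\<lambda>n. \<bar>x n - x0\<bar>"])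
    (auto intro!: always_eventually payoff_like_lipschitz tendsto_rabs_zero LIM_zero)

lemma payoff_like_id: "payoff_like (\<lambda>x. x)"
  unfolding payoff_like_def by (auto simp: le_upper_value intro!: monoI antimonoI)

text \<open>\<open>ou\<close> maps the excess \<open>g x - x\<close> to
  \<open>ou h g x - exp (- 2 h) x\<close>, decreasing again; subtracting the increasing
  \<open>(1 - exp (- 2 h)) x\<close> as well leaves \<open>ou h g x - x\<close> decreasing. The
  upper bound is the excessivity of \<open>upper_value\<close>.\<close>

lemma payoff_like_bellman:
  assumes g: "payoff_like g" and h: "0 \<le> h" shows "payoff_like (bellman h g)"
proof -
  have q: "quartic_growth g" using g by (rule payoff_like_quartic_growth)
  have 1: "mono (ou h g)" using g by (intro ou_monotone q) (simp add: payoff_like_def)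
  have "antimono (ou h (\<lambda>x. g x - x))"
    using g by (intro ou_antimono quartic_growth_diff q quartic_growth_id) (simp add: payoff_like_def)
  moreover have "ou h (\<lambda>x. g x - x) x = ou h g x - exp (- 2 * h) * x" for x
    by (subst ou_diff[OF q quartic_growth_id]) (simp only: ou_id)
  ultimately have 2: "ou h g y - exp (- 2 * h) * y \<le> ou h g x - exp (- 2 * h) * x" if "x \<le> y" for x y
    using that by (simp add: antimono_def)
  have 3: "ou h g y - y \<le> ou h g x - x" if "x \<le> y" for x y
  proof -
    have "exp (- 2 * h) * (y - x) \<le> 1 * (y - x)" using that h by (intro mult_right_mono) auto
    then show ?thesis using 2[OF that] by (simp add: algebra_simps)
  qed
  have 4: "ou h g x \<le> upper_value x" for x
    using ou_mono[OF q upper_value_quartic_growth payoff_like_le[OF g], of h x] ou_upper_value_le[OF h, of x]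
    by linarith
  show ?thesis
    unfolding payoff_like_def
  proof (intro conjI allI monoI antimonoI)
    show "bellman h g x \<le> bellman h g y" if "x \<le> y" for x y
      using that monoD[OF 1 that] by (auto simp: bellman_def)
    show "bellman h g y - y \<le> bellman h g x - x" if "x \<le> y" for x y
      using 3[OF that] by (auto simp: bellman_def)
    show "x \<le> bellman h g x" for x by (simp add: bellman_def)
    show "bellman h g x \<le> upper_value x" for x using 4 le_upper_value by (simp add: bellman_def)
  qed
qed

lemma bellman_mono:
  assumes "payoff_like f" "payoff_like g" "\<And>x. f x \<le> g x"
  shows "bellman h f x \<le> bellman h g x"
  using ou_mono[OF payoff_like_quartic_growth payoff_like_quartic_growth, OF assms(1,2) assms(3), of h x]
  by (auto simp: bellman_def)

text \<open>Two half steps offer one more opportunity to stop, at the midpoint.\<close>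

lemma bellman_half:
  assumes g: "payoff_like g" and h: "0 \<le> h"
  shows "bellman h g x \<le> bellman (h/2) (bellman (h/2) g) x"
proof -
  have "ou h g x = ou (h/2) (ou (h/2) g) x"
    using ou_ou[OF payoff_like_quartic_growth[OF g], of "h/2" "h/2" x] h by simp
  also have "\<dots> \<le> ou (h/2) (bellman (h/2) g) x"
    using h g by (intro ou_mono ou_quartic_growth payoff_like_quartic_growth payoff_like_bellman)
      (auto simp: bellman_def)
  finally show ?thesis by (auto simp: bellman_def[of _ "bellman _ _"] bellman_def[of h g])
qed

section \<open>Dyadic iterates and their limit\<close>

text \<open>The value with \<open>k\<close> steps of length \<open>1 / 2 ^ n\<close> to go when
  stopping is allowed only at the step times.\<close>

definition iter :: "nat \<Rightarrow> nat \<Rightarrow> real \<Rightarrow> real" where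
  "iter n k = (bellman (1 / 2 ^ n) ^^ k) (\<lambda>x. x)"

lemma iter_0: "iter n 0 = (\<lambda>x. x)"
  and iter_Suc: "iter n (Suc k) = bellman (1 / 2 ^ n) (iter n k)"
  by (simp_all add: iter_def)

lemma payoff_like_iter: "payoff_like (iter n k)"
  by (induction k) (auto simp: iter_0 iter_Suc intro: payoff_like_id payoff_like_bellman)

lemma iter_le_Suc: "iter n k x \<le> iter n (Suc k) x"
proof (induction k arbitrary: x)
  case 0 then show ?case by (simp add: iter_0 iter_Suc bellman_def)
next
  case (Suc k)
  show ?case unfolding iter_Suc[of n "Suc k"] iter_Suc[of n k]
    using Suc[unfolded iter_Suc] payoff_like_iter[of n "Suc k", unfolded iter_Suc]
    by (intro bellman_mono payoff_like_iter)
qed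

lemma iter_mono: "k \<le> l \<Longrightarrow> iter n k x \<le> iter n l x"
  using lift_Suc_mono_le[of "\<lambda>k. iter n k x"] iter_le_Suc by blast

lemma iter_refine: "iter n k x \<le> iter (Suc n) (2 * k) x"
proof (induction k arbitrary: x)
  case 0 then show ?case by (simp add: iter_0)
next
  case (Suc k)
  have "iter n (Suc k) x \<le> bellman (1 / 2 ^ n) (iter (Suc n) (2 * k)) x"
    unfolding iter_Suc using Suc by (intro bellman_mono payoff_like_iter)
  also have "\<dots> \<le> bellman (1 / 2 ^ n / 2) (bellman (1 / 2 ^ n / 2) (iter (Suc n) (2 * k))) x"
    by (rule bellman_half[OF payoff_like_iter]) simp
  also have "\<dots> = iter (Suc n) (2 * Suc k) x" by (simp add: iter_Suc mult.commute)
  finally show ?case .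
qed

text \<open>Rounding the horizon down keeps all step times within it, and it makes the values
  increase under refinement, as \<open>2 * floor y <= floor (2 * y)\<close>.\<close>

definition dyadic_value :: "nat \<Rightarrow> real \<Rightarrow> real \<Rightarrow> real" where
  "dyadic_value n \<rho> = iter n (nat \<lfloor>\<rho> * 2 ^ n\<rfloor>)"

lemma payoff_like_dyadic_value: "payoff_like (dyadic_value n \<rho>)"
  by (simp add: dyadic_value_def payoff_like_iter)

lemma dyadic_value_Suc: "dyadic_value n \<rho> x \<le> dyadic_value (Suc n) \<rho> x"
proof -
  have "2 * \<lfloor>\<rho> * 2 ^ n\<rfloor> \<le> \<lfloor>\<rho> * 2 ^ Suc n\<rfloor>"
    by (simp add: le_floor_iff)
  then have "2 * nat \<lfloor>\<rho> * 2 ^ n\<rfloor> \<le> nat \<lfloor>\<rho> * 2 ^ Suc n\<rfloor>" by linarith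
  then show ?thesis unfolding dyadic_value_def
    using iter_refine iter_mono order_trans by blast
qed

lemma dyadic_value_mono: "n \<le> m \<Longrightarrow> dyadic_value n \<rho> x \<le> dyadic_value m \<rho> x"
  using lift_Suc_mono_le[of "\<lambda>n. dyadic_value n \<rho> x"] dyadic_value_Suc by blast

definition ou_value :: "real \<Rightarrow> real \<Rightarrow> real" where
  "ou_value \<rho> x = (SUP n. dyadic_value n \<rho> x)"

lemma dyadic_value_bdd: "bdd_above (range (\<lambda>n. dyadic_value n \<rho> x))"
  using payoff_like_le[OF payoff_like_dyadic_value] by (intro bdd_aboveI2) blast

lemma dyadic_value_tendsto: "(\<lambda>n. dyadic_value n \<rho> x) \<longlonglongrightarrow> ou_value \<rho> x"
  unfolding ou_value_def using dyadic_value_mono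
  by (intro LIMSEQ_incseq_SUP dyadic_value_bdd monoI)

lemma payoff_like_ou_value: "payoff_like (ou_value \<rho>)"
proof -
  note lim = dyadic_value_tendsto and p = payoff_like_dyadic_value
  show ?thesis unfolding payoff_like_def
  proof (intro conjI allI monoI antimonoI)
    show "ou_value \<rho> x \<le> ou_value \<rho> y" if "x \<le> y" for x y
      using payoff_like_mono[OF p that] by (intro LIMSEQ_le[OF lim lim]) blast
    show "ou_value \<rho> y - y \<le> ou_value \<rho> x - x" if "x \<le> y" for x y
      using payoff_like_excess[OF p that]
      by (intro LIMSEQ_le[OF tendsto_diff[OF lim tendsto_const] tendsto_diff[OF lim tendsto_const]]) blast
    show "x \<le> ou_value \<rho> x" for x
      using payoff_like_ge[OF p] by (intro LIMSEQ_le[OF tendsto_const lim]) blast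
    show "ou_value \<rho> x \<le> upper_value x" for x
      using payoff_like_le[OF p] by (intro LIMSEQ_le[OF lim tendsto_const]) blast
  qed
qed

lemma ou_value_mono:
  assumes "\<rho> \<le> \<rho>'" shows "ou_value \<rho> x \<le> ou_value \<rho>' x"
proof (rule LIMSEQ_le[OF dyadic_value_tendsto dyadic_value_tendsto])
  have "nat \<lfloor>\<rho> * 2 ^ n\<rfloor> \<le> nat \<lfloor>\<rho>' * 2 ^ n\<rfloor>" for n
    using assms by (intro nat_mono floor_mono mult_right_mono) auto
  then show "\<exists>N. \<forall>n\<ge>N. dyadic_value n \<rho> x \<le> dyadic_value n \<rho>' x"
    unfolding dyadic_value_def using iter_mono by blast
qed

lemma ou_value_nonpos:
  assumes "\<rho> \<le> 0" shows "ou_value \<rho> x = x"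
proof -
  have "\<lfloor>\<rho> * 2 ^ n\<rfloor> \<le> 0" for n using assms by (simp add: floor_le_iff) (meson mult_nonpos_nonneg order.strict_trans1 zero_le_numeral zero_le_power zero_less_one)
  then have "dyadic_value n \<rho> x = x" for n by (simp add: dyadic_value_def iter_0)
  then show ?thesis by (simp add: ou_value_def)
qed

section \<open>Dynamic programming inequalities for the limit value\<close>

lemma ou_payoff_like_tendsto:
  assumes "\<And>n. payoff_like (g n)" "payoff_like g0" "\<And>x. (\<lambda>n. g n x) \<longlonglongrightarrow> g0 x"
  shows "(\<lambda>n. ou h (g n) x) \<longlonglongrightarrow> ou h g0 x"
  using assms by (intro ou_tendsto[where C=2] payoff_like_bound4 payoff_like_measurable tendsto_const) auto

lemma ou_time_tendsto:
  assumes "payoff_like g" "h \<longlonglongrightarrow> h0" "x \<longlonglongrightarrow> x0"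
  shows "(\<lambda>n. ou (h n) g (x n)) \<longlonglongrightarrow> ou h0 g x0"
proof (rule ou_tendsto[where C=2])
  have "(\<lambda>n. exp (- h n) * x n + sqrt (1 - exp (- 2 * h n)) * y)
      \<longlonglongrightarrow> exp (- h0) * x0 + sqrt (1 - exp (- 2 * h0)) * y" for y
    by (intro tendsto_intros assms)
  then show "AE y in gauss. (\<lambda>n. g (exp (- h n) * x n + sqrt (1 - exp (- 2 * h n)) * y))
      \<longlonglongrightarrow> g (exp (- h0) * x0 + sqrt (1 - exp (- 2 * h0)) * y)"
    by (intro AE_I2 payoff_like_tendsto[OF assms(1)])
qed (use assms payoff_like_bound4 payoff_like_measurable in blast)+

text \<open>Not stopping during the first \<open>j\<close> steps is one of the admissible
  choices.\<close>

lemma ou_iter_le: "ou (real j / 2 ^ n) (iter n k) x \<le> iter n (k + j) x"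
proof (induction j arbitrary: x)
  case 0 then show ?case by simp
next
  case (Suc j)
  have "ou (real (Suc j) / 2 ^ n) (iter n k) x = ou (1 / 2 ^ n) (ou (real j / 2 ^ n) (iter n k)) x"
    by (subst ou_ou) (auto simp: payoff_like_quartic_growth payoff_like_iter add_divide_distrib)
  also have "\<dots> \<le> ou (1 / 2 ^ n) (iter n (k + j)) x"
    by (intro ou_mono Suc ou_quartic_growth payoff_like_quartic_growth payoff_like_iter) auto
  also have "\<dots> \<le> iter n (k + Suc j) x" by (simp add: iter_Suc bellman_def)
  finally show ?case .
qed

lemma dyadic_index:
  assumes "m \<le> n" "0 \<le> \<rho>"
  shows "nat \<lfloor>(\<rho> + real i / 2 ^ m) * 2 ^ n\<rfloor> = nat \<lfloor>\<rho> * 2 ^ n\<rfloor> + i * 2 ^ (n - m)"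
    and "real (i * 2 ^ (n - m)) / 2 ^ n = real i / 2 ^ m"
proof -
  have p: "(2::real) ^ n = 2 ^ m * 2 ^ (n - m)" using assms(1) by (simp flip: power_add)
  show "real (i * 2 ^ (n - m)) / 2 ^ n = real i / 2 ^ m" by (simp add: p)
  have "(\<rho> + real i / 2 ^ m) * 2 ^ n = \<rho> * 2 ^ n + of_int (int (i * 2 ^ (n - m)))"
    by (simp add: p distrib_right)
  then have "\<lfloor>(\<rho> + real i / 2 ^ m) * 2 ^ n\<rfloor> = \<lfloor>\<rho> * 2 ^ n\<rfloor> + int (i * 2 ^ (n - m))"
    by (simp only: floor_add_int)
  moreover have "0 \<le> \<lfloor>\<rho> * 2 ^ n\<rfloor>" using assms(2) by simp
  ultimately show "nat \<lfloor>(\<rho> + real i / 2 ^ m) * 2 ^ n\<rfloor> = nat \<lfloor>\<rho> * 2 ^ n\<rfloor> + i * 2 ^ (n - m)"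
    by (simp add: nat_add_distrib nat_mult_distrib nat_power_eq)
qed

lemma dyadic_floor_tendsto: "(\<lambda>n. of_int \<lfloor>h * 2 ^ n\<rfloor> / 2 ^ n) \<longlonglongrightarrow> (h::real)"
proof (rule LIM_zero_cancel, rule Lim_null_comparison)
  show "\<forall>\<^sub>F n in sequentially. norm (of_int \<lfloor>h * 2 ^ n\<rfloor> / 2 ^ n - h) \<le> (1 / 2) ^ n"
  proof (rule always_eventually, rule allI)
    fix n
    have "of_int \<lfloor>h * 2 ^ n\<rfloor> / 2 ^ n - h = (of_int \<lfloor>h * 2 ^ n\<rfloor> - h * 2 ^ n) / 2 ^ n" by (simp add: field_simps)
    moreover have "\<bar>of_int \<lfloor>h * 2 ^ n\<rfloor> - h * 2 ^ n\<bar> \<le> 1" by linarith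
    ultimately show "norm (of_int \<lfloor>h * 2 ^ n\<rfloor> / 2 ^ n - h) \<le> (1 / 2) ^ n"
      by (simp add: power_divide divide_right_mono)
  qed
qed (auto intro: LIMSEQ_power_zero)

text \<open>For dyadic \<open>h\<close> the inequality passes to the limit from
  \<open>ou_iter_le\<close>, the floor being exact under dyadic shifts. A general \<open>h\<close>
  is approximated by dyadics from below, and the right side is increasing in the horizon.\<close>

lemma ou_ou_value_le:
  assumes \<rho>: "0 \<le> \<rho>" and h: "0 \<le> h" shows "ou h (ou_value \<rho>) x \<le> ou_value (\<rho> + h) x"
proof -
  have dy: "ou (real i / 2 ^ m) (ou_value \<rho>) x \<le> ou_value (\<rho> + real i / 2 ^ m) x" for i m
  proof (rule LIMSEQ_le)
    show "(\<lambda>n. ou (real i / 2 ^ m) (dyadic_value n \<rho>) x) \<longlonglongrightarrow> ou (real i / 2 ^ m) (ou_value \<rho>) x"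
      by (intro ou_payoff_like_tendsto payoff_like_dyadic_value payoff_like_ou_value dyadic_value_tendsto)
    show "(\<lambda>n. dyadic_value n (\<rho> + real i / 2 ^ m) x) \<longlonglongrightarrow> ou_value (\<rho> + real i / 2 ^ m) x"
      by (rule dyadic_value_tendsto)
    show "\<exists>N. \<forall>n\<ge>N. ou (real i / 2 ^ m) (dyadic_value n \<rho>) x \<le> dyadic_value n (\<rho> + real i / 2 ^ m) x"
    proof (intro exI allI impI)
      fix n assume "m \<le> n"
      show "ou (real i / 2 ^ m) (dyadic_value n \<rho>) x \<le> dyadic_value n (\<rho> + real i / 2 ^ m) x"
        using ou_iter_le[of "i * 2 ^ (n - m)" n "nat \<lfloor>\<rho> * 2 ^ n\<rfloor>" x]
        unfolding dyadic_value_def dyadic_index(1)[OF \<open>m \<le> n\<close> \<rho>] dyadic_index(2)[OF \<open>m \<le> n\<close> \<rho>] .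
    qed
  qed
  show ?thesis
  proof (rule LIMSEQ_le_const2)
    show "(\<lambda>n. ou (of_int \<lfloor>h * 2 ^ n\<rfloor> / 2 ^ n) (ou_value \<rho>) x) \<longlonglongrightarrow> ou h (ou_value \<rho>) x"
      by (intro ou_time_tendsto payoff_like_ou_value dyadic_floor_tendsto tendsto_const)
    have "ou (of_int \<lfloor>h * 2 ^ n\<rfloor> / 2 ^ n) (ou_value \<rho>) x \<le> ou_value (\<rho> + h) x" for n
    proof -
      have i: "real (nat \<lfloor>h * 2 ^ n\<rfloor>) = of_int \<lfloor>h * 2 ^ n\<rfloor>" using h by simp
      have "of_int \<lfloor>h * 2 ^ n\<rfloor> / 2 ^ n \<le> h" by (simp add: divide_le_eq)
      then have "ou_value (\<rho> + of_int \<lfloor>h * 2 ^ n\<rfloor> / 2 ^ n) x \<le> ou_value (\<rho> + h) x"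
        by (intro ou_value_mono) simp
      then show ?thesis using dy[of "nat \<lfloor>h * 2 ^ n\<rfloor>" n] unfolding i by linarith
    qed
    then show "\<exists>N. \<forall>n\<ge>N. ou (of_int \<lfloor>h * 2 ^ n\<rfloor> / 2 ^ n) (ou_value \<rho>) x \<le> ou_value (\<rho> + h) x" by blast
  qed
qed

lemma ou_sum:
  assumes "\<And>i. i \<in> I \<Longrightarrow> quartic_growth (f i)" "finite I"
  shows "ou h (\<lambda>x. \<Sum>i\<in>I. f i x) x = (\<Sum>i\<in>I. ou h (f i) x) \<and> quartic_growth (\<lambda>x. \<Sum>i\<in>I. f i x)"
  using assms(2,1)
  by (induction rule: finite_induct) (auto simp: ou_const ou_add quartic_growth_add)

text \<open>A discrete early exercise premium. Stopping at \<open>\<xi>\<close> instead of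
  continuing for one step of length \<open>\<delta>\<close> gains at most
  \<open>(1 - exp (- 2 * \<delta>)) * \<xi> <= 2 * \<delta> * e \<xi>\<close>. One \<open>e\<close>
  serves all steps: with more steps to go the iterate is larger, so the stopping set is contained in
  that of \<open>iter n k\<close>.\<close>

lemma iter_le_ou:
  assumes e: "quartic_growth e" "\<And>\<xi>. 0 \<le> e \<xi>" "\<And>\<xi>. iter n k \<xi> \<le> \<xi> \<Longrightarrow> \<xi> \<le> e \<xi>"
  shows "iter n (k + j) x \<le> ou (real j / 2 ^ n) (iter n k) x + 2 / 2 ^ n * (\<Sum>i<j. ou (real i / 2 ^ n) e x)"
proof (induction j arbitrary: x)
  case 0 then show ?case by simp
next
  case (Suc j)
  define \<delta> :: real where "\<delta> = 1 / 2 ^ n"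
  have \<delta>: "0 \<le> \<delta>" by (simp add: \<delta>_def)
  have q: "quartic_growth (iter n k)" for k by (intro payoff_like_quartic_growth payoff_like_iter)
  have mul: "real i / 2 ^ n = real i * \<delta>" "2 / 2 ^ n = 2 * \<delta>" for i by (simp_all add: \<delta>_def)
  let ?A = "ou \<delta> (iter n (k + j)) x"
  have qe: "quartic_growth (ou (real i * \<delta>) e)" for i using \<delta> by (intro ou_quartic_growth e) auto
  have qs: "quartic_growth (\<lambda>x. \<Sum>i<j. ou (real i * \<delta>) e x)"
    and s: "ou \<delta> (\<lambda>x. \<Sum>i<j. ou (real i * \<delta>) e x) x = (\<Sum>i<j. ou \<delta> (ou (real i * \<delta>) e) x)"
    using ou_sum[of "{..<j}" "\<lambda>i. ou (real i * \<delta>) e"] qe by auto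
  have "?A \<le> ou \<delta> (\<lambda>x. ou (real j * \<delta>) (iter n k) x + 2 * \<delta> * (\<Sum>i<j. ou (real i * \<delta>) e x)) x"
    using \<delta> Suc[unfolded mul] by (intro ou_mono q quartic_growth_add ou_quartic_growth quartic_growth_cmult qs) auto
  also have "\<dots> = ou \<delta> (ou (real j * \<delta>) (iter n k)) x + 2 * \<delta> * (\<Sum>i<j. ou \<delta> (ou (real i * \<delta>) e) x)"
    using \<delta> by (subst ou_add) (auto intro!: q ou_quartic_growth quartic_growth_cmult qs simp: ou_cmult s)
  also have "\<dots> = ou (real (Suc j) * \<delta>) (iter n k) x + 2 * \<delta> * (\<Sum>i<j. ou (real (Suc i) * \<delta>) e x)"
    using \<delta> by (simp add: ou_ou[OF q] ou_ou[OF e(1)] distrib_right)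
  finally have A: "?A \<le> ou (real (Suc j) * \<delta>) (iter n k) x + 2 * \<delta> * (\<Sum>i<j. ou (real (Suc i) * \<delta>) e x)" .
  have S: "(\<Sum>i<Suc j. ou (real i * \<delta>) e x) = e x + (\<Sum>i<j. ou (real (Suc i) * \<delta>) e x)"
    by (subst sum.lessThan_Suc_shift) simp
  \<comment> \<open>If continuing is at least as good there is nothing to pay; otherwise the iterate
    equals \<open>x\<close>, and \<open>?A\<close> is at least the reward
    \<open>exp (- 2 * \<delta>) * x\<close> of waiting one step and then stopping.\<close>
  have B: "iter n (k + Suc j) x \<le> ?A + 2 * \<delta> * e x"
  proof (cases "x \<le> ?A")
    case True then show ?thesis using e(2)[of x] \<delta> by (simp add: iter_Suc bellman_def flip: \<delta>_def)
  next
    case False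
    then have eq: "iter n (k + Suc j) x = x" by (simp add: iter_Suc bellman_def flip: \<delta>_def)
    then have "x \<le> e x" using iter_mono[of k "k + Suc j" n x] by (intro e(3)) auto
    have "exp (- 2 * \<delta>) * x \<le> ?A"
      using ou_mono[OF quartic_growth_id q payoff_like_ge[OF payoff_like_iter], of \<delta> x] by (simp add: ou_id)
    then have "x - ?A \<le> (1 - exp (- 2 * \<delta>)) * x" by (simp add: algebra_simps)
    also have "\<dots> \<le> (1 - exp (- 2 * \<delta>)) * e x"
      using \<delta> \<open>x \<le> e x\<close> by (intro mult_left_mono) auto
    also have "\<dots> \<le> 2 * \<delta> * e x"
      using e(2) exp_ge_add_one_self[of "- 2 * \<delta>"] by (intro mult_right_mono) auto
    finally show ?thesis unfolding eq by simp
  qed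
  show ?case unfolding mul S distrib_left using A B by linarith
qed

text \<open>The limit of \<open>iter_le_ou\<close>: with \<open>B\<close> above
  \<open>ou v e x\<close> on the whole window the sum becomes \<open>h * B\<close>. The domination
  by \<open>e\<close> is asked only for large \<open>n\<close>, since it will come from a strict
  inequality in the limit; \<open>h < H\<close> leaves room for approximating \<open>h\<close> by
  dyadics from above.\<close>

lemma ou_value_le_ou:
  assumes e: "quartic_growth e" "\<And>\<xi>. 0 \<le> e \<xi>"
    and ev: "\<forall>\<^sub>F n in sequentially. \<forall>\<xi>. dyadic_value n \<rho> \<xi> \<le> \<xi> \<longrightarrow> \<xi> \<le> e \<xi>"
    and B: "\<And>v. 0 \<le> v \<Longrightarrow> v \<le> H \<Longrightarrow> ou v e x \<le> B"
    and \<rho>: "0 \<le> \<rho>" and h: "0 \<le> h" "h < H"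
  shows "ou_value (\<rho> + h) x \<le> ou h (ou_value \<rho>) x + 2 * h * B"
proof -
  have dy: "ou_value (\<rho> + real i / 2 ^ m) x \<le> ou (real i / 2 ^ m) (ou_value \<rho>) x + 2 * (real i / 2 ^ m) * B"
    if iH: "real i / 2 ^ m \<le> H" for i m
  proof (rule LIMSEQ_le)
    show "(\<lambda>n. ou (real i / 2 ^ m) (dyadic_value n \<rho>) x + 2 * (real i / 2 ^ m) * B)
        \<longlonglongrightarrow> ou (real i / 2 ^ m) (ou_value \<rho>) x + 2 * (real i / 2 ^ m) * B"
      by (intro tendsto_add ou_payoff_like_tendsto payoff_like_dyadic_value payoff_like_ou_value
          dyadic_value_tendsto tendsto_const)
    show "(\<lambda>n. dyadic_value n (\<rho> + real i / 2 ^ m) x) \<longlonglongrightarrow> ou_value (\<rho> + real i / 2 ^ m) x"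
      by (rule dyadic_value_tendsto)
    obtain N where N: "\<And>n \<xi>. N \<le> n \<Longrightarrow> dyadic_value n \<rho> \<xi> \<le> \<xi> \<Longrightarrow> \<xi> \<le> e \<xi>"
      using ev by (auto simp: eventually_sequentially)
    show "\<exists>N. \<forall>n\<ge>N. dyadic_value n (\<rho> + real i / 2 ^ m) x
        \<le> ou (real i / 2 ^ m) (dyadic_value n \<rho>) x + 2 * (real i / 2 ^ m) * B"
    proof (intro exI allI impI)
      fix n assume n: "max m N \<le> n"
      then have "m \<le> n" "N \<le> n" by auto
      define j where "j = i * 2 ^ (n - m)"
      have j: "real j / 2 ^ n = real i / 2 ^ m" unfolding j_def using dyadic_index(2)[OF \<open>m \<le> n\<close> \<rho>] .
      have "dyadic_value n (\<rho> + real i / 2 ^ m) x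
          \<le> ou (real j / 2 ^ n) (dyadic_value n \<rho>) x + 2 / 2 ^ n * (\<Sum>l<j. ou (real l / 2 ^ n) e x)"
        using N[OF \<open>N \<le> n\<close>] e
        unfolding dyadic_value_def dyadic_index(1)[OF \<open>m \<le> n\<close> \<rho>] j_def[symmetric]
        by (intro iter_le_ou) auto
      also have "2 / 2 ^ n * (\<Sum>l<j. ou (real l / 2 ^ n) e x) \<le> 2 / 2 ^ n * (\<Sum>l<j. B)"
      proof (rule mult_left_mono)
       show "(\<Sum>l<j. ou (real l / 2 ^ n) e x) \<le> (\<Sum>l<j. B)"
       proof (intro sum_mono B)
        fix l assume "l \<in> {..<j}"
        then have "real l / 2 ^ n \<le> real j / 2 ^ n" by (intro divide_right_mono) auto
        then show "real l / 2 ^ n \<le> H" using iH j by linarith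
       qed auto
      qed simp
      also have "2 / 2 ^ n * (\<Sum>l<j. B) = 2 * (real j / 2 ^ n) * B" by simp
      finally show "dyadic_value n (\<rho> + real i / 2 ^ m) x
        \<le> ou (real i / 2 ^ m) (dyadic_value n \<rho>) x + 2 * (real i / 2 ^ m) * B"
        unfolding j by simp
    qed
  qed
  \<comment> \<open>Approximation from above, so that the value at the horizon
    \<open>\<rho> + h\<close> is bounded by the one at \<open>\<rho> + d n\<close>.\<close>
  define d where "d n = (of_int \<lfloor>h * 2 ^ n\<rfloor> / 2 ^ n + (1 / 2) ^ n :: real)" for n
  have d: "d \<longlonglongrightarrow> h"
    unfolding d_def using tendsto_add[OF dyadic_floor_tendsto[of h] LIMSEQ_power_zero[of "1/2 :: real"]] by simp
  have di: "d n = real (nat \<lfloor>h * 2 ^ n\<rfloor> + 1) / 2 ^ n" for n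
    using h by (simp add: d_def power_divide add_divide_distrib)
  have "\<forall>\<^sub>F n in sequentially. d n < H" using order_tendstoD(2)[OF d h(2)] .
  then have ev2: "\<forall>\<^sub>F n in sequentially. ou_value (\<rho> + h) x \<le> ou (d n) (ou_value \<rho>) x + 2 * d n * B"
  proof eventually_elim
    case (elim n)
    have "h \<le> d n" unfolding di using h by (simp add: le_divide_eq) linarith
    then have "ou_value (\<rho> + h) x \<le> ou_value (\<rho> + d n) x" by (intro ou_value_mono) simp
    also have "\<dots> \<le> ou (d n) (ou_value \<rho>) x + 2 * d n * B"
      unfolding di using elim by (intro dy) (simp add: di)
    finally show ?case .
  qed
  have lim: "(\<lambda>n. ou (d n) (ou_value \<rho>) x + 2 * d n * B) \<longlonglongrightarrow> ou h (ou_value \<rho>) x + 2 * h * B"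
    by (intro tendsto_intros ou_time_tendsto payoff_like_ou_value d)
  show ?thesis
    by (rule tendsto_lowerbound[OF lim ev2]) simp
qed

text \<open>The crudest admissible \<open>e\<close>, the absolute value, bounds the premium by
  \<open>O(h)\<close> at every point.\<close>

lemma ou_value_le_ou_linear:
  assumes "0 \<le> \<rho>" "0 \<le> h"
  shows "ou_value (\<rho> + h) x \<le> ou h (ou_value \<rho>) x + 2 * h * (2 + \<bar>x\<bar>)"
proof (rule ou_value_le_ou[where e="\<lambda>\<xi>. \<bar>\<xi>\<bar>" and H="h + 1"])
  show "quartic_growth (\<lambda>\<xi>. \<bar>\<xi>\<bar>)" by (rule quartic_growth_linear[where C=1]) auto
  show "ou v (\<lambda>\<xi>. \<bar>\<xi>\<bar>) x \<le> 2 + \<bar>x\<bar>" if "0 \<le> v" for v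
    using ou_linear_bound[of "\<lambda>\<xi>. \<bar>\<xi>\<bar>" 1 v x] that by simp
qed (use assms in \<open>auto intro!: always_eventually\<close>)

text \<open>Stopping can occur only above the continuation point \<open>y\<close>, so
  \<open>e\<close> may vanish up to \<open>y\<close>, and by \<open>ou_local\<close> it contributes
  only \<open>O(h^2)\<close> at \<open>x\<close>. The window is taken as \<open>H = 2 * h\<close>,
  whence \<open>8 = 2 * 2^2\<close>.\<close>

lemma ou_value_le_ou_local:
  assumes y: "y < ou_value \<rho> y" and x: "x < y" and \<rho>: "0 \<le> \<rho>" and h: "0 < h" "h \<le> 1/2"
  shows "ou_value (\<rho> + h) x \<le> ou h (ou_value \<rho>) x + 8 * local_const 1 x (y - x) * h ^ 3"
proof -
  define e where "e \<xi> = (if \<xi> \<le> y then 0 else max 0 \<xi>)" for \<xi> :: real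
  have [measurable]: "e \<in> borel_measurable borel" unfolding e_def by measurable
  have eb: "\<bar>e \<xi>\<bar> \<le> 1 * (1 + \<bar>\<xi>\<bar>)" for \<xi> by (auto simp: e_def)
  have "ou_value (\<rho> + h) x \<le> ou h (ou_value \<rho>) x + 2 * h * (local_const 1 x (y - x) * (2 * h)\<^sup>2)"
  proof (rule ou_value_le_ou[where e=e and H="2 * h"])
    show "quartic_growth e" using eb by (intro quartic_growth_linear[where C=1]) auto
    show "0 \<le> e \<xi>" for \<xi> by (simp add: e_def)
    have "\<forall>\<^sub>F n in sequentially. y < dyadic_value n \<rho> y"
      using order_tendstoD(1)[OF dyadic_value_tendsto y] .
    then show "\<forall>\<^sub>F n in sequentially. \<forall>\<xi>. dyadic_value n \<rho> \<xi> \<le> \<xi> \<longrightarrow> \<xi> \<le> e \<xi>"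
    proof eventually_elim
      case (elim n)
      show ?case
      proof (intro allI impI)
        fix \<xi> assume "dyadic_value n \<rho> \<xi> \<le> \<xi>"
        then have "\<not> \<xi> \<le> y"
          using payoff_like_excess[OF payoff_like_dyadic_value, of \<xi> y n \<rho>] elim by auto
        then show "\<xi> \<le> e \<xi>" by (simp add: e_def)
      qed
    qed
    fix v assume v: "0 \<le> v" "v \<le> 2 * h"
    have "\<bar>ou v e x\<bar> \<le> local_const 1 x (y - x) * v\<^sup>2"
      using x v h eb by (intro ou_local) (auto simp: e_def)
    also have "\<dots> \<le> local_const 1 x (y - x) * (2 * h)\<^sup>2"
      using v x by (intro mult_left_mono power_mono local_const_nonneg) auto
    finally show "ou v e x \<le> local_const 1 x (y - x) * (2 * h)\<^sup>2" by simp
  qed (use \<rho> h in auto)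
  then show ?thesis by (simp add: power_mult_distrib power2_eq_square power3_eq_cube mult_ac)
qed

section \<open>Continuity of the value in horizon and state\<close>

lemma ou_payoff_like_le:
  assumes g: "payoff_like g" and h: "0 \<le> h"
  shows "ou h g x \<le> g x + h * (1 + 2 * \<bar>x\<bar>) + sqrt (2 * h)"
proof -
  let ?s = "sqrt (1 - exp (- 2 * h))" and ?e = "exp (- h)"
  have e: "0 < ?e" "?e \<le> 1" "1 - h \<le> ?e" using h exp_ge_add_one_self[of "-h"] by auto
  have s: "0 \<le> ?s" "?s \<le> sqrt (2 * h)" using h exp_ge_add_one_self[of "-2 * h"] by auto
  have "(\<integral>y. g (?e * x + ?s * y) \<partial>gauss) \<le> (\<integral>y. (g x + h * \<bar>x\<bar>) + ?s * \<bar>y\<bar> \<partial>gauss)"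
  proof (rule integral_mono)
    show "integrable gauss (\<lambda>y. g (?e * x + ?s * y))"
      by (intro ou_integrable payoff_like_quartic_growth g)
    fix y :: real
    have "g (?e * x + ?s * y) - g x \<le> \<bar>?e * x + ?s * y - x\<bar>"
      using payoff_like_lipschitz[OF g, of "?e * x + ?s * y" x] by linarith
    also have "?e * x + ?s * y - x = ?s * y - (1 - ?e) * x" by (simp add: algebra_simps)
    also have "\<bar>?s * y - (1 - ?e) * x\<bar> \<le> \<bar>(1 - ?e) * x\<bar> + \<bar>?s * y\<bar>"
      using abs_triangle_ineq4[of "?s * y" "(1 - ?e) * x"] by simp
    also have "\<bar>(1 - ?e) * x\<bar> \<le> h * \<bar>x\<bar>" using e by (simp add: abs_mult mult_right_mono)
    finally show "g (?e * x + ?s * y) \<le> (g x + h * \<bar>x\<bar>) + ?s * \<bar>y\<bar>" using s by (simp add: abs_mult)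
  qed simp
  also have "\<dots> = g x + h * \<bar>x\<bar> + ?s * (\<integral>y. \<bar>y\<bar> \<partial>gauss)" by simp
  also have "?s * (\<integral>y. \<bar>y\<bar> \<partial>gauss) \<le> sqrt (2 * h) * 1"
    using s integral_gauss_abs_le by (intro mult_mono integral_nonneg_AE) auto
  finally have 1: "(\<integral>y. g (?e * x + ?s * y) \<partial>gauss) \<le> g x + h * \<bar>x\<bar> + sqrt (2 * h)" by simp
  have "ou h g x \<le> ?e * (g x + (h * \<bar>x\<bar> + sqrt (2 * h)))"
    unfolding ou_def using e 1 by (intro mult_left_mono) (auto simp: add.assoc)
  also have "\<dots> = ?e * g x + ?e * (h * \<bar>x\<bar> + sqrt (2 * h))" by (simp only: distrib_left)
  also have "?e * (h * \<bar>x\<bar> + sqrt (2 * h)) \<le> 1 * (h * \<bar>x\<bar> + sqrt (2 * h))"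
    using e h by (intro mult_right_mono) auto
  also have "?e * g x \<le> g x + h * (1 + \<bar>x\<bar>)"
  proof -
    have "?e * g x - g x = (1 - ?e) * (- g x)" by (simp add: algebra_simps)
    also have "\<dots> \<le> (1 - ?e) * (1 + \<bar>x\<bar>)"
      using e payoff_like_bound[OF g, of x] by (intro mult_left_mono) auto
    also have "\<dots> \<le> h * (1 + \<bar>x\<bar>)" using e by (intro mult_right_mono) auto
    finally show ?thesis by simp
  qed
  finally show ?thesis by (simp add: algebra_simps)
qed

text \<open>Over a step \<open>h\<close> the semigroup raises a 1-Lipschitz payoff by at most
  \<open>O(sqrt h)\<close> and the premium is \<open>O(h)\<close>; \<open>5 + 4 |x|\<close> adds up
  \<open>1 + 2 |x|\<close> and \<open>2 * (2 + |x|)\<close>. Negative horizons are reduced to 0,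
  where the value is the identity.\<close>

lemma ou_value_time_diff:
  assumes "\<rho> \<le> \<rho>'"
  shows "ou_value \<rho>' x - ou_value \<rho> x \<le> (\<rho>' - \<rho>) * (5 + 4 * \<bar>x\<bar>) + sqrt (2 * (\<rho>' - \<rho>))"
proof -
  have *: "ou_value \<rho>' x - ou_value \<rho> x \<le> (\<rho>' - \<rho>) * (5 + 4 * \<bar>x\<bar>) + sqrt (2 * (\<rho>' - \<rho>))"
    if "0 \<le> \<rho>" "\<rho> \<le> \<rho>'" for \<rho> \<rho>'
  proof -
    define h where "h = \<rho>' - \<rho>"
    have h: "0 \<le> h" "\<rho>' = \<rho> + h" using that by (auto simp: h_def)
    show ?thesis unfolding h(2)
      using ou_value_le_ou_linear[OF that(1) h(1), of x] ou_payoff_like_le[OF payoff_like_ou_value h(1), of \<rho> x]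
      by (simp add: algebra_simps)
  qed
  have m: "ou_value \<rho> = ou_value (max 0 \<rho>)" for \<rho> by (cases "0 \<le> \<rho>") (auto simp: ou_value_nonpos max_def)
  let ?h = "max 0 \<rho>' - max 0 \<rho>"
  have le: "?h \<le> \<rho>' - \<rho>" "0 \<le> ?h" using assms by auto
  have "ou_value \<rho>' x - ou_value \<rho> x \<le> ?h * (5 + 4 * \<bar>x\<bar>) + sqrt (2 * ?h)"
    using *[of "max 0 \<rho>" "max 0 \<rho>'"] assms by (simp flip: m)
  also have "\<dots> \<le> (\<rho>' - \<rho>) * (5 + 4 * \<bar>x\<bar>) + sqrt (2 * (\<rho>' - \<rho>))"
    using le(1) by (intro add_mono mult_right_mono real_sqrt_le_mono mult_left_mono) auto
  finally show ?thesis .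
qed

lemma ou_value_time_abs_diff:
  "\<bar>ou_value \<rho>' x - ou_value \<rho> x\<bar> \<le> \<bar>\<rho>' - \<rho>\<bar> * (5 + 4 * \<bar>x\<bar>) + sqrt (2 * \<bar>\<rho>' - \<rho>\<bar>)"
proof (cases "\<rho> \<le> \<rho>'")
  case True then show ?thesis using ou_value_time_diff[OF True, of x] ou_value_mono[OF True, of x] by simp
next
  case False then have "\<rho>' \<le> \<rho>" by simp
  then show ?thesis using ou_value_time_diff[OF \<open>\<rho>' \<le> \<rho>\<close>, of x] ou_value_mono[OF \<open>\<rho>' \<le> \<rho>\<close>, of x]
    by (simp add: abs_minus_commute)
qed

lemma ou_value_tendsto:
  assumes r: "(r \<longlongrightarrow> \<rho>) F" and x: "(x \<longlongrightarrow> x0) F"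
  shows "((\<lambda>n. ou_value (r n) (x n)) \<longlongrightarrow> ou_value \<rho> x0) F"
proof (rule LIM_zero_cancel, rule Lim_null_comparison)
  show "\<forall>\<^sub>F n in F. norm (ou_value (r n) (x n) - ou_value \<rho> x0)
      \<le> \<bar>x n - x0\<bar> + (\<bar>r n - \<rho>\<bar> * (5 + 4 * \<bar>x0\<bar>) + sqrt (2 * \<bar>r n - \<rho>\<bar>))"
  proof (rule always_eventually, rule allI)
    fix n
    have "\<bar>ou_value (r n) (x n) - ou_value (r n) x0\<bar> \<le> \<bar>x n - x0\<bar>"
      by (rule payoff_like_lipschitz[OF payoff_like_ou_value])
    then show "norm (ou_value (r n) (x n) - ou_value \<rho> x0)
      \<le> \<bar>x n - x0\<bar> + (\<bar>r n - \<rho>\<bar> * (5 + 4 * \<bar>x0\<bar>) + sqrt (2 * \<bar>r n - \<rho>\<bar>))"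
      using ou_value_time_abs_diff[of "r n" x0 \<rho>] by simp linarith
  qed
  have a: "((\<lambda>n. x n - x0) \<longlongrightarrow> 0) F" and b: "((\<lambda>n. r n - \<rho>) \<longlongrightarrow> 0) F"
    using x r by (simp_all add: LIM_zero)
  show "((\<lambda>n. \<bar>x n - x0\<bar> + (\<bar>r n - \<rho>\<bar> * (5 + 4 * \<bar>x0\<bar>) + sqrt (2 * \<bar>r n - \<rho>\<bar>))) \<longlongrightarrow> 0) F"
    using tendsto_add[OF tendsto_rabs_zero[OF a] tendsto_add[OF
        tendsto_mult[OF tendsto_rabs_zero[OF b] tendsto_const[of "5 + 4 * \<bar>x0\<bar>"]]
        tendsto_real_sqrt[OF tendsto_mult[OF tendsto_const[of 2] tendsto_rabs_zero[OF b]]]]]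
    by simp
qed

section \<open>The stopping boundary\<close>

text \<open>For \<open>\<rho> > 0\<close> every negative point continues, so inserting 0 changes the
  supremum only when the set is empty, that is for \<open>\<rho> <= 0\<close>; there it assigns 0,
  the point where the source \<open>2 * x\<close> changes sign.\<close>

definition ou_boundary :: "real \<Rightarrow> real" where
  "ou_boundary \<rho> = Sup (insert 0 {x. x < ou_value \<rho> x})"

lemma ou_boundary_bdd: "bdd_above (insert 0 {x. x < ou_value \<rho> x})"
proof (rule bdd_aboveI[where M=2])
  fix x assume "x \<in> insert 0 {x. x < ou_value \<rho> x}"
  moreover have "x < ou_value \<rho> x \<Longrightarrow> x \<le> 2"
    using payoff_like_le[OF payoff_like_ou_value, of \<rho> x] by (auto simp: upper_value_def split: if_splits)
  ultimately show "x \<le> 2" by auto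
qed

lemma ou_boundary_nonneg: "0 \<le> ou_boundary \<rho>"
  unfolding ou_boundary_def by (rule cSup_upper[OF _ ou_boundary_bdd]) simp

lemma ou_boundary_mono: "mono ou_boundary"
proof (rule monoI)
  fix \<rho> \<rho>' :: real assume "\<rho> \<le> \<rho>'"
  then show "ou_boundary \<rho> \<le> ou_boundary \<rho>'"
    unfolding ou_boundary_def using ou_value_mono[OF \<open>\<rho> \<le> \<rho>'\<close>]
    by (intro cSup_subset_mono ou_boundary_bdd) (auto intro: order.strict_trans2)
qed

lemma ou_boundary_nonpos: "\<rho> \<le> 0 \<Longrightarrow> ou_boundary \<rho> = 0"
  by (simp add: ou_boundary_def ou_value_nonpos)

text \<open>The boundary point itself is included: a point with \<open>x < ou_value \<rho> x\<close>
  has, by monotonicity, another such point halfway up to \<open>ou_value \<rho> x\<close>, so it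
  lies strictly below the supremum.\<close>

lemma ou_value_above_boundary:
  assumes "ou_boundary \<rho> \<le> x" shows "ou_value \<rho> x = x"
proof (rule ccontr)
  assume "ou_value \<rho> x \<noteq> x"
  then have lt: "x < ou_value \<rho> x" using payoff_like_ge[OF payoff_like_ou_value, of x \<rho>] by simp
  define y where "y = x + (ou_value \<rho> x - x) / 2"
  have "x < y" using lt by (simp add: y_def)
  moreover have "y < ou_value \<rho> y"
    using payoff_like_mono[OF payoff_like_ou_value, of x y \<rho>] lt \<open>x < y\<close> by (simp add: y_def field_simps)
  then have "y \<le> ou_boundary \<rho>" unfolding ou_boundary_def by (intro cSup_upper ou_boundary_bdd) auto
  ultimately show False using assms by simp
qed

text \<open>For negative \<open>x\<close> holding to the horizon already gives
  \<open>exp (- 2 * \<rho>) * x > x\<close>. For \<open>x >= 0\<close> the decreasing excess carries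
  the strict inequality down from a continuation point \<open>y > x\<close>.\<close>

lemma ou_value_below_boundary:
  assumes \<rho>: "0 < \<rho>" and x: "x < ou_boundary \<rho>" shows "x < ou_value \<rho> x"
proof (cases "x < 0")
  case True
  have "ou \<rho> (ou_value 0) x \<le> ou_value \<rho> x" using ou_ou_value_le[of 0 \<rho> x] \<rho> by simp
  moreover have "ou \<rho> (ou_value 0) x = exp (- 2 * \<rho>) * x"
    by (simp add: ou_value_nonpos[of 0, THEN ext, OF order_refl] ou_id del: mult_minus_left)
  moreover have "x < exp (- 2 * \<rho>) * x"
    using mult_strict_right_mono_neg[of "exp (- 2 * \<rho>)" 1 x] True \<rho> by simp
  ultimately show ?thesis by simp
next
  case False
  obtain y where y: "y \<in> insert 0 {x. x < ou_value \<rho> x}" "x < y"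
    using x unfolding ou_boundary_def by (subst (asm) less_cSup_iff[OF _ ou_boundary_bdd]) auto
  then have "y < ou_value \<rho> y" using False by auto
  then show ?thesis using payoff_like_excess[OF payoff_like_ou_value, of x y \<rho>] y by auto
qed

lemma ou_value_gt_iff: "0 < \<rho> \<Longrightarrow> x < ou_value \<rho> x \<longleftrightarrow> x < ou_boundary \<rho>"
  using ou_value_below_boundary ou_value_above_boundary by (metis not_less order_less_irrefl)

text \<open>The boundary increases with the horizon, so around \<open>x\<close> the value is the
  identity for every horizon up to \<open>\<rho>\<close>; the excess over the identity is then a
  case of \<open>ou_local\<close>.\<close>

lemma ou_excess_near_boundary:
  assumes x: "ou_boundary \<rho> < x" and h: "0 \<le> h" "h \<le> 1" and \<rho>': "\<rho>' \<le> \<rho>"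
  shows "ou h (ou_value \<rho>') x \<le> exp (- 2 * h) * x + local_const 2 x (x - ou_boundary \<rho>) * h\<^sup>2"
proof -
  let ?e = "\<lambda>\<xi>. ou_value \<rho>' \<xi> - \<xi>"
  have m: "ou_value \<rho>' \<in> borel_measurable borel" by (intro payoff_like_measurable payoff_like_ou_value)
  have "\<bar>ou h ?e x\<bar> \<le> local_const 2 x (x - ou_boundary \<rho>) * h\<^sup>2"
  proof (rule ou_local)
    show "?e \<in> borel_measurable borel" using m by measurable
    show "\<bar>?e \<xi>\<bar> \<le> 2 * (1 + \<bar>\<xi>\<bar>)" for \<xi> using payoff_like_bound[OF payoff_like_ou_value, of \<rho>' \<xi>] by auto
    show "?e \<xi> = 0" if "\<bar>\<xi> - x\<bar> < x - ou_boundary \<rho>" for \<xi>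
      using that monoD[OF ou_boundary_mono \<rho>'] by (simp add: ou_value_above_boundary)
  qed (use x h in auto)
  moreover have "ou h ?e x = ou h (ou_value \<rho>') x - exp (- 2 * h) * x"
    by (subst ou_diff[OF payoff_like_quartic_growth[OF payoff_like_ou_value] quartic_growth_id]) (simp only: ou_id)
  ultimately show ?thesis by linarith
qed

text \<open>Suppose the boundary jumps up just after \<open>\<rho>\<close>, and take
  \<open>x\<close> inside the gap. After \<open>\<rho>\<close> stopping is far from
  \<open>x\<close>, so the premium over a step \<open>h\<close> is \<open>O(h^3)\<close>; at
  \<open>\<rho>\<close> the value is the identity near \<open>x\<close>, which the semigroup lowers
  to \<open>exp (- 2 * h) * x + O(h^2)\<close>. Hence \<open>x <= x - 2 * h * x + O(h^2)\<close>,
  impossible for \<open>x > 0\<close> and small \<open>h\<close>.\<close>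

lemma ou_boundary_right_limit:
  assumes \<rho>: "0 \<le> \<rho>" and \<epsilon>: "0 < \<epsilon>" shows "\<exists>\<rho>'>\<rho>. ou_boundary \<rho>' < ou_boundary \<rho> + \<epsilon>"
proof (rule ccontr)
  assume "\<not> ?thesis"
  then have ge: "ou_boundary \<rho> + \<epsilon> \<le> ou_boundary \<rho>'" if "\<rho> < \<rho>'" for \<rho>' using that by force
  define x y where "x = ou_boundary \<rho> + \<epsilon> / 3" and "y = ou_boundary \<rho> + \<epsilon> / 2"
  have xy: "ou_boundary \<rho> < x" "x < y" "0 < x" using \<epsilon> ou_boundary_nonneg[of \<rho>] by (auto simp: x_def y_def)
  have yv: "y < ou_value \<rho>' y" if "\<rho> < \<rho>'" for \<rho>'
    using ge[OF that] that \<rho> \<epsilon> by (intro ou_value_below_boundary) (auto simp: y_def)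
  define K where "K = 8 * local_const 1 x (y - x) + local_const 2 x (x - ou_boundary \<rho>)"
  have up: "x * (1 - exp (- 2 * h)) \<le> K * h\<^sup>2" if h: "0 < h" "h \<le> 1/2" for h
  proof -
    \<comment> \<open>\<open>y\<close> is known to continue only for horizons above
      \<open>\<rho>\<close>, so the estimate is applied at \<open>\<rho> + \<eta>\<close>, and
      \<open>\<eta>\<close> tends to 0 by continuity of the value.\<close>
    have "ou_value (\<rho> + h) x \<le> ou h (ou_value \<rho>) x + 8 * local_const 1 x (y - x) * h ^ 3"
    proof (rule tendsto_le[where F="at_right 0"])
      show "((\<lambda>\<eta>. ou_value (\<rho> + \<eta> + h) x) \<longlongrightarrow> ou_value (\<rho> + h) x) (at_right 0)"
        by (rule ou_value_tendsto) (auto intro!: tendsto_eq_intros)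
      have "((\<lambda>\<eta>. ou h (ou_value (\<rho> + \<eta>)) x) \<longlongrightarrow> ou h (ou_value \<rho>) x) (at_right 0)"
      proof (rule tendsto_at_right_sequentially[where b=1])
        fix S :: "nat \<Rightarrow> real" assume "S \<longlonglongrightarrow> 0"
        then show "(\<lambda>n. ou h (ou_value (\<rho> + S n)) x) \<longlonglongrightarrow> ou h (ou_value \<rho>) x"
          by (intro ou_payoff_like_tendsto payoff_like_ou_value ou_value_tendsto) (auto intro!: tendsto_eq_intros)
      qed simp
      then show "((\<lambda>\<eta>. ou h (ou_value (\<rho> + \<eta>)) x + 8 * local_const 1 x (y - x) * h ^ 3)
          \<longlongrightarrow> ou h (ou_value \<rho>) x + 8 * local_const 1 x (y - x) * h ^ 3) (at_right 0)"
        by (intro tendsto_intros)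
      show "\<forall>\<^sub>F \<eta> in at_right 0. ou_value (\<rho> + \<eta> + h) x
          \<le> ou h (ou_value (\<rho> + \<eta>)) x + 8 * local_const 1 x (y - x) * h ^ 3"
        unfolding eventually_at_right_field using yv xy \<rho> h
        by (intro exI[of _ 1]) (auto intro!: ou_value_le_ou_local)
    qed simp
    also have "\<dots> \<le> (exp (- 2 * h) * x + local_const 2 x (x - ou_boundary \<rho>) * h\<^sup>2) + 8 * local_const 1 x (y - x) * h\<^sup>2"
      using xy h by (intro add_mono mult_left_mono ou_excess_near_boundary mult_nonneg_nonneg local_const_nonneg power_decreasing) auto
    also have "\<dots> = exp (- 2 * h) * x + K * h\<^sup>2" by (simp add: K_def algebra_simps)
    finally show ?thesis using payoff_like_ge[OF payoff_like_ou_value, of x "\<rho> + h"] by (simp add: algebra_simps)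
  qed
  have low: "h \<le> 1 - exp (- 2 * h)" if "0 \<le> h" "h \<le> 1/2" for h :: real
  proof -
    have "(1 + 2 * h) * exp (- 2 * h) \<le> exp (2 * h) * exp (- 2 * h)"
      using exp_ge_add_one_self[of "2 * h"] by (intro mult_right_mono) auto
    then have "(1 + 2 * h) * exp (- 2 * h) \<le> 1" by (simp flip: exp_add)
    then have "exp (- 2 * h) \<le> 1 / (1 + 2 * h)" using that by (simp add: field_simps)
    also have "\<dots> \<le> 1 - h"
    proof -
      have "1 \<le> (1 - h) * (1 + 2 * h)"
        using mult_nonneg_nonneg[of h "1 - 2 * h"] that by (simp add: algebra_simps)
      then show ?thesis using that by (simp add: divide_le_eq)
    qed
    finally show ?thesis by simp
  qed
  have up2: "x \<le> K * h" if h: "0 < h" "h \<le> 1/2" for h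
  proof -
    have "x * h \<le> x * (1 - exp (- 2 * h))" using low[of h] h xy by (intro mult_left_mono) auto
    also have "\<dots> \<le> (K * h) * h" using up[OF h] by (simp add: power2_eq_square mult_ac)
    finally show ?thesis using h by simp
  qed
  have K: "0 \<le> K" using xy by (simp add: K_def local_const_nonneg)
  define h where "h = min (1/2) (x / (2 * (K + 1)))"
  have h: "0 < h" "h \<le> 1/2" using xy K unfolding h_def by (simp, intro min.cobounded1)
  have "K * h \<le> (K + 1) * (x / (2 * (K + 1)))" using K h by (intro mult_mono) (auto simp: h_def)
  also have "\<dots> < x" using xy K by (simp add: field_simps add_pos_nonneg)
  finally show False using up2[OF h] by simp
qed

text \<open>Lying strictly below the value is an open condition in the horizon.\<close>

lemma ou_boundary_left_limit:
  assumes \<rho>: "0 < \<rho>" and \<epsilon>: "0 < \<epsilon>" shows "\<exists>\<rho>'<\<rho>. ou_boundary \<rho> - \<epsilon> < ou_boundary \<rho>'"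
proof -
  let ?x = "ou_boundary \<rho> - \<epsilon>"
  have "?x < ou_value \<rho> ?x" using \<rho> \<epsilon> by (intro ou_value_below_boundary) auto
  moreover have "((\<lambda>r. ou_value r ?x) \<longlongrightarrow> ou_value \<rho> ?x) (at_left \<rho>)"
    by (intro ou_value_tendsto) (auto intro: tendsto_intros)
  ultimately have "\<forall>\<^sub>F r in at_left \<rho>. ?x < ou_value r ?x" by (metis order_tendstoD(1))
  moreover have "\<forall>\<^sub>F r in at_left \<rho>. r \<in> {0<..<\<rho>}" using eventually_at_leftI[of 0 \<rho> "\<lambda>r. r \<in> {0<..<\<rho>}"] \<rho> by auto
  ultimately have "\<forall>\<^sub>F r in at_left \<rho>. r < \<rho> \<and> ?x < ou_boundary r"
    by eventually_elim (auto simp: ou_value_gt_iff)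
  then show ?thesis using eventually_happens[of _ "at_left \<rho>"] by auto
qed

lemma ou_boundary_isCont: "isCont ou_boundary \<rho>"
proof -
  have right: "\<exists>\<rho>'>\<rho>. ou_boundary \<rho>' < ou_boundary \<rho> + \<epsilon>" if "0 < \<epsilon>" for \<epsilon>
  proof (cases "0 \<le> \<rho>")
    case False then show ?thesis using that by (intro exI[of _ "\<rho> / 2"]) (auto simp: ou_boundary_nonpos)
  qed (use ou_boundary_right_limit that in blast)
  have left: "\<exists>\<rho>'<\<rho>. ou_boundary \<rho> - \<epsilon> < ou_boundary \<rho>'" if "0 < \<epsilon>" for \<epsilon>
  proof (cases "0 < \<rho>")
    case False then show ?thesis using that by (intro exI[of _ "\<rho> - 1"]) (auto simp: ou_boundary_nonpos)
  qed (use ou_boundary_left_limit that in blast)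
  show ?thesis unfolding continuous_at_eps_delta
  proof (intro allI impI)
    fix \<epsilon> :: real assume \<epsilon>: "0 < \<epsilon>"
    obtain a where a: "\<rho> < a" "ou_boundary a < ou_boundary \<rho> + \<epsilon>" using right[OF \<epsilon>] by blast
    obtain c where c: "c < \<rho>" "ou_boundary \<rho> - \<epsilon> < ou_boundary c" using left[OF \<epsilon>] by blast
    show "\<exists>d>0. \<forall>x'. dist x' \<rho> < d \<longrightarrow> dist (ou_boundary x') (ou_boundary \<rho>) < \<epsilon>"
    proof (intro exI[of _ "min (a - \<rho>) (\<rho> - c)"] conjI allI impI)
      fix r assume "dist r \<rho> < min (a - \<rho>) (\<rho> - c)"
      then have "r \<le> a" "c \<le> r" by (auto simp: dist_real_def)
      then show "dist (ou_boundary r) (ou_boundary \<rho>) < \<epsilon>"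
        using monoD[OF ou_boundary_mono, of r a] monoD[OF ou_boundary_mono, of c r] a c
        by (auto simp: dist_real_def)
    qed (use a c in auto)
  qed
qed

section \<open>The early exercise premium\<close>

text \<open>The killed generator \<open>g \<mapsto> g'' - x g' - g\<close> maps the identity to \<open>- 2 x\<close>.\<close>

definition above :: "(real \<Rightarrow> real) \<Rightarrow> real \<Rightarrow> real \<Rightarrow> real" where
  "above b \<rho> \<xi> = (if b \<rho> < \<xi> then 2 * \<xi> else 0)"

text \<open>\<open>exp (- 2 * \<rho>) * x\<close> is the reward of holding to the end. For an
  arbitrary candidate \<open>b\<close> the integral adds the source collected above
  \<open>b\<close>; after elapsed time \<open>v\<close> the remaining horizon, at which
  \<open>b\<close> is read, is \<open>\<rho> - v\<close>.\<close>

definition premium :: "(real \<Rightarrow> real) \<Rightarrow> real \<Rightarrow> real \<Rightarrow> real" where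
  "premium b \<rho> x = exp (- 2 * \<rho>) * x + (LINT v:{0..\<rho>}|lborel. ou v (above b (\<rho> - v)) x)"

lemma above_bound: "\<bar>above b \<rho> \<xi>\<bar> \<le> 2 * (1 + \<bar>\<xi>\<bar>)"
  by (simp add: above_def abs_mult)

lemma above_measurable [measurable]: "above b \<rho> \<in> borel_measurable borel"
  unfolding above_def by measurable

lemma above_quartic_growth: "quartic_growth (above b \<rho>)"
  by (rule quartic_growth_linear[OF above_measurable above_bound])

lemma ou_above_bound: "0 \<le> v \<Longrightarrow> \<bar>ou v (above b \<rho>) x\<bar> \<le> 2 * (2 + \<bar>x\<bar>)"
  by (rule ou_linear_bound[OF above_measurable above_bound])

lemma abs_le_pow4_bound: "\<bar>g :: real\<bar> \<le> C * (1 + \<bar>x\<bar>) \<Longrightarrow> 0 \<le> C \<Longrightarrow> \<bar>g\<bar> \<le> 2 * C * (1 + x ^ 4)"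
proof -
  assume a: "\<bar>g\<bar> \<le> C * (1 + \<bar>x\<bar>)" "0 \<le> C"
  have "0 \<le> x ^ 4" by simp
  then have "1 + \<bar>x\<bar> \<le> 2 * (1 + x ^ 4)" using abs_le_one_plus_pow4[of x] by (simp only: distrib_left)
  then have "C * (1 + \<bar>x\<bar>) \<le> C * (2 * (1 + x ^ 4))" using a by (intro mult_left_mono)
  moreover have "2 * C * (1 + x ^ 4) = C * (2 * (1 + x ^ 4))" by (simp only: mult_ac)
  ultimately show ?thesis using a by linarith
qed

lemma AE_gauss_neq: "AE y in gauss. y \<noteq> c"
  by (subst AE_density) (auto intro: AE_mp[OF AE_lborel_singleton[of c]])

lemma AE_gauss_affine_neq:
  assumes "s \<noteq> 0" shows "AE y in gauss. a + s * y \<noteq> (c :: real)"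
  using AE_gauss_neq[of "(c - a) / s"]
proof eventually_elim
  case (elim y)
  have "(a + s * y - a) / s = y" using assms by simp
  with elim show ?case by metis
qed

lemma sqrt_one_minus_exp_pos: "0 < v \<Longrightarrow> 0 < sqrt (1 - exp (- 2 * v))"
  by simp

section \<open>Regularity and splitting of the premium\<close>

text \<open>The source jumps across the boundary, but for \<open>v0 > 0\<close> the Gaussian step
  has no atoms and meets the limiting boundary value with probability 0; off it the sign of the
  difference is eventually constant.\<close>

lemma ou_above_tendsto:
  assumes b: "\<And>r. isCont b r" and v: "v \<longlonglongrightarrow> v0" "0 < v0" and r: "r \<longlonglongrightarrow> r0" and x: "x \<longlonglongrightarrow> x0"
  shows "(\<lambda>n. ou (v n) (above b (r n)) (x n)) \<longlonglongrightarrow> ou v0 (above b r0) x0"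
proof (rule ou_tendsto[OF above_measurable above_measurable _ v(1) x, where C=4])
  show "\<bar>above b (r n) x\<bar> \<le> 4 * (1 + x ^ 4)" for n x
    using abs_le_pow4_bound[OF above_bound] by simp
  let ?s = "sqrt (1 - exp (- 2 * v0))"
  have "?s \<noteq> 0" using sqrt_one_minus_exp_pos[OF v(2)] by linarith
  from AE_gauss_affine_neq[OF this, of "exp (- v0) * x0" "b r0"]
  show "AE y in gauss. (\<lambda>n. above b (r n) (exp (- v n) * x n + sqrt (1 - exp (- 2 * v n)) * y))
      \<longlonglongrightarrow> above b r0 (exp (- v0) * x0 + ?s * y)"
  proof eventually_elim
    case (elim y)
    let ?a = "\<lambda>n. exp (- v n) * x n + sqrt (1 - exp (- 2 * v n)) * y"
    let ?l = "exp (- v0) * x0 + ?s * y"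
    have a: "?a \<longlonglongrightarrow> ?l" by (intro tendsto_intros v x)
    have br: "(\<lambda>n. b (r n)) \<longlonglongrightarrow> b r0" by (rule isCont_tendsto_compose[OF b r])
    have d: "(\<lambda>n. ?a n - b (r n)) \<longlonglongrightarrow> ?l - b r0" by (intro tendsto_diff a br)
    show ?case
    proof (cases "b r0 < ?l")
      case True
      then have "\<forall>\<^sub>F n in sequentially. 0 < ?a n - b (r n)" by (intro order_tendstoD(1)[OF d]) simp
      then have ev: "\<forall>\<^sub>F n in sequentially. 2 * ?a n = above b (r n) (?a n)"
        by eventually_elim (simp add: above_def)
      have lim: "(\<lambda>n. 2 * ?a n) \<longlonglongrightarrow> 2 * ?l" by (intro tendsto_mult a tendsto_const)
      have "above b r0 ?l = 2 * ?l" using True by (simp add: above_def)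
      then show ?thesis using Lim_transform_eventually[OF lim ev] by simp
    next
      case False
      with elim have "?l - b r0 < 0" by simp
      then have "\<forall>\<^sub>F n in sequentially. ?a n - b (r n) < 0" by (rule order_tendstoD(2)[OF d])
      then have "\<forall>\<^sub>F n in sequentially. above b (r n) (?a n) = above b r0 ?l"
        by eventually_elim (use False in \<open>simp add: above_def\<close>)
      then show ?thesis by (rule tendsto_eventually)
    qed
  qed
qed

lemma ou_above_measurable:
  assumes [measurable]: "b \<in> borel_measurable borel"
  shows "(\<lambda>v. ou v (above b (c - v)) x) \<in> borel_measurable borel"
  unfolding ou_def above_def by measurable

lemma set_integrable_bounded:
  fixes f :: "real \<Rightarrow> real"
  assumes "f \<in> borel_measurable borel" "\<And>v. v \<in> {p..q} \<Longrightarrow> \<bar>f v\<bar> \<le> B"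
  shows "set_integrable lborel {p..q} f"
  unfolding set_integrable_def
  by (rule integrableI_bounded_set_indicator[where B=B]) (use assms in \<open>auto simp: emeasure_lborel_Icc_eq\<close>)

lemma set_integral_abs_le:
  fixes f :: "real \<Rightarrow> real"
  assumes "f \<in> borel_measurable borel" "\<And>v. v \<in> {p..q} \<Longrightarrow> \<bar>f v\<bar> \<le> B" "p \<le> q"
  shows "\<bar>LINT v:{p..q}|lborel. f v\<bar> \<le> (q - p) * B"
proof -
  have i: "set_integrable lborel {p..q} f" by (rule set_integrable_bounded[OF assms(1,2)])
  have B: "0 \<le> B" using assms(2)[of p] assms(3) by auto
  have "\<bar>LINT v:{p..q}|lborel. f v\<bar> \<le> (LINT v|lborel. \<bar>indicator {p..q} v *\<^sub>R f v\<bar>)"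
    unfolding set_lebesgue_integral_def by (rule integral_abs_bound)
  also have "\<dots> \<le> (LINT v|lborel. indicator {p..q} v * B)"
    using i assms(2) unfolding set_integrable_def
    by (intro integral_mono integrable_abs)
      (auto split: split_indicator simp: integrable_real_indicator emeasure_lborel_Icc_eq)
  also have "\<dots> = (q - p) * B" using assms(3) by simp
  finally show ?thesis .
qed

lemma ou_above_set_integrable:
  assumes "b \<in> borel_measurable borel" "0 \<le> p"
  shows "set_integrable lborel {p..q} (\<lambda>v. ou v (above b (c - v)) x)"
  using ou_above_bound assms by (intro set_integrable_bounded[where B="2 * (2 + \<bar>x\<bar>)"] ou_above_measurable) auto

lemma set_integral_split:
  fixes f :: "real \<Rightarrow> real"
  assumes "p \<le> h" "h \<le> q" "set_integrable lborel {p..q} f"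
  shows "(LINT v:{p..q}|lborel. f v) = (LINT v:{p..h}|lborel. f v) + (LINT v:{h..q}|lborel. f v)"
proof -
  have "{p..q} = {p..h} \<union> {h..q}" using assms by auto
  moreover have "AE v in lborel. \<not> (v \<in> {p..h} \<and> v \<in> {h..q})"
    using AE_lborel_singleton[of h] by eventually_elim auto
  ultimately show ?thesis using assms
    by (auto intro!: set_integral_Un_AE elim: set_integrable_subset)
qed

lemma premium_measurable:
  assumes [measurable]: "b \<in> borel_measurable borel" shows "premium b \<rho> \<in> borel_measurable borel"
  unfolding premium_def set_lebesgue_integral_def ou_def above_def by measurable

lemma premium_bound:
  assumes "b \<in> borel_measurable borel" "0 \<le> \<rho>"
  shows "\<bar>premium b \<rho> x\<bar> \<le> (1 + 4 * \<rho>) * (1 + \<bar>x\<bar>)"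
proof -
  have "\<bar>LINT v:{0..\<rho>}|lborel. ou v (above b (\<rho> - v)) x\<bar> \<le> (\<rho> - 0) * (2 * (2 + \<bar>x\<bar>))"
    using ou_above_bound assms by (intro set_integral_abs_le ou_above_measurable) auto
  moreover have "\<bar>exp (- 2 * \<rho>) * x\<bar> \<le> 1 * \<bar>x\<bar>"
    unfolding abs_mult using assms by (intro mult_right_mono) auto
  moreover have "0 \<le> \<rho> * \<bar>x\<bar>" using assms by simp
  ultimately show ?thesis unfolding premium_def by (simp add: algebra_simps)
qed

lemma premium_quartic_growth:
  assumes "b \<in> borel_measurable borel" "0 \<le> \<rho>" shows "quartic_growth (premium b \<rho>)"
  by (rule quartic_growth_linear[OF premium_measurable premium_bound]) (use assms in auto)

lemma ou_integral_above:
  assumes [measurable]: "b \<in> borel_measurable borel" and h: "0 \<le> h" and \<rho>: "0 \<le> \<rho>"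
  shows "ou h (\<lambda>x. LINT v:{0..\<rho>}|lborel. ou v (above b (\<rho> - v)) x) x
     = (LINT v:{0..\<rho>}|lborel. ou h (ou v (above b (\<rho> - v))) x)"
proof -
  interpret pair_sigma_finite lborel gauss ..
  let ?z = "\<lambda>y. exp (- h) * x + sqrt (1 - exp (- 2 * h)) * y"
  let ?k = "\<lambda>v y. indicator {0..\<rho>} v *\<^sub>R ou v (above b (\<rho> - v)) (?z y)"
  have s: "0 \<le> sqrt (1 - exp (- 2 * h))" "sqrt (1 - exp (- 2 * h)) \<le> 1" using h by auto
  have bd: "norm (?k v y) \<le> indicator {0..\<rho>} v * (2 * (2 + \<bar>x\<bar> + \<bar>y\<bar>))" for v y
  proof (cases "v \<in> {0..\<rho>}")
    case True
    have "\<bar>?z y\<bar> \<le> \<bar>exp (- h) * x\<bar> + \<bar>sqrt (1 - exp (- 2 * h)) * y\<bar>" by (rule abs_triangle_ineq)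
    also have "\<dots> \<le> \<bar>x\<bar> + \<bar>y\<bar>"
      using s h by (auto simp: abs_mult intro!: add_mono mult_left_le_one_le)
    finally show ?thesis using True ou_above_bound[of v b "\<rho> - v" "?z y"] by simp
  qed simp
  have m [measurable]: "(\<lambda>(v, y). ?k v y) \<in> borel_measurable (lborel \<Otimes>\<^sub>M gauss)"
  proof -
    have "(\<lambda>p. ou (fst p) (above b (\<rho> - fst p)) (?z (snd p))) \<in> borel_measurable (lborel \<Otimes>\<^sub>M gauss)"
      unfolding ou_def above_def by measurable
    then show ?thesis by (simp add: case_prod_beta')
  qed
  have dom: "integrable gauss (\<lambda>y. indicator {0..\<rho>} v * (2 * (2 + \<bar>x\<bar> + \<bar>y\<bar>)))" for v by simp
  have ig: "integrable gauss (?k v)" for v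
    by (rule Bochner_Integration.integrable_bound[OF dom[of v]])
      (use bd[of v] in \<open>auto simp: abs_mult intro!: AE_I2 order_trans[OF bd[of v]]\<close>)
  have int: "integrable (lborel \<Otimes>\<^sub>M gauss) (\<lambda>(v, y). ?k v y)"
  proof (rule Fubini_integrable[OF m])
    show "integrable lborel (\<lambda>v. \<integral>y. norm (case (v, y) of (v, y) \<Rightarrow> ?k v y) \<partial>gauss)"
    proof (rule Bochner_Integration.integrable_bound)
      show "integrable lborel (\<lambda>v. indicator {0..\<rho>} v * (2 * (3 + \<bar>x\<bar>)) :: real)" using \<rho> by simp
      show "AE v in lborel. norm (\<integral>y. norm (case (v, y) of (v, y) \<Rightarrow> ?k v y) \<partial>gauss)
          \<le> norm (indicator {0..\<rho>} v * (2 * (3 + \<bar>x\<bar>)) :: real)"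
      proof (rule AE_I2)
        fix v
        have "(\<integral>y. norm (?k v y) \<partial>gauss) \<le> (\<integral>y. indicator {0..\<rho>} v * (2 * (2 + \<bar>x\<bar> + \<bar>y\<bar>)) \<partial>gauss)"
          by (intro integral_mono integrable_norm ig dom bd)
        also have "\<dots> = indicator {0..\<rho>} v * (2 * (2 + \<bar>x\<bar> + (\<integral>y. \<bar>y\<bar> \<partial>gauss)))" by simp
        also have "\<dots> \<le> indicator {0..\<rho>} v * (2 * (3 + \<bar>x\<bar>))"
          using integral_gauss_abs_le by (intro mult_left_mono) auto
        finally show "norm (\<integral>y. norm (case (v, y) of (v, y) \<Rightarrow> ?k v y) \<partial>gauss)
          \<le> norm (indicator {0..\<rho>} v * (2 * (3 + \<bar>x\<bar>)) :: real)"
          by simp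
      qed
    qed measurable
  qed (use ig in auto)
  have "(\<integral>y. (\<integral>v. ?k v y \<partial>lborel) \<partial>gauss) = (\<integral>v. (\<integral>y. ?k v y \<partial>gauss) \<partial>lborel)"
    by (rule Fubini_integral[OF int])
  then show ?thesis
    unfolding set_lebesgue_integral_def ou_def[of h] by (simp add: mult.left_commute)
qed

text \<open>The Markov property: the premium collected after \<open>h\<close> is the premium for the
  horizon \<open>\<rho> - h\<close> transported by \<open>ou h\<close>, by Fubini, the semigroup law
  and the shift of \<open>v\<close> by \<open>h\<close>.\<close>

lemma premium_split:
  assumes b [measurable]: "b \<in> borel_measurable borel" and h: "0 \<le> h" "h \<le> \<rho>"
  shows "premium b \<rho> x = ou h (premium b (\<rho> - h)) x + (LINT v:{0..h}|lborel. ou v (above b (\<rho> - v)) x)"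
proof -
  let ?I = "\<lambda>x. LINT v:{0..\<rho> - h}|lborel. ou v (above b (\<rho> - h - v)) x"
  have qI: "quartic_growth ?I"
    using quartic_growth_diff[OF premium_quartic_growth[OF b, of "\<rho> - h"] quartic_growth_cmult[OF quartic_growth_id, of "exp (- 2 * (\<rho> - h))"]] h
    by (simp add: premium_def)
  have "ou h (premium b (\<rho> - h)) x = ou h (\<lambda>x. exp (- 2 * (\<rho> - h)) * x) x + ou h ?I x"
    unfolding premium_def by (rule ou_add[OF quartic_growth_cmult[OF quartic_growth_id] qI])
  also have "ou h (\<lambda>x. exp (- 2 * (\<rho> - h)) * x) x = exp (- 2 * \<rho>) * x"
    unfolding ou_cmult ou_id by (simp add: mult.assoc[symmetric] flip: exp_add)
  also have "ou h ?I x = (LINT v:{0..\<rho> - h}|lborel. ou h (ou v (above b (\<rho> - h - v))) x)"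
    using h by (intro ou_integral_above) auto
  also have "\<dots> = (LINT v:{0..\<rho> - h}|lborel. ou (h + v) (above b (\<rho> - (h + v))) x)"
    using h by (intro set_lebesgue_integral_cong) (auto simp: ou_ou above_quartic_growth algebra_simps)
  also have "\<dots> = (LINT v:{h..\<rho>}|lborel. ou v (above b (\<rho> - v)) x)"
    unfolding set_lebesgue_integral_def
    by (subst lborel_integral_real_affine[where c=1 and t=h, of "\<lambda>v. indicator {h..\<rho>} v *\<^sub>R ou v (above b (\<rho> - v)) x"])
      (auto intro!: Bochner_Integration.integral_cong split: split_indicator)
  also have "exp (- 2 * \<rho>) * x + \<dots> + (LINT v:{0..h}|lborel. ou v (above b (\<rho> - v)) x) = premium b \<rho> x"
    unfolding premium_def
    by (subst set_integral_split[of 0 h \<rho>]) (use h in \<open>auto intro!: ou_above_set_integrable\<close>)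
  finally show ?thesis by simp
qed

lemma premium_0 [simp]: "premium b 0 x = x"
proof -
  have "(LINT v:{0..0}|lborel. ou v (above b (0 - v)) x) = 0"
  proof (unfold set_lebesgue_integral_def, rule integral_eq_zero_AE)
    show "AE v in lborel. indicator {0..0} v *\<^sub>R ou v (above b (0 - v)) x = 0"
      using AE_lborel_singleton[of 0] by eventually_elim auto
  qed
  then show ?thesis by (simp add: premium_def)
qed

lemma continuous_imp_borel: "(\<And>r. isCont b r) \<Longrightarrow> b \<in> borel_measurable borel" for b :: "real \<Rightarrow> real"
  by (intro borel_measurable_continuous_onI continuous_at_imp_continuous_on) blast

lemma premium_tendsto:
  assumes b: "\<And>r. isCont b r" and r: "r \<longlonglongrightarrow> \<rho>" "\<And>n. 0 \<le> r n" and x: "x \<longlonglongrightarrow> x0"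
  shows "(\<lambda>n. premium b (r n) (x n)) \<longlonglongrightarrow> premium b \<rho> x0"
proof -
  note [measurable] = continuous_imp_borel[OF b]
  obtain R where R: "\<And>n. \<bar>r n\<bar> \<le> R"
    using convergent_imp_Bseq[OF convergentI[OF r(1)]] by (metis Bseq_def real_norm_def)
  obtain X where X: "\<And>n. \<bar>x n\<bar> \<le> X"
    using convergent_imp_Bseq[OF convergentI[OF x]] by (metis Bseq_def real_norm_def)
  have "(\<lambda>n. LINT v|lborel. indicator {0..r n} v *\<^sub>R ou v (above b (r n - v)) (x n))
      \<longlonglongrightarrow> (LINT v|lborel. indicator {0..\<rho>} v *\<^sub>R ou v (above b (\<rho> - v)) x0)"
  proof (rule integral_dominated_convergence)
    show "integrable lborel (\<lambda>v. indicator {0..R} v * (2 * (2 + X)))"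
      using R[of 0] by (simp add: integrable_real_indicator)
    show "AE v in lborel. norm (indicator {0..r n} v *\<^sub>R ou v (above b (r n - v)) (x n))
        \<le> indicator {0..R} v * (2 * (2 + X))" for n
    proof (rule AE_I2)
      fix v
      show "norm (indicator {0..r n} v *\<^sub>R ou v (above b (r n - v)) (x n)) \<le> indicator {0..R} v * (2 * (2 + X))"
      proof (cases "v \<in> {0..r n}")
        case True
        then have "v \<in> {0..R}" using R[of n] by auto
        then show ?thesis using True ou_above_bound[of v b "r n - v" "x n"] X[of n] by simp
      next
        case False
        have "0 \<le> X" using X[of 0] by linarith
        then show ?thesis using False by simp
      qed
    qed
    \<comment> \<open>The excluded points are \<open>v = 0\<close>, where the Gaussian step
      degenerates, and \<open>v = \<rho>\<close>, the end of the interval of integration.\<close>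
    show "AE v in lborel. (\<lambda>n. indicator {0..r n} v *\<^sub>R ou v (above b (r n - v)) (x n))
        \<longlonglongrightarrow> indicator {0..\<rho>} v *\<^sub>R ou v (above b (\<rho> - v)) x0"
      using AE_lborel_singleton[of 0] AE_lborel_singleton[of \<rho>]
    proof eventually_elim
      case (elim v)
      consider "v < 0" | "0 < v" "v < \<rho>" | "\<rho> < v" using elim by linarith
      then show ?case
      proof cases
        case 1 then show ?thesis by simp
      next
        case 2
        have "\<forall>\<^sub>F n in sequentially. v < r n" using order_tendstoD(1)[OF r(1) 2(2)] .
        then have ev: "\<forall>\<^sub>F n in sequentially. ou v (above b (r n - v)) (x n)
            = indicator {0..r n} v *\<^sub>R ou v (above b (r n - v)) (x n)"
          by eventually_elim (use 2 in simp)
        have lim: "(\<lambda>n. ou v (above b (r n - v)) (x n)) \<longlonglongrightarrow> ou v (above b (\<rho> - v)) x0"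
          by (rule ou_above_tendsto[OF b tendsto_const 2(1) tendsto_diff[OF r(1) tendsto_const] x])
        show ?thesis using Lim_transform_eventually[OF lim ev] 2 by simp
      next
        case 3
        have "\<forall>\<^sub>F n in sequentially. r n < v" using order_tendstoD(2)[OF r(1) 3] .
        then have "\<forall>\<^sub>F n in sequentially. indicator {0..r n} v *\<^sub>R ou v (above b (r n - v)) (x n)
            = indicator {0..\<rho>} v *\<^sub>R ou v (above b (\<rho> - v)) x0"
          by eventually_elim (use 3 in simp)
        then show ?thesis by (rule tendsto_eventually)
      qed
    qed
    show "(\<lambda>v. indicator {0..r n} v *\<^sub>R ou v (above b (r n - v)) (x n)) \<in> borel_measurable lborel" for n
      unfolding ou_def above_def by measurable
    show "(\<lambda>v. indicator {0..\<rho>} v *\<^sub>R ou v (above b (\<rho> - v)) x0) \<in> borel_measurable lborel"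
      unfolding ou_def above_def by measurable
  qed
  then show ?thesis unfolding premium_def set_lebesgue_integral_def
    by (intro tendsto_add tendsto_mult tendsto_exp tendsto_const r(1) x)
qed

section \<open>The premium formula for the value\<close>

text \<open>For each slope \<open>e > 0\<close> the points with
  \<open>|f x - f a| <= e * (x - a)\<close> form a closed set; if its largest element were below
  \<open>b\<close>, the right derivative 0 would allow a further step to the right. Then
  \<open>e\<close> tends to 0.\<close>

lemma right_derivative_zero_imp_const:
  fixes f :: "real \<Rightarrow> real"
  assumes ab: "a \<le> b" and cont: "continuous_on {a..b} f"
    and der: "\<And>x. a \<le> x \<Longrightarrow> x < b \<Longrightarrow> ((\<lambda>h. (f (x + h) - f x) / h) \<longlongrightarrow> 0) (at_right 0)"
  shows "f b = f a"
proof -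
  have *: "\<bar>f b - f a\<bar> \<le> e * (b - a)" if e: "0 < e" for e
  proof -
    define S where "S = {x \<in> {a..b}. \<bar>f x - f a\<bar> \<le> e * (x - a)}"
    have cl: "closed S"
      unfolding S_def using cont
      by (intro continuous_closed_preimage_constant[where a=True, simplified] continuous_on_closed_Collect_le continuous_intros) auto
    have bdd: "bdd_above S" by (rule bdd_aboveI[of _ b]) (auto simp: S_def)
    have "a \<in> S" using ab by (simp add: S_def)
    then have ne: "S \<noteq> {}" by auto
    define s where "s = Sup S"
    have sS: "s \<in> S" unfolding s_def using closed_contains_Sup[OF ne bdd cl] .
    have "s = b"
    proof (rule ccontr)
      assume "s \<noteq> b"
      then have s: "a \<le> s" "s < b" using sS by (auto simp: S_def)
      have "\<forall>\<^sub>F h in at_right 0. dist ((f (s + h) - f s) / h) 0 < e"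
        using tendstoD[OF der[OF s] e] .
      then obtain d where d: "0 < d" "\<And>h. 0 < h \<Longrightarrow> h < d \<Longrightarrow> \<bar>(f (s + h) - f s) / h\<bar> < e"
        by (auto simp: eventually_at_right_field)
      define h where "h = min (d / 2) (b - s)"
      have h: "0 < h" "h < d" "s + h \<le> b" using d s by (auto simp: h_def)
      have "\<bar>f (s + h) - f s\<bar> < e * h" using d(2)[OF h(1,2)] h(1) by (simp add: abs_divide pos_divide_less_eq)
      moreover have "\<bar>f s - f a\<bar> \<le> e * (s - a)" using sS by (simp add: S_def)
      ultimately have "\<bar>f (s + h) - f a\<bar> \<le> e * (s + h - a)" by (simp add: algebra_simps)
      then have "s + h \<in> S" using h s by (simp add: S_def)
      then have "s + h \<le> s" unfolding s_def by (rule cSup_upper[OF _ bdd])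
      then show False using h by simp
    qed
    then show ?thesis using sS by (simp add: S_def)
  qed
  have "\<bar>f b - f a\<bar> \<le> 0 + \<eta>" if \<eta>: "0 < \<eta>" for \<eta>
  proof -
    have "\<bar>f b - f a\<bar> \<le> \<eta> / (b - a + 1) * (b - a)" using ab \<eta> by (intro *) simp
    also have "\<dots> \<le> \<eta>" using ab \<eta> by (simp add: field_simps)
    finally show ?thesis by simp
  qed
  then have "\<bar>f b - f a\<bar> \<le> 0" by (rule field_le_epsilon)
  then show ?thesis by simp
qed

lemma exp_quotient_tendsto:
  assumes "S \<longlonglongrightarrow> 0" "\<And>n. 0 < S n"
  shows "(\<lambda>n. (1 - exp (- 2 * S n)) / S n) \<longlonglongrightarrow> (2::real)"
proof -
  have "((\<lambda>h::real. exp (- 2 * h)) has_real_derivative - 2) (at 0)"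
    by (auto intro!: derivative_eq_intros)
  then have "(\<lambda>h::real. (exp (- 2 * h) - 1) / h) \<midarrow>0\<rightarrow> - 2"
    by (simp add: DERIV_def)
  then have "(\<lambda>n. (exp (- 2 * S n) - 1) / S n) \<longlonglongrightarrow> - 2"
    using assms by (intro LIMSEQ_SEQ_conv[THEN iffD2, rule_format]) (auto simp: less_imp_neq[symmetric])
  from tendsto_minus[OF this] show ?thesis by (simp add: minus_divide_left)
qed

text \<open>The rate at which the value exceeds its own transport. Below the boundary the premium
  over a step is \<open>O(h^3)\<close>; above it the value is locally the identity, transported up
  to \<open>O(h^2)\<close> as \<open>exp (- 2 * h) * \<xi>\<close>, and
  \<open>(1 - exp (- 2 * h)) / h\<close> tends to 2. At the boundary neither estimate applies; that
  point is later a null set.\<close>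

lemma ou_value_defect_tendsto:
  assumes \<rho>: "0 < \<rho>" and S: "S \<longlonglongrightarrow> 0" "\<And>n. 0 < S n" and \<xi>: "\<xi> \<noteq> ou_boundary \<rho>"
  shows "(\<lambda>n. (ou_value \<rho> \<xi> - ou (S n) (ou_value (\<rho> - S n)) \<xi>) / S n) \<longlonglongrightarrow> above ou_boundary \<rho> \<xi>"
proof -
  have ev1: "\<forall>\<^sub>F n in sequentially. S n < min (1/2) \<rho>" using \<rho> by (intro order_tendstoD(2)[OF S(1)]) simp
  show ?thesis
  proof (cases "\<xi> < ou_boundary \<rho>")
    case True
    obtain y where y: "\<xi> < y" "y < ou_boundary \<rho>" using dense[OF True] by auto
    have "y < ou_value \<rho> y" using ou_value_below_boundary[OF \<rho> y(2)] .
    \<comment> \<open>The local estimate starts from the shorter horizon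
      \<open>\<rho> - S n\<close>, so \<open>y\<close> must still continue there.\<close>
    moreover have "(\<lambda>n. ou_value (\<rho> - S n) y) \<longlonglongrightarrow> ou_value \<rho> y"
      by (rule ou_value_tendsto) (auto intro!: tendsto_eq_intros S(1))
    ultimately have ev2: "\<forall>\<^sub>F n in sequentially. y < ou_value (\<rho> - S n) y" by (metis order_tendstoD(1))
    let ?K = "8 * local_const 1 \<xi> (y - \<xi>)"
    have "\<forall>\<^sub>F n in sequentially. norm ((ou_value \<rho> \<xi> - ou (S n) (ou_value (\<rho> - S n)) \<xi>) / S n) \<le> ?K * (S n)\<^sup>2"
      using ev1 ev2
    proof eventually_elim
      case (elim n)
      have le: "ou_value \<rho> \<xi> \<le> ou (S n) (ou_value (\<rho> - S n)) \<xi> + ?K * (S n) ^ 3"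
        using ou_value_le_ou_local[of y "\<rho> - S n" \<xi> "S n"] y S(2)[of n] elim by simp
      have ge: "ou (S n) (ou_value (\<rho> - S n)) \<xi> \<le> ou_value \<rho> \<xi>"
        using ou_ou_value_le[of "\<rho> - S n" "S n" \<xi>] elim S(2)[of n] by simp
      show ?case using le ge S(2)[of n]
        by (simp add: abs_divide divide_le_eq power2_eq_square power3_eq_cube mult_ac)
    qed
    moreover have "(\<lambda>n. ?K * (S n)\<^sup>2) \<longlonglongrightarrow> 0" using tendsto_mult[OF tendsto_const tendsto_power[OF S(1), of 2], of ?K] by simp
    ultimately have "(\<lambda>n. (ou_value \<rho> \<xi> - ou (S n) (ou_value (\<rho> - S n)) \<xi>) / S n) \<longlonglongrightarrow> 0"
      by (rule Lim_null_comparison)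
    then show ?thesis using True by (simp add: above_def)
  next
    case False
    with \<xi> have gt: "ou_boundary \<rho> < \<xi>" by simp
    let ?K = "local_const 2 \<xi> (\<xi> - ou_boundary \<rho>)"
    have "\<forall>\<^sub>F n in sequentially. norm ((ou_value \<rho> \<xi> - ou (S n) (ou_value (\<rho> - S n)) \<xi>) / S n
        - (1 - exp (- 2 * S n)) / S n * \<xi>) \<le> ?K * S n"
      using ev1
    proof eventually_elim
      case (elim n)
      have le: "ou (S n) (ou_value (\<rho> - S n)) \<xi> \<le> exp (- 2 * S n) * \<xi> + ?K * (S n)\<^sup>2"
        using gt S(2)[of n] elim by (intro ou_excess_near_boundary) auto
      have ge: "exp (- 2 * S n) * \<xi> \<le> ou (S n) (ou_value (\<rho> - S n)) \<xi>"
        using ou_mono[OF quartic_growth_id payoff_like_quartic_growth[OF payoff_like_ou_value]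
            payoff_like_ge[OF payoff_like_ou_value], of "S n" \<xi> "\<rho> - S n"] by (simp only: ou_id)
      have eq: "ou_value \<rho> \<xi> = \<xi>" using gt by (simp add: ou_value_above_boundary)
      have "(ou_value \<rho> \<xi> - ou (S n) (ou_value (\<rho> - S n)) \<xi>) / S n - (1 - exp (- 2 * S n)) / S n * \<xi>
          = - (ou (S n) (ou_value (\<rho> - S n)) \<xi> - exp (- 2 * S n) * \<xi>) / S n"
        unfolding eq using S(2)[of n] by (simp add: field_simps)
      then show ?case using le ge S(2)[of n]
        by (simp add: abs_divide divide_le_eq power2_eq_square mult_ac)
    qed
    moreover have "(\<lambda>n. ?K * S n) \<longlonglongrightarrow> 0" by (rule tendsto_mult_right_zero[OF S(1)])
    ultimately have "(\<lambda>n. (ou_value \<rho> \<xi> - ou (S n) (ou_value (\<rho> - S n)) \<xi>) / S n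
        - (1 - exp (- 2 * S n)) / S n * \<xi>) \<longlonglongrightarrow> 0" by (rule Lim_null_comparison)
    moreover have "(\<lambda>n. (1 - exp (- 2 * S n)) / S n * \<xi>) \<longlonglongrightarrow> 2 * \<xi>"
      by (intro tendsto_mult exp_quotient_tendsto S tendsto_const)
    ultimately show ?thesis using gt by (auto simp: above_def intro: Lim_transform)
  qed
qed

lemma ou_value_flow_tendsto:
  assumes "u \<longlonglongrightarrow> u0"
  shows "(\<lambda>n. ou (u n) (ou_value (\<rho> - u n)) x) \<longlonglongrightarrow> ou u0 (ou_value (\<rho> - u0)) x"
proof (rule ou_tendsto[where C=2])
  show "AE y in gauss. (\<lambda>n. ou_value (\<rho> - u n) (exp (- u n) * x + sqrt (1 - exp (- 2 * u n)) * y))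
      \<longlonglongrightarrow> ou_value (\<rho> - u0) (exp (- u0) * x + sqrt (1 - exp (- 2 * u0)) * y)"
    by (intro AE_I2 ou_value_tendsto tendsto_intros assms)
qed (use assms payoff_like_bound4[OF payoff_like_ou_value] payoff_like_measurable[OF payoff_like_ou_value] in auto)

text \<open>By the semigroup law the difference quotient is \<open>- ou u\<close> of the defect
  quotient \<open>D n\<close>, which is dominated by a linear function of \<open>|\<xi>|\<close>
  uniformly in \<open>n\<close>; the defect converges off the boundary, a null set since
  \<open>u > 0\<close>.\<close>

lemma ou_value_flow_right_derivative:
  assumes u: "0 < u" "u < \<rho>"
  shows "((\<lambda>h. (ou (u + h) (ou_value (\<rho> - (u + h))) x - ou u (ou_value (\<rho> - u)) x) / h)
     \<longlongrightarrow> - ou u (above ou_boundary (\<rho> - u)) x) (at_right 0)"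
proof (rule tendsto_at_right_sequentially[where b="\<rho> - u"])
  fix S :: "nat \<Rightarrow> real"
  assume S: "\<And>n. 0 < S n" "\<And>n. S n < \<rho> - u" "S \<longlonglongrightarrow> 0"
  define D where "D n \<xi> = (ou_value (\<rho> - u) \<xi> - ou (S n) (ou_value (\<rho> - u - S n)) \<xi>) / S n" for n \<xi>
  have q: "quartic_growth (ou_value r)" for r by (intro payoff_like_quartic_growth payoff_like_ou_value)
  have eq: "- ou u (D n) x = (ou (u + S n) (ou_value (\<rho> - (u + S n))) x - ou u (ou_value (\<rho> - u)) x) / S n" for n
  proof -
    have "ou u (D n) x = (ou u (ou_value (\<rho> - u)) x - ou u (ou (S n) (ou_value (\<rho> - u - S n))) x) / S n"
      unfolding D_def using S(1)[of n] ou_cmult[of u "1 / S n"]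
      by (simp add: ou_diff q ou_quartic_growth)
    also have "ou u (ou (S n) (ou_value (\<rho> - u - S n))) x = ou (u + S n) (ou_value (\<rho> - (u + S n))) x"
      using S(1)[of n] u by (simp add: ou_ou q diff_diff_eq)
    finally show ?thesis by (simp add: minus_divide_left)
  qed
  have "(\<lambda>n. ou u (D n) x) \<longlonglongrightarrow> ou u (above ou_boundary (\<rho> - u)) x"
  proof (rule ou_tendsto[where C=8])
    show "D n \<in> borel_measurable borel" for n
    proof -
      have [measurable]: "ou_value r \<in> borel_measurable borel" for r by (intro quartic_growth_measurable q)
      show ?thesis unfolding D_def by measurable
    qed
    show "\<bar>D n \<xi>\<bar> \<le> 8 * (1 + \<xi> ^ 4)" for n \<xi>
    proof -
      have "ou_value (\<rho> - u) \<xi> \<le> ou (S n) (ou_value (\<rho> - u - S n)) \<xi> + 2 * S n * (2 + \<bar>\<xi>\<bar>)"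
        using ou_value_le_ou_linear[of "\<rho> - u - S n" "S n" \<xi>] S(1,2)[of n] by simp
      moreover have "ou (S n) (ou_value (\<rho> - u - S n)) \<xi> \<le> ou_value (\<rho> - u) \<xi>"
        using ou_ou_value_le[of "\<rho> - u - S n" "S n" \<xi>] S(1,2)[of n] by simp
      ultimately have "\<bar>D n \<xi>\<bar> \<le> 2 * (2 + \<bar>\<xi>\<bar>)"
        using S(1)[of n] unfolding D_def by (simp add: abs_divide divide_le_eq mult_ac)
      also have "\<dots> \<le> 4 * (1 + \<bar>\<xi>\<bar>)" by simp
      finally show ?thesis using abs_le_pow4_bound[of "D n \<xi>" 4 \<xi>] by simp
    qed
    have "sqrt (1 - exp (- 2 * u)) \<noteq> 0" using sqrt_one_minus_exp_pos[OF u(1)] by linarith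
    from AE_gauss_affine_neq[OF this, of "exp (- u) * x" "ou_boundary (\<rho> - u)"]
    show "AE y in gauss. (\<lambda>n. D n (exp (- u) * x + sqrt (1 - exp (- 2 * u)) * y))
      \<longlonglongrightarrow> above ou_boundary (\<rho> - u) (exp (- u) * x + sqrt (1 - exp (- 2 * u)) * y)"
    proof eventually_elim
      case (elim y)
      then show ?case unfolding D_def using u S by (intro ou_value_defect_tendsto) auto
    qed
  qed auto
  from tendsto_minus[OF this] show "(\<lambda>n. (ou (u + S n) (ou_value (\<rho> - (u + S n))) x - ou u (ou_value (\<rho> - u)) x) / S n)
     \<longlonglongrightarrow> - ou u (above ou_boundary (\<rho> - u)) x" unfolding eq .
qed (use u in auto)

lemma ou_above_continuous_on:
  assumes b: "\<And>r. isCont b r" and p: "0 < p"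
  shows "continuous_on {p..q} (\<lambda>v. ou v (above b (c - v)) x)"
  unfolding continuous_on_sequentially
proof (intro allI impI ballI)
  fix s a assume a: "a \<in> {p..q}" and s: "(\<forall>n. s n \<in> {p..q}) \<and> s \<longlonglongrightarrow> a"
  then show "((\<lambda>v. ou v (above b (c - v)) x) \<circ> s) \<longlonglongrightarrow> ou a (above b (c - a)) x"
    unfolding comp_def using p by (intro ou_above_tendsto b) (auto intro!: tendsto_intros)
qed

lemma ou_boundary_measurable [measurable]: "ou_boundary \<in> borel_measurable borel"
  by (rule continuous_imp_borel[OF ou_boundary_isCont])

text \<open>Along \<open>\<phi>\<close> the value at \<open>u = 0\<close> flows to the reward of
  holding at \<open>u = \<rho>\<close>, with right derivative minus the source. The sum of
  \<open>\<phi>\<close> and the integral of the source is thus constant on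
  \<open>[p, \<rho>]\<close> for \<open>p > 0\<close>; the integrand being bounded, \<open>p\<close>
  can tend to 0.\<close>

lemma ou_value_eq_premium:
  assumes \<rho>: "0 \<le> \<rho>" shows "ou_value \<rho> x = premium ou_boundary \<rho> x"
proof (cases "\<rho> = 0")
  case True then show ?thesis by (simp add: ou_value_nonpos)
next
  case False
  with \<rho> have \<rho>: "0 < \<rho>" by simp
  define \<phi> where "\<phi> u = ou u (ou_value (\<rho> - u)) x" for u
  define \<psi> where "\<psi> v = ou v (above ou_boundary (\<rho> - v)) x" for v
  have \<psi>i: "set_integrable lborel {p..q} \<psi>" if "0 \<le> p" for p q
    unfolding \<psi>_def using that by (intro ou_above_set_integrable) auto
  have \<psi>c: "continuous_on {p..q} \<psi>" if "0 < p" for p q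
    unfolding \<psi>_def using that by (intro ou_above_continuous_on ou_boundary_isCont)
  have \<phi>c: "continuous_on {0..\<rho>} \<phi>"
    unfolding continuous_on_sequentially comp_def \<phi>_def by (intro allI impI ballI ou_value_flow_tendsto) auto
  have step: "\<phi> \<rho> + (LINT v:{p..\<rho>}|lborel. \<psi> v) = \<phi> p" if p: "0 < p" "p \<le> \<rho>" for p
  proof -
    let ?P = "\<lambda>u. \<phi> u + integral {p..u} \<psi>"
    have "?P \<rho> = ?P p"
    proof (rule right_derivative_zero_imp_const[OF p(2)])
      show "continuous_on {p..\<rho>} ?P"
        using p by (intro continuous_on_add continuous_on_subset[OF \<phi>c] indefinite_integral_continuous_1
            integrable_continuous_interval \<psi>c) auto
      fix u assume u: "p \<le> u" "u < \<rho>"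
      have "((\<lambda>u. integral {p..u} \<psi>) has_vector_derivative \<psi> u) (at u within {p..\<rho>})"
        using u p by (intro integral_has_vector_derivative \<psi>c) auto
      then have "((\<lambda>u. integral {p..u} \<psi>) has_real_derivative \<psi> u) (at u within {u..\<rho>})"
        unfolding has_real_derivative_iff_has_vector_derivative
        by (rule has_vector_derivative_within_subset) (use u in auto)
      then have "((\<lambda>u. integral {p..u} \<psi>) has_real_derivative \<psi> u) (at_right u)"
        by (simp only: at_within_Icc_at_right[OF u(2)])
      then have "((\<lambda>y. (integral {p..y} \<psi> - integral {p..u} \<psi>) / (y - u)) \<longlongrightarrow> \<psi> u) (at_right u)"
        by (simp only: has_field_derivative_iff)
      then have "((\<lambda>h. (integral {p..u + h} \<psi> - integral {p..u} \<psi>) / h) \<longlongrightarrow> \<psi> u) (at_right 0)"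
        by (subst (asm) filterlim_at_right_to_0) (simp add: add.commute)
      moreover have "((\<lambda>h. (\<phi> (u + h) - \<phi> u) / h) \<longlongrightarrow> - \<psi> u) (at_right 0)"
        unfolding \<phi>_def \<psi>_def using u p by (intro ou_value_flow_right_derivative) auto
      ultimately have "((\<lambda>h. (\<phi> (u + h) - \<phi> u) / h + (integral {p..u + h} \<psi> - integral {p..u} \<psi>) / h)
          \<longlongrightarrow> - \<psi> u + \<psi> u) (at_right 0)" by (intro tendsto_add)
      moreover have "(?P (u + h) - ?P u) / h = (\<phi> (u + h) - \<phi> u) / h + (integral {p..u + h} \<psi> - integral {p..u} \<psi>) / h" for h
        unfolding add_divide_distrib[symmetric] by (rule arg_cong[where f="\<lambda>z. z / h"]) linarith
      ultimately show "((\<lambda>h. (?P (u + h) - ?P u) / h) \<longlongrightarrow> 0) (at_right 0)"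
        by simp
    qed
    moreover have "(LINT v:{p..\<rho>}|lborel. \<psi> v) = integral {p..\<rho>} \<psi>"
      using \<psi>i[of p \<rho>] p by (intro set_borel_integral_eq_integral) auto
    ultimately show ?thesis by simp
  qed
  define S where "S n = \<rho> * (1/2) ^ n" for n :: nat
  have S: "0 < S n" "S n \<le> \<rho>" for n
    unfolding S_def using \<rho> by (auto simp: mult_left_le power_le_one)
  have S0: "S \<longlonglongrightarrow> 0" unfolding S_def using LIMSEQ_power_zero[of "1/2 :: real"] by (auto intro!: tendsto_mult_right_zero)
  have "(\<lambda>n. \<phi> \<rho> + (LINT v:{0..\<rho>}|lborel. \<psi> v) - (LINT v:{0..S n}|lborel. \<psi> v)) \<longlonglongrightarrow> \<phi> \<rho> + (LINT v:{0..\<rho>}|lborel. \<psi> v) - 0"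
  proof (rule tendsto_diff[OF tendsto_const], rule Lim_null_comparison)
    have "\<bar>LINT v:{0..S n}|lborel. \<psi> v\<bar> \<le> (S n - 0) * (2 * (2 + \<bar>x\<bar>))" for n
      unfolding \<psi>_def using S(1)[of n] ou_above_bound
      by (intro set_integral_abs_le ou_above_measurable ou_boundary_measurable) auto
    then show "\<forall>\<^sub>F n in sequentially. norm (LINT v:{0..S n}|lborel. \<psi> v) \<le> S n * (2 * (2 + \<bar>x\<bar>))"
      by (intro always_eventually) simp
    show "(\<lambda>n. S n * (2 * (2 + \<bar>x\<bar>))) \<longlonglongrightarrow> 0" by (rule tendsto_mult_left_zero[OF S0])
  qed
  moreover have "\<phi> \<rho> + (LINT v:{0..\<rho>}|lborel. \<psi> v) - (LINT v:{0..S n}|lborel. \<psi> v) = \<phi> (S n)" for n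
    using set_integral_split[OF less_imp_le[OF S(1)] S(2) \<psi>i[OF order_refl], of n] step[OF S, of n] by linarith
  ultimately have "(\<lambda>n. \<phi> (S n)) \<longlonglongrightarrow> \<phi> \<rho> + (LINT v:{0..\<rho>}|lborel. \<psi> v)" by simp
  moreover have "(\<lambda>n. \<phi> (S n)) \<longlonglongrightarrow> \<phi> 0" unfolding \<phi>_def by (rule ou_value_flow_tendsto[OF S0])
  ultimately have "\<phi> 0 = \<phi> \<rho> + (LINT v:{0..\<rho>}|lborel. \<psi> v)" using LIMSEQ_unique by blast
  moreover have "\<phi> \<rho> = exp (- 2 * \<rho>) * x"
    unfolding \<phi>_def by (simp add: ou_value_nonpos[of 0, THEN ext, OF order_refl] ou_id del: mult_minus_left)
  ultimately show ?thesis unfolding premium_def \<phi>_def \<psi>_def by simp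
qed

section \<open>Uniqueness for the premium equation\<close>

lemma quadratic_dominates_linear:
  fixes x :: real
  assumes C: "0 \<le> C" and \<epsilon>: "0 < \<epsilon>" and x: "1 + 8 * C / \<epsilon> \<le> \<bar>x\<bar>"
  shows "C * (1 + \<bar>x\<bar>) \<le> \<epsilon> * (1 + x\<^sup>2 / 4)"
proof -
  have "0 \<le> 8 * C / \<epsilon>" using C \<epsilon> by simp
  then have x1: "1 \<le> \<bar>x\<bar>" "8 * C / \<epsilon> \<le> \<bar>x\<bar>" using x by auto
  have "C * (1 + \<bar>x\<bar>) \<le> C * (2 * \<bar>x\<bar>)" using C x1 by (intro mult_left_mono) auto
  also have "\<dots> = (8 * C / \<epsilon>) * \<bar>x\<bar> * (\<epsilon> / 4)" using \<epsilon> by simp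
  also have "\<dots> \<le> (\<bar>x\<bar> * \<bar>x\<bar>) * (\<epsilon> / 4)" using x1 \<epsilon> by (intro mult_right_mono) auto
  also have "\<dots> = \<epsilon> * (x\<^sup>2 / 4)" by (simp add: power2_eq_square)
  also have "\<dots> \<le> \<epsilon> * (1 + x\<^sup>2 / 4)" using \<epsilon> by (intro mult_left_mono) auto
  finally show ?thesis .
qed

lemma one_minus_exp_ge:
  assumes "0 \<le> h" "h \<le> 1" shows "h / 2 \<le> 1 - exp (- h :: real)"
proof -
  have "(1 + h) * exp (- h) \<le> exp h * exp (- h)"
    using exp_ge_add_one_self[of h] by (intro mult_right_mono) auto
  then have "exp (- h) \<le> 1 / (1 + h)" using assms by (simp add: field_simps flip: exp_add)
  also have "\<dots> \<le> 1 - h / 2"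
  proof -
    have "1 \<le> (1 - h / 2) * (1 + h)" using mult_nonneg_nonneg[of h "1 - h"] assms by (simp add: algebra_simps)
    then show ?thesis using assms by (simp add: divide_le_eq)
  qed
  finally show ?thesis by simp
qed

text \<open>The killing factor \<open>exp (- h)\<close> in \<^const>\<open>ou\<close> is what rules out a positive maximum.\<close>

lemma max_principle:
  fixes w :: "real \<Rightarrow> real \<Rightarrow> real"
  assumes cont: "continuous_on ({0..R} \<times> UNIV) (\<lambda>(r, x). w r x)"
    and growth: "\<And>r x. r \<in> {0..R} \<Longrightarrow> \<bar>w r x\<bar> \<le> C * (1 + \<bar>x\<bar>)"
    and sub: "\<And>r x. r \<in> {0..R} \<Longrightarrow> 0 < w r x \<Longrightarrow>
      \<exists>K h0. 0 < h0 \<and> h0 \<le> r \<and> (\<forall>h. 0 < h \<longrightarrow> h \<le> h0 \<longrightarrow> w r x \<le> ou h (w (r - h)) x + K * h\<^sup>2)"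
    and r0: "r0 \<in> {0..R}"
  shows "w r0 x0 \<le> 0"
proof (rule ccontr)
  assume "\<not> w r0 x0 \<le> 0"
  then have pos: "0 < w r0 x0" by simp
  let ?q = "\<lambda>x::real. 1 + x\<^sup>2 / 4"
  have C: "0 \<le> C" using growth[OF r0, of 0] by simp
  have meas: "w r \<in> borel_measurable borel" if "r \<in> {0..R}" for r
  proof (rule borel_measurable_continuous_onI)
    have "continuous_on UNIV ((\<lambda>(r, x). w r x) \<circ> (\<lambda>x. (r, x)))"
      by (intro continuous_on_compose continuous_on_subset[OF cont] continuous_intros) (use that in auto)
    then show "continuous_on UNIV (w r)" by (simp add: comp_def)
  qed
  have q1: "1 \<le> ?q x" for x by simp
  \<comment> \<open>Half of what would cancel the positive value at the chosen point, so the
    penalised function is still positive there.\<close>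
  define \<epsilon> where "\<epsilon> = w r0 x0 / (2 * ?q x0)"
  have \<epsilon>: "0 < \<epsilon>" using pos unfolding \<epsilon>_def by (intro divide_pos_pos mult_pos_pos add_pos_nonneg) auto
  have \<epsilon>0: "0 < w r0 x0 - \<epsilon> * ?q x0"
  proof -
    have "a / (2 * c) * c = a / 2" if "1 \<le> c" for a c :: real using that by simp
    from this[OF q1] have "\<epsilon> * ?q x0 = w r0 x0 / 2" unfolding \<epsilon>_def .
    then show ?thesis using pos by simp
  qed
  \<comment> \<open>Outside \<open>[- X, X]\<close> the linear growth of \<open>w\<close> is below
    the penalty, so the positive maximum over the compact rectangle bounds the penalised function on
    the whole strip.\<close>
  define X where "X = max \<bar>x0\<bar> (1 + 8 * C / \<epsilon>)"
  let ?\<Phi> = "\<lambda>(r, x). w r x - \<epsilon> * ?q x"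
  have "\<exists>p\<in>{0..R} \<times> {- X..X}. \<forall>q\<in>{0..R} \<times> {- X..X}. ?\<Phi> q \<le> ?\<Phi> p"
  proof (rule continuous_attains_sup)
    show "compact ({0..R} \<times> {- X..X})" by (intro compact_Times compact_Icc)
    show "{0..R} \<times> {- X..X} \<noteq> {}" using r0 by (auto simp: X_def)
    have "continuous_on ({0..R} \<times> {- X..X}) (\<lambda>p. (\<lambda>(r, x). w r x) p - \<epsilon> * ?q (snd p))"
      by (intro continuous_intros continuous_on_subset[OF cont]) auto
    then show "continuous_on ({0..R} \<times> {- X..X}) ?\<Phi>" by (simp add: case_prod_beta')
  qed
  then obtain r x where rx: "r \<in> {0..R}" "x \<in> {- X..X}"
    and max: "\<And>r' x'. r' \<in> {0..R} \<Longrightarrow> x' \<in> {- X..X} \<Longrightarrow> w r' x' - \<epsilon> * ?q x' \<le> w r x - \<epsilon> * ?q x"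
    by force
  have "\<bar>x0\<bar> \<le> X" by (simp add: X_def)
  then have x0X: "x0 \<in> {- X..X}" by auto
  define M where "M = w r x - \<epsilon> * ?q x"
  have M: "0 < M" using max[OF r0 x0X] \<epsilon>0 by (simp add: M_def)
  have le: "w r' x' \<le> M + \<epsilon> * ?q x'" if "r' \<in> {0..R}" for r' x'
  proof (cases "x' \<in> {- X..X}")
    case True then show ?thesis using max[OF that True] by (simp add: M_def)
  next
    case False
    then have "1 + 8 * C / \<epsilon> \<le> \<bar>x'\<bar>" by (auto simp: X_def)
    then have "w r' x' \<le> \<epsilon> * ?q x'"
      using quadratic_dominates_linear[OF C \<epsilon>] growth[OF that, of x'] by force
    then show ?thesis using M by simp
  qed
  have "0 < \<epsilon> * ?q x" using \<epsilon> by (intro mult_pos_pos add_pos_nonneg) auto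
  then have "0 < w r x" using M unfolding M_def by linarith
  then obtain K h0 where h0: "0 < h0" "h0 \<le> r"
    and K: "\<And>h. 0 < h \<Longrightarrow> h \<le> h0 \<Longrightarrow> w r x \<le> ou h (w (r - h)) x + K * h\<^sup>2"
    using sub[OF rx(1)] by blast
  \<comment> \<open>\<open>w (r - h)\<close> lies below \<open>M + \<epsilon> * ?q\<close>, with
    equality for \<open>w r\<close> at \<open>x\<close>. The semigroup does not increase
    \<open>?q\<close> but multiplies the constant by \<open>exp (- h)\<close>, leaving
    \<open>M * (1 - exp (- h)) <= K * h^2\<close>.\<close>
  have est: "M \<le> 2 * \<bar>K\<bar> * h" if h: "0 < h" "h \<le> h0" "h \<le> 1" for h
  proof -
    have rh: "r - h \<in> {0..R}" using h h0 rx by auto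
    have "M + \<epsilon> * ?q x \<le> ou h (w (r - h)) x + K * h\<^sup>2" using K[OF h(1,2)] by (simp add: M_def)
    also have "ou h (w (r - h)) x \<le> ou h (\<lambda>y. M + \<epsilon> * ?q y) x"
      by (intro ou_mono quartic_growth_linear[OF meas[OF rh] growth[OF rh]] quartic_growth_add
          quartic_growth_const quartic_growth_cmult quadratic_quartic_growth le rh)
    also have "\<dots> = exp (- h) * M + \<epsilon> * ou h ?q x"
      by (subst ou_add[OF quartic_growth_const quartic_growth_cmult[OF quadratic_quartic_growth]])
        (simp only: ou_const ou_cmult)
    also have "\<epsilon> * ou h ?q x \<le> \<epsilon> * ?q x"
      using \<epsilon> h by (intro mult_left_mono ou_quadratic_le) auto
    finally have "M * (1 - exp (- h)) \<le> K * h\<^sup>2" by (simp add: algebra_simps)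
    moreover have "M * (h / 2) \<le> M * (1 - exp (- h))"
      using M one_minus_exp_ge[of h] h by (intro mult_left_mono) auto
    moreover have "K * h\<^sup>2 \<le> \<bar>K\<bar> * h\<^sup>2" by (intro mult_right_mono) auto
    ultimately have "M * h \<le> (2 * \<bar>K\<bar> * h) * h" by (simp add: power2_eq_square)
    then show ?thesis using h(1) by simp
  qed
  define h where "h = min (min h0 1) (M / (4 * (\<bar>K\<bar> + 1)))"
  have h: "0 < h" "h \<le> h0" "h \<le> 1" "h \<le> M / (4 * (\<bar>K\<bar> + 1))" using h0 M unfolding h_def by auto
  have "2 * \<bar>K\<bar> * h \<le> 2 * (\<bar>K\<bar> + 1) * (M / (4 * (\<bar>K\<bar> + 1)))" using h M by (intro mult_mono) auto
  also have "\<dots> = M / 2" by (simp add: field_simps)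
  finally show False using est[OF h(1-3)] M by simp
qed

lemma AE_lborel_interval:
  assumes "AE v in lborel. P v" "a < (b::real)" shows "\<exists>v. a < v \<and> v < b \<and> P v"
proof (rule ccontr)
  assume "\<not> ?thesis"
  then have n: "\<not> P v" if "a < v" "v < b" for v using that by blast
  have "AE v in lborel. v \<notin> {a<..<b}" using assms(1) by eventually_elim (use n in auto)
  then have "emeasure lborel {v. a < v \<and> v < b} = 0" by (subst (asm) AE_iff_measurable[OF _ refl]) auto
  moreover have "{v. a < v \<and> v < b} = {a<..<b}" by auto
  ultimately show False using assms(2) by simp
qed

lemma ou_pos:
  assumes k: "quartic_growth k" "\<And>\<xi>. 0 \<le> k \<xi>" "\<And>\<xi>. p < \<xi> \<Longrightarrow> \<xi> < q \<Longrightarrow> 0 < k \<xi>" and pq: "p < q" and v: "0 < v"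
  shows "0 < ou v k x"
proof (rule ccontr)
  assume "\<not> 0 < ou v k x"
  with ou_nonneg[of k v x] k(2) have "ou v k x = 0" by force
  define s where "s = sqrt (1 - exp (- 2 * v))"
  have s: "0 < s" unfolding s_def by (rule sqrt_one_minus_exp_pos[OF v])
  let ?k = "\<lambda>y. k (exp (- v) * x + s * y)"
  have "(\<integral>y. ?k y \<partial>gauss) = 0" using \<open>ou v k x = 0\<close> by (simp add: ou_def s_def)
  moreover have "integrable gauss ?k" by (rule ou_integrable[OF k(1)])
  ultimately have "AE y in gauss. ?k y = 0" using k(2) by (subst (asm) integral_nonneg_eq_0_iff_AE) auto
  then have "AE y in lborel. 0 < ennreal (std_normal_density y) \<longrightarrow> ?k y = 0"
    by (subst (asm) AE_density) auto
  then have "AE y in lborel. ?k y = 0" by eventually_elim (simp add: normal_density_pos)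
  moreover have "(p - exp (- v) * x) / s < (q - exp (- v) * x) / s" using pq s by (simp add: divide_strict_right_mono)
  ultimately obtain y where y: "(p - exp (- v) * x) / s < y" "y < (q - exp (- v) * x) / s" "?k y = 0"
    using AE_lborel_interval by blast
  then have "p < exp (- v) * x + s * y" "exp (- v) * x + s * y < q"
    using s by (simp_all add: divide_less_eq less_divide_eq mult.commute)
  then show False using k(3) y(3) by force
qed

section \<open>Comparison of a candidate with the optimal boundary\<close>

text \<open>A candidate boundary in the horizon variable. Non-negativity is the lower bound
  \<open>m / (1 - \<gamma>\<^sup>2)\<close> after centring at \<open>\<kappa>\<close>.
  \<open>b\<close> is continuous on the whole line, while the equation is demanded for horizons in
  \<open>(0, R]\<close>.\<close>

locale integral_equation_solution =
  fixes b :: "real \<Rightarrow> real" and R :: real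
  assumes isCont_b: "isCont b r"
    and b_nonneg: "0 \<le> b r"
    and R_nonneg: "0 \<le> R"
    and eq_b: "0 < r \<Longrightarrow> r \<le> R \<Longrightarrow> premium b r (b r) = b r"
begin

lemma b_measurable [measurable]: "b \<in> borel_measurable borel"
  by (rule continuous_imp_borel[OF isCont_b])

lemma b_near:
  assumes "0 < d" obtains h0 where "0 < h0" "\<And>h. 0 \<le> h \<Longrightarrow> h \<le> h0 \<Longrightarrow> \<bar>b (r - h) - b r\<bar> < d"
proof -
  obtain e where e: "0 < e" "\<And>r'. \<bar>r' - r\<bar> < e \<Longrightarrow> \<bar>b r' - b r\<bar> < d"
    using isCont_b[of r] assms unfolding continuous_at_eps_delta dist_real_def by blast
  show ?thesis by (rule that[of "e / 2"]) (use e in auto)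
qed

text \<open>Strictly above \<open>b\<close> the source may be replaced by \<open>2 * \<xi>\<close>,
  with an error controlled by \<open>ou_local\<close>; its transport
  \<open>2 * exp (- 2 * v) * x\<close> integrates to \<open>x * (1 - exp (- 2 * h))\<close>, exactly
  what the identity loses over \<open>h\<close>.\<close>

lemma integral_above_approx:
  assumes "\<And>v. 0 \<le> v \<Longrightarrow> v \<le> h \<Longrightarrow> b (r - v) < x - d" "0 < d" "0 \<le> h" "h \<le> 1"
  shows "\<bar>(LINT v:{0..h}|lborel. ou v (above b (r - v)) x) - x * (1 - exp (- 2 * h))\<bar> \<le> local_const 2 x d * h\<^sup>2"
proof -
  let ?f = "\<lambda>v. ou v (above b (r - v)) x - 2 * exp (- 2 * v) * x"
  have m: "(\<lambda>v. ou v (above b (r - v)) x) \<in> borel_measurable borel" by (rule ou_above_measurable[OF b_measurable])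
  have i1: "set_integrable lborel {0..h} (\<lambda>v. ou v (above b (r - v)) x)" by (intro ou_above_set_integrable) auto
  have i2: "set_integrable lborel {0..h} (\<lambda>v. 2 * exp (- 2 * v) * x)"
    by (intro borel_integrable_compact[unfolded set_integrable_def[symmetric]] continuous_intros compact_Icc)
  have "(LINT v:{0..h}|lborel. 2 * exp (- 2 * v) * x) = (- exp (- 2 * h) * x) - (- exp (- 2 * 0) * x)"
    unfolding set_lebesgue_integral_def using assms(3)
    by (intro integral_FTC_atLeastAtMost)
      (auto intro!: derivative_eq_intros continuous_intros simp flip: has_real_derivative_iff_has_vector_derivative)
  then have "(LINT v:{0..h}|lborel. ou v (above b (r - v)) x) - x * (1 - exp (- 2 * h)) = (LINT v:{0..h}|lborel. ?f v)"
    unfolding set_integral_diff(2)[OF i1 i2] by (simp only:) (simp add: algebra_simps)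
  also have "\<bar>\<dots>\<bar> \<le> (h - 0) * (local_const 2 x d * h\<^sup>2)"
  proof (rule set_integral_abs_le)
    show "?f \<in> borel_measurable borel" using m by measurable
    fix v assume v: "v \<in> {0..h}"
    let ?e = "\<lambda>\<xi>. above b (r - v) \<xi> - 2 * \<xi>"
    have "\<bar>ou v ?e x\<bar> \<le> local_const 2 x d * v\<^sup>2"
    proof (rule ou_local)
      show "?e \<xi> = 0" if "\<bar>\<xi> - x\<bar> < d" for \<xi>
      proof -
        have "b (r - v) < \<xi>" using assms(1)[of v] v that by auto
        then show ?thesis by (simp add: above_def)
      qed
      show "\<bar>?e \<xi>\<bar> \<le> 2 * (1 + \<bar>\<xi>\<bar>)" for \<xi> by (simp add: above_def abs_mult)
    qed (use v assms in auto)
    also have "\<dots> \<le> local_const 2 x d * h\<^sup>2"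
      using v assms by (intro mult_left_mono power_mono local_const_nonneg) auto
    also have "ou v ?e x = ?f v"
      by (subst ou_diff[OF above_quartic_growth quartic_growth_cmult[OF quartic_growth_id]])
        (simp only: ou_cmult ou_id mult.assoc)
    finally show "\<bar>?f v\<bar> \<le> local_const 2 x d * h\<^sup>2" .
  qed (use assms in auto)
  also have "\<dots> \<le> 1 * (local_const 2 x d * h\<^sup>2)"
    using assms by (intro mult_right_mono mult_nonneg_nonneg local_const_nonneg) auto
  finally show ?thesis by simp
qed

lemma integral_above_small:
  assumes "\<And>v. 0 \<le> v \<Longrightarrow> v \<le> h \<Longrightarrow> x + d < b (r - v)" "0 < d" "0 \<le> h" "h \<le> 1"
  shows "\<bar>LINT v:{0..h}|lborel. ou v (above b (r - v)) x\<bar> \<le> local_const 2 x d * h\<^sup>2"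
proof -
  have "\<bar>LINT v:{0..h}|lborel. ou v (above b (r - v)) x\<bar> \<le> (h - 0) * (local_const 2 x d * h\<^sup>2)"
  proof (rule set_integral_abs_le)
    fix v assume v: "v \<in> {0..h}"
    have "\<bar>ou v (above b (r - v)) x\<bar> \<le> local_const 2 x d * v\<^sup>2"
    proof (rule ou_local[OF above_measurable above_bound])
      show "above b (r - v) \<xi> = 0" if "\<bar>\<xi> - x\<bar> < d" for \<xi>
      proof -
        have "\<xi> < b (r - v)" using assms(1)[of v] v that by auto
        then show ?thesis by (simp add: above_def)
      qed
    qed (use v assms in auto)
    also have "\<dots> \<le> local_const 2 x d * h\<^sup>2"
      using v assms by (intro mult_left_mono power_mono local_const_nonneg) auto
    finally show "\<bar>ou v (above b (r - v)) x\<bar> \<le> local_const 2 x d * h\<^sup>2" .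
  qed (use assms ou_above_measurable[OF b_measurable] in auto)
  also have "\<dots> \<le> 1 * (local_const 2 x d * h\<^sup>2)"
    using assms by (intro mult_right_mono mult_nonneg_nonneg local_const_nonneg) auto
  finally show ?thesis by simp
qed

lemma premium_continuous_on: "continuous_on ({0..R} \<times> UNIV) (\<lambda>(r, x). premium b r x)"
  unfolding continuous_on_sequentially
proof (intro allI impI ballI)
  fix s and a :: "real \<times> real" assume a: "a \<in> {0..R} \<times> UNIV" and s: "(\<forall>n. s n \<in> {0..R} \<times> UNIV) \<and> s \<longlonglongrightarrow> a"
  have s': "0 \<le> fst (s n)" for n using s by (metis atLeastAtMost_iff mem_Times_iff)
  have "(\<lambda>n. premium b (fst (s n)) (snd (s n))) \<longlonglongrightarrow> premium b (fst a) (snd a)"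
    using s s' by (intro premium_tendsto isCont_b tendsto_fst tendsto_snd) auto
  then show "((\<lambda>(r, x). premium b r x) \<circ> s) \<longlonglongrightarrow> (\<lambda>(r, x). premium b r x) a"
    by (simp add: comp_def case_prod_beta')
qed

text \<open>Above \<open>b\<close> the premium and the identity follow the same evolution up to
  \<open>O(h^2)\<close> per step; they agree on \<open>b\<close> by the equation and coincide at
  horizon 0. So the deviation \<open>w\<close> and its negative both satisfy the hypotheses of
  \<open>max_principle\<close>.\<close>

lemma premium_above:
  assumes r: "r \<in> {0..R}" and x: "b r \<le> x" shows "premium b r x = x"
proof -
  \<comment> \<open>Evaluating at \<open>max x (b r)\<close> makes \<open>w\<close> continuous by
    construction; the integral equation makes it vanish below \<open>b\<close>.\<close>
  define w where "w r x = premium b r (max x (b r)) - max x (b r)" for r x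
  have w0: "w r x = (if b r < x then premium b r x - x else 0)" if "r \<in> {0..R}" for r x
  proof (cases "r = 0")
    case True then show ?thesis by (simp add: w_def)
  next
    case False
    then have "premium b r (b r) = b r" using that by (intro eq_b) auto
    then show ?thesis by (auto simp: w_def max_def)
  qed
  have P: "\<bar>premium b r x\<bar> \<le> (1 + 4 * R) * (1 + \<bar>x\<bar>)" if "r \<in> {0..R}" for r x
  proof -
    have "\<bar>premium b r x\<bar> \<le> (1 + 4 * r) * (1 + \<bar>x\<bar>)" using that by (intro premium_bound b_measurable) auto
    also have "\<dots> \<le> (1 + 4 * R) * (1 + \<bar>x\<bar>)" using that by (intro mult_right_mono) auto
    finally show ?thesis .
  qed
  define C where "C = 2 + 4 * R"
  have PC: "\<bar>premium b r x - x\<bar> \<le> C * (1 + \<bar>x\<bar>)" if "r \<in> {0..R}" for r x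
    using P[OF that, of x] R_nonneg unfolding C_def by (simp add: algebra_simps)
  have C0: "0 \<le> C" using R_nonneg by (simp add: C_def)
  have growth: "\<bar>w r x\<bar> \<le> C * (1 + \<bar>x\<bar>)" if "r \<in> {0..R}" for r x
    using PC[OF that, of x] C0 by (simp add: w0[OF that])
  have cont: "continuous_on ({0..R} \<times> UNIV) (\<lambda>(r, x). c * w r x)" for c
  proof -
    have bc: "continuous_on UNIV b" by (intro continuous_at_imp_continuous_on) (use isCont_b in auto)
    have bf: "continuous_on ({0..R} \<times> UNIV) (\<lambda>p :: real \<times> real. b (fst p))"
      by (intro continuous_on_compose2[OF bc] continuous_intros) auto
    have m: "continuous_on ({0..R} \<times> UNIV) (\<lambda>p. max (snd p) (b (fst p)))"
      by (intro continuous_intros bf)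
    have "continuous_on ({0..R} \<times> UNIV) (\<lambda>p. (\<lambda>(r, x). premium b r x) (fst p, max (snd p) (b (fst p))))"
      by (intro continuous_on_compose2[OF premium_continuous_on] continuous_intros m) auto
    then have mp: "continuous_on ({0..R} \<times> UNIV) (\<lambda>p. premium b (fst p) (max (snd p) (b (fst p))))"
      by simp
    have "continuous_on ({0..R} \<times> UNIV) (\<lambda>p. c * (premium b (fst p) (max (snd p) (b (fst p))) - max (snd p) (b (fst p))))"
      by (intro continuous_intros m bf mp)
    then show ?thesis by (simp add: w_def case_prod_beta')
  qed
  have sub: "\<exists>K h0. 0 < h0 \<and> h0 \<le> r \<and> (\<forall>h. 0 < h \<longrightarrow> h \<le> h0 \<longrightarrow> \<bar>w r x - ou h (w (r - h)) x\<bar> \<le> K * h\<^sup>2)"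
    if r: "r \<in> {0..R}" and w: "w r x \<noteq> 0" for r x
  proof -
    have x: "b r < x" using w by (auto simp: w0[OF r] split: if_splits)
    have r0: "0 < r" using w r by (cases "r = 0") (auto simp: w_def)
    define d where "d = (x - b r) / 2"
    have d: "0 < d" using x by (simp add: d_def)
    obtain h1 where h1: "0 < h1" "\<And>h. 0 \<le> h \<Longrightarrow> h \<le> h1 \<Longrightarrow> \<bar>b (r - h) - b r\<bar> < d" using b_near[OF d] by blast
    have bl: "b (r - h) < x - d" if "0 \<le> h" "h \<le> h1" for h
    proof -
      have "b r + d = x - d" by (simp add: d_def field_simps)
      then show ?thesis using h1(2)[OF that] by linarith
    qed
    define h0 where "h0 = min (min 1 r) h1"
    show ?thesis
    proof (rule exI[of _ "local_const 2 x d + local_const C x d"], rule exI[of _ h0], intro conjI allI impI)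
      show "0 < h0" "h0 \<le> r" using h1 r0 by (auto simp: h0_def)
      fix h assume h: "0 < h" "h \<le> h0"
      then have h': "0 \<le> h" "h \<le> 1" "h \<le> r" "h \<le> h1" by (auto simp: h0_def)
      have rh: "r - h \<in> {0..R}" using h' r by auto
      let ?e = "\<lambda>\<xi>. (premium b (r - h) \<xi> - \<xi>) - w (r - h) \<xi>"
      have qp: "quartic_growth (premium b (r - h))" using rh by (intro premium_quartic_growth b_measurable) auto
      have wm: "w (r - h) \<in> borel_measurable borel"
      proof -
        have [measurable]: "premium b (r - h) \<in> borel_measurable borel" by (rule premium_measurable[OF b_measurable])
        show ?thesis unfolding w_def by measurable
      qed
      have qw: "quartic_growth (w (r - h))" using growth[OF rh] by (intro quartic_growth_linear[OF wm])
      have e1: "\<bar>ou h ?e x\<bar> \<le> local_const C x d * h\<^sup>2"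
      proof (rule ou_local)
        show "?e \<in> borel_measurable borel"
          using quartic_growth_measurable[OF qp] wm by measurable
        show "\<bar>?e \<xi>\<bar> \<le> C * (1 + \<bar>\<xi>\<bar>)" for \<xi> using PC[OF rh, of \<xi>] C0 by (auto simp: w0[OF rh])
        show "?e \<xi> = 0" if "\<bar>\<xi> - x\<bar> < d" for \<xi>
        proof -
          have "b (r - h) < \<xi>" using bl[of h] h' that by auto
          then show ?thesis by (simp add: w0[OF rh])
        qed
      qed (use d h' in auto)
      have e2: "ou h ?e x = ou h (premium b (r - h)) x - exp (- 2 * h) * x - ou h (w (r - h)) x"
        by (subst ou_diff[OF quartic_growth_diff[OF qp quartic_growth_id] qw],
            subst ou_diff[OF qp quartic_growth_id]) (simp only: ou_id)
      have "w r x = premium b r x - x" using x by (simp add: w0[OF r])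
      also have "premium b r x = ou h (premium b (r - h)) x + (LINT v:{0..h}|lborel. ou v (above b (r - v)) x)"
        using h' by (intro premium_split b_measurable) auto
      finally have e3: "w r x - ou h (w (r - h)) x = ou h ?e x
          + ((LINT v:{0..h}|lborel. ou v (above b (r - v)) x) - x * (1 - exp (- 2 * h)))"
        unfolding e2 by (simp add: algebra_simps)
      have "\<bar>(LINT v:{0..h}|lborel. ou v (above b (r - v)) x) - x * (1 - exp (- 2 * h))\<bar> \<le> local_const 2 x d * h\<^sup>2"
        using h' d by (intro integral_above_approx bl) auto
      then show "\<bar>w r x - ou h (w (r - h)) x\<bar> \<le> (local_const 2 x d + local_const C x d) * h\<^sup>2"
        unfolding e3 using e1 by (simp add: distrib_right)
    qed
  qed
  have "c * w r x \<le> 0" if c: "\<bar>c\<bar> = 1" for c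
  proof (rule max_principle[OF cont _ _ r, of c C])
    show "\<bar>c * w r x\<bar> \<le> C * (1 + \<bar>x\<bar>)" if "r \<in> {0..R}" for r x using growth[OF that] c by (simp add: abs_mult)
    fix r x assume r: "r \<in> {0..R}" and "0 < c * w r x"
    then have "w r x \<noteq> 0" by auto
    then obtain K h0 where K: "0 < h0" "h0 \<le> r" "\<And>h. 0 < h \<Longrightarrow> h \<le> h0 \<Longrightarrow> \<bar>w r x - ou h (w (r - h)) x\<bar> \<le> K * h\<^sup>2"
      using sub[OF r] by blast
    show "\<exists>K h0. 0 < h0 \<and> h0 \<le> r \<and> (\<forall>h. 0 < h \<longrightarrow> h \<le> h0 \<longrightarrow> c * w r x \<le> ou h (\<lambda>x. c * w (r - h) x) x + K * h\<^sup>2)"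
    proof (rule exI[of _ K], rule exI[of _ h0], intro conjI allI impI K(1,2))
      fix h assume "0 < h" "h \<le> h0"
      then have "\<bar>c * (w r x - ou h (w (r - h)) x)\<bar> \<le> K * h\<^sup>2" using K(3) c by (simp add: abs_mult)
      then show "c * w r x \<le> ou h (\<lambda>x. c * w (r - h) x) x + K * h\<^sup>2"
        unfolding ou_cmult by (simp add: right_diff_distrib abs_le_iff)
    qed
  qed
  from this[of 1] this[of "- 1"] have "w r x = 0" by simp
  then show ?thesis using x by (simp add: w_def max_def)
qed

text \<open>A positive difference forces \<open>x < b r\<close>, as above \<open>b\<close> the
  premium is \<open>x\<close>. Below \<open>b\<close> the source is locally absent, so the premium
  is transported by the semigroup up to \<open>O(h^2)\<close>, while the value dominates its own
  transport; \<open>max_principle\<close> applies to the difference.\<close>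

lemma premium_le_ou_value:
  assumes r: "r \<in> {0..R}" shows "premium b r x \<le> ou_value r x"
proof -
  define w where "w r x = premium b r x - ou_value r x" for r x
  have "w r x \<le> 0"
  proof (rule max_principle[where w=w and C="2 + 4 * R", OF _ _ _ r])
    have "continuous_on ({0..R} \<times> UNIV) (\<lambda>p. ou_value (fst p) (snd p))"
      unfolding continuous_on_def by (intro ballI ou_value_tendsto tendsto_fst tendsto_snd tendsto_ident_at)
    then show "continuous_on ({0..R} \<times> UNIV) (\<lambda>(r, x). w r x)"
      using premium_continuous_on unfolding w_def case_prod_beta' by (intro continuous_intros)
    show "\<bar>w r x\<bar> \<le> (2 + 4 * R) * (1 + \<bar>x\<bar>)" if "r \<in> {0..R}" for r x
    proof -
      have "\<bar>premium b r x\<bar> \<le> (1 + 4 * r) * (1 + \<bar>x\<bar>)" using that by (intro premium_bound b_measurable) auto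
      also have "\<dots> \<le> (1 + 4 * R) * (1 + \<bar>x\<bar>)" using that by (intro mult_right_mono) auto
      finally show ?thesis using payoff_like_bound[OF payoff_like_ou_value, of r x]
        unfolding w_def by (simp add: algebra_simps)
    qed
    fix r x assume r: "r \<in> {0..R}" and w: "0 < w r x"
    have x: "x < b r"
      using w premium_above[OF r, of x] payoff_like_ge[OF payoff_like_ou_value, of x r] by (force simp: w_def)
    have r0: "0 < r" using w r by (cases "r = 0") (auto simp: w_def ou_value_nonpos)
    define d where "d = (b r - x) / 2"
    have d: "0 < d" using x by (simp add: d_def)
    obtain h1 where h1: "0 < h1" "\<And>h. 0 \<le> h \<Longrightarrow> h \<le> h1 \<Longrightarrow> \<bar>b (r - h) - b r\<bar> < d" using b_near[OF d] by blast
    have bl: "x + d < b (r - h)" if "0 \<le> h" "h \<le> h1" for h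
    proof -
      have "b r - d = x + d" by (simp add: d_def field_simps)
      then show ?thesis using h1(2)[OF that] by linarith
    qed
    define h0 where "h0 = min (min 1 r) h1"
    show "\<exists>K h0. 0 < h0 \<and> h0 \<le> r \<and> (\<forall>h. 0 < h \<longrightarrow> h \<le> h0 \<longrightarrow> w r x \<le> ou h (w (r - h)) x + K * h\<^sup>2)"
    proof (rule exI[of _ "local_const 2 x d"], rule exI[of _ h0], intro conjI allI impI)
      show "0 < h0" "h0 \<le> r" using h1 r0 by (auto simp: h0_def)
      fix h assume h: "0 < h" "h \<le> h0"
      then have h': "0 \<le> h" "h \<le> 1" "h \<le> r" "h \<le> h1" by (auto simp: h0_def)
      have qp: "quartic_growth (premium b (r - h))" using h' by (intro premium_quartic_growth b_measurable) auto
      have qv: "quartic_growth (ou_value (r - h))" by (intro payoff_like_quartic_growth payoff_like_ou_value)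
      have "premium b r x = ou h (premium b (r - h)) x + (LINT v:{0..h}|lborel. ou v (above b (r - v)) x)"
        using h' by (intro premium_split b_measurable) auto
      moreover have "\<bar>LINT v:{0..h}|lborel. ou v (above b (r - v)) x\<bar> \<le> local_const 2 x d * h\<^sup>2"
        using h' d by (intro integral_above_small bl) auto
      moreover have "ou h (ou_value (r - h)) x \<le> ou_value r x"
        using ou_ou_value_le[of "r - h" h x] h' by simp
      moreover have "ou h (w (r - h)) x = ou h (premium b (r - h)) x - ou h (ou_value (r - h)) x"
        unfolding w_def by (rule ou_diff[OF qp qv])
      ultimately show "w r x \<le> ou h (w (r - h)) x + local_const 2 x d * h\<^sup>2"
        unfolding w_def by linarith
    qed
  qed
  then show ?thesis by (simp add: w_def)
qed

lemma above_diff_quartic_growth: "quartic_growth (\<lambda>\<xi>. above ou_boundary r \<xi> - above b r \<xi>)"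
  by (intro quartic_growth_diff above_quartic_growth)

lemma ou_value_minus_premium:
  assumes r: "r \<in> {0..R}" and h: "0 \<le> h" "h \<le> r"
  shows "ou_value r x - premium b r x = ou h (\<lambda>\<xi>. ou_value (r - h) \<xi> - premium b (r - h) \<xi>) x
     + (LINT v:{0..h}|lborel. ou v (\<lambda>\<xi>. above ou_boundary (r - v) \<xi> - above b (r - v) \<xi>) x)"
proof -
  have p: "ou_value r x = premium ou_boundary r x" for x using r by (intro ou_value_eq_premium) auto
  have p': "ou_value (r - h) = premium ou_boundary (r - h)" using h by (intro ext ou_value_eq_premium) auto
  have q: "quartic_growth (premium b (r - h))" "quartic_growth (premium ou_boundary (r - h))"
    using h by (intro premium_quartic_growth b_measurable ou_boundary_measurable; simp)+
  have i: "set_integrable lborel {0..h} (\<lambda>v. ou v (above b (r - v)) x)"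
    "set_integrable lborel {0..h} (\<lambda>v. ou v (above ou_boundary (r - v)) x)"
    by (intro ou_above_set_integrable b_measurable ou_boundary_measurable; simp)+
  have "(LINT v:{0..h}|lborel. ou v (\<lambda>\<xi>. above ou_boundary (r - v) \<xi> - above b (r - v) \<xi>) x)
      = (LINT v:{0..h}|lborel. ou v (above ou_boundary (r - v)) x) - (LINT v:{0..h}|lborel. ou v (above b (r - v)) x)"
    unfolding ou_diff[OF above_quartic_growth above_quartic_growth] by (rule set_integral_diff(2)[OF i(2) i(1)])
  then show ?thesis
    unfolding p p' ou_diff[OF q(2) q(1)]
    using premium_split[OF b_measurable h, of x] premium_split[OF ou_boundary_measurable h, of x] by simp
qed

text \<open>If the optimal boundary were below \<open>b\<close> at \<open>r\<close>, then at
  \<open>x = b r\<close> value and premium would both equal \<open>x\<close>. Their difference is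
  also the transported difference at \<open>r - h\<close>, which is non-negative, plus an integral
  with positive integrand: between the two boundaries only the value collects the source, and the
  Gaussian step reaches that strip.\<close>

lemma b_le_ou_boundary:
  assumes r: "0 < r" "r \<le> R" shows "b r \<le> ou_boundary r"
proof (rule ccontr)
  assume "\<not> b r \<le> ou_boundary r"
  then have gt: "ou_boundary r < b r" by simp
  let ?d = "\<lambda>r. b r - ou_boundary r"
  have "isCont ?d r" by (intro continuous_intros isCont_b ou_boundary_isCont)
  then obtain e where e: "0 < e" "\<And>r'. \<bar>r' - r\<bar> < e \<Longrightarrow> \<bar>?d r' - ?d r\<bar> < ?d r"
    using gt unfolding continuous_at_eps_delta dist_real_def by (metis diff_gt_0_iff_gt)
  define h where "h = min r (e / 2)"
  have h: "0 < h" "h \<le> r" using r e by (auto simp: h_def)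
  have lt: "ou_boundary (r - v) < b (r - v)" if "0 \<le> v" "v \<le> h" for v
  proof -
    have "\<bar>(r - v) - r\<bar> < e" using that e(1) by (auto simp: h_def)
    from e(2)[OF this] show ?thesis by (simp add: abs_less_iff)
  qed
  let ?x = "b r"
  let ?k = "\<lambda>v \<xi>. above ou_boundary (r - v) \<xi> - above b (r - v) \<xi>"
  have k0: "0 \<le> ?k v \<xi>" if "0 \<le> v" "v \<le> h" for v \<xi>
    using lt[OF that] ou_boundary_nonneg[of "r - v"] by (auto simp: above_def)
  have k1: "0 < ?k v \<xi>" if "0 \<le> v" "v \<le> h" "ou_boundary (r - v) < \<xi>" "\<xi> < b (r - v)" for v \<xi>
    using that ou_boundary_nonneg[of "r - v"] by (auto simp: above_def)
  have rR: "r \<in> {0..R}" using r by auto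
  have "ou_value r ?x - premium b r ?x = 0"
    using eq_b[OF r] gt by (simp add: ou_value_above_boundary)
  moreover have "0 \<le> ou h (\<lambda>\<xi>. ou_value (r - h) \<xi> - premium b (r - h) \<xi>) ?x"
    using premium_le_ou_value[of "r - h"] h r by (intro ou_nonneg) auto
  ultimately have le: "(LINT v:{0..h}|lborel. ou v (?k v) ?x) \<le> 0"
    using ou_value_minus_premium[OF rR, of h ?x] h by simp
  have kq: "quartic_growth (?k v)" for v by (rule above_diff_quartic_growth)
  have i: "set_integrable lborel {0..h} (\<lambda>v. ou v (?k v) ?x)"
    unfolding ou_diff[OF above_quartic_growth above_quartic_growth]
    by (intro set_integral_diff ou_above_set_integrable b_measurable ou_boundary_measurable) auto
  have nn: "AE v in lborel. 0 \<le> indicator {0..h} v *\<^sub>R ou v (?k v) ?x"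
    using k0 by (auto intro!: AE_I2 ou_nonneg split: split_indicator)
  have "(LINT v:{0..h}|lborel. ou v (?k v) ?x) = 0"
    using le integral_nonneg_AE[OF nn] unfolding set_lebesgue_integral_def by linarith
  then have "AE v in lborel. indicator {0..h} v *\<^sub>R ou v (?k v) ?x = 0"
    using integral_nonneg_eq_0_iff_AE[OF i[unfolded set_integrable_def] nn] by (simp add: set_lebesgue_integral_def)
  then obtain v where v: "0 < v" "v < h" "indicator {0..h} v *\<^sub>R ou v (?k v) ?x = 0"
    using AE_lborel_interval[OF _ h(1)] by blast
  have "0 < ou v (?k v) ?x"
    using v k0[of v] k1[of v] lt[of v] by (intro ou_pos[OF kq, where p="ou_boundary (r - v)" and q="b (r - v)"]) auto
  then show False using v by simp
qed

text \<open>The same identity over the full horizon, where both terminal values are the identity. As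
  \<open>b\<close> lies below the optimal boundary the integrand is now non-positive, so at
  \<open>x = b r\<close> the value is at most the premium, which is \<open>b r\<close>; but strictly
  below the optimal boundary the value is larger than \<open>x\<close>.\<close>

theorem eq_ou_boundary:
  assumes r: "0 < r" "r \<le> R" shows "b r = ou_boundary r"
proof (rule ccontr)
  assume "b r \<noteq> ou_boundary r"
  with b_le_ou_boundary[OF r] have lt: "b r < ou_boundary r" by simp
  have rR: "r \<in> {0..R}" using r by auto
  let ?x = "b r"
  have "b r < ou_value r ?x" using ou_value_below_boundary[OF r(1) lt] .
  moreover have "ou_value r ?x - premium b r ?x \<le> 0"
  proof -
    have "ou_value r ?x - premium b r ?x
        = (LINT v:{0..r}|lborel. ou v (\<lambda>\<xi>. above ou_boundary (r - v) \<xi> - above b (r - v) \<xi>) ?x)"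
      using ou_value_minus_premium[OF rR, of r ?x] r by (simp add: ou_value_nonpos ou_const)
    also have "\<dots> \<le> 0"
    proof -
      \<comment> \<open>At \<open>v = r\<close> the remaining horizon is 0, where \<open>b\<close>
        has not been compared with the boundary; a single point is a null set.\<close>
      have "AE v in lborel. 0 \<le> - (indicator {0..r} v *\<^sub>R ou v (\<lambda>\<xi>. above ou_boundary (r - v) \<xi> - above b (r - v) \<xi>) ?x)"
        using AE_lborel_singleton[of r]
      proof eventually_elim
        case (elim v)
        show ?case
        proof (cases "v \<in> {0..r}")
          case True
          have "b (r - v) \<le> ou_boundary (r - v)" using True elim r by (intro b_le_ou_boundary) auto
          then have "0 \<le> ou v (\<lambda>\<xi>. - 1 * (above ou_boundary (r - v) \<xi> - above b (r - v) \<xi>)) ?x"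
            using b_nonneg[of "r - v"] by (intro ou_nonneg) (auto simp: above_def)
          then show ?thesis unfolding ou_cmult by (auto split: split_indicator)
        qed simp
      qed
      from integral_nonneg_AE[OF this] show ?thesis unfolding set_lebesgue_integral_def by simp
    qed
    finally show ?thesis .
  qed
  ultimately show False using eq_b[OF r] by simp
qed

end

section \<open>The bridge as a time-changed Ornstein-Uhlenbeck process\<close>

text \<open>Completing the square: the tilted prior density is \<open>K\<close> times the normal
  density with precision \<open>1 / \<gamma>\<^sup>2 + t / (1 - t)\<close> and mean
  \<open>\<mu>\<close>.\<close>

lemma posterior_mean_normal_prior:
  assumes \<gamma>: "0 < \<gamma>" and t: "0 \<le> t" "t < 1"
  shows "posterior_mean (normal_prior m \<gamma>) t z = (m * (1 - t) + z * \<gamma>\<^sup>2) / (1 - t * (1 - \<gamma>\<^sup>2))"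
proof -
  define D where "D = 1 - t * (1 - \<gamma>\<^sup>2)"
  have "D = (1 - t) + t * \<gamma>\<^sup>2" by (simp add: D_def algebra_simps)
  moreover have "0 \<le> t * \<gamma>\<^sup>2" using t by simp
  ultimately have D: "0 < D" using t by linarith
  define s where "s = sqrt ((1 - t) * \<gamma>\<^sup>2 / D)"
  have s2: "s\<^sup>2 = (1 - t) * \<gamma>\<^sup>2 / D" and s: "0 < s" using t D \<gamma> by (auto simp: s_def)
  define \<mu> where "\<mu> = (m * (1 - t) + z * \<gamma>\<^sup>2) / D"
  define K where "K = (sqrt (2 * pi * s\<^sup>2) / sqrt (2 * pi * \<gamma>\<^sup>2)) * exp (\<mu>\<^sup>2 / (2 * s\<^sup>2) - m\<^sup>2 / (2 * \<gamma>\<^sup>2))"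
  have K: "0 < K" using s \<gamma> by (simp add: K_def)
  have key: "normal_density m \<gamma> u * posterior_weight t z u = K * normal_density \<mu> s u" for u
  proof -
    have "- (u - m)\<^sup>2 / (2 * \<gamma>\<^sup>2) + (u * z / (1 - t) - t * u\<^sup>2 / (2 * (1 - t)))
        = - (u - \<mu>)\<^sup>2 / (2 * s\<^sup>2) + (\<mu>\<^sup>2 / (2 * s\<^sup>2) - m\<^sup>2 / (2 * \<gamma>\<^sup>2))"
    proof -
      have a: "1 / s\<^sup>2 = 1 / \<gamma>\<^sup>2 + t / (1 - t)"
        unfolding s2 using D \<gamma> t by (simp add: D_def field_simps)
      have b: "\<mu> * (1 / s\<^sup>2) = m / \<gamma>\<^sup>2 + z / (1 - t)"
        unfolding s2 \<mu>_def using D \<gamma> t by (simp add: field_simps)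
      have "- (u - \<mu>)\<^sup>2 / (2 * s\<^sup>2) + \<mu>\<^sup>2 / (2 * s\<^sup>2) = - u\<^sup>2 / 2 * (1 / s\<^sup>2) + u * (\<mu> * (1 / s\<^sup>2))"
        using s by (simp add: power2_eq_square field_simps)
      also have "\<dots> = - u\<^sup>2 / 2 * (1 / \<gamma>\<^sup>2 + t / (1 - t)) + u * (m / \<gamma>\<^sup>2 + z / (1 - t))"
        unfolding a[symmetric] b[symmetric] ..
      also have "\<dots> - m\<^sup>2 / (2 * \<gamma>\<^sup>2) = - (u - m)\<^sup>2 / (2 * \<gamma>\<^sup>2) + (u * z / (1 - t) - t * u\<^sup>2 / (2 * (1 - t)))"
      proof -
        have "- u\<^sup>2 / 2 * (P + t * Q) + u * (m * P + z * Q) - m\<^sup>2 * P / 2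
            = - (u - m)\<^sup>2 * P / 2 + (u * z * Q - t * u\<^sup>2 * Q / 2)" for P Q :: real
          by (simp add: power2_eq_square field_simps)
        from this[of "1 / \<gamma>\<^sup>2" "1 / (1 - t)"] show ?thesis by (simp add: mult.commute)
      qed
      finally show ?thesis by simp
    qed
    then show ?thesis
      unfolding normal_density_def posterior_weight_def K_def using s \<gamma>
      by (simp add: exp_add[symmetric] mult.assoc)
  qed
  have [measurable]: "posterior_weight t z \<in> borel_measurable borel"
    unfolding posterior_weight_def by measurable
  have Z: "(\<integral>y. posterior_weight t z y \<partial>normal_prior m \<gamma>) = K"
  proof -
    have "(\<integral>y. posterior_weight t z y \<partial>normal_prior m \<gamma>) = (\<integral>y. normal_density m \<gamma> y * posterior_weight t z y \<partial>lborel)"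
      unfolding normal_prior_def by (subst integral_density) auto
    also have "\<dots> = K" unfolding key using s by simp
    finally show ?thesis .
  qed
  have "posterior_mean (normal_prior m \<gamma>) t z = (\<integral>u. posterior_weight t z u / K * u \<partial>normal_prior m \<gamma>)"
    unfolding posterior_mean_def posterior_def Z using K
    by (subst integral_density) (auto simp: normal_prior_def posterior_weight_def)
  also have "\<dots> = (\<integral>u. normal_density m \<gamma> u * (posterior_weight t z u / K * u) \<partial>lborel)"
    unfolding normal_prior_def by (subst integral_density) auto
  also have "\<dots> = (\<integral>u. normal_density \<mu> s u * u \<partial>lborel)"
  proof (rule Bochner_Integration.integral_cong)
    fix u
    have "normal_density m \<gamma> u * (posterior_weight t z u / K * u) = (normal_density m \<gamma> u * posterior_weight t z u) / K * u" by simp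
    also have "\<dots> = normal_density \<mu> s u * u" unfolding key using K by simp
    finally show "normal_density m \<gamma> u * (posterior_weight t z u / K * u) = normal_density \<mu> s u * u" .
  qed simp
  also have "\<dots> = \<mu>" using integral_normal_moment_nz_1[OF s] .
  finally show ?thesis by (simp add: \<mu>_def D_def)
qed

section \<open>The Wiener integral as a pathwise limit of Riemann sums\<close>

text \<open>Along one path \<open>dw = dx + a x dr\<close>, while \<open>dc = a c dr\<close>, so
  formally \<open>c dw = d (c x)\<close>. Over a cell \<open>[u, v]\<close> the error is the
  integral of \<open>a s * (c u * x s - x v * c s)\<close>, small by uniform continuity of
  \<open>c\<close> and \<open>x\<close>.\<close>

lemma linear_ode_riemann_sum:
  fixes a c x w :: "real \<Rightarrow> real"
  assumes pq: "p \<le> q"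
    and cont: "continuous_on {p..q} a" "continuous_on {p..q} c" "continuous_on {p..q} x"
    and w: "\<And>u v. p \<le> u \<Longrightarrow> u \<le> v \<Longrightarrow> v \<le> q \<Longrightarrow> w v - w u = x v - x u + integral {u..v} (\<lambda>r. a r * x r)"
    and c: "\<And>u v. p \<le> u \<Longrightarrow> u \<le> v \<Longrightarrow> v \<le> q \<Longrightarrow> c v - c u = integral {u..v} (\<lambda>r. a r * c r)"
    and N: "filterlim N at_top sequentially"
  shows "(\<lambda>n. \<Sum>i<N n. c (p + (q - p) * real i / real (N n)) *
      (w (p + (q - p) * real (Suc i) / real (N n)) - w (p + (q - p) * real i / real (N n))))
    \<longlonglongrightarrow> c q * x q - c p * x p"
proof (rule metric_LIMSEQ_I)
  fix \<epsilon> :: real assume \<epsilon>: "0 < \<epsilon>"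
  have bdd: "\<exists>B>0. \<forall>r\<in>{p..q}. \<bar>f r\<bar> \<le> B" if "continuous_on {p..q} f" for f :: "real \<Rightarrow> real"
    using compact_imp_bounded[OF compact_continuous_image[OF that compact_Icc]]
    unfolding bounded_pos by auto
  obtain A where A: "0 < A" "\<And>r. r \<in> {p..q} \<Longrightarrow> \<bar>a r\<bar> \<le> A" using bdd[OF cont(1)] by blast
  obtain B1 where B1: "0 < B1" "\<And>r. r \<in> {p..q} \<Longrightarrow> \<bar>c r\<bar> \<le> B1" using bdd[OF cont(2)] by blast
  obtain B2 where B2: "0 < B2" "\<And>r. r \<in> {p..q} \<Longrightarrow> \<bar>x r\<bar> \<le> B2" using bdd[OF cont(3)] by blast
  define \<eta> where "\<eta> = \<epsilon> / (A * (B1 + B2) * (q - p + 1))"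
  have \<eta>: "0 < \<eta>" using \<epsilon> A B1 B2 pq by (simp add: \<eta>_def)
  have uc: "\<exists>d>0. \<forall>r\<in>{p..q}. \<forall>r'\<in>{p..q}. \<bar>r' - r\<bar> < d \<longrightarrow> \<bar>f r' - f r\<bar> < \<eta>" if "continuous_on {p..q} f" for f :: "real \<Rightarrow> real"
    using compact_uniformly_continuous[OF that compact_Icc] \<eta>
    unfolding uniformly_continuous_on_def dist_real_def by blast
  obtain d1 where d1: "0 < d1" "\<And>r r'. r \<in> {p..q} \<Longrightarrow> r' \<in> {p..q} \<Longrightarrow> \<bar>r' - r\<bar> < d1 \<Longrightarrow> \<bar>c r' - c r\<bar> < \<eta>"
    using uc[OF cont(2)] by blast
  obtain d2 where d2: "0 < d2" "\<And>r r'. r \<in> {p..q} \<Longrightarrow> r' \<in> {p..q} \<Longrightarrow> \<bar>r' - r\<bar> < d2 \<Longrightarrow> \<bar>x r' - x r\<bar> < \<eta>"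
    using uc[OF cont(3)] by blast
  define d where "d = min d1 d2"
  have d: "0 < d" using d1 d2 by (simp add: d_def)
  obtain n0 where n0: "\<And>n. n0 \<le> n \<Longrightarrow> nat \<lceil>(q - p) / d\<rceil> + 1 \<le> N n"
    using N unfolding filterlim_at_top eventually_sequentially by blast
  show "\<exists>n0. \<forall>n\<ge>n0. dist (\<Sum>i<N n. c (p + (q - p) * real i / real (N n)) *
      (w (p + (q - p) * real (Suc i) / real (N n)) - w (p + (q - p) * real i / real (N n)))) (c q * x q - c p * x p) < \<epsilon>"
  proof (intro exI allI impI)
    fix n assume "n0 \<le> n"
    define k where "k = N n"
    define r where "r i = p + (q - p) * real i / real k" for i
    have k: "0 < k" "(q - p) / d < real k"
      using n0[OF \<open>n0 \<le> n\<close>] unfolding k_def by linarith+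
    have mesh: "(q - p) / real k < d" using k d by (simp add: field_simps)
    have step: "r (Suc i) - r i = (q - p) / real k" for i
      using k(1) by (simp add: r_def field_simps)
    have rin: "p \<le> r i" "r i \<le> q" if "i \<le> k" for i
    proof -
      have "(q - p) * real i \<le> (q - p) * real k" using pq that by (intro mult_left_mono) auto
      then have "(q - p) * real i / real k \<le> q - p" using k by (simp add: divide_le_eq)
      then show "r i \<le> q" by (simp add: r_def)
      show "p \<le> r i" using pq by (simp add: r_def)
    qed
    have rle: "r i \<le> r (Suc i)" for i using step[of i] pq k by (smt (verit) divide_nonneg_nonneg of_nat_0_le_iff)
    have cell: "\<bar>c (r i) * (w (r (Suc i)) - w (r i)) - (c (r (Suc i)) * x (r (Suc i)) - c (r i) * x (r i))\<bar>
        \<le> A * (B1 + B2) * \<eta> * ((q - p) / real k)" if i: "i < k" for i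
    proof -
      let ?u = "r i" and ?v = "r (Suc i)"
      have uv: "p \<le> ?u" "?u \<le> ?v" "?v \<le> q" using rin[of i] rin[of "Suc i"] rle[of i] i by auto
      have sub: "{?u..?v} \<subseteq> {p..q}" using uv by auto
      note cs = continuous_on_subset[OF cont(1) sub] continuous_on_subset[OF cont(2) sub] continuous_on_subset[OF cont(3) sub]
      have i1: "(\<lambda>s. a s * x s) integrable_on {?u..?v}" and i2: "(\<lambda>s. a s * c s) integrable_on {?u..?v}"
        by (intro integrable_continuous_interval continuous_intros cs)+
      have "integral {?u..?v} (\<lambda>s. a s * (c ?u * x s - x ?v * c s))
          = integral {?u..?v} (\<lambda>s. c ?u * (a s * x s) - x ?v * (a s * c s))"
        by (simp add: algebra_simps)
      also have "\<dots> = c ?u * integral {?u..?v} (\<lambda>s. a s * x s) - x ?v * integral {?u..?v} (\<lambda>s. a s * c s)"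
        by (subst Henstock_Kurzweil_Integration.integral_diff) (auto intro!: integrable_on_mult_right i1 i2)
      finally have "c ?u * (w ?v - w ?u) - (c ?v * x ?v - c ?u * x ?u)
          = integral {?u..?v} (\<lambda>s. a s * (c ?u * x s - x ?v * c s))"
        unfolding w[OF uv] c[OF uv, symmetric] by (simp add: algebra_simps)
      also have "norm \<dots> \<le> (A * (B1 + B2) * \<eta>) * (?v - ?u)"
      proof (rule integral_bound[OF uv(2)])
        show "continuous_on {?u..?v} (\<lambda>s. a s * (c ?u * x s - x ?v * c s))"
          by (intro continuous_intros cs)
        fix s assume s: "s \<in> {?u..?v}"
        have inn: "s \<in> {p..q}" "?u \<in> {p..q}" "?v \<in> {p..q}" using s uv by auto
        have near: "\<bar>s - ?u\<bar> < d" "\<bar>s - ?v\<bar> < d" using s step[of i] mesh by auto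
        have "\<bar>c ?u * x s - x ?v * c s\<bar> = \<bar>c ?u * (x s - x ?v) - x ?v * (c s - c ?u)\<bar>"
          by (simp add: algebra_simps)
        also have "\<dots> \<le> \<bar>c ?u * (x s - x ?v)\<bar> + \<bar>x ?v * (c s - c ?u)\<bar>" by (rule abs_triangle_ineq4)
        also have "\<dots> \<le> B1 * \<eta> + B2 * \<eta>"
          unfolding abs_mult using B1 B2 inn near d1(2)[OF inn(2,1)] d2(2)[OF inn(3,1)]
          by (intro add_mono mult_mono) (auto simp: d_def)
        finally have "\<bar>a s\<bar> * \<bar>c ?u * x s - x ?v * c s\<bar> \<le> A * (B1 * \<eta> + B2 * \<eta>)"
          using A(2)[OF inn(1)] A(1) by (intro mult_mono) auto
        then show "norm (a s * (c ?u * x s - x ?v * c s)) \<le> A * (B1 + B2) * \<eta>"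
          by (simp only: abs_mult real_norm_def distrib_left distrib_right mult.assoc)
      qed
      finally show ?thesis unfolding step by simp
    qed
    have "(\<Sum>i<k. c (r (Suc i)) * x (r (Suc i)) - c (r i) * x (r i)) = c q * x q - c p * x p"
      using sum_lessThan_telescope[of "\<lambda>i. c (r i) * x (r i)" k] k by (simp add: r_def)
    then have "\<bar>(\<Sum>i<k. c (r i) * (w (r (Suc i)) - w (r i))) - (c q * x q - c p * x p)\<bar>
        = \<bar>\<Sum>i<k. c (r i) * (w (r (Suc i)) - w (r i)) - (c (r (Suc i)) * x (r (Suc i)) - c (r i) * x (r i))\<bar>"
      by (simp only: sum_subtractf)
    also have "\<dots> \<le> (\<Sum>i<k. A * (B1 + B2) * \<eta> * ((q - p) / real k))"
      by (intro order_trans[OF sum_abs] sum_mono cell) auto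
    also have "\<dots> = A * (B1 + B2) * \<eta> * (q - p)" using k by simp
    also have "\<dots> < A * (B1 + B2) * \<eta> * (q - p + 1)"
      using A B1 B2 \<eta> by (intro mult_strict_left_mono) auto
    also have "\<dots> = \<epsilon>" using A B1 B2 pq by (simp add: \<eta>_def)
    finally show "dist (\<Sum>i<N n. c (p + (q - p) * real i / real (N n)) *
      (w (p + (q - p) * real (Suc i) / real (N n)) - w (p + (q - p) * real i / real (N n)))) (c q * x q - c p * x p) < \<epsilon>"
      by (simp add: dist_real_def r_def k_def)
  qed
qed

text \<open>The quantities \<open>sqrt (\<alpha> * cc s)\<close> and \<open>rho s\<close> of the
  locale \<open>bridge\<close>, written with \<open>\<gamma>\<close> alone: different starting
  points are different instances of the locale but share \<open>scale\<close> and
  \<open>horizon\<close>.\<close>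

definition scale :: "real \<Rightarrow> real \<Rightarrow> real" where
  "scale \<gamma> s = sqrt ((1 - \<gamma>\<^sup>2) / (1 - (1 - \<gamma>\<^sup>2) * s))"

definition horizon :: "real \<Rightarrow> real \<Rightarrow> real" where
  "horizon \<gamma> s = ln ((1 - (1 - \<gamma>\<^sup>2) * s) / \<gamma>\<^sup>2) / 2"

locale bridge = prob_space M for M :: "'a measure" +
  fixes m \<gamma> t z :: real and W Z :: "real \<Rightarrow> 'a \<Rightarrow> real"
  assumes \<gamma>: "0 < \<gamma>" "\<gamma> < 1" and t: "0 \<le> t" "t < 1"
    and sol: "is_solution_from (normal_prior m \<gamma>) t z M W Z"
begin

definition \<alpha> :: real where "\<alpha> = 1 - \<gamma>\<^sup>2"
definition \<kappa> :: real where "\<kappa> = m / \<alpha>"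
text \<open>The integrating factor: \<open>cc' = \<alpha> cc^2\<close> and the drift is
  \<open>- \<alpha> cc (Z - \<kappa>)\<close>, so \<open>G = cc (Z - \<kappa>)\<close> satisfies
  \<open>dG = cc dW\<close>.\<close>

definition cc :: "real \<Rightarrow> real" where "cc s = 1 / (1 - \<alpha> * s)"
definition G :: "real \<Rightarrow> 'a \<Rightarrow> real" where "G s \<omega> = cc s * (Z s \<omega> - \<kappa>)"
definition pt :: "real \<Rightarrow> real \<Rightarrow> nat \<Rightarrow> nat \<Rightarrow> real" where
  "pt p q n i = p + (q - p) * real i / 2 ^ n"
text \<open>The left-point sum of the Wiener integral of \<open>cc\<close> over the dyadic partition
  of \<open>[p, q]\<close>.\<close>

definition S :: "real \<Rightarrow> real \<Rightarrow> nat \<Rightarrow> 'a \<Rightarrow> real" where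
  "S p q n \<omega> = (\<Sum>i<2 ^ n. cc (pt p q n i) * (W (pt p q n (Suc i)) \<omega> - W (pt p q n i) \<omega>))"

lemma \<alpha>: "0 < \<alpha>" "\<alpha> < 1"
  using \<gamma> by (auto simp: \<alpha>_def power_less_one_iff)

lemma one_minus_\<alpha>_pos: "s \<le> 1 \<Longrightarrow> 0 < 1 - \<alpha> * s"
proof -
  assume "s \<le> 1"
  then have "\<alpha> * s \<le> \<alpha> * 1" using \<alpha> by (intro mult_left_mono) auto
  then show ?thesis using \<alpha> by linarith
qed

lemma cc_pos: "s \<le> 1 \<Longrightarrow> 0 < cc s"
  using one_minus_\<alpha>_pos by (simp add: cc_def)

lemma cc_diff: "u \<le> 1 \<Longrightarrow> v \<le> 1 \<Longrightarrow> cc v - cc u = \<alpha> * (v - u) * (cc u * cc v)"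
  using one_minus_\<alpha>_pos[of u] one_minus_\<alpha>_pos[of v] by (simp add: cc_def field_simps)

lemma cc_mono: "u \<le> v \<Longrightarrow> v \<le> 1 \<Longrightarrow> cc u \<le> cc v"
proof -
  assume uv: "u \<le> v" "v \<le> 1"
  then have "0 \<le> \<alpha> * (v - u) * (cc u * cc v)" using cc_pos[of u] cc_pos[of v] \<alpha> by simp
  then show ?thesis using cc_diff[of u v] uv by simp
qed

lemma cc_continuous_on: "A \<subseteq> {..1} \<Longrightarrow> continuous_on A cc"
  unfolding cc_def using one_minus_\<alpha>_pos by (intro continuous_intros) force

lemma bm: "standard_brownian_motion_on M {0..<1} W"
  using sol by (simp add: is_solution_from_def)

lemma W_measurable [measurable]: "0 \<le> s \<Longrightarrow> s < 1 \<Longrightarrow> W s \<in> borel_measurable M"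
  using bm by (simp add: standard_brownian_motion_on_def)

lemma W_continuous: "AE \<omega> in M. continuous_on {0..<1} (\<lambda>s. W s \<omega>)"
  using bm by (simp add: standard_brownian_motion_on_def)

lemma W_normal: "0 \<le> r \<Longrightarrow> r < s \<Longrightarrow> s < 1 \<Longrightarrow>
    distributed M lborel (\<lambda>\<omega>. W s \<omega> - W r \<omega>) (normal_density 0 (sqrt (s - r)))"
  using bm by (simp add: standard_brownian_motion_on_def)

lemma W_indep: "ts ` {..n} \<subseteq> {0..<1} \<Longrightarrow> strict_mono_on {..n} ts \<Longrightarrow>
    indep_vars (\<lambda>_. borel) (\<lambda>i \<omega>. W (ts (Suc i)) \<omega> - W (ts i) \<omega>) {..<n}" for n :: nat
  using bm unfolding standard_brownian_motion_on_def by blast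

lemma Z_measurable [measurable]: "t \<le> s \<Longrightarrow> s \<le> 1 \<Longrightarrow> Z s \<in> borel_measurable M"
  using sol by (simp add: is_solution_from_def)

lemma Z_continuous: "\<omega> \<in> space M \<Longrightarrow> continuous_on {t..<1} (\<lambda>s. Z s \<omega>)"
  using sol by (simp add: is_solution_from_def)

lemma Z_limit: "AE \<omega> in M. ((\<lambda>s. Z s \<omega>) \<longlongrightarrow> Z 1 \<omega>) (at_left 1)"
  using sol by (simp add: is_solution_from_def)

lemma drift_eq:
  assumes "0 \<le> s" "s < 1" shows "drift (normal_prior m \<gamma>) s y = - (\<alpha> * cc s * (y - \<kappa>))"
proof -
  have D: "0 < 1 - s * \<alpha>" using one_minus_\<alpha>_pos[of s] assms by (simp add: mult.commute)
  have g: "\<gamma>\<^sup>2 = 1 - \<alpha>" by (simp add: \<alpha>_def)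
  have k: "\<alpha> * \<kappa> = m" using \<alpha> by (simp add: \<kappa>_def)
  have "posterior_mean (normal_prior m \<gamma>) s y - y = (m * (1 - s) + y * (1 - \<alpha>)) / (1 - s * \<alpha>) - y"
    using posterior_mean_normal_prior[OF \<gamma>(1) assms, of m y] g by simp
  also have "\<dots> = (1 - s) * (m - \<alpha> * y) / (1 - s * \<alpha>)"
  proof -
    have "m * (1 - s) + y * (1 - \<alpha>) - y * (1 - s * \<alpha>) = (1 - s) * (m - \<alpha> * y)"
      by (simp add: algebra_simps)
    then show ?thesis using D by (simp only: divide_diff_eq_iff[OF less_imp_neq[OF D, symmetric]])
  qed
  finally have "drift (normal_prior m \<gamma>) s y = (m - \<alpha> * y) / (1 - s * \<alpha>)"
    using assms by (simp add: drift_def)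
  also have "\<dots> = - (\<alpha> * cc s * (y - \<kappa>))"
  proof -
    have "m - \<alpha> * y = - (\<alpha> * (y - \<kappa>))" using k by (simp add: right_diff_distrib)
    then show ?thesis by (simp add: cc_def mult.commute)
  qed
  finally show ?thesis .
qed

lemma sde: "AE \<omega> in M. \<forall>s\<in>{0..<1 - t}.
    set_integrable lborel {0..s} (\<lambda>r. - (\<alpha> * cc (t + r) * (Z (t + r) \<omega> - \<kappa>))) \<and>
    Z (t + s) \<omega> = z + (LINT r:{0..s}|lborel. - (\<alpha> * cc (t + r) * (Z (t + r) \<omega> - \<kappa>))) + (W (t + s) \<omega> - W t \<omega>)"
proof -
  have "AE \<omega> in M. \<forall>s\<in>{0..<1 - t}.
        set_integrable lborel {0..s} (\<lambda>r. drift (normal_prior m \<gamma>) (t + r) (Z (t + r) \<omega>)) \<and>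
        Z (t + s) \<omega> = z + (LINT r:{0..s}|lborel. drift (normal_prior m \<gamma>) (t + r) (Z (t + r) \<omega>))
                         + (W (t + s) \<omega> - W t \<omega>)"
    using sol by (simp add: is_solution_from_def)
  then show ?thesis
  proof eventually_elim
    case (elim \<omega>)
    show ?case
    proof (intro ballI)
      fix s assume s: "s \<in> {0..<1 - t}"
      have eq: "indicator {0..s} r *\<^sub>R drift (normal_prior m \<gamma>) (t + r) (Z (t + r) \<omega>)
          = indicator {0..s} r *\<^sub>R - (\<alpha> * cc (t + r) * (Z (t + r) \<omega> - \<kappa>))" for r
        using s t drift_eq[of "t + r"] by (auto split: split_indicator)
      show "set_integrable lborel {0..s} (\<lambda>r. - (\<alpha> * cc (t + r) * (Z (t + r) \<omega> - \<kappa>))) \<and>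
        Z (t + s) \<omega> = z + (LINT r:{0..s}|lborel. - (\<alpha> * cc (t + r) * (Z (t + r) \<omega> - \<kappa>))) + (W (t + s) \<omega> - W t \<omega>)"
        using bspec[OF elim s] unfolding set_integrable_def set_lebesgue_integral_def eq .
    qed
  qed
qed

lemma Z_start: "AE \<omega> in M. Z t \<omega> = z"
  using sde
proof eventually_elim
  case (elim \<omega>)
  have "(LINT r:{0..0}|lborel. - (\<alpha> * cc (t + r) * (Z (t + r) \<omega> - \<kappa>))) = 0"
  proof (unfold set_lebesgue_integral_def, rule integral_eq_zero_AE)
    show "AE r in lborel. indicator {0..0} r *\<^sub>R - (\<alpha> * cc (t + r) * (Z (t + r) \<omega> - \<kappa>)) = 0"
      using AE_lborel_singleton[of 0] by eventually_elim auto
  qed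
  then show ?case using elim t by (auto dest!: bspec[where x=0])
qed

text \<open>\<open>linear_ode_riemann_sum\<close> path by path with \<open>c = cc\<close> and
  \<open>a = \<alpha> cc\<close>, as \<open>cc' = a cc\<close>. It exhibits the increments of
  \<open>G\<close> as limits of functions of the noise, which gives both their law and their
  adaptedness.\<close>

lemma S_tendsto:
  assumes pq: "t \<le> p" "p \<le> q" "q < 1"
  shows "AE \<omega> in M. (\<lambda>n. S p q n \<omega>) \<longlonglongrightarrow> G q \<omega> - G p \<omega>"
  using sde AE_space
proof eventually_elim
  case (elim \<omega>)
  let ?x = "\<lambda>s. Z s \<omega> - \<kappa>" and ?a = "\<lambda>s. \<alpha> * cc s"
  let ?f = "\<lambda>r. - (\<alpha> * cc (t + r) * (Z (t + r) \<omega> - \<kappa>))"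
  have xc: "continuous_on {u..v} ?x" if "t \<le> u" "v \<le> q" for u v
    using pq that by (intro continuous_intros continuous_on_subset[OF Z_continuous[OF elim(2)]]) auto
  have cc: "continuous_on {u..v} cc" if "v \<le> q" for u v
    using pq that by (intro cc_continuous_on) auto
  have ac: "continuous_on {u..v} ?a" if "v \<le> q" for u v
    using that by (intro continuous_intros cc)
  have lim: "(\<lambda>n. \<Sum>i<2 ^ n. cc (p + (q - p) * real i / real (2 ^ n)) *
      (W (p + (q - p) * real (Suc i) / real (2 ^ n)) \<omega> - W (p + (q - p) * real i / real (2 ^ n)) \<omega>))
    \<longlonglongrightarrow> cc q * ?x q - cc p * ?x p"
  proof (rule linear_ode_riemann_sum[where a="?a"])
    show "continuous_on {p..q} (\<lambda>s. Z s \<omega> - \<kappa>)" by (rule xc[OF pq(1) order_refl])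
    show "continuous_on {p..q} cc" by (rule cc[OF order_refl])
    show "continuous_on {p..q} ?a" by (rule ac[OF order_refl])
    show "filterlim (\<lambda>n::nat. 2 ^ n :: nat) at_top sequentially"
      by (rule filterlim_subseq) (simp add: strict_mono_def)
    fix u v assume uv: "p \<le> u" "u \<le> v" "v \<le> q"
    have 1: "set_integrable lborel {0..v - t} ?f"
      "Z v \<omega> = z + (LINT r:{0..v - t}|lborel. ?f r) + (W v \<omega> - W t \<omega>)"
      "Z u \<omega> = z + (LINT r:{0..u - t}|lborel. ?f r) + (W u \<omega> - W t \<omega>)"
      using bspec[OF elim(1), of "v - t"] bspec[OF elim(1), of "u - t"] uv pq by auto
    have "(LINT r:{0..v - t}|lborel. ?f r) = (LINT r:{0..u - t}|lborel. ?f r) + (LINT r:{u - t..v - t}|lborel. ?f r)"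
      using uv pq by (intro set_integral_split 1) auto
    also have "(LINT r:{u - t..v - t}|lborel. ?f r) = (LINT r:{u..v}|lborel. - (?a r * ?x r))"
      unfolding set_lebesgue_integral_def
      by (subst lborel_integral_real_affine[where c=1 and t=t, of "\<lambda>r. indicator {u..v} r *\<^sub>R - (?a r * ?x r)"])
        (auto intro!: Bochner_Integration.integral_cong split: split_indicator simp: algebra_simps)
    also have "\<dots> = - integral {u..v} (\<lambda>r. ?a r * ?x r)"
    proof -
      have "set_integrable lborel {u..v} (\<lambda>r. - (?a r * ?x r))"
        using uv pq by (intro borel_integrable_compact[unfolded set_integrable_def[symmetric]] continuous_intros ac xc compact_Icc) auto
      from set_borel_integral_eq_integral(2)[OF this] show ?thesis by simp
    qed
    finally show "W v \<omega> - W u \<omega> = Z v \<omega> - \<kappa> - (Z u \<omega> - \<kappa>) + integral {u..v} (\<lambda>r. ?a r * (Z r \<omega> - \<kappa>))"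
      using 1(2,3) by simp
    have "((\<lambda>r. ?a r * cc r) has_integral cc v - cc u) {u..v}"
    proof (rule fundamental_theorem_of_calculus[OF uv(2)])
      fix r assume r: "r \<in> {u..v}"
      then have "1 - \<alpha> * r \<noteq> 0" using one_minus_\<alpha>_pos[of r] uv pq by auto
      then have "(cc has_real_derivative ?a r * cc r) (at r within {u..v})"
        unfolding cc_def by (auto intro!: derivative_eq_intros simp: power2_eq_square)
      then show "(cc has_vector_derivative ?a r * cc r) (at r within {u..v})"
        by (simp add: has_real_derivative_iff_has_vector_derivative)
    qed
    then show "cc v - cc u = integral {u..v} (\<lambda>r. ?a r * cc r)" by (simp add: integral_unique)
  qed (use pq in auto)
  then show ?case by (simp add: S_def pt_def G_def)
qed

section \<open>Dyadic partitions and independence of past and future noise\<close>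

lemma pt_0 [simp]: "pt p q n 0 = p"
  by (simp add: pt_def)

lemma pt_end [simp]: "pt p q n (2 ^ n) = q"
  by (simp add: pt_def)

lemma pt_less: "p < q \<Longrightarrow> i < j \<Longrightarrow> pt p q n i < pt p q n j"
  by (simp add: pt_def divide_strict_right_mono)

lemma pt_mem: "p \<le> q \<Longrightarrow> i \<le> 2 ^ n \<Longrightarrow> p \<le> pt p q n i \<and> pt p q n i \<le> q"
proof -
  assume a: "p \<le> q" "i \<le> 2 ^ n"
  have "real i \<le> 2 ^ n" using a(2) by (metis of_nat_le_iff of_nat_numeral of_nat_power)
  then have "(q - p) * real i \<le> (q - p) * 2 ^ n" using a by (intro mult_left_mono) auto
  then have "(q - p) * real i / 2 ^ n \<le> q - p" by (simp add: divide_le_eq)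
  then show ?thesis using a by (simp add: pt_def)
qed

lemma S_measurable: "0 \<le> p \<Longrightarrow> p \<le> q \<Longrightarrow> q < 1 \<Longrightarrow> S p q n \<in> borel_measurable M"
  unfolding S_def
proof (intro borel_measurable_sum borel_measurable_times borel_measurable_const borel_measurable_diff W_measurable)
  fix i :: nat assume a: "0 \<le> p" "p \<le> q" "q < 1" "i \<in> {..<2 ^ n}"
  show "0 \<le> pt p q n (Suc i)" "pt p q n (Suc i) < 1" using pt_mem[of p q "Suc i" n] a by auto
  show "0 \<le> pt p q n i" "pt p q n i < 1" using pt_mem[of p q i n] a by auto
qed

text \<open>Dyadic points only: countably many increments generate the past by path continuity.\<close>

definition past_gen :: "real \<Rightarrow> nat \<Rightarrow> 'a set set" where
  "past_gen p n = {(\<lambda>\<omega>. W (pt t p n i) \<omega> - W t \<omega>) -` B \<inter> space M | i B. i \<le> 2 ^ n \<and> B \<in> sets borel}"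

definition past :: "real \<Rightarrow> 'a set set" where
  "past p = sigma_sets (space M) (\<Union>n. sigma_sets (space M) (past_gen p n))"

lemma past_gen_subset: "past_gen p n \<subseteq> Pow (space M)"
  by (auto simp: past_gen_def)

lemma past_gen_mono: "n \<le> k \<Longrightarrow> past_gen p n \<subseteq> past_gen p k"
proof (rule lift_Suc_mono_le[of "past_gen p"])
  fix n
  have e: "pt t p n i = pt t p (Suc n) (2 * i)" for i by (simp add: pt_def)
  show "past_gen p n \<subseteq> past_gen p (Suc n)"
  proof
    fix A assume "A \<in> past_gen p n"
    then obtain i B where "A = (\<lambda>\<omega>. W (pt t p n i) \<omega> - W t \<omega>) -` B \<inter> space M" "i \<le> 2 ^ n" "B \<in> sets borel"
      by (auto simp: past_gen_def)
    then show "A \<in> past_gen p (Suc n)" unfolding past_gen_def e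
      by (intro CollectI exI[of _ "2 * i"] exI[of _ B]) auto
  qed
qed

text \<open>The dyadic partitions of \<open>[t, p]\<close> and \<open>[p, q]\<close> are joined into
  one. Past events depend on the first \<open>2 ^ n\<close> increments, \<open>S p q k\<close> on
  the following \<open>2 ^ k\<close>, and increments over one partition are independent.\<close>

lemma past_future_level:
  assumes pq: "t \<le> p" "p < q" "q < 1" and A: "A \<in> sigma_sets (space M) (past_gen p n)" and B: "B \<in> sets borel"
  shows "prob (A \<inter> (S p q k -` B \<inter> space M)) = prob A * prob (S p q k -` B \<inter> space M)"
proof (cases "p = t")
  \<comment> \<open>The partition of \<open>[t, p]\<close> collapses to a point, and the past
    consists of \<open>{}\<close> and \<open>space M\<close> only.\<close>
  case True
  have "A \<in> {{}, space M}" using A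
  proof induction
    case (Basic a)
    then show ?case by (auto simp: past_gen_def pt_def True split: if_splits)
  next
    case (Union a)
    show ?case
    proof (cases "\<exists>i. a i = space M")
      case True
      then obtain i where "a i = space M" by blast
      then have "space M \<subseteq> (\<Union>i. a i)" by blast
      moreover have "(\<Union>i. a i) \<subseteq> space M" using Union by blast
      ultimately show ?thesis by blast
    next
      case False
      then have "a i = {}" for i using Union(2)[of i] by blast
      then show ?thesis by simp
    qed
  qed auto
  moreover have "space M \<inter> (S p q k -` B \<inter> space M) = S p q k -` B \<inter> space M" by auto
  ultimately show ?thesis by (auto simp: prob_space)
next
  case False
  with pq have tp: "t < p" by simp
  \<comment> \<open>At the common index \<open>2 ^ n\<close> both partitions give \<open>p\<close>,
    so the two pieces fit together.\<close>
  define ts where "ts i = (if i \<le> 2 ^ n then pt t p n i else pt p q k (i - 2 ^ n))" for i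
  have ts1: "ts i = pt t p n i" if "i \<le> 2 ^ n" for i using that by (simp add: ts_def)
  have ts2: "ts (2 ^ n + i) = pt p q k i" for i by (cases "i = 0") (auto simp: ts_def)
  define X where "X i \<omega> = W (ts (Suc i)) \<omega> - W (ts i) \<omega>" for i \<omega>
  have mem: "ts i \<in> {t..q}" if i: "i \<le> 2 ^ n + 2 ^ k" for i
  proof (cases "i \<le> 2 ^ n")
    case True then show ?thesis using pt_mem[of t p i n] tp pq by (auto simp: ts1)
  next
    case False
    then obtain j where j: "i = 2 ^ n + j" by (metis le_add_diff_inverse nat_le_linear)
    then show ?thesis using pt_mem[of p q j k] i pq by (auto simp: ts2)
  qed
  have "indep_vars (\<lambda>_. borel) X {..<2 ^ n + 2 ^ k}"
    unfolding X_def
  proof (rule W_indep)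
    show "ts ` {..2 ^ n + 2 ^ k} \<subseteq> {0..<1}" using mem t pq by force
    show "strict_mono_on {..2 ^ n + 2 ^ k} ts"
    proof (rule strict_mono_onI)
      fix i j :: nat assume ij: "i < j"
      show "ts i < ts j"
      proof (cases "j \<le> 2 ^ n")
        case True then show ?thesis using ij pt_less[OF tp] by (simp add: ts1)
      next
        case False
        then obtain j' where j': "j = 2 ^ n + j'" "0 < j'" by (metis le_add_diff_inverse nat_le_linear not_le zero_less_diff)
        show ?thesis
        proof (cases "i \<le> 2 ^ n")
          case True
          then have "ts i \<le> p" using pt_mem[of t p i n] tp by (simp add: ts1)
          moreover have "p < ts j" unfolding j' ts2 using pt_less[OF pq(2) j'(2), of k] by simp
          ultimately show ?thesis by simp
        next
          case False
          then obtain i' where i': "i = 2 ^ n + i'" by (metis le_add_diff_inverse nat_le_linear)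
          then show ?thesis using ij pt_less[OF pq(2), of i' j'] unfolding i' j' ts2 by simp
        qed
      qed
    qed
  qed
  then have "indep_var (PiM {..<2 ^ n} (\<lambda>_. borel)) (\<lambda>\<omega>. restrict (\<lambda>i. X i \<omega>) {..<2 ^ n})
      (PiM {2 ^ n..<2 ^ n + 2 ^ k} (\<lambda>_. borel)) (\<lambda>\<omega>. restrict (\<lambda>i. X i \<omega>) {2 ^ n..<2 ^ n + 2 ^ k})"
    (is "indep_var ?P1 ?U ?P2 ?V") by (rule indep_var_restrict) auto
  then have ind: "indep_set (sigma_sets (space M) {?U -` A \<inter> space M | A. A \<in> sets ?P1})
      (sigma_sets (space M) {?V -` A \<inter> space M | A. A \<in> sets ?P2})"
    by (simp add: indep_var_eq)
  have A': "A \<in> sigma_sets (space M) {?U -` A \<inter> space M | A. A \<in> sets ?P1}"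
  proof (rule sigma_sets_mono[THEN subsetD, OF _ A], rule subsetI)
    fix A assume "A \<in> past_gen p n"
    then obtain i B where iB: "A = (\<lambda>\<omega>. W (pt t p n i) \<omega> - W t \<omega>) -` B \<inter> space M" "i \<le> 2 ^ n" "B \<in> sets borel"
      by (auto simp: past_gen_def)
    have m: "(\<lambda>f. \<Sum>j<i. f j) \<in> borel_measurable ?P1"
      using iB by (intro borel_measurable_sum measurable_component_singleton) auto
    have "W (pt t p n i) \<omega> - W t \<omega> = (\<Sum>j<i. ?U \<omega> j)" for \<omega>
    proof -
      have "(\<Sum>j<i. ?U \<omega> j) = (\<Sum>j<i. W (ts (Suc j)) \<omega> - W (ts j) \<omega>)"
        using iB by (intro sum.cong) (auto simp: X_def)
      also have "\<dots> = W (ts i) \<omega> - W (ts 0) \<omega>" by (rule sum_lessThan_telescope)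
      finally show ?thesis using iB by (simp add: ts1)
    qed
    then have "A = ?U -` ((\<lambda>f. \<Sum>j<i. f j) -` B \<inter> space ?P1) \<inter> space M"
      unfolding iB(1) by (auto simp: space_PiM)
    moreover have "(\<lambda>f. \<Sum>j<i. f j) -` B \<inter> space ?P1 \<in> sets ?P1" using m iB(3) by (rule measurable_sets)
    ultimately show "A \<in> sigma_sets (space M) {?U -` A \<inter> space M | A. A \<in> sets ?P1}"
      by (intro sigma_sets.Basic CollectI) blast
  qed
  have B': "S p q k -` B \<inter> space M \<in> sigma_sets (space M) {?V -` A \<inter> space M | A. A \<in> sets ?P2}"
  proof -
    let ?F = "\<lambda>f. \<Sum>j<2 ^ k. cc (pt p q k j) * f (2 ^ n + j)"
    have m: "?F \<in> borel_measurable ?P2"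
      by (intro borel_measurable_sum borel_measurable_times borel_measurable_const measurable_component_singleton) auto
    have "S p q k \<omega> = ?F (?V \<omega>)" for \<omega>
      unfolding S_def by (intro sum.cong) (auto simp: X_def ts2 simp flip: add_Suc_right)
    then have "S p q k -` B \<inter> space M = ?V -` (?F -` B \<inter> space ?P2) \<inter> space M"
      by (auto simp: space_PiM)
    moreover have "?F -` B \<inter> space ?P2 \<in> sets ?P2" using m B by (rule measurable_sets)
    ultimately show ?thesis by (intro sigma_sets.Basic CollectI) blast
  qed
  show ?thesis by (rule indep_setD[OF ind A' B'])
qed

lemma past_level_events: "t \<le> p \<Longrightarrow> p < 1 \<Longrightarrow> sigma_sets (space M) (past_gen p n) \<subseteq> events"
proof (rule sets.sigma_sets_subset, rule subsetI)
  fix A assume p: "t \<le> p" "p < 1" and "A \<in> past_gen p n"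
  then obtain i B where iB: "A = (\<lambda>\<omega>. W (pt t p n i) \<omega> - W t \<omega>) -` B \<inter> space M" "i \<le> 2 ^ n" "B \<in> sets borel"
    by (auto simp: past_gen_def)
  have [measurable]: "W (pt t p n i) \<in> borel_measurable M" "W t \<in> borel_measurable M"
    using pt_mem[OF p(1) iB(2)] p t by (auto intro!: W_measurable)
  have "(\<lambda>\<omega>. W (pt t p n i) \<omega> - W t \<omega>) \<in> borel_measurable M" by measurable
  then show "A \<in> events" unfolding iB(1) using iB(3) by (rule measurable_sets)
qed

lemma past_events: "t \<le> p \<Longrightarrow> p < 1 \<Longrightarrow> past p \<subseteq> events"
  unfolding past_def using past_level_events by (intro sets.sigma_sets_subset) blast

text \<open>The levels increase with \<open>n\<close>, so the union of their sigma-algebras is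
  stable under intersection, and independence extends from it to the generated
  sigma-algebra.\<close>

lemma past_future:
  assumes pq: "t \<le> p" "p < q" "q < 1" and A: "A \<in> past p" and B: "B \<in> sets borel"
  shows "prob (A \<inter> (S p q k -` B \<inter> space M)) = prob A * prob (S p q k -` B \<inter> space M)"
proof -
  let ?B = "{S p q k -` B \<inter> space M}"
  let ?A = "\<Union>n. sigma_sets (space M) (past_gen p n)"
  have SB: "S p q k -` B \<inter> space M \<in> events"
    using S_measurable[of p q k] pq t B by (intro measurable_sets[where A=borel]) auto
  have "indep_set ?A ?B"
    unfolding indep_sets2_eq
  proof (intro conjI ballI)
    show "?A \<subseteq> events" using pq by (intro UN_least past_level_events) auto
    show "?B \<subseteq> events" using SB by simp
    fix a b assume "a \<in> ?A" "b \<in> ?B"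
    then show "prob (a \<inter> b) = prob a * prob b" using past_future_level[OF pq _ B] by auto
  qed
  moreover have "Int_stable ?A"
  proof (rule Int_stableI)
    fix a b assume "a \<in> ?A" "b \<in> ?A"
    then obtain n1 n2 where n: "a \<in> sigma_sets (space M) (past_gen p n1)" "b \<in> sigma_sets (space M) (past_gen p n2)" by auto
    let ?n = "max n1 n2"
    interpret s: sigma_algebra "space M" "sigma_sets (space M) (past_gen p ?n)"
      by (rule sigma_algebra_sigma_sets[OF past_gen_subset])
    have "a \<in> sigma_sets (space M) (past_gen p ?n)" "b \<in> sigma_sets (space M) (past_gen p ?n)"
      using n sigma_sets_mono'[OF past_gen_mono[of n1 ?n p]] sigma_sets_mono'[OF past_gen_mono[of n2 ?n p]] by auto
    then show "a \<inter> b \<in> ?A" using s.Int by blast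
  qed
  moreover have "Int_stable ?B" by (auto simp: Int_stable_def)
  ultimately have "indep_set (sigma_sets (space M) ?A) (sigma_sets (space M) ?B)" by (rule indep_set_sigma_sets)
  from indep_setD[OF this, of A "S p q k -` B \<inter> space M"] show ?thesis
    using A by (auto simp: past_def)
qed


abbreviation pastM :: "real \<Rightarrow> 'a measure" where "pastM p \<equiv> sigma (space M) (past p)"

lemma past_Pow: "past p \<subseteq> Pow (space M)"
proof -
  have "(\<Union>n. sigma_sets (space M) (past_gen p n)) \<subseteq> Pow (space M)"
    using sigma_sets_into_sp[OF past_gen_subset] by blast
  then show ?thesis unfolding past_def using sigma_sets_into_sp by blast
qed

lemma sets_pastM: "sets (pastM p) = past p"
proof -
  have "(\<Union>n. sigma_sets (space M) (past_gen p n)) \<subseteq> Pow (space M)"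
    using sigma_sets_into_sp[OF past_gen_subset] by blast
  then show ?thesis
    using past_Pow by (simp add: sets_measure_of) (simp add: past_def sigma_sets_sigma_sets_eq)
qed

lemma space_pastM: "space (pastM p) = space M"
  using past_Pow by (simp add: space_measure_of)

text \<open>\<open>past p\<close> is not completed, hence measurability only up to null sets.\<close>

definition ae_past :: "real \<Rightarrow> ('a \<Rightarrow> real) \<Rightarrow> bool" where
  "ae_past p f \<longleftrightarrow> f \<in> borel_measurable M \<and> (\<exists>f'\<in>borel_measurable (pastM p). AE \<omega> in M. f \<omega> = f' \<omega>)"

lemma ae_pastI:
  assumes "AE \<omega> in M. f \<omega> = f' \<omega>" "f' \<in> borel_measurable (pastM p)" "f \<in> borel_measurable M"
  shows "ae_past p f"
  unfolding ae_past_def by (intro conjI bexI[of _ f'] assms)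

lemma ae_past_const: "ae_past p (\<lambda>\<omega>. c)"
  unfolding ae_past_def by (auto intro!: bexI[of _ "\<lambda>\<omega>. c"])

lemma ae_past_diff:
  assumes "ae_past p f" "ae_past p g" shows "ae_past p (\<lambda>\<omega>. f \<omega> - g \<omega>)"
proof -
  obtain f' g' where *: "f' \<in> borel_measurable (pastM p)" "g' \<in> borel_measurable (pastM p)"
    "AE \<omega> in M. f \<omega> = f' \<omega>" "AE \<omega> in M. g \<omega> = g' \<omega>" using assms unfolding ae_past_def by blast
  have "AE \<omega> in M. f \<omega> - g \<omega> = f' \<omega> - g' \<omega>" using *(3,4) by eventually_elim simp
  then show ?thesis using assms * unfolding ae_past_def
    by (intro conjI bexI[of _ "\<lambda>\<omega>. f' \<omega> - g' \<omega>"] borel_measurable_diff) auto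
qed

lemma ae_past_cmult:
  assumes "ae_past p f" shows "ae_past p (\<lambda>\<omega>. c * f \<omega>)"
proof -
  obtain f' where *: "f' \<in> borel_measurable (pastM p)" "AE \<omega> in M. f \<omega> = f' \<omega>"
    using assms unfolding ae_past_def by blast
  have "AE \<omega> in M. c * f \<omega> = c * f' \<omega>" using *(2) by eventually_elim simp
  then show ?thesis using assms * unfolding ae_past_def
    by (intro conjI bexI[of _ "\<lambda>\<omega>. c * f' \<omega>"] borel_measurable_times) auto
qed

lemma ae_past_add:
  assumes "ae_past p f" "ae_past p g" shows "ae_past p (\<lambda>\<omega>. f \<omega> + g \<omega>)"
  using ae_past_diff[OF assms(1) ae_past_cmult[OF assms(2), of "-1"]] by simp

lemma ae_past_sum:
  assumes "finite I" "\<And>i. i \<in> I \<Longrightarrow> ae_past p (f i)" shows "ae_past p (\<lambda>\<omega>. \<Sum>i\<in>I. f i \<omega>)"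
  using assms
proof (induction I rule: finite_induct)
  case empty then show ?case using ae_past_const[of p 0] by simp
next
  case (insert i I)
  then have "ae_past p (\<lambda>\<omega>. f i \<omega> + (\<Sum>i\<in>I. f i \<omega>))" by (intro ae_past_add) auto
  then show ?case using insert(1,2) by simp
qed

lemma ae_past_lim:
  assumes "\<And>n. ae_past p (f n)" "f0 \<in> borel_measurable M" "AE \<omega> in M. (\<lambda>n. f n \<omega>) \<longlonglongrightarrow> f0 \<omega>"
  shows "ae_past p f0"
proof -
  obtain f' where *: "\<And>n. f' n \<in> borel_measurable (pastM p)" "\<And>n. AE \<omega> in M. f n \<omega> = f' n \<omega>"
    using assms(1) unfolding ae_past_def by metis
  have "AE \<omega> in M. \<forall>n. f n \<omega> = f' n \<omega>" using *(2) by (simp add: AE_all_countable)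
  then have "AE \<omega> in M. f0 \<omega> = lim (\<lambda>n. f' n \<omega>)"
    using assms(3) by eventually_elim (simp add: limI)
  moreover have "(\<lambda>\<omega>. lim (\<lambda>n. f' n \<omega>)) \<in> borel_measurable (pastM p)"
    using *(1) by (rule borel_measurable_lim_metric)
  ultimately show ?thesis using assms(2) by (rule ae_pastI)
qed

lemma ae_past_W_grid:
  assumes p: "t \<le> p" "p < 1" and i: "i \<le> 2 ^ n" shows "ae_past p (\<lambda>\<omega>. W (pt t p n i) \<omega> - W t \<omega>)"
  unfolding ae_past_def
proof (intro conjI bexI)
  have [measurable]: "W (pt t p n i) \<in> borel_measurable M" "W t \<in> borel_measurable M"
    using pt_mem[OF p(1) i] p t by (auto intro!: W_measurable)
  show "(\<lambda>\<omega>. W (pt t p n i) \<omega> - W t \<omega>) \<in> borel_measurable M" by measurable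
  show "(\<lambda>\<omega>. W (pt t p n i) \<omega> - W t \<omega>) \<in> borel_measurable (pastM p)"
  proof (rule measurableI)
    fix B :: "real set" assume "B \<in> sets borel"
    then have "(\<lambda>\<omega>. W (pt t p n i) \<omega> - W t \<omega>) -` B \<inter> space M \<in> past_gen p n"
      using i by (auto simp: past_gen_def)
    then have "(\<lambda>\<omega>. W (pt t p n i) \<omega> - W t \<omega>) -` B \<inter> space M \<in> past p"
      unfolding past_def by (intro sigma_sets.Basic UN_I[of n] UNIV_I)
    then show "(\<lambda>\<omega>. W (pt t p n i) \<omega> - W t \<omega>) -` B \<inter> space (pastM p) \<in> sets (pastM p)"
      by (simp add: sets_pastM space_pastM del: space_measure_of_conv sets_measure_of_conv)
  qed simp
qed simp

lemma ae_past_W: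
  assumes p: "t \<le> p" "p < 1" and u: "t \<le> u" "u \<le> p" shows "ae_past p (\<lambda>\<omega>. W u \<omega> - W t \<omega>)"
proof (cases "u = t")
  case True then show ?thesis using ae_past_const[of p 0] by simp
next
  case False
  with u have tp: "t < p" by simp
  define h where "h = (u - t) / (p - t)"
  have h: "0 \<le> h" "h \<le> 1" using u tp by (auto simp: h_def)
  define i where "i n = nat \<lfloor>h * 2 ^ n\<rfloor>" for n :: nat
  have i: "i n \<le> 2 ^ n" for n
  proof -
    have "h * 2 ^ n \<le> 1 * 2 ^ n" using h by (intro mult_right_mono) auto
    then have "\<lfloor>h * 2 ^ n\<rfloor> \<le> \<lfloor>real_of_int (2 ^ n)\<rfloor>" by (intro floor_mono) simp
    then show ?thesis unfolding i_def by (simp only: floor_of_int) (simp add: nat_le_iff)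
  qed
  have ri: "real (i n) = of_int \<lfloor>h * 2 ^ n\<rfloor>" for n using h by (simp add: i_def)
  have "(\<lambda>n. t + (p - t) * (of_int \<lfloor>h * 2 ^ n\<rfloor> / 2 ^ n)) \<longlonglongrightarrow> t + (p - t) * h"
    by (intro tendsto_intros dyadic_floor_tendsto)
  also have "t + (p - t) * h = u" using tp by (simp add: h_def)
  finally have lim: "(\<lambda>n. pt t p n (i n)) \<longlonglongrightarrow> u" by (simp add: pt_def ri)
  show ?thesis
  proof (rule ae_past_lim)
    show "ae_past p (\<lambda>\<omega>. W (pt t p n (i n)) \<omega> - W t \<omega>)" for n by (rule ae_past_W_grid[OF p i])
    have [measurable]: "W u \<in> borel_measurable M" "W t \<in> borel_measurable M"
      using u p t by (auto intro!: W_measurable)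
    show "(\<lambda>\<omega>. W u \<omega> - W t \<omega>) \<in> borel_measurable M" by measurable
    show "AE \<omega> in M. (\<lambda>n. W (pt t p n (i n)) \<omega> - W t \<omega>) \<longlonglongrightarrow> W u \<omega> - W t \<omega>"
      using W_continuous
    proof eventually_elim
      case (elim \<omega>)
      have "(\<lambda>n. W (pt t p n (i n)) \<omega>) \<longlonglongrightarrow> W u \<omega>"
      proof (intro continuous_on_tendsto_compose[OF elim lim] always_eventually allI)
        show "u \<in> {0..<1}" using p u t by simp
        show "pt t p n (i n) \<in> {0..<1}" for n using pt_mem[OF p(1) i[of n]] p t by simp
      qed
      then show ?case by (intro tendsto_intros)
    qed
  qed
qed

lemma G_measurable: "t \<le> s \<Longrightarrow> s \<le> 1 \<Longrightarrow> G s \<in> borel_measurable M"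
  unfolding G_def by measurable

text \<open>The noise determines the solution: \<open>G u - G t\<close> is a limit of the sums
  \<open>S t u n\<close>, \<open>G t\<close> is almost surely constant, and \<open>Z u\<close> is
  recovered by dividing by \<open>cc u\<close>.\<close>

lemma ae_past_Z:
  assumes p: "t \<le> p" "p < 1" and u: "t \<le> u" "u \<le> p" shows "ae_past p (Z u)"
proof -
  have S: "ae_past p (S t u n)" for n
    unfolding S_def
  proof (intro ae_past_sum ae_past_cmult finite_lessThan)
    fix i :: nat assume i: "i \<in> {..<2 ^ n}"
    have "ae_past p (\<lambda>\<omega>. (W (pt t u n (Suc i)) \<omega> - W t \<omega>) - (W (pt t u n i) \<omega> - W t \<omega>))"
      using pt_mem[OF u(1), of "Suc i" n] pt_mem[OF u(1), of i n] i u
      by (intro ae_past_diff ae_past_W[OF p]) auto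
    then show "ae_past p (\<lambda>\<omega>. W (pt t u n (Suc i)) \<omega> - W (pt t u n i) \<omega>)" by simp
  qed
  have mG: "G u \<in> borel_measurable M" "G t \<in> borel_measurable M" using u p t by (auto intro!: G_measurable)
  have D: "ae_past p (\<lambda>\<omega>. G u \<omega> - G t \<omega>)"
    using u p mG by (intro ae_past_lim[OF S _ S_tendsto] borel_measurable_diff) auto
  obtain D' where D': "D' \<in> borel_measurable (pastM p)" "AE \<omega> in M. G u \<omega> - G t \<omega> = D' \<omega>"
    using D unfolding ae_past_def by blast
  have "AE \<omega> in M. Z u \<omega> = \<kappa> + (D' \<omega> + cc t * (z - \<kappa>)) / cc u"
    using D'(2) Z_start
  proof eventually_elim
    case (elim \<omega>)
    have "cc u * (Z u \<omega> - \<kappa>) = D' \<omega> + cc t * (z - \<kappa>)" using elim by (simp add: G_def)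
    then have "Z u \<omega> - \<kappa> = (D' \<omega> + cc t * (z - \<kappa>)) / cc u" using cc_pos[of u] u p by (simp add: field_simps)
    then show ?case by simp
  qed
  moreover have "(\<lambda>\<omega>. \<kappa> + (D' \<omega> + cc t * (z - \<kappa>)) / cc u) \<in> borel_measurable (pastM p)"
    using D'(1) by measurable
  moreover have "Z u \<in> borel_measurable M" using u p by (intro Z_measurable) auto
  ultimately show ?thesis by (rule ae_pastI)
qed

section \<open>The natural filtration of the bridge\<close>

definition nat_gen :: "real \<Rightarrow> 'a set set" where
  "nat_gen p = {Z (t + r) -` A \<inter> space M | r A. r \<in> {0..min (p - t) (1 - t)} \<and> A \<in> sets borel}"

abbreviation natM :: "real \<Rightarrow> 'a measure" where "natM p \<equiv> natural_filtration_from M t Z (p - t)"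

lemma sets_natM: "sets (natM p) = sigma_sets (space M) (nat_gen p)"
  and space_natM: "space (natM p) = space M"
proof -
  have eq: "natM p = sigma (space M) (nat_gen p)" by (simp add: natural_filtration_from_def nat_gen_def)
  have "nat_gen p \<subseteq> Pow (space M)" by (auto simp: nat_gen_def)
  then show "sets (natM p) = sigma_sets (space M) (nat_gen p)" "space (natM p) = space M"
    unfolding eq by (simp_all add: sets_measure_of space_measure_of)
qed

lemma natM_events: "sets (natM p) \<subseteq> events"
  unfolding sets_natM
proof (rule sets.sigma_sets_subset, rule subsetI)
  fix E assume "E \<in> nat_gen p"
  then obtain r A where "E = Z (t + r) -` A \<inter> space M" "r \<in> {0..min (p - t) (1 - t)}" "A \<in> sets borel"
    by (auto simp: nat_gen_def)
  then show "E \<in> events" using Z_measurable[of "t + r"] by (auto intro!: measurable_sets)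
qed

lemma Z_natM:
  assumes "t \<le> u" "u \<le> p" "u \<le> 1" shows "Z u \<in> borel_measurable (natM p)"
proof (rule measurableI)
  fix A :: "real set" assume A: "A \<in> sets borel"
  have "Z (t + (u - t)) -` A \<inter> space M \<in> nat_gen p"
    unfolding nat_gen_def using A assms by (intro CollectI exI[of _ "u - t"] exI[of _ A]) auto
  then show "Z u -` A \<inter> space (natM p) \<in> sets (natM p)"
    by (simp add: sets_natM space_natM sigma_sets.Basic)
qed simp

lemma natM_mono: "p \<le> q \<Longrightarrow> sets (natM p) \<subseteq> sets (natM q)"
  unfolding sets_natM
proof (intro sigma_sets_mono' subsetI)
  fix E assume pq: "p \<le> q" and "E \<in> nat_gen p"
  then obtain r A where "E = Z (t + r) -` A \<inter> space M" "r \<in> {0..min (p - t) (1 - t)}" "A \<in> sets borel"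
    by (auto simp: nat_gen_def)
  then show "E \<in> nat_gen q"
    unfolding nat_gen_def using pq by (intro CollectI exI[of _ r] exI[of _ A]) auto
qed

text \<open>Independence is known for the past of the noise, while stopping times refer to the
  filtration of \<open>Z\<close>. Each event of the latter agrees with one of the former up to a
  null set, by induction over the generated sigma-algebra.\<close>

lemma natM_past:
  assumes p: "t \<le> p" "p < 1" and E: "E \<in> sets (natM p)"
  shows "\<exists>A\<in>past p. AE \<omega> in M. \<omega> \<in> E \<longleftrightarrow> \<omega> \<in> A"
  using E unfolding sets_natM
proof induction
  case (Basic E)
  then obtain r B where rB: "E = Z (t + r) -` B \<inter> space M" "r \<in> {0..min (p - t) (1 - t)}" "B \<in> sets borel"
    by (auto simp: nat_gen_def)
  have "ae_past p (Z (t + r))" using rB p by (intro ae_past_Z) auto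
  then obtain f where f: "f \<in> borel_measurable (pastM p)" "AE \<omega> in M. Z (t + r) \<omega> = f \<omega>"
    unfolding ae_past_def by blast
  have "f -` B \<inter> space (pastM p) \<in> sets (pastM p)" using f(1) rB(3) by (rule measurable_sets)
  then have "f -` B \<inter> space M \<in> past p" by (simp only: space_pastM sets_pastM)
  moreover have "AE \<omega> in M. \<omega> \<in> E \<longleftrightarrow> \<omega> \<in> f -` B \<inter> space M"
    using f(2) AE_space by eventually_elim (simp add: rB(1))
  ultimately show ?case by blast
next
  case Empty
  show ?case by (intro bexI[of _ "{}"]) (auto simp: past_def intro: sigma_sets.Empty)
next
  case (Compl E)
  then obtain A where A: "A \<in> past p" "AE \<omega> in M. \<omega> \<in> E \<longleftrightarrow> \<omega> \<in> A" by blast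
  have "space M - A \<in> past p" using A(1) unfolding past_def by (rule sigma_sets.Compl)
  moreover have "AE \<omega> in M. \<omega> \<in> space M - E \<longleftrightarrow> \<omega> \<in> space M - A" using A(2) by eventually_elim auto
  ultimately show ?case by blast
next
  case (Union E)
  then obtain A where A: "\<And>i :: nat. A i \<in> past p" "\<And>i. AE \<omega> in M. \<omega> \<in> E i \<longleftrightarrow> \<omega> \<in> A i" by metis
  have "(\<Union>i. A i) \<in> past p" using A(1) unfolding past_def by (rule sigma_sets.Union)
  moreover have "AE \<omega> in M. \<forall>i. \<omega> \<in> E i \<longleftrightarrow> \<omega> \<in> A i" using A(2) by (simp add: AE_all_countable)
  then have "AE \<omega> in M. \<omega> \<in> (\<Union>i. E i) \<longleftrightarrow> \<omega> \<in> (\<Union>i. A i)" by eventually_elim auto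
  ultimately show ?case by blast
qed

section \<open>Gaussian law of the increments of the rescaled bridge\<close>

text \<open>The variance of \<open>S p q n\<close>, a Riemann sum for the integral of
  \<open>cc^2\<close>, which is \<open>(cc q - cc p) / \<alpha>\<close>.\<close>

definition Svar :: "real \<Rightarrow> real \<Rightarrow> nat \<Rightarrow> real" where
  "Svar p q n = (\<Sum>i<2 ^ n. (cc (pt p q n i))\<^sup>2 * ((q - p) / 2 ^ n))"

lemma pt_step: "pt p q n (Suc i) - pt p q n i = (q - p) / 2 ^ n"
  by (simp add: pt_def field_simps)

lemma S_distributed:
  assumes pq: "0 \<le> p" "p < q" "q < 1"
  shows "distributed M lborel (S p q n) (normal_density 0 (sqrt (Svar p q n)))" and "0 < Svar p q n"
proof -
  let ?X = "\<lambda>i \<omega>. W (pt p q n (Suc i)) \<omega> - W (pt p q n i) \<omega>"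
  have pt: "p \<le> pt p q n i" "pt p q n i \<le> q" if "i \<le> 2 ^ n" for i using pt_mem[of p q i n] pq that by auto
  have c: "0 < cc (pt p q n i)" if "i < 2 ^ n" for i using pt[of i] pq that by (intro cc_pos) auto
  have h: "0 < (q - p) / 2 ^ n" using pq by simp
  have "indep_vars (\<lambda>_. borel) ?X {..<2 ^ n}"
  proof (rule W_indep)
    show "pt p q n ` {..2 ^ n} \<subseteq> {0..<1}" using pt pq by force
    show "strict_mono_on {..2 ^ n} (pt p q n)" using pt_less[OF pq(2)] by (auto intro: strict_mono_onI)
  qed
  from indep_vars_compose2[OF this, of "\<lambda>i x. cc (pt p q n i) * x" "\<lambda>_. borel"]
  have ind: "indep_vars (\<lambda>_. borel) (\<lambda>i \<omega>. cc (pt p q n i) * ?X i \<omega>) {..<2 ^ n}" by simp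
  have "distributed M lborel (\<lambda>\<omega>. \<Sum>i<2 ^ n. cc (pt p q n i) * ?X i \<omega>)
      (normal_density (\<Sum>i<(2::nat) ^ n. 0) (sqrt (\<Sum>i<2 ^ n. (cc (pt p q n i) * sqrt ((q - p) / 2 ^ n))\<^sup>2)))"
  proof (rule sum_indep_normal[OF _ _ ind])
    fix i :: nat assume i: "i \<in> {..<2 ^ n}"
    then show "0 < cc (pt p q n i) * sqrt ((q - p) / 2 ^ n)" using c[of i] h by simp
    have "distributed M lborel (?X i) (normal_density 0 (sqrt ((q - p) / 2 ^ n)))"
      using W_normal[of "pt p q n i" "pt p q n (Suc i)"] pt[of i] pt[of "Suc i"] i pq pt_less[OF pq(2), of i "Suc i" n]
      by (simp add: pt_step)
    from normal_density_affine[OF this, of "cc (pt p q n i)" 0]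
    show "distributed M lborel (\<lambda>\<omega>. cc (pt p q n i) * ?X i \<omega>) (normal_density 0 (cc (pt p q n i) * sqrt ((q - p) / 2 ^ n)))"
      using h c[of i] i by simp
  next
    show "{..<(2::nat) ^ n} \<noteq> {}" by (metis empty_iff lessThan_iff zero_less_numeral zero_less_power)
  qed auto
  moreover have "(\<Sum>i<2 ^ n. (cc (pt p q n i) * sqrt ((q - p) / 2 ^ n))\<^sup>2) = Svar p q n"
    unfolding Svar_def power_mult_distrib using h by simp
  ultimately show "distributed M lborel (S p q n) (normal_density 0 (sqrt (Svar p q n)))"
    by (simp add: S_def[abs_def])
  show "0 < Svar p q n" unfolding Svar_def
  proof (rule sum_pos)
    show "{..<(2::nat) ^ n} \<noteq> {}" by (metis empty_iff lessThan_iff zero_less_numeral zero_less_power)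
    show "0 < (cc (pt p q n i))\<^sup>2 * ((q - p) / 2 ^ n)" if "i \<in> {..<2 ^ n}" for i
      using h c[of i] that by (intro mult_pos_pos) auto
  qed simp
qed

lemma S_char:
  assumes pq: "0 \<le> p" "p < q" "q < 1"
  shows "expectation (\<lambda>\<omega>. iexp (l * S p q n \<omega>)) = complex_of_real (exp (- (Svar p q n * l\<^sup>2) / 2))"
proof -
  define \<sigma> where "\<sigma> = sqrt (Svar p q n)"
  have \<sigma>: "0 < \<sigma>" "\<sigma>\<^sup>2 = Svar p q n" using S_distributed(2)[OF pq, of n] by (auto simp: \<sigma>_def)
  have [measurable]: "S p q n \<in> borel_measurable M" using pq by (intro S_measurable) auto
  have "distributed M lborel (\<lambda>\<omega>. (S p q n \<omega> - 0) / \<sigma>) std_normal_density"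
    using normal_standard_normal_convert[OF \<sigma>(1), of "S p q n" 0] S_distributed(1)[OF pq, of n] by (simp add: \<sigma>_def)
  then have d: "distr M lborel (\<lambda>\<omega>. S p q n \<omega> / \<sigma>) = gauss" by (simp add: distributed_distr_eq_density)
  have "expectation (\<lambda>\<omega>. iexp (l * S p q n \<omega>)) = expectation (\<lambda>\<omega>. iexp ((l * \<sigma>) * (S p q n \<omega> / \<sigma>)))"
    using \<sigma> by simp
  also have "\<dots> = (\<integral>y. iexp ((l * \<sigma>) * y) \<partial>distr M lborel (\<lambda>\<omega>. S p q n \<omega> / \<sigma>))"
    by (subst integral_distr) auto
  also have "\<dots> = char gauss (l * \<sigma>)" unfolding d char_def ..
  finally show ?thesis by (simp add: char_std_normal_distribution power_mult_distrib \<sigma> mult.commute)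
qed

text \<open>By \<open>cc_diff\<close> the sum with \<open>cc u * cc v\<close> in place of
  \<open>(cc u)^2\<close> on each cell is exactly \<open>(cc q - cc p) / \<alpha>\<close>; the
  discrepancy per cell is at most \<open>cc q\<close> times the mesh times
  \<open>cc v - cc u\<close>, which telescopes as well.\<close>

lemma Svar_tendsto:
  assumes pq: "0 \<le> p" "p < q" "q < 1"
  shows "Svar p q \<longlonglongrightarrow> (cc q - cc p) / \<alpha>"
proof (rule LIM_zero_cancel, rule Lim_null_comparison)
  have pt: "p \<le> pt p q n i" "pt p q n i \<le> q" if "i \<le> 2 ^ n" for i n using pt_mem[of p q i n] pq that by auto
  show "\<forall>\<^sub>F n in sequentially. norm (Svar p q n - (cc q - cc p) / \<alpha>) \<le> (cc q * (q - p) * (cc q - cc p)) * (1 / 2) ^ n"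
  proof (rule always_eventually, rule allI)
    fix n :: nat
    let ?c = "\<lambda>i. cc (pt p q n i)" and ?h = "(q - p) / 2 ^ n"
    have h: "0 < ?h" using pq by simp
    have tel: "(\<Sum>i<2 ^ n. ?c (Suc i) - ?c i) = cc q - cc p"
      using sum_lessThan_telescope[of ?c "2 ^ n"] by simp
    have inc: "?c (Suc i) - ?c i = \<alpha> * ?h * (?c i * ?c (Suc i))" if "i < 2 ^ n" for i
      using cc_diff[of "pt p q n i" "pt p q n (Suc i)"] pt[of i n] pt[of "Suc i" n] that pq by (simp add: pt_step)
    have "(cc q - cc p) / \<alpha> = (\<Sum>i<2 ^ n. (?c (Suc i) - ?c i) / \<alpha>)"
      unfolding sum_divide_distrib[symmetric] tel ..
    also have "\<dots> = (\<Sum>i<2 ^ n. ?h * (?c i * ?c (Suc i)))"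
    proof (rule sum.cong[OF refl])
      fix i :: nat assume "i \<in> {..<2 ^ n}"
      then have "(?c (Suc i) - ?c i) / \<alpha> = \<alpha> * ?h * (?c i * ?c (Suc i)) / \<alpha>" using inc[of i] by simp
      also have "\<dots> = ?h * (?c i * ?c (Suc i))"
      proof -
        have "\<alpha> * h * x / \<alpha> = h * x" for h x using \<alpha> by simp
        then show ?thesis .
      qed
      finally show "(?c (Suc i) - ?c i) / \<alpha> = ?h * (?c i * ?c (Suc i))" .
    qed
    finally have s1: "Svar p q n - (cc q - cc p) / \<alpha> = (\<Sum>i<2 ^ n. (?c i)\<^sup>2 * ?h - ?h * (?c i * ?c (Suc i)))"
      by (simp add: Svar_def sum_subtractf)
    have s2: "\<bar>\<Sum>i<2 ^ n. (?c i)\<^sup>2 * ?h - ?h * (?c i * ?c (Suc i))\<bar> \<le> (\<Sum>i<2 ^ n. cc q * ?h * (?c (Suc i) - ?c i))"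
    proof (rule order_trans[OF sum_abs], rule sum_mono)
      fix i :: nat assume i: "i \<in> {..<2 ^ n}"
      have mono: "?c i \<le> ?c (Suc i)" "?c i \<le> cc q" "0 < ?c i"
        using pt[of i n] pt[of "Suc i" n] i pq pt_less[OF pq(2), of i "Suc i" n]
          cc_mono[of "pt p q n i" "pt p q n (Suc i)"] cc_mono[of "pt p q n i" q] cc_pos[of "pt p q n i"] by simp_all
      have "(?c i)\<^sup>2 * ?h - ?h * (?c i * ?c (Suc i)) = - (?c i * ?h * (?c (Suc i) - ?c i))"
      proof -
        have "a\<^sup>2 * h - h * (a * b) = - (a * h * (b - a))" for a b h :: real
          by (simp add: power2_eq_square algebra_simps)
        then show ?thesis by blast
      qed
      also have "\<bar>\<dots>\<bar> = ?c i * ?h * (?c (Suc i) - ?c i)" 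
      proof -
        have "0 \<le> ?c i * ?h * (?c (Suc i) - ?c i)" using mono h by (intro mult_nonneg_nonneg) auto
        then show ?thesis by (simp only: abs_minus_cancel abs_of_nonneg)
      qed
      also have "\<dots> \<le> cc q * ?h * (?c (Suc i) - ?c i)" using mono h by (intro mult_right_mono) auto
      finally show "\<bar>(?c i)\<^sup>2 * ?h - ?h * (?c i * ?c (Suc i))\<bar> \<le> cc q * ?h * (?c (Suc i) - ?c i)" .
    qed
    have s3: "(\<Sum>i<2 ^ n. cc q * ?h * (?c (Suc i) - ?c i)) = cc q * ?h * (\<Sum>i<2 ^ n. ?c (Suc i) - ?c i)"
      by (rule sum_distrib_left[symmetric])
    have s4: "a * ((q - p) / 2 ^ n) * b = (a * (q - p) * b) * (1 / 2) ^ n" for a b :: real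
      by (simp add: power_divide)
    show "norm (Svar p q n - (cc q - cc p) / \<alpha>) \<le> (cc q * (q - p) * (cc q - cc p)) * (1 / 2) ^ n"
      unfolding s1 real_norm_def using s2 s3[unfolded tel, THEN trans, OF s4] by (rule ord_le_eq_trans)
  qed
  show "(\<lambda>n. (cc q * (q - p) * (cc q - cc p)) * (1 / 2) ^ n) \<longlonglongrightarrow> 0"
    by (intro tendsto_mult_right_zero LIMSEQ_power_zero) simp
qed

lemma past_S_char:
  assumes pq: "t \<le> p" "p < q" "q < 1" and A: "A \<in> past p"
  shows "expectation (\<lambda>\<omega>. indicator A \<omega> * iexp (l * S p q n \<omega>))
     = complex_of_real (prob A * exp (- (Svar p q n * l\<^sup>2) / 2))"
proof -
  have p0: "0 \<le> p" "0 \<le> q" using t pq by auto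
  have S[measurable]: "S p q n \<in> borel_measurable M" using pq p0 by (intro S_measurable) auto
  have Ae[measurable]: "A \<in> events" using past_events[of p] pq A by auto
  have pst: "sigma_algebra (space M) (past p)"
    unfolding past_def by (rule sigma_algebra_sigma_sets) (use sigma_sets_into_sp[OF past_gen_subset] in blast)
  have "indep_var borel (indicator A :: 'a \<Rightarrow> real) borel (S p q n)"
    unfolding indep_var_eq
  proof (intro conjI)
    show "random_variable borel (indicator A :: 'a \<Rightarrow> real)" by measurable
    show "random_variable borel (S p q n)" by (rule S)
    let ?IS = "{(indicator A :: 'a \<Rightarrow> real) -` B \<inter> space M | B. B \<in> sets borel}"
    let ?SS = "{S p q n -` B \<inter> space M | B. B \<in> sets borel}"
    have "indicator A \<in> borel_measurable (pastM p)"
      using A by (intro borel_measurable_indicator) (simp only: sets_pastM)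
    from measurable_sets[OF this] have "?IS \<subseteq> past p" unfolding sets_pastM space_pastM by auto
    then have IS: "sigma_sets (space M) ?IS \<subseteq> past p" by (rule sigma_algebra.sigma_sets_subset[OF pst])
    have "sets (vimage_algebra (space M) (S p q n) borel) = ?SS" by (rule sets_vimage_algebra2) simp
    then have SS: "sigma_sets (space M) ?SS = ?SS"
      using sets.sigma_sets_eq[of "vimage_algebra (space M) (S p q n) borel"] by simp
    show "indep_set (sigma_sets (space M) ?IS) (sigma_sets (space M) ?SS)"
      unfolding SS indep_sets2_eq
    proof (intro conjI ballI)
      show "sigma_sets (space M) ?IS \<subseteq> events" using IS past_events[of p] pq by auto
      show "?SS \<subseteq> events" using measurable_sets[OF S] by auto
      fix a b assume "a \<in> sigma_sets (space M) ?IS" "b \<in> ?SS"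
      then show "prob (a \<inter> b) = prob a * prob b" using past_future[OF pq] IS by blast
    qed
  qed
  from indep_var_compose[OF this, of complex_of_real borel "\<lambda>y. iexp (l * y)" borel]
  have ind: "indep_var borel (\<lambda>\<omega>. indicator A \<omega> :: complex) borel (\<lambda>\<omega>. iexp (l * S p q n \<omega>))"
    by (simp add: comp_def of_real_indicator)
  have "expectation (\<lambda>\<omega>. indicator A \<omega> * iexp (l * S p q n \<omega>))
      = expectation (\<lambda>\<omega>. indicator A \<omega> :: complex) * expectation (\<lambda>\<omega>. iexp (l * S p q n \<omega>))"
  proof (rule indep_var_lebesgue_integral[OF ind])
    show "integrable M (\<lambda>\<omega>. indicator A \<omega> :: complex)" by (rule integrable_const_bound[where B=1]) (auto split: split_indicator)
    show "integrable M (\<lambda>\<omega>. iexp (l * S p q n \<omega>))" by (rule integrable_const_bound[where B=1]) auto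
  qed
  also have "expectation (\<lambda>\<omega>. indicator A \<omega> :: complex) = complex_of_real (prob A)"
  proof -
    have "expectation (\<lambda>\<omega>. indicator A \<omega> :: complex) = expectation (\<lambda>\<omega>. complex_of_real (indicator A \<omega>))"
      by (simp add: of_real_indicator)
    also have "\<dots> = complex_of_real (expectation (indicator A))" by (rule integral_complex_of_real)
    finally show ?thesis using Ae by (simp add: sets.Int_space_eq2)
  qed
  also have "expectation (\<lambda>\<omega>. iexp (l * S p q n \<omega>)) = complex_of_real (exp (- (Svar p q n * l\<^sup>2) / 2))"
    using pq p0 by (intro S_char) auto
  finally show ?thesis by simp
qed

text \<open>\<open>E\<close> is replaced by an almost surely equal event of the past, for which the
  Riemann sums factor; dominated convergence then passes to the increment of
  \<open>G\<close>.\<close>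

lemma natM_G_char_open:
  assumes pq: "t \<le> p" "p < q" "q < 1" and E: "E \<in> sets (natM p)"
  shows "expectation (\<lambda>\<omega>. indicator E \<omega> * iexp (l * (G q \<omega> - G p \<omega>)))
     = complex_of_real (prob E * exp (- ((cc q - cc p) / \<alpha> * l\<^sup>2) / 2))"
proof -
  have p0: "0 \<le> p" "0 \<le> q" using t pq by auto
  obtain A where A: "A \<in> past p" "AE \<omega> in M. \<omega> \<in> E \<longleftrightarrow> \<omega> \<in> A" using natM_past[OF _ _ E] pq by auto
  have [measurable]: "E \<in> events" "A \<in> events" using E natM_events A(1) past_events[of p] pq by auto
  have [measurable]: "G q \<in> borel_measurable M" "G p \<in> borel_measurable M" using pq by (auto intro!: G_measurable)
  have [measurable]: "S p q n \<in> borel_measurable M" for n using pq p0 by (intro S_measurable) auto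
  have "(\<lambda>n. expectation (\<lambda>\<omega>. indicator A \<omega> * iexp (l * S p q n \<omega>)))
      \<longlonglongrightarrow> expectation (\<lambda>\<omega>. indicator A \<omega> * iexp (l * (G q \<omega> - G p \<omega>)))"
  proof (rule integral_dominated_convergence[where w="\<lambda>_. 1"])
    have "AE \<omega> in M. (\<lambda>n. S p q n \<omega>) \<longlonglongrightarrow> G q \<omega> - G p \<omega>" using pq by (intro S_tendsto) auto
    then show "AE \<omega> in M. (\<lambda>n. indicator A \<omega> * iexp (l * S p q n \<omega>)) \<longlonglongrightarrow> indicator A \<omega> * iexp (l * (G q \<omega> - G p \<omega>))"
      by eventually_elim (intro tendsto_intros)
  qed (auto split: split_indicator)
  moreover have "(\<lambda>n. expectation (\<lambda>\<omega>. indicator A \<omega> * iexp (l * S p q n \<omega>)))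
      \<longlonglongrightarrow> complex_of_real (prob A * exp (- ((cc q - cc p) / \<alpha> * l\<^sup>2) / 2))"
    unfolding past_S_char[OF pq A(1)] using p0 pq by (intro tendsto_intros Svar_tendsto) auto
  ultimately have "expectation (\<lambda>\<omega>. indicator A \<omega> * iexp (l * (G q \<omega> - G p \<omega>)))
      = complex_of_real (prob A * exp (- ((cc q - cc p) / \<alpha> * l\<^sup>2) / 2))" by (rule LIMSEQ_unique)
  moreover have "expectation (\<lambda>\<omega>. indicator A \<omega> * iexp (l * (G q \<omega> - G p \<omega>)))
      = expectation (\<lambda>\<omega>. indicator E \<omega> * iexp (l * (G q \<omega> - G p \<omega>)))"
  proof (rule integral_cong_AE)
    show "AE \<omega> in M. indicator A \<omega> * iexp (l * (G q \<omega> - G p \<omega>)) = indicator E \<omega> * iexp (l * (G q \<omega> - G p \<omega>))"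
      using A(2) by eventually_elim (auto split: split_indicator)
  qed auto
  moreover have "prob A = prob E"
    using A(2) by (intro measure_eq_AE) auto
  ultimately show ?thesis by simp
qed

text \<open>The noise runs only over \<open>[0, 1)\<close>, and \<open>Z 1\<close> is the almost
  sure left limit, so the case \<open>q = 1\<close> follows from a sequence of times tending to 1
  from below.\<close>

lemma natM_G_char:
  assumes pq: "t \<le> p" "p < q" "q \<le> 1" and E: "E \<in> sets (natM p)"
  shows "expectation (\<lambda>\<omega>. indicator E \<omega> * iexp (l * (G q \<omega> - G p \<omega>)))
     = complex_of_real (prob E * exp (- ((cc q - cc p) / \<alpha> * l\<^sup>2) / 2))"
proof (cases "q = 1")
  case False then show ?thesis using pq E by (intro natM_G_char_open) auto
next
  case True
  define r where "r n = 1 - (1 - p) / (real n + 2)" for n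
  have r: "p < r n" "r n < 1" for n
  proof -
    have "(1 - p) * 1 < (1 - p) * (real n + 2)" using pq True by (intro mult_strict_left_mono) auto
    then have "(1 - p) / (real n + 2) < 1 - p" by (simp add: divide_less_eq)
    then show "p < r n" by (simp add: r_def)
    show "r n < 1" using pq True by (simp add: r_def)
  qed
  have "(\<lambda>n. (1 - p) / (real n + 2)) \<longlonglongrightarrow> 0"
    by (intro tendsto_divide_0[OF tendsto_const] filterlim_at_top_imp_at_infinity
        filterlim_tendsto_add_at_top[OF tendsto_const filterlim_real_sequentially, of 2, simplified add.commute])
  from tendsto_diff[OF tendsto_const[of 1] this] have r1: "r \<longlonglongrightarrow> 1" by (simp add: r_def[abs_def])
  have rl: "filterlim r (at_left 1) sequentially"
    using r1 r(2) by (intro tendsto_imp_filterlim_at_left always_eventually allI)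
  have ccr: "(\<lambda>n. cc (r n)) \<longlonglongrightarrow> cc 1"
    unfolding cc_def using \<alpha> by (intro tendsto_intros r1) simp
  have [measurable]: "E \<in> events" using E natM_events by auto
  have [measurable]: "G 1 \<in> borel_measurable M" "G p \<in> borel_measurable M" using pq t by (auto intro!: G_measurable)
  have [measurable]: "G (r n) \<in> borel_measurable M" for n using r[of n] pq by (intro G_measurable) auto
  have "(\<lambda>n. expectation (\<lambda>\<omega>. indicator E \<omega> * iexp (l * (G (r n) \<omega> - G p \<omega>))))
      \<longlonglongrightarrow> expectation (\<lambda>\<omega>. indicator E \<omega> * iexp (l * (G 1 \<omega> - G p \<omega>)))"
  proof (rule integral_dominated_convergence[where w="\<lambda>_. 1"])
    show "AE \<omega> in M. (\<lambda>n. indicator E \<omega> * iexp (l * (G (r n) \<omega> - G p \<omega>))) \<longlonglongrightarrow> indicator E \<omega> * iexp (l * (G 1 \<omega> - G p \<omega>))"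
      using Z_limit
    proof eventually_elim
      case (elim \<omega>)
      have "(\<lambda>n. Z (r n) \<omega>) \<longlonglongrightarrow> Z 1 \<omega>" by (rule filterlim_compose[OF elim rl])
      then show ?case unfolding G_def by (intro tendsto_intros ccr)
    qed
  qed (auto split: split_indicator)
  moreover have "(\<lambda>n. expectation (\<lambda>\<omega>. indicator E \<omega> * iexp (l * (G (r n) \<omega> - G p \<omega>))))
      \<longlonglongrightarrow> complex_of_real (prob E * exp (- ((cc 1 - cc p) / \<alpha> * l\<^sup>2) / 2))"
    unfolding natM_G_char_open[OF pq(1) r E] using \<alpha> by (intro tendsto_intros ccr) auto
  ultimately show ?thesis unfolding True by (rule LIMSEQ_unique)
qed


section \<open>Ornstein-Uhlenbeck coordinates and the Markov property\<close>

definition dG :: "real \<Rightarrow> real \<Rightarrow> 'a \<Rightarrow> real" where "dG p q \<omega> = G q \<omega> - G p \<omega>"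
definition sd :: "real \<Rightarrow> real \<Rightarrow> real" where "sd p q = sqrt ((cc q - cc p) / \<alpha>)"
definition xi :: "real \<Rightarrow> 'a \<Rightarrow> real" where "xi s \<omega> = sqrt (\<alpha> * cc s) * (Z s \<omega> - \<kappa>)"
definition rho :: "real \<Rightarrow> real" where "rho s = ln (cc 1 / cc s) / 2"
definition x0 :: real where "x0 = sqrt (\<alpha> * cc t) * (z - \<kappa>)"

lemma cc_strict_mono:
  assumes "p < q" "q \<le> 1" shows "cc p < cc q"
proof -
  have "0 < \<alpha> * (q - p) * (cc p * cc q)" using assms \<alpha> cc_pos[of p] cc_pos[of q] by simp
  then show ?thesis using cc_diff[of p q] assms by simp
qed

lemma sd_pos: "p < q \<Longrightarrow> q \<le> 1 \<Longrightarrow> 0 < sd p q"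
  using cc_strict_mono[of p q] \<alpha> by (simp add: sd_def)

lemma dG_measurable: "t \<le> p \<Longrightarrow> p \<le> q \<Longrightarrow> q \<le> 1 \<Longrightarrow> dG p q \<in> borel_measurable M"
  unfolding dG_def[abs_def] by (intro borel_measurable_diff G_measurable) auto

text \<open>Conditioning on \<open>E\<close> means passing to the uniform measure on
  \<open>E\<close>; under it the increment has the same characteristic function for every
  \<open>E\<close> of positive probability, hence the same law.\<close>

lemma natM_indep:
  assumes pq: "t \<le> p" "p < q" "q \<le> 1" and E: "E \<in> sets (natM p)" and B: "B \<in> sets borel"
  shows "prob (E \<inter> (dG p q -` B \<inter> space M)) = prob E * measure (distr gauss borel (\<lambda>y. sd p q * y)) B"
proof -
  have Ee[measurable]: "E \<in> events" using E natM_events by auto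
  have D[measurable]: "dG p q \<in> borel_measurable M" using pq by (intro dG_measurable) auto
  show ?thesis
  proof (cases "prob E = 0")
    case True
    have "prob (E \<inter> (dG p q -` B \<inter> space M)) \<le> prob E" using B by (intro finite_measure_mono) auto
    then show ?thesis using True measure_nonneg[of M "E \<inter> (dG p q -` B \<inter> space M)"] by simp
  next
    case False
    then have pE: "0 < prob E" by (simp add: zero_less_measure_iff)
    let ?N = "uniform_measure M E"
    have N: "?N = density M (\<lambda>\<omega>. ennreal (indicator E \<omega> / prob E))"
      unfolding uniform_measure_def
      by (intro density_cong AE_I2) (use pE divide_ennreal[of 1 "prob E"] in \<open>auto simp: emeasure_eq_measure split: split_indicator\<close>)
    interpret N: prob_space ?N
      using pE by (intro prob_space_uniform_measure) (auto simp: emeasure_eq_measure)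
    have [measurable]: "dG p q \<in> borel_measurable ?N" by (subst measurable_cong_sets[of ?N M borel borel]) (use D in simp_all)
    have "distr ?N borel (dG p q) = distr gauss borel (\<lambda>y. sd p q * y)"
    proof (rule Levy_uniqueness)
      show "real_distribution (distr ?N borel (dG p q))" by (rule N.real_distribution_distr) measurable
      show "real_distribution (distr gauss borel (\<lambda>y. sd p q * y))" by (rule gauss.real_distribution_distr) measurable
      show "char (distr ?N borel (dG p q)) = char (distr gauss borel (\<lambda>y. sd p q * y))"
      proof
        fix l
        have "char (distr ?N borel (dG p q)) l = (\<integral>\<omega>. iexp (l * dG p q \<omega>) \<partial>?N)"
          unfolding char_def by (subst integral_distr) auto
        also have "\<dots> = (\<integral>\<omega>. (indicator E \<omega> / prob E) *\<^sub>R iexp (l * dG p q \<omega>) \<partial>M)"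
          unfolding N using pE by (subst integral_density) (auto split: split_indicator)
        also have "\<dots> = (\<integral>\<omega>. (1 / complex_of_real (prob E)) * (indicator E \<omega> * iexp (l * dG p q \<omega>)) \<partial>M)"
          by (intro Bochner_Integration.integral_cong) (auto split: split_indicator simp: scaleR_conv_of_real)
        also have "\<dots> = (1 / complex_of_real (prob E)) * expectation (\<lambda>\<omega>. indicator E \<omega> * iexp (l * dG p q \<omega>))"
          by (rule integral_mult_right_zero)
        also have "expectation (\<lambda>\<omega>. indicator E \<omega> * iexp (l * dG p q \<omega>))
            = complex_of_real (prob E * exp (- ((cc q - cc p) / \<alpha> * l\<^sup>2) / 2))"
          unfolding dG_def by (rule natM_G_char[OF pq E])
        also have "(1 / complex_of_real (prob E)) * complex_of_real (prob E * exp (- ((cc q - cc p) / \<alpha> * l\<^sup>2) / 2))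
            = complex_of_real (exp (- ((cc q - cc p) / \<alpha> * l\<^sup>2) / 2))"
          using pE by simp
        also have "\<dots> = complex_of_real (exp (- (sd p q * l)\<^sup>2 / 2))"
        proof -
          have "0 \<le> (cc q - cc p) / \<alpha>" using cc_strict_mono[OF pq(2,3)] \<alpha> by simp
          then show ?thesis by (simp add: sd_def power_mult_distrib)
        qed
        also have "\<dots> = char (distr gauss borel (\<lambda>y. sd p q * y)) l" by (rule char_gauss_scale[symmetric])
        finally show "char (distr ?N borel (dG p q)) l = char (distr gauss borel (\<lambda>y. sd p q * y)) l" .
      qed
    qed
    then have "measure (distr gauss borel (\<lambda>y. sd p q * y)) B = measure ?N (dG p q -` B \<inter> space M)"
      using B by (metis N.prob_space_axioms \<open>dG p q \<in> borel_measurable ?N\<close> measure_distr space_uniform_measure)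
    also have "\<dots> = prob (E \<inter> (dG p q -` B \<inter> space M)) / prob E"
      using pE B by (intro measure_uniform_measure) (auto simp: emeasure_eq_measure)
    finally show ?thesis using pE by simp
  qed
qed

lemma dG_distr:
  assumes pq: "t \<le> p" "p < q" "q \<le> 1"
  shows "distr M borel (dG p q) = distr gauss borel (\<lambda>y. sd p q * y)"
proof (rule measure_eqI)
  have D[measurable]: "dG p q \<in> borel_measurable M" using pq by (intro dG_measurable) auto
  interpret D: prob_space "distr gauss borel (\<lambda>y. sd p q * y)" by (rule gauss.prob_space_distr) measurable
  fix B assume "B \<in> sets (distr M borel (dG p q))"
  then have B: "B \<in> sets borel" by simp
  have sp: "space M \<in> sets (natM p)" using sets.top[of "natM p"] by (simp only: space_natM)
  have "space M \<inter> (dG p q -` B \<inter> space M) = dG p q -` B \<inter> space M" by auto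
  then have "prob (dG p q -` B \<inter> space M) = measure (distr gauss borel (\<lambda>y. sd p q * y)) B"
    using natM_indep[OF pq sp B] by (simp add: prob_space)
  then show "emeasure (distr M borel (dG p q)) B = emeasure (distr gauss borel (\<lambda>y. sd p q * y)) B"
    using B unfolding D.emeasure_eq_measure by (simp add: emeasure_distr emeasure_eq_measure)
qed simp

lemma id_natM: "(\<lambda>\<omega>. \<omega>) \<in> measurable M (natM p)"
  using natM_events by (intro measurableI) (auto simp: space_natM)

text \<open>Independence in a form fit for Fubini: the identity map, read into
  \<open>natM p\<close>, carries the whole information up to \<open>p\<close> as first
  coordinate.\<close>

lemma joint_law:
  assumes pq: "t \<le> p" "p < q" "q \<le> 1"
  shows "distr M (natM p) (\<lambda>\<omega>. \<omega>) \<Otimes>\<^sub>M distr gauss borel (\<lambda>y. sd p q * y)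
     = distr M (natM p \<Otimes>\<^sub>M borel) (\<lambda>\<omega>. (\<omega>, dG p q \<omega>))"
proof (rule pair_measure_eqI)
  have D[measurable]: "dG p q \<in> borel_measurable M" using pq by (intro dG_measurable) auto
  interpret A: prob_space "distr M (natM p) (\<lambda>\<omega>. \<omega>)" by (rule prob_space_distr[OF id_natM])
  interpret B: prob_space "distr gauss borel (\<lambda>y. sd p q * y)" by (rule gauss.prob_space_distr) measurable
  show "sigma_finite_measure (distr M (natM p) (\<lambda>\<omega>. \<omega>))" ..
  show "sigma_finite_measure (distr gauss borel (\<lambda>y. sd p q * y))" ..
  show "sets (distr M (natM p) (\<lambda>\<omega>. \<omega>) \<Otimes>\<^sub>M distr gauss borel (\<lambda>y. sd p q * y))
     = sets (distr M (natM p \<Otimes>\<^sub>M borel) (\<lambda>\<omega>. (\<omega>, dG p q \<omega>)))"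
    by (simp only: sets_distr) (intro sets_pair_measure_cong, simp_all)
  fix E B assume "E \<in> sets (distr M (natM p) (\<lambda>\<omega>. \<omega>))" "B \<in> sets (distr gauss borel (\<lambda>y. sd p q * y))"
  then have EB: "E \<in> sets (natM p)" "B \<in> sets borel" by simp_all
  have pm: "(\<lambda>\<omega>. (\<omega>, dG p q \<omega>)) \<in> measurable M (natM p \<Otimes>\<^sub>M borel)" using id_natM D by (rule measurable_Pair)
  have Esp: "E \<subseteq> space M" using sets.sets_into_space[OF EB(1)] by (simp only: space_natM)
  have "emeasure (distr M (natM p \<Otimes>\<^sub>M borel) (\<lambda>\<omega>. (\<omega>, dG p q \<omega>))) (E \<times> B)
      = emeasure M ((\<lambda>\<omega>. (\<omega>, dG p q \<omega>)) -` (E \<times> B) \<inter> space M)"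
    using EB by (intro emeasure_distr[OF pm]) auto
  also have "(\<lambda>\<omega>. (\<omega>, dG p q \<omega>)) -` (E \<times> B) \<inter> space M = E \<inter> (dG p q -` B \<inter> space M)" by auto
  also have "emeasure M \<dots> = ennreal (prob E * measure (distr gauss borel (\<lambda>y. sd p q * y)) B)"
    unfolding emeasure_eq_measure natM_indep[OF pq EB] ..
  also have "\<dots> = emeasure (distr M (natM p) (\<lambda>\<omega>. \<omega>)) E * emeasure (distr gauss borel (\<lambda>y. sd p q * y)) B"
  proof -
    have "emeasure (distr M (natM p) (\<lambda>\<omega>. \<omega>)) E = ennreal (prob E)"
      using EB Esp by (subst emeasure_distr[OF id_natM]) (auto simp: emeasure_eq_measure Int_absorb2)
    then show ?thesis by (simp add: B.emeasure_eq_measure ennreal_mult)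
  qed
  finally show "emeasure (distr M (natM p) (\<lambda>\<omega>. \<omega>)) E * emeasure (distr gauss borel (\<lambda>y. sd p q * y)) B
      = emeasure (distr M (natM p \<Otimes>\<^sub>M borel) (\<lambda>\<omega>. (\<omega>, dG p q \<omega>))) (E \<times> B)" by simp
qed

lemma rho_diff:
  assumes "p \<le> 1" "q \<le> 1"
  shows "exp (- 2 * (rho p - rho q)) = cc p / cc q" "exp (- (rho p - rho q)) = sqrt (cc p / cc q)"
proof -
  have c: "0 < cc p" "0 < cc q" "0 < cc 1" using assms cc_pos by auto
  have "- 2 * (rho p - rho q) = ln (cc p / cc q)" using c by (simp add: rho_def ln_div field_simps)
  then show 1: "exp (- 2 * (rho p - rho q)) = cc p / cc q" using c by simp
  have "(exp (- (rho p - rho q)))\<^sup>2 = cc p / cc q" using 1 by (simp add: power2_eq_square flip: exp_add)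
  then show "exp (- (rho p - rho q)) = sqrt (cc p / cc q)"
    by (metis abs_of_nonneg exp_ge_zero real_sqrt_abs)
qed

lemma rho_mono: "p \<le> q \<Longrightarrow> q \<le> 1 \<Longrightarrow> rho q \<le> rho p"
  using cc_mono[of p q] cc_pos[of p] cc_pos[of q] cc_pos[of 1] by (simp add: rho_def frac_le)

lemma rho_strict_mono: "p < q \<Longrightarrow> q \<le> 1 \<Longrightarrow> rho q < rho p"
  using cc_strict_mono[of p q] cc_pos[of p] cc_pos[of q] cc_pos[of 1] by (simp add: rho_def divide_strict_left_mono)

lemma rho_1: "rho 1 = 0"
  using cc_pos[of 1] by (simp add: rho_def)

text \<open>An exact pathwise recursion, from
  \<open>exp (- (rho p - rho q)) = sqrt (cc p / cc q)\<close>; the normalised increment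
  \<open>dG p q \<omega> / sd p q\<close> is standard normal for \<open>t <= p\<close> by
  \<open>dG_distr\<close>.\<close>

lemma xi_step:
  assumes pq: "p < q" "q \<le> 1"
  shows "xi q \<omega> = exp (- (rho p - rho q)) * xi p \<omega> + sqrt (1 - exp (- 2 * (rho p - rho q))) * (dG p q \<omega> / sd p q)"
proof -
  have c: "0 < cc p" "0 < cc q" using pq cc_pos by auto
  have lt: "cc p < cc q" by (rule cc_strict_mono[OF pq])
  have a: "xi s \<omega> = sqrt (\<alpha> / cc s) * G s \<omega>" if "0 < cc s" for s
  proof -
    have "sqrt (\<alpha> * cc s) = sqrt (\<alpha> / cc s * (cc s)\<^sup>2)" using that by (simp add: power2_eq_square)
    also have "\<dots> = sqrt (\<alpha> / cc s) * cc s" by (subst real_sqrt_mult) (use that in simp)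
    finally show ?thesis by (simp add: xi_def G_def)
  qed
  have b: "sqrt (cc p / cc q) * sqrt (\<alpha> / cc p) = sqrt (\<alpha> / cc q)"
    using c by (simp flip: real_sqrt_mult)
  have d: "sqrt (1 - cc p / cc q) = sqrt (\<alpha> / cc q) * sd p q"
  proof -
    have "1 - cc p / cc q = \<alpha> / cc q * ((cc q - cc p) / \<alpha>)" using c \<alpha> by (simp add: field_simps)
    then show ?thesis unfolding sd_def by (simp only: real_sqrt_mult)
  qed
  have "sqrt (1 - cc p / cc q) * (dG p q \<omega> / sd p q) = sqrt (\<alpha> / cc q) * dG p q \<omega>"
    unfolding d using sd_pos[OF pq] by simp
  then show ?thesis
    unfolding rho_diff[OF order_trans[OF less_imp_le[OF pq(1)] pq(2)] pq(2)] a[OF c(1)] a[OF c(2)] mult.assoc[symmetric] b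
    by (simp add: dG_def algebra_simps)
qed

lemma xi_start: "AE \<omega> in M. xi t \<omega> = x0"
  using Z_start by eventually_elim (simp add: xi_def x0_def)

lemma xi_measurable: "t \<le> s \<Longrightarrow> s \<le> 1 \<Longrightarrow> xi s \<in> borel_measurable M"
  unfolding xi_def[abs_def] by measurable

lemma xi_natM: "t \<le> u \<Longrightarrow> u \<le> p \<Longrightarrow> u \<le> 1 \<Longrightarrow> xi u \<in> borel_measurable (natM p)"
  unfolding xi_def[abs_def] using Z_natM[of u p] by measurable

lemma xi_integrable:
  assumes g: "quartic_growth g" and q: "t \<le> q" "q \<le> 1" shows "integrable M (\<lambda>\<omega>. g (xi q \<omega>))"
proof -
  have gm[measurable]: "g \<in> borel_measurable borel" using g by (rule quartic_growth_measurable)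
  have [measurable]: "xi q \<in> borel_measurable M" "xi t \<in> borel_measurable M" using q t by (auto intro!: xi_measurable)
  show ?thesis
  proof (cases "q = t")
    case True
    have "AE \<omega> in M. g x0 = g (xi q \<omega>)" using xi_start by eventually_elim (simp add: True)
    moreover have "integrable M (\<lambda>\<omega>. g x0)" by simp
    ultimately show ?thesis by (subst integrable_cong_AE[where g="\<lambda>\<omega>. g x0"]) (auto simp: eq_commute)
  next
    case False
    then have tq: "t \<le> t" "t < q" "q \<le> 1" using q by auto
    let ?f = "\<lambda>y. g (exp (- (rho t - rho q)) * x0 + sqrt (1 - exp (- 2 * (rho t - rho q))) * (y / sd t q))"
    have D[measurable]: "dG t q \<in> borel_measurable M" using q by (intro dG_measurable) auto
    have "integrable (distr M borel (dG t q)) ?f"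
      unfolding dG_distr[OF tq] using sd_pos[OF tq(2,3)]
        ou_integrable[OF g, of "rho t - rho q" x0 "sqrt (1 - exp (- 2 * (rho t - rho q)))"] by (subst integrable_distr_eq) auto
    then have "integrable M (\<lambda>\<omega>. ?f (dG t q \<omega>))" by (subst (asm) integrable_distr_eq) auto
    moreover have "AE \<omega> in M. ?f (dG t q \<omega>) = g (xi q \<omega>)"
      using xi_start by eventually_elim (simp add: xi_step[OF tq(2,3)])
    ultimately show ?thesis by (subst integrable_cong_AE[where g="\<lambda>\<omega>. ?f (dG t q \<omega>)"]) (auto simp: eq_commute)
  qed
qed

text \<open>The process is not killed, whereas \<open>ou\<close> is, so the survival factor
  \<open>exp (- (rho p - rho q))\<close> multiplies the left side. Testing against events of
  \<open>natM p\<close> takes the place of conditional expectations.\<close>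

lemma markov:
  assumes pq: "t \<le> p" "p < q" "q \<le> 1" and E: "E \<in> sets (natM p)" and g: "quartic_growth g"
  shows "exp (- (rho p - rho q)) * expectation (\<lambda>\<omega>. indicator E \<omega> * g (xi q \<omega>))
     = expectation (\<lambda>\<omega>. indicator E \<omega> * ou (rho p - rho q) g (xi p \<omega>))"
proof -
  let ?d = "rho p - rho q"
  let ?N1 = "distr M (natM p) (\<lambda>\<omega>. \<omega>)" and ?N2 = "distr gauss borel (\<lambda>y. sd p q * y)"
  let ?\<phi> = "\<lambda>\<omega> y. indicator E \<omega> * g (exp (- ?d) * xi p \<omega> + sqrt (1 - exp (- 2 * ?d)) * (y / sd p q))"
  interpret A: prob_space ?N1 by (rule prob_space_distr[OF id_natM])
  interpret B: prob_space ?N2 by (rule gauss.prob_space_distr) measurable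
  interpret P: pair_sigma_finite ?N1 ?N2 ..
  have gm[measurable]: "g \<in> borel_measurable borel" using g by (rule quartic_growth_measurable)
  have Ee[measurable]: "E \<in> events" using E natM_events by auto
  have E'[measurable]: "E \<in> sets (natM p)" by (rule E)
  have D[measurable]: "dG p q \<in> borel_measurable M" using pq by (intro dG_measurable) auto
  have [measurable]: "xi q \<in> borel_measurable M" "xi p \<in> borel_measurable M" using pq by (auto intro!: xi_measurable)
  have xn[measurable]: "xi p \<in> borel_measurable (natM p)" using pq by (intro xi_natM) auto
  have pm: "(\<lambda>\<omega>. (\<omega>, dG p q \<omega>)) \<in> measurable M (natM p \<Otimes>\<^sub>M borel)" using id_natM D by (rule measurable_Pair)
  have \<phi>m: "(\<lambda>(\<omega>, y). ?\<phi> \<omega> y) \<in> borel_measurable (natM p \<Otimes>\<^sub>M borel)" by measurable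
  have ig: "integrable M (\<lambda>\<omega>. indicator E \<omega> * g (xi q \<omega>))"
    using integrable_real_mult_indicator[OF Ee xi_integrable[OF g, of q]] pq by (simp add: mult.commute)
  have eq: "?\<phi> \<omega> (dG p q \<omega>) = indicator E \<omega> * g (xi q \<omega>)" for \<omega>
    by (simp add: xi_step[OF pq(2,3), of \<omega>])
  have int: "integrable (?N1 \<Otimes>\<^sub>M ?N2) (\<lambda>(\<omega>, y). ?\<phi> \<omega> y)"
    unfolding joint_law[OF pq] using ig by (subst integrable_distr_eq[OF pm \<phi>m]) (simp only: prod.case eq)
  have "expectation (\<lambda>\<omega>. indicator E \<omega> * g (xi q \<omega>)) = (\<integral>p. (\<lambda>(\<omega>, y). ?\<phi> \<omega> y) p \<partial>(?N1 \<Otimes>\<^sub>M ?N2))"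
    unfolding joint_law[OF pq] by (subst integral_distr[OF pm \<phi>m]) (simp only: prod.case eq)
  also have "\<dots> = (\<integral>\<omega>. (\<integral>y. ?\<phi> \<omega> y \<partial>?N2) \<partial>?N1)" using P.integral_fst'[OF int] by simp
  also have "\<dots> = (\<integral>\<omega>. indicator E \<omega> * (exp ?d * ou ?d g (xi p \<omega>)) \<partial>?N1)"
  proof (rule Bochner_Integration.integral_cong[OF refl])
    fix \<omega>
    have "(\<integral>y. ?\<phi> \<omega> y \<partial>?N2) = (\<integral>y. ?\<phi> \<omega> (sd p q * y) \<partial>gauss)" by (subst integral_distr) auto
    also have "\<dots> = indicator E \<omega> * (\<integral>y. g (exp (- ?d) * xi p \<omega> + sqrt (1 - exp (- 2 * ?d)) * y) \<partial>gauss)"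
      using sd_pos[OF pq(2,3)] by simp
    also have "\<dots> = indicator E \<omega> * (exp ?d * ou ?d g (xi p \<omega>))"
      unfolding ou_def by (simp add: mult.assoc[symmetric] flip: exp_add)
    finally show "(\<integral>y. ?\<phi> \<omega> y \<partial>?N2) = indicator E \<omega> * (exp ?d * ou ?d g (xi p \<omega>))" .
  qed
  also have "\<dots> = expectation (\<lambda>\<omega>. indicator E \<omega> * (exp ?d * ou ?d g (xi p \<omega>)))"
  proof (rule integral_distr[OF id_natM])
    have [measurable]: "ou ?d g \<in> borel_measurable borel" by (rule ou_measurable[OF gm])
    show "(\<lambda>\<omega>. indicator E \<omega> * (exp ?d * ou ?d g (xi p \<omega>))) \<in> borel_measurable (natM p)" by measurable
  qed
  also have "\<dots> = exp ?d * expectation (\<lambda>\<omega>. indicator E \<omega> * ou ?d g (xi p \<omega>))"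
    by (subst integral_mult_right_zero[symmetric]) (simp only: mult.left_commute)
  finally show ?thesis by (simp add: mult.assoc[symmetric] flip: exp_add)
qed

lemma ou_expectation:
  assumes q: "t < q" "q \<le> 1" and g: "quartic_growth g"
  shows "expectation (\<lambda>\<omega>. g (xi q \<omega>)) = exp (rho t - rho q) * ou (rho t - rho q) g x0"
proof -
  have sp: "space M \<in> sets (natM t)" using sets.top[of "natM t"] by (simp only: space_natM)
  have [measurable]: "g \<in> borel_measurable borel" using g by (rule quartic_growth_measurable)
  have [measurable]: "xi t \<in> borel_measurable M" using t by (auto intro!: xi_measurable)
  have [measurable]: "ou (rho t - rho q) g \<in> borel_measurable borel" by (rule ou_measurable) measurable
  have 1: "expectation (\<lambda>\<omega>. indicator (space M) \<omega> * g (xi q \<omega>)) = expectation (\<lambda>\<omega>. g (xi q \<omega>))"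
    by (intro Bochner_Integration.integral_cong) auto
  have "expectation (\<lambda>\<omega>. indicator (space M) \<omega> * ou (rho t - rho q) g (xi t \<omega>)) = expectation (\<lambda>\<omega>. ou (rho t - rho q) g x0)"
    using xi_start by (intro integral_cong_AE) (auto elim!: eventually_mono)
  then have 2: "expectation (\<lambda>\<omega>. indicator (space M) \<omega> * ou (rho t - rho q) g (xi t \<omega>)) = ou (rho t - rho q) g x0"
    by (simp add: prob_space)
  have "exp (- (rho t - rho q)) * expectation (\<lambda>\<omega>. g (xi q \<omega>)) = ou (rho t - rho q) g x0"
    using markov[OF order_refl q sp g] unfolding 1 2 .
  then have "exp (rho t - rho q) * (exp (- (rho t - rho q)) * expectation (\<lambda>\<omega>. g (xi q \<omega>))) = exp (rho t - rho q) * ou (rho t - rho q) g x0"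
    by simp
  then show ?thesis by (simp add: mult.assoc[symmetric] del: minus_diff_eq flip: exp_add)
qed

section \<open>Optional stopping on a finite grid of times\<close>

text \<open>A discrete Dynkin formula: the stopped value telescopes over the steps
  \<open>i < k\<close>, and the Markov property at \<open>P i\<close> turns each increment into the
  defect of \<open>U i\<close> against the transported \<open>U (Suc i)\<close>. One formula serves
  non-positive defects, for an upper bound, and vanishing ones, for a stopping time that attains a
  value.\<close>

lemma optional_stopping:
  fixes P :: "nat \<Rightarrow> real" and U :: "nat \<Rightarrow> real \<Rightarrow> real" and k :: "'a \<Rightarrow> nat"
  assumes P0: "P 0 = t" and P: "\<And>i. i < K \<Longrightarrow> P i < P (Suc i)" "\<And>i. i \<le> K \<Longrightarrow> t \<le> P i \<and> P i \<le> 1"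
    and U: "\<And>i. i \<le> K \<Longrightarrow> quartic_growth (U i)"
    and k: "\<And>\<omega>. \<omega> \<in> space M \<Longrightarrow> k \<omega> \<le> K" "\<And>i. i < K \<Longrightarrow> {\<omega> \<in> space M. i < k \<omega>} \<in> sets (natM (P i))"
  defines "Y \<equiv> \<lambda>i \<omega>. exp (- (rho t - rho (P i))) * U i (xi (P i) \<omega>)"
  shows "integrable M (\<lambda>\<omega>. Y (k \<omega>) \<omega>)"
    and "expectation (\<lambda>\<omega>. Y (k \<omega>) \<omega>) = U 0 x0 + (\<Sum>i<K. exp (- (rho t - rho (P i))) *
      expectation (\<lambda>\<omega>. indicator {\<omega> \<in> space M. i < k \<omega>} \<omega> * (ou (rho (P i) - rho (P (Suc i))) (U (Suc i)) (xi (P i) \<omega>) - U i (xi (P i) \<omega>))))"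
proof -
  let ?B = "\<lambda>i. {\<omega> \<in> space M. i < k \<omega>}"
  have Be: "?B i \<in> events" if "i < K" for i using k(2)[OF that] natM_events by auto
  have Yi: "integrable M (Y i)" if "i \<le> K" for i
    unfolding Y_def using U[OF that] P(2)[OF that] by (intro integrable_mult_right xi_integrable) auto
  have dec: "Y (k \<omega>) \<omega> = Y 0 \<omega> + (\<Sum>i<K. indicator (?B i) \<omega> * (Y (Suc i) \<omega> - Y i \<omega>))" if "\<omega> \<in> space M" for \<omega>
  proof -
    have "(\<Sum>i<K. indicator (?B i) \<omega> * (Y (Suc i) \<omega> - Y i \<omega>)) = (\<Sum>i<k \<omega>. indicator (?B i) \<omega> * (Y (Suc i) \<omega> - Y i \<omega>))"
      using k(1)[OF that] by (intro sum.mono_neutral_right) auto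
    also have "\<dots> = (\<Sum>i<k \<omega>. Y (Suc i) \<omega> - Y i \<omega>)" using that by (intro sum.cong) auto
    also have "\<dots> = Y (k \<omega>) \<omega> - Y 0 \<omega>" by (rule sum_lessThan_telescope)
    finally show ?thesis by simp
  qed
  have ind: "integrable M (\<lambda>\<omega>. indicator (?B i) \<omega> * Y j \<omega>)" if "i < K" "j \<le> K" for i j
    using integrable_real_mult_indicator[OF Be[OF that(1)] Yi[OF that(2)]] by (simp add: mult.commute)
  have di: "integrable M (\<lambda>\<omega>. indicator (?B i) \<omega> * (Y (Suc i) \<omega> - Y i \<omega>))" if "i < K" for i
    using ind[OF that, of "Suc i"] ind[OF that, of i] that by (simp add: right_diff_distrib)
  have tot: "integrable M (\<lambda>\<omega>. Y 0 \<omega> + (\<Sum>i<K. indicator (?B i) \<omega> * (Y (Suc i) \<omega> - Y i \<omega>)))"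
    using Yi[of 0] di by (intro Bochner_Integration.integrable_add Bochner_Integration.integrable_sum) auto
  then show "integrable M (\<lambda>\<omega>. Y (k \<omega>) \<omega>)"
    by (subst Bochner_Integration.integrable_cong[OF refl dec]) auto
  have "expectation (\<lambda>\<omega>. Y (k \<omega>) \<omega>) = expectation (\<lambda>\<omega>. Y 0 \<omega> + (\<Sum>i<K. indicator (?B i) \<omega> * (Y (Suc i) \<omega> - Y i \<omega>)))"
    by (intro Bochner_Integration.integral_cong dec) auto
  also have "\<dots> = expectation (Y 0) + (\<Sum>i<K. expectation (\<lambda>\<omega>. indicator (?B i) \<omega> * (Y (Suc i) \<omega> - Y i \<omega>)))"
  proof -
    have di': "integrable M (\<lambda>\<omega>. indicator (?B i) \<omega> * (Y (Suc i) \<omega> - Y i \<omega>))" if "i \<in> {..<K}" for i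
      using di that by simp
    show ?thesis
      by (simp only: Bochner_Integration.integral_add[OF Yi[OF le0] Bochner_Integration.integrable_sum[OF di']]
          Bochner_Integration.integral_sum[OF di'])
  qed
  also have "expectation (Y 0) = U 0 x0"
  proof -
    have [measurable]: "U 0 \<in> borel_measurable borel" using U[of 0] by (intro quartic_growth_measurable) auto
    have [measurable]: "xi t \<in> borel_measurable M" using t by (auto intro!: xi_measurable)
    have "expectation (Y 0) = expectation (\<lambda>\<omega>. U 0 x0)"
      unfolding Y_def P0 using xi_start by (intro integral_cong_AE) (auto elim!: eventually_mono)
    then show ?thesis by (simp add: prob_space)
  qed
  also have "(\<Sum>i<K. expectation (\<lambda>\<omega>. indicator (?B i) \<omega> * (Y (Suc i) \<omega> - Y i \<omega>)))
      = (\<Sum>i<K. exp (- (rho t - rho (P i))) *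
      expectation (\<lambda>\<omega>. indicator (?B i) \<omega> * (ou (rho (P i) - rho (P (Suc i))) (U (Suc i)) (xi (P i) \<omega>) - U i (xi (P i) \<omega>))))"
  proof (rule sum.cong[OF refl])
    fix i assume "i \<in> {..<K}"
    then have i: "i < K" by simp
    let ?d = "rho (P i) - rho (P (Suc i))" and ?e = "exp (- (rho t - rho (P i)))"
    have Pi: "t \<le> P i" "P i < P (Suc i)" "P (Suc i) \<le> 1" using P(1)[OF i] P(2)[of i] P(2)[of "Suc i"] i by auto
    have d0: "0 \<le> ?d" using rho_mono[of "P i" "P (Suc i)"] Pi by simp
    have US: "quartic_growth (U (Suc i))" using U i by simp
    have io: "integrable M (\<lambda>\<omega>. indicator (?B i) \<omega> * ou ?d (U (Suc i)) (xi (P i) \<omega>))"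
      using integrable_real_mult_indicator[OF Be[OF i] xi_integrable[OF ou_quartic_growth[OF US d0], of "P i"]] Pi
      by (simp add: mult.commute)
    have iu: "integrable M (\<lambda>\<omega>. indicator (?B i) \<omega> * U i (xi (P i) \<omega>))"
      using integrable_real_mult_indicator[OF Be[OF i] xi_integrable[OF U[of i], of "P i"]] Pi i
      by (simp add: mult.commute)
    have "expectation (\<lambda>\<omega>. indicator (?B i) \<omega> * (Y (Suc i) \<omega> - Y i \<omega>))
        = expectation (\<lambda>\<omega>. indicator (?B i) \<omega> * Y (Suc i) \<omega>) - expectation (\<lambda>\<omega>. indicator (?B i) \<omega> * Y i \<omega>)"
      using ind[OF i, of "Suc i"] ind[OF i, of i] i by (simp add: right_diff_distrib)
    also have "expectation (\<lambda>\<omega>. indicator (?B i) \<omega> * Y i \<omega>) = ?e * expectation (\<lambda>\<omega>. indicator (?B i) \<omega> * U i (xi (P i) \<omega>))"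
      unfolding Y_def by (simp only: mult.left_commute integral_mult_right_zero)
    also have "expectation (\<lambda>\<omega>. indicator (?B i) \<omega> * Y (Suc i) \<omega>)
        = exp (- (rho t - rho (P (Suc i)))) * expectation (\<lambda>\<omega>. indicator (?B i) \<omega> * U (Suc i) (xi (P (Suc i)) \<omega>))"
      unfolding Y_def by (simp only: mult.left_commute integral_mult_right_zero)
    also have "exp (- (rho t - rho (P (Suc i)))) = ?e * exp (- ?d)" by (simp flip: exp_add)
    also have "?e * exp (- ?d) * expectation (\<lambda>\<omega>. indicator (?B i) \<omega> * U (Suc i) (xi (P (Suc i)) \<omega>))
        = ?e * expectation (\<lambda>\<omega>. indicator (?B i) \<omega> * ou ?d (U (Suc i)) (xi (P i) \<omega>))"
      unfolding mult.assoc markov[OF Pi k(2)[OF i] US] ..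
    also have "\<dots> - ?e * expectation (\<lambda>\<omega>. indicator (?B i) \<omega> * U i (xi (P i) \<omega>))
        = ?e * expectation (\<lambda>\<omega>. indicator (?B i) \<omega> * (ou ?d (U (Suc i)) (xi (P i) \<omega>) - U i (xi (P i) \<omega>)))"
      unfolding right_diff_distrib Bochner_Integration.integral_diff[OF io iu] ..
    finally show "expectation (\<lambda>\<omega>. indicator (?B i) \<omega> * (Y (Suc i) \<omega> - Y i \<omega>))
        = ?e * expectation (\<lambda>\<omega>. indicator (?B i) \<omega> * (ou ?d (U (Suc i)) (xi (P i) \<omega>) - U i (xi (P i) \<omega>)))" .
  qed
  finally show "expectation (\<lambda>\<omega>. Y (k \<omega>) \<omega>) = U 0 x0 + (\<Sum>i<K. exp (- (rho t - rho (P i))) *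
      expectation (\<lambda>\<omega>. indicator {\<omega> \<in> space M. i < k \<omega>} \<omega> * (ou (rho (P i) - rho (P (Suc i))) (U (Suc i)) (xi (P i) \<omega>) - U i (xi (P i) \<omega>))))" .
qed


definition A0 :: real where "A0 = 1 / sqrt (\<alpha> * cc t)"

lemma A0_pos: "0 < A0"
  using \<alpha> cc_pos[of t] t by (simp add: A0_def)

text \<open>The discount cancels the time-dependent scaling and leaves the constant
  \<open>A0\<close> fixed by the starting time. Up to the shift \<open>\<kappa>\<close>, the
  stopping reward is thus \<open>A0\<close> times a discounted \<open>xi\<close>.\<close>

lemma Z_eq_xi:
  assumes q: "q \<le> 1" shows "Z q \<omega> - \<kappa> = A0 * (exp (- (rho t - rho q)) * xi q \<omega>)"
proof -
  have c: "0 < cc t" "0 < cc q" using q t cc_pos by auto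
  have "A0 * sqrt (cc t / cc q) * sqrt (\<alpha> * cc q) = 1"
    using c \<alpha> unfolding A0_def by (simp add: real_sqrt_mult real_sqrt_divide)
  moreover have "exp (- (rho t - rho q)) = sqrt (cc t / cc q)" using rho_diff(2)[of t q] t q by simp
  ultimately have "A0 * exp (- (rho t - rho q)) * sqrt (\<alpha> * cc q) = 1" by simp
  then have "A0 * (exp (- (rho t - rho q)) * xi q \<omega>) = 1 * (Z q \<omega> - \<kappa>)"
    unfolding xi_def by (metis mult.assoc)
  then show ?thesis by simp
qed

lemma Z_start_value: "A0 * x0 = z - \<kappa>"
  using \<alpha> cc_pos[of t] t by (simp add: A0_def x0_def)

section \<open>Optimal stopping of the bridge\<close>

text \<open>The ceiling rounds \<open>\<tau>\<close> up to the partition, so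
  \<open>i < grid_index N \<tau> \<omega>\<close> means that \<open>\<tau>\<close> exceeds the
  elapsed time of the i-th point, an event known at that point.\<close>

definition grid_index :: "nat \<Rightarrow> ('a \<Rightarrow> real) \<Rightarrow> 'a \<Rightarrow> nat" where
  "grid_index N \<tau> \<omega> = nat \<lceil>\<tau> \<omega> / (1 - t) * 2 ^ N\<rceil>"

lemma grid_index_le:
  assumes "0 \<le> \<tau> \<omega>" "\<tau> \<omega> \<le> 1 - t" shows "grid_index N \<tau> \<omega> \<le> 2 ^ N"
proof -
  have "\<tau> \<omega> / (1 - t) * 2 ^ N \<le> 1 * 2 ^ N" using assms t by (intro mult_right_mono) auto
  then have "\<lceil>\<tau> \<omega> / (1 - t) * 2 ^ N\<rceil> \<le> \<lceil>real_of_int (2 ^ N)\<rceil>" by (intro ceiling_mono) simp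
  then show ?thesis unfolding grid_index_def by (simp only: ceiling_of_int) (simp add: nat_le_iff)
qed

lemma grid_index_gt:
  assumes "0 \<le> \<tau> \<omega>" shows "i < grid_index N \<tau> \<omega> \<longleftrightarrow> pt t 1 N i - t < \<tau> \<omega>"
proof -
  have "i < grid_index N \<tau> \<omega> \<longleftrightarrow> int i < \<lceil>\<tau> \<omega> / (1 - t) * 2 ^ N\<rceil>" by (simp add: grid_index_def zless_nat_eq_int_zless)
  also have "\<dots> \<longleftrightarrow> real i < \<tau> \<omega> / (1 - t) * 2 ^ N" by (simp add: less_ceiling_iff)
  also have "\<dots> \<longleftrightarrow> pt t 1 N i - t < \<tau> \<omega>" using t by (simp add: pt_def field_simps)
  finally show ?thesis .
qed

lemma grid_time_bounds:
  assumes "0 \<le> \<tau> \<omega>" "\<tau> \<omega> \<le> 1 - t"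
  shows "t + \<tau> \<omega> \<le> pt t 1 N (grid_index N \<tau> \<omega>)" "pt t 1 N (grid_index N \<tau> \<omega>) \<le> t + \<tau> \<omega> + (1 - t) * (1 / 2) ^ N"
proof -
  let ?x = "\<tau> \<omega> / (1 - t) * 2 ^ N"
  have x: "0 \<le> ?x" using assms t by simp
  have k: "real (grid_index N \<tau> \<omega>) = of_int \<lceil>?x\<rceil>" using x by (simp add: grid_index_def)
  have a: "?x \<le> real (grid_index N \<tau> \<omega>)" "real (grid_index N \<tau> \<omega>) \<le> ?x + 1" unfolding k by linarith+
  have b: "?x / 2 ^ N \<le> real (grid_index N \<tau> \<omega>) / 2 ^ N" "real (grid_index N \<tau> \<omega>) / 2 ^ N \<le> (?x + 1) / 2 ^ N"
    by (rule divide_right_mono[OF a(1)], simp) (rule divide_right_mono[OF a(2)], simp)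
  have "(1 - t) * (?x / 2 ^ N) \<le> (1 - t) * (real (grid_index N \<tau> \<omega>) / 2 ^ N)"
    "(1 - t) * (real (grid_index N \<tau> \<omega>) / 2 ^ N) \<le> (1 - t) * ((?x + 1) / 2 ^ N)"
    by (rule mult_left_mono[OF b(1)], use t in simp) (rule mult_left_mono[OF b(2)], use t in simp)
  moreover have "(1 - t) * (?x / 2 ^ N) = \<tau> \<omega>" using t by simp
  moreover have "(1 - t) * ((?x + 1) / 2 ^ N) = \<tau> \<omega> + (1 - t) * (1 / 2) ^ N"
    using t by (simp add: add_divide_distrib power_divide distrib_left)
  ultimately show "t + \<tau> \<omega> \<le> pt t 1 N (grid_index N \<tau> \<omega>)"
    "pt t 1 N (grid_index N \<tau> \<omega>) \<le> t + \<tau> \<omega> + (1 - t) * (1 / 2) ^ N"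
    by (simp_all add: pt_def)
qed

text \<open>Rounded times approach from the right, and paths are continuous on \<open>[t, 1)\<close>
  for every outcome; if \<open>\<tau> \<omega> = 1 - t\<close>, all rounded times are exactly 1 and
  the sequence is constant.\<close>

lemma Z_grid_tendsto:
  assumes \<omega>: "\<omega> \<in> space M" and \<tau>: "0 \<le> \<tau> \<omega>" "\<tau> \<omega> \<le> 1 - t"
  shows "(\<lambda>N. Z (pt t 1 N (grid_index N \<tau> \<omega>)) \<omega>) \<longlonglongrightarrow> Z (t + \<tau> \<omega>) \<omega>"
proof (cases "\<tau> \<omega> = 1 - t")
  case True
  have "pt t 1 N (grid_index N \<tau> \<omega>) = 1" for N
    using grid_time_bounds(1)[where \<tau>=\<tau>, OF \<tau>, of N] pt_mem[OF _ grid_index_le[where \<tau>=\<tau>, OF \<tau>], of t 1 N] True t by simp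
  then show ?thesis using True by simp
next
  case False
  let ?p = "\<lambda>N. pt t 1 N (grid_index N \<tau> \<omega>)"
  have "?p \<longlonglongrightarrow> t + \<tau> \<omega>"
  proof (rule tendsto_sandwich)
    show "\<forall>\<^sub>F N in sequentially. t + \<tau> \<omega> \<le> ?p N" using grid_time_bounds(1)[where \<tau>=\<tau>, OF \<tau>] by simp
    show "\<forall>\<^sub>F N in sequentially. ?p N \<le> t + \<tau> \<omega> + (1 - t) * (1 / 2) ^ N" using grid_time_bounds(2)[where \<tau>=\<tau>, OF \<tau>] by simp
    have "(\<lambda>N. t + \<tau> \<omega> + (1 - t) * (1 / 2) ^ N) \<longlonglongrightarrow> t + \<tau> \<omega> + (1 - t) * 0"
      by (intro tendsto_intros LIMSEQ_power_zero) simp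
    then show "(\<lambda>N. t + \<tau> \<omega> + (1 - t) * (1 / 2) ^ N) \<longlonglongrightarrow> t + \<tau> \<omega>" by simp
  qed simp
  moreover have lt: "t + \<tau> \<omega> < 1" using False \<tau> by simp
  ultimately have ev: "\<forall>\<^sub>F N in sequentially. ?p N < 1" by (rule order_tendstoD(2))
  show ?thesis
  proof (rule continuous_on_tendsto_compose[OF Z_continuous[OF \<omega>] \<open>?p \<longlonglongrightarrow> t + \<tau> \<omega>\<close>])
    show "t + \<tau> \<omega> \<in> {t..<1}" using lt \<tau> by simp
    show "\<forall>\<^sub>F N in sequentially. ?p N \<in> {t..<1}"
      using ev
    proof eventually_elim
      case (elim N)
      then show ?case using grid_time_bounds(1)[where \<tau>=\<tau>, OF \<tau>, of N] \<tau> by simp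
    qed
  qed
qed

lemma sum_nonpos_exp: "(\<And>i. i < K \<Longrightarrow> E i \<le> 0) \<Longrightarrow> (\<Sum>i<K. exp (f i) * E i) \<le> (0::real)" for K :: nat
  by (intro sum_nonpos mult_nonneg_nonpos) auto

text \<open>If \<open>U\<close> dominates its own transport, every defect in
  \<open>optional_stopping\<close> is non-positive.\<close>

lemma stopped_supermartingale:
  assumes \<tau>: "stopping_time (natural_filtration_from M t Z) \<tau>" "\<And>\<omega>. \<omega> \<in> space M \<Longrightarrow> \<tau> \<omega> \<in> {0..1 - t}"
    and U: "\<And>r. quartic_growth (U r)"
    and super: "\<And>r d x. 0 \<le> r \<Longrightarrow> 0 \<le> d \<Longrightarrow> ou d (U r) x \<le> U (r + d) x"
  defines "Y \<equiv> \<lambda>N \<omega>. exp (- (rho t - rho (pt t 1 N (grid_index N \<tau> \<omega>)))) *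
      U (rho (pt t 1 N (grid_index N \<tau> \<omega>))) (xi (pt t 1 N (grid_index N \<tau> \<omega>)) \<omega>)"
  shows "integrable M (Y N)" "expectation (Y N) \<le> U (rho t) x0"
proof -
  let ?P = "pt t 1 N" and ?k = "grid_index N \<tau>"
  have P: "t \<le> ?P i \<and> ?P i \<le> 1" if "i \<le> 2 ^ N" for i using pt_mem[OF _ that, of t 1] t by simp
  have Pl: "?P i < ?P (Suc i)" for i using t by (intro pt_less) auto
  have kB: "{\<omega> \<in> space M. i < ?k \<omega>} \<in> sets (natM (?P i))" for i
  proof -
    have "{\<omega> \<in> space M. i < ?k \<omega>} = {\<omega> \<in> space (natM (?P i)). ?P i - t < \<tau> \<omega>}"
      using \<tau>(2) by (auto simp: space_natM grid_index_gt)
    also have "\<dots> \<in> sets (natM (?P i))"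
      using stopping_timeD2[OF \<tau>(1), of "?P i - t"] by (simp add: pred_def)
    finally show ?thesis .
  qed
  have kK: "\<omega> \<in> space M \<Longrightarrow> ?k \<omega> \<le> 2 ^ N" for \<omega> using \<tau>(2) by (intro grid_index_le) auto
  note os = optional_stopping[of ?P "2 ^ N" "\<lambda>i. U (rho (?P i))" ?k, OF pt_0 Pl P U kK kB]
  show "integrable M (Y N)" unfolding Y_def by (rule os(1))
  have "expectation (Y N) = U (rho (?P 0)) x0 + (\<Sum>i<2 ^ N. exp (- (rho t - rho (?P i))) *
      expectation (\<lambda>\<omega>. indicator {\<omega> \<in> space M. i < ?k \<omega>} \<omega> *
        (ou (rho (?P i) - rho (?P (Suc i))) (U (rho (?P (Suc i)))) (xi (?P i) \<omega>) - U (rho (?P i)) (xi (?P i) \<omega>))))"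
    unfolding Y_def by (rule os(2))
  also have "\<dots> \<le> U (rho (?P 0)) x0 + 0"
  proof (intro add_left_mono sum_nonpos_exp)
    fix i :: nat assume i: "i < 2 ^ N"
    let ?d = "rho (?P i) - rho (?P (Suc i))"
    have Pi: "?P i \<le> ?P (Suc i)" "?P (Suc i) \<le> 1" using Pl[of i] P[of "Suc i"] i by auto
    have "ou ?d (U (rho (?P (Suc i)))) y \<le> U (rho (?P (Suc i)) + ?d) y" for y
      using rho_mono[OF Pi] rho_mono[of "?P (Suc i)" 1] Pi by (intro super) (auto simp: rho_1)
    then have le: "ou ?d (U (rho (?P (Suc i)))) y - U (rho (?P i)) y \<le> 0" for y by simp
    have "0 \<le> expectation (\<lambda>\<omega>. - (indicator {\<omega> \<in> space M. i < ?k \<omega>} \<omega> *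
        (ou ?d (U (rho (?P (Suc i)))) (xi (?P i) \<omega>) - U (rho (?P i)) (xi (?P i) \<omega>))))"
      using le by (intro integral_nonneg_AE AE_I2) (auto split: split_indicator)
    then show "expectation (\<lambda>\<omega>. indicator {\<omega> \<in> space M. i < ?k \<omega>} \<omega> *
        (ou ?d (U (rho (?P (Suc i)))) (xi (?P i) \<omega>) - U (rho (?P i)) (xi (?P i) \<omega>))) \<le> 0"
      by simp
  qed
  finally show "expectation (Y N) \<le> U (rho t) x0" by simp
qed

text \<open>The integrability part of \<open>optional_stopping\<close> for the identity yields
  measurability of the stopped variable.\<close>

lemma grid_Z_measurable:
  assumes \<tau>: "stopping_time (natural_filtration_from M t Z) \<tau>" "\<And>\<omega>. \<omega> \<in> space M \<Longrightarrow> \<tau> \<omega> \<in> {0..1 - t}"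
  shows "(\<lambda>\<omega>. Z (pt t 1 N (grid_index N \<tau> \<omega>)) \<omega> - \<kappa>) \<in> borel_measurable M"
proof -
  have "integrable M (\<lambda>\<omega>. exp (- (rho t - rho (pt t 1 N (grid_index N \<tau> \<omega>)))) * xi (pt t 1 N (grid_index N \<tau> \<omega>)) \<omega>)"
  proof (rule optional_stopping(1)[of "pt t 1 N" "2 ^ N" "\<lambda>_ x. x" "grid_index N \<tau>"])
    show "pt t 1 N 0 = t" by simp
    show "pt t 1 N i < pt t 1 N (Suc i)" for i using t by (intro pt_less) auto
    show "t \<le> pt t 1 N i \<and> pt t 1 N i \<le> 1" if "i \<le> 2 ^ N" for i using pt_mem[OF _ that, of t 1] t by simp
    show "grid_index N \<tau> \<omega> \<le> 2 ^ N" if "\<omega> \<in> space M" for \<omega> using \<tau>(2)[OF that] by (intro grid_index_le) auto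
    show "{\<omega> \<in> space M. i < grid_index N \<tau> \<omega>} \<in> sets (natM (pt t 1 N i))" for i
    proof -
      have "{\<omega> \<in> space M. i < grid_index N \<tau> \<omega>} = {\<omega> \<in> space (natM (pt t 1 N i)). pt t 1 N i - t < \<tau> \<omega>}"
        using \<tau>(2) by (auto simp: space_natM grid_index_gt)
      also have "\<dots> \<in> sets (natM (pt t 1 N i))"
        using stopping_timeD2[OF \<tau>(1), of "pt t 1 N i - t"] by (simp add: pred_def)
      finally show ?thesis .
    qed
  qed simp
  then have "(\<lambda>\<omega>. A0 * (exp (- (rho t - rho (pt t 1 N (grid_index N \<tau> \<omega>)))) * xi (pt t 1 N (grid_index N \<tau> \<omega>)) \<omega>)) \<in> borel_measurable M"
    by (intro borel_measurable_times borel_measurable_const borel_measurable_integrable)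
  moreover have "A0 * (exp (- (rho t - rho (pt t 1 N (grid_index N \<tau> \<omega>)))) * xi (pt t 1 N (grid_index N \<tau> \<omega>)) \<omega>)
      = Z (pt t 1 N (grid_index N \<tau> \<omega>)) \<omega> - \<kappa>" if "\<omega> \<in> space M" for \<omega>
  proof -
    have "grid_index N \<tau> \<omega> \<le> 2 ^ N" using \<tau>(2)[OF that] by (intro grid_index_le) auto
    then have "pt t 1 N (grid_index N \<tau> \<omega>) \<le> 1" using pt_mem[of t 1] t by simp
    then show ?thesis by (rule Z_eq_xi[symmetric])
  qed
  ultimately show ?thesis by (subst measurable_cong) (auto simp: eq_commute)
qed

text \<open>On each grid the reward is bounded by the supermartingale of \<open>ou_value\<close>.
  For the limit, the excessive quadratic bounds the second moments uniformly; Fatou, applied to the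
  non-negative \<open>x + \<epsilon> * x^2 + 1 / (4 * \<epsilon>)\<close>, gives the bound with an
  extra \<open>\<epsilon> * C\<close>, and \<open>\<epsilon>\<close> tends to 0.\<close>

theorem stopped_value_le:
  assumes \<tau>: "\<tau> \<in> stopping_times_from M t Z"
  shows "(\<integral>\<omega>. Z (t + \<tau> \<omega>) \<omega> \<partial>M) \<le> \<kappa> + A0 * ou_value (rho t) x0"
proof -
  have \<tau>1: "stopping_time (natural_filtration_from M t Z) \<tau>" and \<tau>2: "\<And>\<omega>. \<omega> \<in> space M \<Longrightarrow> \<tau> \<omega> \<in> {0..1 - t}"
    using \<tau> by (auto simp: stopping_times_from_def)
  define k where "k N = grid_index N \<tau>" for N
  define P where "P N \<omega> = pt t 1 N (k N \<omega>)" for N \<omega>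
  define X where "X N \<omega> = Z (P N \<omega>) \<omega> - \<kappa>" for N \<omega>
  define X0 where "X0 \<omega> = Z (t + \<tau> \<omega>) \<omega> - \<kappa>" for \<omega>
  define v where "v = A0 * ou_value (rho t) x0"
  define C where "C = 4 * A0\<^sup>2 * (1 + x0\<^sup>2 / 4)"
  have P1: "P N \<omega> \<le> 1" "t \<le> P N \<omega>" if "\<omega> \<in> space M" for N \<omega>
  proof -
    have "k N \<omega> \<le> 2 ^ N" using \<tau>2[OF that] unfolding k_def by (intro grid_index_le) auto
    then show "P N \<omega> \<le> 1" "t \<le> P N \<omega>" using pt_mem[of t 1] t by (auto simp: P_def)
  qed
  have Xe: "X N \<omega> = A0 * (exp (- (rho t - rho (P N \<omega>))) * xi (P N \<omega>) \<omega>)" if "\<omega> \<in> space M" for N \<omega>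
    unfolding X_def by (rule Z_eq_xi[OF P1(1)[OF that]])
  have Xm[measurable]: "X N \<in> borel_measurable M" for N
    unfolding X_def[abs_def] P_def k_def by (rule grid_Z_measurable[OF \<tau>1 \<tau>2])
  have lim: "(\<lambda>N. X N \<omega>) \<longlonglongrightarrow> X0 \<omega>" if "\<omega> \<in> space M" for \<omega>
    unfolding X_def X0_def P_def k_def using \<tau>2[OF that] by (intro tendsto_intros Z_grid_tendsto that) auto
  have X0m[measurable]: "X0 \<in> borel_measurable M" by (rule borel_measurable_LIMSEQ_metric[OF Xm lim])
  define Y1 where "Y1 N \<omega> = exp (- (rho t - rho (P N \<omega>))) * ou_value (rho (P N \<omega>)) (xi (P N \<omega>) \<omega>)" for N \<omega>
  define Y2 where "Y2 N \<omega> = exp (- (rho t - rho (P N \<omega>))) * (1 + (xi (P N \<omega>) \<omega>)\<^sup>2 / 4)" for N \<omega>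
  have Y1: "integrable M (Y1 N)" "expectation (Y1 N) \<le> ou_value (rho t) x0" for N
    unfolding Y1_def[abs_def] P_def k_def
    by (intro stopped_supermartingale[OF \<tau>1 \<tau>2, of ou_value] payoff_like_quartic_growth payoff_like_ou_value ou_ou_value_le; assumption)+
  have Y2: "integrable M (Y2 N)" "expectation (Y2 N) \<le> 1 + x0\<^sup>2 / 4" for N
    unfolding Y2_def[abs_def] P_def k_def
    by (intro stopped_supermartingale[OF \<tau>1 \<tau>2, of "\<lambda>_ x. 1 + x\<^sup>2 / 4"] quadratic_quartic_growth ou_quadratic_le; assumption)+
  have le1: "X N \<omega> \<le> A0 * Y1 N \<omega>" if "\<omega> \<in> space M" for N \<omega>
    unfolding Xe[OF that] Y1_def using A0_pos payoff_like_ge[OF payoff_like_ou_value]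
    by (intro mult_left_mono) auto
  have le2: "(X N \<omega>)\<^sup>2 \<le> 4 * A0\<^sup>2 * Y2 N \<omega>" if "\<omega> \<in> space M" for N \<omega>
  proof -
    let ?e = "exp (- (rho t - rho (P N \<omega>)))" and ?x = "xi (P N \<omega>) \<omega>"
    have "0 \<le> rho t - rho (P N \<omega>)" using rho_mono[of t "P N \<omega>"] P1[OF that, of N] by simp
    \<comment> \<open>The square of the reward carries two discount factors, the quadratic
      supermartingale only one.\<close>
    then have "?e\<^sup>2 \<le> ?e" by (simp add: power2_eq_square mult_left_le)
    then have "?e\<^sup>2 * ?x\<^sup>2 \<le> ?e * (4 * (1 + ?x\<^sup>2 / 4))" by (intro mult_mono) auto
    then have "A0\<^sup>2 * (?e\<^sup>2 * ?x\<^sup>2) \<le> A0\<^sup>2 * (?e * (4 * (1 + ?x\<^sup>2 / 4)))" by (intro mult_left_mono) auto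
    moreover have "(a * (e * x))\<^sup>2 = a\<^sup>2 * (e\<^sup>2 * x\<^sup>2)" "4 * a\<^sup>2 * (e * y) = a\<^sup>2 * (e * (4 * y))" for a e x y :: real
      by (simp_all add: power_mult_distrib)
    ultimately show ?thesis unfolding Xe[OF that] Y2_def by (simp only:)
  qed
  have X2i: "integrable M (\<lambda>\<omega>. (X N \<omega>)\<^sup>2)" for N
  proof (rule Bochner_Integration.integrable_bound)
    show "integrable M (\<lambda>\<omega>. 4 * A0\<^sup>2 * Y2 N \<omega>)" using Y2(1) by (rule integrable_mult_right)
    show "AE \<omega> in M. norm ((X N \<omega>)\<^sup>2) \<le> norm (4 * A0\<^sup>2 * Y2 N \<omega>)"
    proof (rule AE_I2)
      fix \<omega> assume "\<omega> \<in> space M"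
      from le2[OF this, of N] show "norm ((X N \<omega>)\<^sup>2) \<le> norm (4 * A0\<^sup>2 * Y2 N \<omega>)"
        by (simp only: real_norm_def abs_power2)
    qed
  qed measurable
  have Xi: "integrable M (X N)" for N by (rule square_integrable_imp_integrable[OF Xm X2i])
  have EX: "expectation (X N) \<le> v" for N
  proof -
    have "expectation (X N) \<le> expectation (\<lambda>\<omega>. A0 * Y1 N \<omega>)"
      using le1 by (intro integral_mono Xi integrable_mult_right Y1(1)) auto
    also have "\<dots> \<le> v" unfolding v_def using Y1(2)[of N] A0_pos by simp
    finally show ?thesis .
  qed
  have EX2: "expectation (\<lambda>\<omega>. (X N \<omega>)\<^sup>2) \<le> C" for N
  proof -
    have "expectation (\<lambda>\<omega>. (X N \<omega>)\<^sup>2) \<le> expectation (\<lambda>\<omega>. 4 * A0\<^sup>2 * Y2 N \<omega>)"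
      using le2 by (intro integral_mono X2i integrable_mult_right Y2(1)) auto
    also have "\<dots> \<le> C" unfolding C_def using Y2(2)[of N] by (simp add: mult_left_mono)
    finally show ?thesis .
  qed
  have C0: "0 \<le> C" by (simp add: C_def)
  have fatou: "(\<integral>\<^sup>+\<omega>. ennreal (f (X0 \<omega>)) \<partial>M) \<le> ennreal c"
    if f: "continuous_on UNIV f" "\<And>x. 0 \<le> f x" and fi: "\<And>N. integrable M (\<lambda>\<omega>. f (X N \<omega>))" and fc: "\<And>N. expectation (\<lambda>\<omega>. f (X N \<omega>)) \<le> c"
    for f :: "real \<Rightarrow> real" and c
  proof -
    have [measurable]: "f \<in> borel_measurable borel" by (rule borel_measurable_continuous_onI[OF f(1)])
    have "(\<integral>\<^sup>+\<omega>. ennreal (f (X0 \<omega>)) \<partial>M) = (\<integral>\<^sup>+\<omega>. liminf (\<lambda>N. ennreal (f (X N \<omega>))) \<partial>M)"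
    proof (rule nn_integral_cong)
      fix \<omega> assume "\<omega> \<in> space M"
      have "(\<lambda>N. ennreal (f (X N \<omega>))) \<longlonglongrightarrow> ennreal (f (X0 \<omega>))"
        by (intro tendsto_ennrealI continuous_on_tendsto_compose[OF f(1) lim[OF \<open>\<omega> \<in> space M\<close>]]) auto
      then show "ennreal (f (X0 \<omega>)) = liminf (\<lambda>N. ennreal (f (X N \<omega>)))"
        by (intro lim_imp_Liminf[symmetric]) auto
    qed
    also have "\<dots> \<le> liminf (\<lambda>N. \<integral>\<^sup>+\<omega>. ennreal (f (X N \<omega>)) \<partial>M)" by (rule nn_integral_liminf) measurable
    also have "\<dots> \<le> ennreal c"
    proof (rule Liminf_le)
      show "\<forall>\<^sub>F N in sequentially. (\<integral>\<^sup>+\<omega>. ennreal (f (X N \<omega>)) \<partial>M) \<le> ennreal c"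
        using fi fc f(2) by (intro always_eventually allI) (simp add: nn_integral_eq_integral ennreal_leI)
    qed simp
    finally show ?thesis .
  qed
  have "(\<integral>\<^sup>+\<omega>. ennreal ((X0 \<omega>)\<^sup>2) \<partial>M) \<le> ennreal C"
    by (rule fatou) (auto intro!: continuous_intros X2i EX2)
  then have X02i: "integrable M (\<lambda>\<omega>. (X0 \<omega>)\<^sup>2)"
    by (intro integrableI_bounded) (auto simp: order.strict_trans1[OF _ ennreal_less_top])
  have X0i: "integrable M X0" by (rule square_integrable_imp_integrable[OF X0m X02i])
  have main: "expectation X0 \<le> v + \<epsilon> * C" if \<epsilon>: "0 < \<epsilon>" for \<epsilon>
  proof -
    \<comment> \<open>A completed square, hence non-negative; it adds to the identity only a small
      multiple of \<open>x^2\<close> and a constant that cancels in the end.\<close>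
    let ?f = "\<lambda>x::real. x + \<epsilon> * x\<^sup>2 + 1 / (4 * \<epsilon>)"
    have f0: "0 \<le> ?f x" for x
    proof -
      have "?f x = \<epsilon> * (x + 1 / (2 * \<epsilon>))\<^sup>2" using \<epsilon> by (simp add: power2_eq_square field_simps)
      then show ?thesis using \<epsilon> by simp
    qed
    have i0: "integrable M (\<lambda>\<omega>. ?f (X0 \<omega>))" using X0i X02i by simp
    have "(\<integral>\<^sup>+\<omega>. ennreal (?f (X0 \<omega>)) \<partial>M) \<le> ennreal (v + \<epsilon> * C + 1 / (4 * \<epsilon>))"
    proof (rule fatou[OF _ f0])
      show "continuous_on UNIV ?f" by (intro continuous_intros)
      show "integrable M (\<lambda>\<omega>. ?f (X N \<omega>))" for N using Xi X2i by simp
      show "expectation (\<lambda>\<omega>. ?f (X N \<omega>)) \<le> v + \<epsilon> * C + 1 / (4 * \<epsilon>)" for N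
        using Xi[of N] X2i[of N] EX[of N] EX2[of N] \<epsilon> by (simp add: prob_space add_mono mult_left_mono)
    qed
    then have "ennreal (expectation (\<lambda>\<omega>. ?f (X0 \<omega>))) \<le> ennreal (v + \<epsilon> * C + 1 / (4 * \<epsilon>))"
      using nn_integral_eq_integral[OF i0] f0 by simp
    moreover have "0 \<le> v + \<epsilon> * C + 1 / (4 * \<epsilon>)"
    proof -
      have "0 \<le> expectation (\<lambda>\<omega>. ?f (X 0 \<omega>))" using f0 by (intro integral_nonneg_AE) auto
      also have "\<dots> \<le> v + \<epsilon> * C + 1 / (4 * \<epsilon>)"
        using Xi[of 0] X2i[of 0] EX[of 0] EX2[of 0] \<epsilon> by (simp add: prob_space add_mono mult_left_mono)
      finally show ?thesis .
    qed
    ultimately have "expectation (\<lambda>\<omega>. ?f (X0 \<omega>)) \<le> v + \<epsilon> * C + 1 / (4 * \<epsilon>)" by simp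
    moreover have "expectation (\<lambda>\<omega>. ?f (X0 \<omega>)) = expectation X0 + \<epsilon> * expectation (\<lambda>\<omega>. (X0 \<omega>)\<^sup>2) + 1 / (4 * \<epsilon>)"
      using X0i X02i by (simp add: prob_space)
    moreover have "0 \<le> \<epsilon> * expectation (\<lambda>\<omega>. (X0 \<omega>)\<^sup>2)" using \<epsilon> by simp
    ultimately show ?thesis by linarith
  qed
  have "expectation X0 \<le> v"
  proof (rule field_le_epsilon)
    fix e :: real assume e: "0 < e"
    have "e / (C + 1) * C \<le> e" using e C0 by (simp add: field_simps)
    then show "expectation X0 \<le> v + e" using main[of "e / (C + 1)"] e C0 by simp
  qed
  moreover have "expectation X0 = (\<integral>\<omega>. Z (t + \<tau> \<omega>) \<omega> \<partial>M) - \<kappa>"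
  proof -
    have "integrable M (\<lambda>\<omega>. X0 \<omega> + \<kappa>)" using X0i by simp
    then have "integrable M (\<lambda>\<omega>. Z (t + \<tau> \<omega>) \<omega>)" by (simp add: X0_def)
    then show ?thesis unfolding X0_def by (simp add: prob_space)
  qed
  ultimately show ?thesis by (simp add: v_def)
qed


section \<open>A stopping time for each dyadic value\<close>

lemma rho_pos: "0 < rho t"
  using rho_strict_mono[of t 1] t by (simp add: rho_1)

lemma exp_rho: "s \<le> 1 \<Longrightarrow> exp (- 2 * rho s) = cc s / cc 1"
  using rho_diff(1)[of s 1] by (simp add: rho_1)

text \<open>The bridge time at which the Ornstein-Uhlenbeck clock, started at \<open>t\<close>, shows \<open>d\<close>.\<close>

definition otime :: "real \<Rightarrow> real" where
  "otime d = (1 - (1 - \<alpha> * t) * exp (- 2 * d)) / \<alpha>"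

lemma otime_0: "otime 0 = t"
  using \<alpha> by (simp add: otime_def)

lemma otime_strict_mono: "d < d' \<Longrightarrow> otime d < otime d'"
  using \<alpha> one_minus_\<alpha>_pos[of t] t by (simp add: otime_def divide_strict_right_mono)

lemma otime_mono: "d \<le> d' \<Longrightarrow> otime d \<le> otime d'"
  using otime_strict_mono[of d d'] by (cases "d = d'") auto

lemma otime_le_1: assumes "d \<le> rho t" shows "otime d \<le> 1"
proof -
  have p: "0 < 1 - \<alpha> * t" "0 < 1 - \<alpha>" using one_minus_\<alpha>_pos[of t] t \<alpha> by auto
  have "(1 - \<alpha>) / (1 - \<alpha> * t) = exp (- 2 * rho t)" using exp_rho[of t] t p by (simp add: cc_def)
  also have "\<dots> \<le> exp (- 2 * d)" using assms by simp
  finally have "1 - \<alpha> \<le> (1 - \<alpha> * t) * exp (- 2 * d)" using p by (simp add: divide_le_eq mult.commute)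
  then show ?thesis using \<alpha> by (simp add: otime_def divide_le_eq)
qed

lemma rho_otime:
  assumes "d \<le> rho t" shows "rho (otime d) = rho t - d"
proof -
  have p: "0 < 1 - \<alpha> * t" using one_minus_\<alpha>_pos[of t] t by auto
  have "1 - \<alpha> * otime d = (1 - \<alpha> * t) * exp (- 2 * d)" using \<alpha> by (simp add: otime_def)
  then have "cc (otime d) = cc t * exp (2 * d)" unfolding cc_def by (simp only:) (simp add: exp_minus divide_inverse)
  moreover have "ln (cc 1 / (cc t * exp (2 * d))) = ln (cc 1 / cc t) - 2 * d"
    using cc_pos[of 1] cc_pos[of t] t by (simp add: ln_div ln_mult)
  ultimately show ?thesis by (simp add: rho_def diff_divide_distrib)
qed

text \<open>Stop at the first grid point where the iterate with the remaining steps equals the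
  payoff. Before it the Bellman maximum is attained by continuing, so all defects in
  \<open>optional_stopping\<close> vanish.\<close>

theorem dyadic_value_attained:
  "\<exists>\<tau>\<in>stopping_times_from M t Z. (\<integral>\<omega>. Z (t + \<tau> \<omega>) \<omega> \<partial>M) = \<kappa> + A0 * dyadic_value n (rho t) x0"
proof -
  define K where "K = nat \<lfloor>rho t * 2 ^ n\<rfloor>"
  \<comment> \<open>Equidistant in the Ornstein-Uhlenbeck clock rather than in bridge time, so that
    each step is one Bellman step of length \<open>1 / 2 ^ n\<close>.\<close>
  define P where "P i = otime (real i / 2 ^ n)" for i
  define U where "U i = iter n (K - i)" for i
  have iK: "real i / 2 ^ n \<le> rho t" if "i \<le> K" for i
  proof -
    have "real i \<le> real K" using that by simp
    also have "\<dots> \<le> rho t * 2 ^ n" using rho_pos by (simp add: K_def)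
    finally show ?thesis by (simp add: divide_le_eq)
  qed
  have P0: "P 0 = t" by (simp add: P_def otime_0)
  have Pl: "P i < P (Suc i)" for i
    unfolding P_def by (intro otime_strict_mono divide_strict_right_mono) auto
  have Pm: "P i \<le> P j" if "i \<le> j" for i j unfolding P_def using that by (intro otime_mono divide_right_mono) auto
  have Pb: "t \<le> P i \<and> P i \<le> 1" if "i \<le> K" for i
    using Pm[of 0 i] otime_le_1[OF iK[OF that]] by (simp add: P0) (simp add: P_def)
  have rP: "rho (P i) = rho t - real i / 2 ^ n" if "i \<le> K" for i
    unfolding P_def by (rule rho_otime[OF iK[OF that]])
  have Up: "payoff_like (U i)" for i unfolding U_def by (rule payoff_like_iter)
  have UK: "U K = (\<lambda>x. x)" by (simp add: U_def iter_0)
  \<comment> \<open>The least index exists and is at most \<open>K\<close>, since with no steps left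
    \<open>U K\<close> is the identity.\<close>
  define k where "k \<omega> = (LEAST i. U i (xi (P i) \<omega>) \<le> xi (P i) \<omega>)" for \<omega>
  have kK: "k \<omega> \<le> K" for \<omega> unfolding k_def by (rule Least_le) (simp add: UK)
  have kL: "U (k \<omega>) (xi (P (k \<omega>)) \<omega>) = xi (P (k \<omega>)) \<omega>" for \<omega>
  proof (rule antisym)
    show "U (k \<omega>) (xi (P (k \<omega>)) \<omega>) \<le> xi (P (k \<omega>)) \<omega>"
      unfolding k_def by (rule LeastI[of "\<lambda>i. U i (xi (P i) \<omega>) \<le> xi (P i) \<omega>" K]) (simp add: UK)
  qed (rule payoff_like_ge[OF Up])
  have ik: "i < k \<omega> \<longleftrightarrow> (\<forall>j\<in>{..i}. xi (P j) \<omega> < U j (xi (P j) \<omega>))" for i \<omega>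
  proof
    assume "i < k \<omega>"
    show "\<forall>j\<in>{..i}. xi (P j) \<omega> < U j (xi (P j) \<omega>)"
    proof
      fix j assume "j \<in> {..i}"
      then have "j < k \<omega>" using \<open>i < k \<omega>\<close> by simp
      then show "xi (P j) \<omega> < U j (xi (P j) \<omega>)" unfolding k_def using not_less_Least by fastforce
    qed
  next
    assume a: "\<forall>j\<in>{..i}. xi (P j) \<omega> < U j (xi (P j) \<omega>)"
    show "i < k \<omega>"
    proof (rule ccontr)
      assume "\<not> i < k \<omega>"
      then have "xi (P (k \<omega>)) \<omega> < U (k \<omega>) (xi (P (k \<omega>)) \<omega>)" using a by simp
      then show False using kL[of \<omega>] by simp
    qed
  qed
  have kB: "{\<omega> \<in> space M. i < k \<omega>} \<in> sets (natM (P i))" if i: "i < K" for i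
  proof -
    have "{\<omega> \<in> space (natM (P i)). \<forall>j\<in>{..i}. xi (P j) \<omega> < U j (xi (P j) \<omega>)} \<in> sets (natM (P i))"
    proof (rule sets.sets_Collect_finite_All)
      fix j assume j: "j \<in> {..i}"
      have [measurable]: "U j \<in> borel_measurable borel" by (rule payoff_like_measurable[OF Up])
      have [measurable]: "xi (P j) \<in> borel_measurable (natM (P i))"
        using Pb[of j] Pm[of j i] j i by (intro xi_natM) auto
      show "{\<omega> \<in> space (natM (P i)). xi (P j) \<omega> < U j (xi (P j) \<omega>)} \<in> sets (natM (P i))" by measurable
    qed simp
    then show ?thesis by (simp add: ik space_natM)
  qed
  note os = optional_stopping[of P K U k, OF P0 Pl Pb payoff_like_quartic_growth[OF Up] kK kB]
  let ?Y = "\<lambda>\<omega>. exp (- (rho t - rho (P (k \<omega>)))) * U (k \<omega>) (xi (P (k \<omega>)) \<omega>)"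
  have zero: "indicator {\<omega> \<in> space M. i < k \<omega>} \<omega> * (ou (rho (P i) - rho (P (Suc i))) (U (Suc i)) (xi (P i) \<omega>) - U i (xi (P i) \<omega>)) = 0"
    if i: "i < K" for i \<omega>
  proof (cases "\<omega> \<in> space M \<and> i < k \<omega>")
    case True
    then have lt: "xi (P i) \<omega> < U i (xi (P i) \<omega>)" using ik[of i \<omega>] by simp
    have "rho (P i) - rho (P (Suc i)) = 1 / 2 ^ n" using rP[of i] rP[of "Suc i"] i by (simp add: add_divide_distrib)
    moreover have "U i = bellman (1 / 2 ^ n) (U (Suc i))"
      unfolding U_def iter_Suc[symmetric] using i by (simp add: Suc_diff_Suc)
    ultimately show ?thesis using lt by (simp add: bellman_def max_def split: if_splits)
  qed auto
  have E1: "expectation ?Y = U 0 x0 + (\<Sum>i<K. exp (- (rho t - rho (P i))) *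
      expectation (\<lambda>\<omega>. indicator {\<omega> \<in> space M. i < k \<omega>} \<omega> * (ou (rho (P i) - rho (P (Suc i))) (U (Suc i)) (xi (P i) \<omega>) - U i (xi (P i) \<omega>))))"
    by (rule os(2))
  have E2: "(\<Sum>i<K. exp (- (rho t - rho (P i))) *
      expectation (\<lambda>\<omega>. indicator {\<omega> \<in> space M. i < k \<omega>} \<omega> * (ou (rho (P i) - rho (P (Suc i))) (U (Suc i)) (xi (P i) \<omega>) - U i (xi (P i) \<omega>)))) = 0"
  proof (rule sum.neutral, rule ballI)
    fix i assume "i \<in> {..<K}"
    then have "i < K" by simp
    show "exp (- (rho t - rho (P i))) *
      expectation (\<lambda>\<omega>. indicator {\<omega> \<in> space M. i < k \<omega>} \<omega> * (ou (rho (P i) - rho (P (Suc i))) (U (Suc i)) (xi (P i) \<omega>) - U i (xi (P i) \<omega>))) = 0"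
      by (simp only: zero[OF \<open>i < K\<close>] Bochner_Integration.integral_zero mult_zero_right)
  qed
  have "U 0 x0 = dyadic_value n (rho t) x0" by (simp add: U_def dyadic_value_def K_def)
  then have EY: "expectation ?Y = dyadic_value n (rho t) x0" using E1 unfolding E2 by simp
  define \<tau> where "\<tau> \<omega> = P (k \<omega>) - t" for \<omega>
  have Z\<tau>: "Z (t + \<tau> \<omega>) \<omega> = \<kappa> + A0 * ?Y \<omega>" for \<omega>
    using Z_eq_xi[of "P (k \<omega>)" \<omega>] Pb[OF kK[of \<omega>]] by (simp add: \<tau>_def kL)
  have Yi: "integrable M ?Y" by (rule os(1))
  have "(\<integral>\<omega>. Z (t + \<tau> \<omega>) \<omega> \<partial>M) = expectation (\<lambda>\<omega>. \<kappa> + A0 * ?Y \<omega>)"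
    unfolding Z\<tau> ..
  also have "\<dots> = \<kappa> + A0 * expectation ?Y"
    using Yi by (subst Bochner_Integration.integral_add) (simp_all add: prob_space)
  finally have E\<tau>: "(\<integral>\<omega>. Z (t + \<tau> \<omega>) \<omega> \<partial>M) = \<kappa> + A0 * dyadic_value n (rho t) x0" unfolding EY .
  have "stopping_time (natural_filtration_from M t Z) \<tau>"
    unfolding stopping_time_def
  proof
    fix s
    have F: "natural_filtration_from M t Z s = natM (t + s)" by simp
    \<comment> \<open>\<open>P\<close> increases and \<open>i < k \<omega>\<close> is decided at
      \<open>P i\<close>, so the event is a finite union over the grid points up to
      \<open>t + s\<close>.\<close>
    have "{\<omega> \<in> space M. \<tau> \<omega> \<le> s} = (\<Union>i\<in>{i. i \<le> K \<and> P i \<le> t + s}. space M - {\<omega> \<in> space M. i < k \<omega>})"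
    proof (intro set_eqI iffI)
      fix \<omega> assume "\<omega> \<in> {\<omega> \<in> space M. \<tau> \<omega> \<le> s}"
      then show "\<omega> \<in> (\<Union>i\<in>{i. i \<le> K \<and> P i \<le> t + s}. space M - {\<omega> \<in> space M. i < k \<omega>})"
        using kK[of \<omega>] by (intro UN_I[of "k \<omega>"]) (auto simp: \<tau>_def)
    next
      fix \<omega> assume "\<omega> \<in> (\<Union>i\<in>{i. i \<le> K \<and> P i \<le> t + s}. space M - {\<omega> \<in> space M. i < k \<omega>})"
      then obtain i where i: "P i \<le> t + s" "\<omega> \<in> space M" "k \<omega> \<le> i" by auto
      then show "\<omega> \<in> {\<omega> \<in> space M. \<tau> \<omega> \<le> s}" using Pm[of "k \<omega>" i] by (simp add: \<tau>_def)
    qed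
    also have "\<dots> \<in> sets (natM (t + s))"
    proof (rule sets.finite_UN)
      fix i assume i: "i \<in> {i. i \<le> K \<and> P i \<le> t + s}"
      show "space M - {\<omega> \<in> space M. i < k \<omega>} \<in> sets (natM (t + s))"
      proof (cases "i < K")
        case True
        then have "{\<omega> \<in> space M. i < k \<omega>} \<in> sets (natM (t + s))" using kB[of i] natM_mono[of "P i" "t + s"] i by auto
        then show ?thesis using sets.compl_sets[of _ "natM (t + s)"] by (simp only: space_natM)
      next
        case False
        then have "{\<omega> \<in> space M. i < k \<omega>} = {}" using kK i by (auto simp: not_less)
        then show ?thesis using sets.top[of "natM (t + s)"] by (simp only: space_natM Diff_empty)
      qed
    qed simp
    finally have "{\<omega> \<in> space (natM (t + s)). \<tau> \<omega> \<le> s} \<in> sets (natM (t + s))" by (simp only: space_natM)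
    then show "Measurable.pred (natural_filtration_from M t Z s) (\<lambda>\<omega>. \<tau> \<omega> \<le> s)"
      unfolding F[symmetric] by (simp add: pred_def)
  qed
  moreover have "\<tau> \<omega> \<in> {0..1 - t}" for \<omega> using Pb[OF kK[of \<omega>]] by (simp add: \<tau>_def)
  ultimately have "\<tau> \<in> stopping_times_from M t Z" by (simp add: stopping_times_from_def)
  then show ?thesis using E\<tau> by blast
qed

theorem value_eq:
  "(SUP \<tau>\<in>stopping_times_from M t Z. \<integral>\<omega>. Z (t + \<tau> \<omega>) \<omega> \<partial>M) = \<kappa> + A0 * ou_value (rho t) x0"
proof (rule antisym)
  let ?E = "\<lambda>\<tau>. \<integral>\<omega>. Z (t + \<tau> \<omega>) \<omega> \<partial>M"
  have ne: "stopping_times_from M t Z \<noteq> {}" using dyadic_value_attained[of 0] by auto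
  show "(SUP \<tau>\<in>stopping_times_from M t Z. ?E \<tau>) \<le> \<kappa> + A0 * ou_value (rho t) x0"
    by (rule cSUP_least[OF ne stopped_value_le])
  have bdd: "bdd_above (?E ` stopping_times_from M t Z)"
    by (rule bdd_aboveI2[OF stopped_value_le])
  have "\<kappa> + A0 * dyadic_value n (rho t) x0 \<le> (SUP \<tau>\<in>stopping_times_from M t Z. ?E \<tau>)" for n
  proof -
    obtain \<tau> where \<tau>: "\<tau> \<in> stopping_times_from M t Z" "?E \<tau> = \<kappa> + A0 * dyadic_value n (rho t) x0"
      using dyadic_value_attained[of n] by blast
    show ?thesis using cSUP_upper[OF \<tau>(1) bdd] unfolding \<tau>(2) .
  qed
  moreover have "(\<lambda>n. \<kappa> + A0 * dyadic_value n (rho t) x0) \<longlonglongrightarrow> \<kappa> + A0 * ou_value (rho t) x0"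
    by (intro tendsto_intros dyadic_value_tendsto)
  ultimately show "\<kappa> + A0 * ou_value (rho t) x0 \<le> (SUP \<tau>\<in>stopping_times_from M t Z. ?E \<tau>)"
    by (intro LIMSEQ_le_const2) auto
qed

section \<open>The integral equation in Ornstein-Uhlenbeck coordinates\<close>

text \<open>The drift at \<open>Z s\<close> is linear in \<open>xi s\<close>; as
  \<open>above\<close> carries the factor 2, half of \<open>\<alpha> * cc s\<close> remains. The
  discount in \<open>Z_eq_xi\<close> cancels the factor by which the unkilled expectation exceeds
  the killed semigroup.\<close>

lemma drift_expectation:
  assumes s: "t < s" "s < 1" and b: "b (rho s) = sqrt (\<alpha> * cc s) * (c - \<kappa>)"
  shows "(\<integral>\<omega>. drift (normal_prior m \<gamma>) s (Z s \<omega>) * indicator {y. y > c} (Z s \<omega>) \<partial>M)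
     = - A0 * (\<alpha> * cc s / 2 * ou (rho t - rho s) (above b (rho s)) x0)"
proof -
  have c: "0 < cc s" using s cc_pos by simp
  let ?e = "exp (- (rho t - rho s))"
  have eq: "drift (normal_prior m \<gamma>) s (Z s \<omega>) * indicator {y. y > c} (Z s \<omega>)
      = (- A0 * (\<alpha> * cc s / 2) * ?e) * above b (rho s) (xi s \<omega>)" for \<omega>
  proof -
    have "c < Z s \<omega> \<longleftrightarrow> b (rho s) < xi s \<omega>" unfolding b xi_def using c \<alpha> by simp
    moreover have "drift (normal_prior m \<gamma>) s (Z s \<omega>) = - (\<alpha> * cc s * (A0 * (?e * xi s \<omega>)))"
      using drift_eq[of s "Z s \<omega>"] Z_eq_xi[of s \<omega>] s t by simp
    ultimately show ?thesis by (simp add: above_def)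
  qed
  have "(\<integral>\<omega>. drift (normal_prior m \<gamma>) s (Z s \<omega>) * indicator {y. y > c} (Z s \<omega>) \<partial>M)
      = (- A0 * (\<alpha> * cc s / 2) * ?e) * expectation (\<lambda>\<omega>. above b (rho s) (xi s \<omega>))"
    unfolding eq by (rule integral_mult_right_zero)
  also have "expectation (\<lambda>\<omega>. above b (rho s) (xi s \<omega>)) = exp (rho t - rho s) * ou (rho t - rho s) (above b (rho s)) x0"
    using s by (intro ou_expectation above_quartic_growth) auto
  also have "(- A0 * (\<alpha> * cc s / 2) * ?e) * (exp (rho t - rho s) * ou (rho t - rho s) (above b (rho s)) x0)
      = - A0 * (\<alpha> * cc s / 2) * (?e * exp (rho t - rho s)) * ou (rho t - rho s) (above b (rho s)) x0"
    by (simp only: mult.assoc)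
  also have "?e * exp (rho t - rho s) = 1" by (simp flip: exp_add)
  finally show ?thesis by (simp only: mult.assoc mult_1)
qed

lemma rho_derivative:
  assumes "s \<le> 1" shows "(rho has_real_derivative - (\<alpha> * cc s / 2)) (at s)"
proof -
  have p: "0 < 1 - \<alpha> * s" "0 < 1 - \<alpha>" using one_minus_\<alpha>_pos[OF assms] \<alpha> by auto
  have "((\<lambda>s. ln ((1 - \<alpha> * s) / (1 - \<alpha>)) / 2) has_real_derivative - (\<alpha> * cc s / 2)) (at s)"
  proof -
    have "((\<lambda>s. ln ((1 - \<alpha> * s) / (1 - \<alpha>)) / 2) has_real_derivative
        (1 / ((1 - \<alpha> * s) / (1 - \<alpha>)) * ((0 - \<alpha> * 1) / (1 - \<alpha>))) / 2) (at s)"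
      using p by (intro DERIV_cdivide DERIV_chain2[OF DERIV_ln_divide] DERIV_diff DERIV_const DERIV_cmult DERIV_ident) simp
    moreover have "(1 / ((1 - \<alpha> * s) / (1 - \<alpha>)) * ((0 - \<alpha> * 1) / (1 - \<alpha>))) / 2 = - (\<alpha> * cc s / 2)"
      using p by (simp add: cc_def)
    ultimately show ?thesis by simp
  qed
  moreover have "rho = (\<lambda>s. ln ((1 - \<alpha> * s) / (1 - \<alpha>)) / 2)" by (auto simp: rho_def cc_def)
  ultimately show ?thesis by simp
qed

text \<open>The factor \<open>\<alpha> * cc / 2\<close> of \<open>drift_expectation\<close> is the
  derivative of \<open>rho t - rho (t + u)\<close> in \<open>u\<close>, so substitution gives the
  integral of the premium; the posterior mean is the reward of holding to time 1.\<close>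

theorem boundary_point:
  fixes b c :: "real \<Rightarrow> real"
  assumes bm: "b \<in> borel_measurable borel"
    and b: "\<And>s. t \<le> s \<Longrightarrow> s < 1 \<Longrightarrow> b (rho s) = sqrt (\<alpha> * cc s) * (c s - \<kappa>)"
  shows "posterior_mean (normal_prior m \<gamma>) t z -
      (LINT u:{0..<1 - t}|lborel. (\<integral>\<omega>. drift (normal_prior m \<gamma>) (t + u) (Z (t + u) \<omega>) *
         indicator {y. y > c (t + u)} (Z (t + u) \<omega>) \<partial>M)) = \<kappa> + A0 * premium b (rho t) x0"
proof -
  let ?f = "\<lambda>v. ou v (above b (rho t - v)) x0"
  let ?g = "\<lambda>u. rho t - rho (t + u)" and ?g' = "\<lambda>u. \<alpha> * cc (t + u) / 2"
  let ?J = "\<lambda>u. \<integral>\<omega>. drift (normal_prior m \<gamma>) (t + u) (Z (t + u) \<omega>) * indicator {y. y > c (t + u)} (Z (t + u) \<omega>) \<partial>M"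
  have "(LINT u:{0..<1 - t}|lborel. ?J u) = (LINT u|lborel. - A0 * (?f (?g u) * ?g' u * indicator {0..1 - t} u))"
    unfolding set_lebesgue_integral_def
  proof (rule integral_cong_AE)
    have [measurable]: "b \<in> borel_measurable borel" by (rule bm)
    have r[measurable]: "(\<lambda>u. indicator {0<..<1 - t} u * rho (t + u)) \<in> borel_measurable borel"
    proof -
      have "(\<lambda>u. indicator {0<..<1 - t} u * rho (t + u)) = (\<lambda>u. indicator {0<..<1 - t} u * (ln ((1 - \<alpha> * (t + u)) / (1 - \<alpha>)) / 2))"
        by (auto simp: rho_def cc_def)
      then show ?thesis by simp
    qed
    have rm[measurable]: "rho \<in> borel_measurable borel" unfolding rho_def[abs_def] cc_def by measurable
    have fm: "?f \<in> borel_measurable borel" by (rule ou_above_measurable[OF bm])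
    have gm: "(\<lambda>u. ?f (?g u)) \<in> borel_measurable borel"
      by (rule measurable_compose[OF _ fm]) measurable
    have ccm[measurable]: "cc \<in> borel_measurable borel" unfolding cc_def[abs_def] by measurable
    show rhs: "(\<lambda>u. - A0 * (?f (?g u) * ?g' u * indicator {0..1 - t} u)) \<in> borel_measurable lborel"
      using gm by measurable
    have AEe: "AE u in lborel. indicator {0..<1 - t} u *\<^sub>R ?J u = - A0 * (?f (?g u) * ?g' u * indicator {0..1 - t} u)"
      using AE_lborel_singleton[of 0] AE_lborel_singleton[of "1 - t"]
    proof eventually_elim
      case (elim u)
      show ?case
      proof (cases "u \<in> {0<..<1 - t}")
        case True
        have "?J u = - A0 * (\<alpha> * cc (t + u) / 2 * ou (rho t - rho (t + u)) (above b (rho (t + u))) x0)"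
          using True b[of "t + u"] t by (intro drift_expectation) auto
        then show ?thesis using True by simp
      next
        case False then show ?thesis using elim by (auto split: split_indicator)
      qed
    qed
    then show "AE u in lborel. indicator {0..<1 - t} u *\<^sub>R ?J u = - A0 * (?f (?g u) * ?g' u * indicator {0..1 - t} u)" .
    \<comment> \<open>Within the range of integration only \<open>u = 0\<close> escapes the formula
      for the expectation; measurability is read off from an explicit function altered at that
      point.\<close>
    have "indicator {0..<1 - t} u *\<^sub>R ?J u = (if u = 0 then ?J 0 else - A0 * (?f (?g u) * ?g' u * indicator {0<..<1 - t} u))" for u
    proof (cases "u \<in> {0<..<1 - t}")
      case True
      have "?J u = - A0 * (\<alpha> * cc (t + u) / 2 * ou (rho t - rho (t + u)) (above b (rho (t + u))) x0)"
        using True b[of "t + u"] t by (intro drift_expectation) auto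
      then show ?thesis using True by simp
    next
      case False then show ?thesis using t by (auto split: split_indicator)
    qed
    moreover have "(\<lambda>u. if u = 0 then ?J 0 else - A0 * (?f (?g u) * ?g' u * indicator {0<..<1 - t} u)) \<in> borel_measurable borel"
      using gm by measurable
    ultimately show "(\<lambda>u. indicator {0..<1 - t} u *\<^sub>R ?J u) \<in> borel_measurable lborel" by simp
  qed
  also have "\<dots> = - A0 * (LINT u|lborel. ?f (?g u) * ?g' u * indicator {0..1 - t} u)"
    by (rule integral_mult_right_zero)
  also have "(LINT u|lborel. ?f (?g u) * ?g' u * indicator {0..1 - t} u) = (LINT v|lborel. ?f v * indicator {?g 0..?g (1 - t)} v)"
  proof (rule integral_substitution(2)[symmetric])
    show "set_integrable lborel {?g 0..?g (1 - t)} ?f" by (intro ou_above_set_integrable bm) simp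
    show "(?g has_real_derivative ?g' u) (at u)" if "u \<in> {0..1 - t}" for u
    proof -
      have "((\<lambda>u. rho (t + u)) has_real_derivative - (\<alpha> * cc (t + u) / 2) * 1) (at u)"
        using that by (intro DERIV_chain2[OF rho_derivative]) (auto intro!: derivative_eq_intros)
      from DERIV_diff[OF DERIV_const this] show ?thesis by simp
    qed
    show "continuous_on {0..1 - t} ?g'"
      by (intro continuous_intros continuous_on_compose2[OF cc_continuous_on[OF order_refl]]) auto
    show "0 \<le> ?g' u" if "u \<in> {0..1 - t}" for u
      using that \<alpha> cc_pos[of "t + u"] by simp
  qed (use t in simp)
  also have "(LINT v|lborel. ?f v * indicator {?g 0..?g (1 - t)} v) = (LINT v:{0..rho t}|lborel. ?f v)"
    by (simp add: set_lebesgue_integral_def rho_1 mult.commute)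
  finally have I: "(LINT u:{0..<1 - t}|lborel. ?J u) = - A0 * (LINT v:{0..rho t}|lborel. ?f v)" .
  have pm: "posterior_mean (normal_prior m \<gamma>) t z = \<kappa> + A0 * (exp (- 2 * rho t) * x0)"
  proof -
    have p: "0 < 1 - \<alpha> * t" "0 < 1 - \<alpha>" using one_minus_\<alpha>_pos[of t] t \<alpha> by auto
    have g: "\<gamma>\<^sup>2 = 1 - \<alpha>" by (simp add: \<alpha>_def)
    have k: "m = \<alpha> * \<kappa>" using \<alpha> by (simp add: \<kappa>_def)
    have "posterior_mean (normal_prior m \<gamma>) t z = (m * (1 - t) + z * (1 - \<alpha>)) / (1 - \<alpha> * t)"
      using posterior_mean_normal_prior[OF \<gamma>(1) t, of m z] g by (simp add: mult.commute)
    also have "m * (1 - t) + z * (1 - \<alpha>) = \<kappa> * (1 - \<alpha> * t) + (1 - \<alpha>) * (z - \<kappa>)"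
      by (subst k) (simp add: algebra_simps)
    also have "(\<kappa> * (1 - \<alpha> * t) + (1 - \<alpha>) * (z - \<kappa>)) / (1 - \<alpha> * t) = \<kappa> + (1 - \<alpha>) / (1 - \<alpha> * t) * (z - \<kappa>)"
      using p by (simp add: add_divide_distrib)
    also have "(1 - \<alpha>) / (1 - \<alpha> * t) = exp (- 2 * rho t)" using exp_rho[of t] t p by (simp add: cc_def)
    finally show ?thesis unfolding Z_start_value[symmetric] by (simp add: mult.left_commute)
  qed
  show ?thesis unfolding I pm premium_def by (simp add: distrib_left)
qed

lemma \<kappa>_eq: "\<kappa> = m / (1 - \<gamma>\<^sup>2)"
  by (simp add: \<kappa>_def \<alpha>_def)

lemma rho_eq: "rho s = horizon \<gamma> s"
  by (simp add: rho_def horizon_def cc_def \<alpha>_def)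

lemma scale_eq: "sqrt (\<alpha> * cc s) = scale \<gamma> s"
  by (simp add: scale_def cc_def \<alpha>_def)

lemma A0_eq: "A0 = 1 / scale \<gamma> t"
  by (simp add: A0_def scale_eq)

lemma x0_eq: "x0 = scale \<gamma> t * (z - m / (1 - \<gamma>\<^sup>2))"
  by (simp add: x0_def scale_eq \<kappa>_eq)

lemmas global_eqs = \<kappa>_eq rho_eq scale_eq A0_eq x0_eq

lemmas value_eq_global = value_eq[unfolded global_eqs]
lemmas boundary_point_global = boundary_point[unfolded global_eqs]

end

section \<open>Change of variables between bridge time and horizon\<close>

context
  fixes \<gamma> :: real assumes \<gamma>: "0 < \<gamma>" "\<gamma> < 1"
begin

lemma one_minus_square_pos: "0 < 1 - \<gamma>\<^sup>2" "0 < \<gamma>\<^sup>2"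
  using \<gamma> by (auto simp: power_less_one_iff)

lemma denominator_ge: "s \<le> 1 \<Longrightarrow> \<gamma>\<^sup>2 \<le> 1 - (1 - \<gamma>\<^sup>2) * s"
proof -
  assume "s \<le> 1"
  then have "(1 - \<gamma>\<^sup>2) * s \<le> (1 - \<gamma>\<^sup>2) * 1" using one_minus_square_pos by (intro mult_left_mono) auto
  then show ?thesis by simp
qed

lemma denominator_pos: "s \<le> 1 \<Longrightarrow> 0 < 1 - (1 - \<gamma>\<^sup>2) * s"
  using denominator_ge[of s] one_minus_square_pos by linarith

lemma scale_pos: "s \<le> 1 \<Longrightarrow> 0 < scale \<gamma> s"
  using denominator_pos[of s] one_minus_square_pos by (simp add: scale_def)

lemma scale_mono: "s \<le> s' \<Longrightarrow> s' \<le> 1 \<Longrightarrow> scale \<gamma> s \<le> scale \<gamma> s'"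
  unfolding scale_def using denominator_pos[of s] denominator_pos[of s'] one_minus_square_pos
  by (intro real_sqrt_le_mono divide_left_mono) auto

lemma horizon_nonneg: "s \<le> 1 \<Longrightarrow> 0 \<le> horizon \<gamma> s"
  using denominator_ge[of s] one_minus_square_pos by (simp add: horizon_def)

lemma horizon_pos: "s < 1 \<Longrightarrow> 0 < horizon \<gamma> s"
proof -
  assume "s < 1"
  then have "(1 - \<gamma>\<^sup>2) * s < (1 - \<gamma>\<^sup>2) * 1" using one_minus_square_pos by (intro mult_strict_left_mono) auto
  then have "\<gamma>\<^sup>2 < 1 - (1 - \<gamma>\<^sup>2) * s" by (simp add: algebra_simps)
  then have "1 < (1 - (1 - \<gamma>\<^sup>2) * s) / \<gamma>\<^sup>2" using one_minus_square_pos(2) by (simp add: less_divide_eq)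
  then show ?thesis by (simp add: horizon_def)
qed

lemma horizon_1: "horizon \<gamma> 1 = 0"
  using one_minus_square_pos by (simp add: horizon_def)

lemma horizon_antimono: "s \<le> s' \<Longrightarrow> s' \<le> 1 \<Longrightarrow> horizon \<gamma> s' \<le> horizon \<gamma> s"
  using denominator_pos[of s] denominator_pos[of s'] one_minus_square_pos
  by (simp add: horizon_def divide_right_mono)

lemma scale_continuous: "continuous_on {..1} (scale \<gamma>)"
  unfolding scale_def using denominator_pos by (intro continuous_intros) force

lemma horizon_continuous: "continuous_on {..1} (horizon \<gamma>)"
  unfolding horizon_def using denominator_pos one_minus_square_pos by (intro continuous_intros) force+

text \<open>The inverse of \<open>horizon \<gamma>\<close> for times up to 1, by which a candidate
  boundary in bridge time is rewritten in the horizon.\<close>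

definition clock :: "real \<Rightarrow> real" where
  "clock r = (1 - \<gamma>\<^sup>2 * exp (2 * r)) / (1 - \<gamma>\<^sup>2)"

lemma clock_horizon: "s \<le> 1 \<Longrightarrow> clock (horizon \<gamma> s) = s"
  using denominator_pos[of s] one_minus_square_pos by (simp add: clock_def horizon_def)

lemma horizon_clock: "horizon \<gamma> (clock r) = r"
  using one_minus_square_pos by (simp add: clock_def horizon_def)

lemma clock_0: "clock 0 = 1"
  using one_minus_square_pos by (simp add: clock_def)

lemma clock_antimono: "r \<le> r' \<Longrightarrow> clock r' \<le> clock r"
  using one_minus_square_pos by (simp add: clock_def divide_right_mono)

lemma clock_isCont: "isCont clock r"
  unfolding clock_def using one_minus_square_pos by (intro continuous_intros) auto

end

section \<open>The stopping boundary and its uniqueness in bridge time\<close>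

theorem proposition5p1:
  fixes m \<gamma> :: real
    and M :: "real \<Rightarrow> real \<Rightarrow> 'a measure"
    and W Z :: "real \<Rightarrow> real \<Rightarrow> real \<Rightarrow> 'a \<Rightarrow> real"
  assumes "0 < \<gamma>" and "\<gamma> < 1"
    and "\<And>t z. t \<in> {0..<1} \<Longrightarrow> is_solution_from (normal_prior m \<gamma>) t z (M t z) (W t z) (Z t z)"
  shows "\<exists>b :: real \<Rightarrow> real.
           antimono_on {0..1} b \<and>
           continuous_on {0..1} b \<and>
           b 1 = m / (1 - \<gamma>\<^sup>2) \<and>
           continuation_region M Z = {(t, z). t \<in> {0..<1} \<and> z < b t} \<and>
           boundary_equation (normal_prior m \<gamma>) M Z b \<and>
           (\<forall>t\<in>{0..1}. m / (1 - \<gamma>\<^sup>2) \<le> b t) \<and>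
           (\<forall>c :: real \<Rightarrow> real.
              continuous_on {0..1} c \<and>
              boundary_equation (normal_prior m \<gamma>) M Z c \<and>
              (\<forall>t\<in>{0..1}. m / (1 - \<gamma>\<^sup>2) \<le> c t)
              \<longrightarrow> (\<forall>t\<in>{0..1}. c t = b t))"
proof -
  note \<gamma> = assms(1,2)
  let ?k = "m / (1 - \<gamma>\<^sup>2)" and ?h = "horizon \<gamma>" and ?s = "scale \<gamma>"
  have br: "bridge (M t z) m \<gamma> t z (W t z) (Z t z)" if "t \<in> {0..<1}" for t z
  proof -
    have "prob_space (M t z)" using assms(3)[OF that] by (simp add: is_solution_from_def)
    then show ?thesis using assms(3)[OF that] \<gamma> that by (intro bridge.intro bridge_axioms.intro) auto
  qed
  define b where "b t = ?k + ou_boundary (?h t) / ?s t" for t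
  have val: "value_fun M Z t z = ?k + 1 / ?s t * ou_value (?h t) (?s t * (z - ?k))" if "t \<in> {0..<1}" for t z
    unfolding value_fun_def by (rule bridge.value_eq_global[OF br[OF that]])
  \<comment> \<open>\<open>g\<close> is the candidate in the horizon variable, tied to
    \<open>c\<close> at the times in \<open>[0, 1)\<close>; the right side of the boundary equation
    becomes a premium at the point \<open>g (?h t)\<close>.\<close>
  have equation: "posterior_mean (normal_prior m \<gamma>) t (c t) -
          (LINT u:{0..<1 - t}|lborel.
             (\<integral>\<omega>. drift (normal_prior m \<gamma>) (t + u) (Z t (c t) (t + u) \<omega>) *
                   indicator {y. y > c (t + u)} (Z t (c t) (t + u) \<omega>) \<partial>M t (c t)))
        = ?k + 1 / ?s t * premium g (?h t) (g (?h t))"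
    if t: "t \<in> {0..<1}" and g: "g \<in> borel_measurable borel" "\<And>s. 0 \<le> s \<Longrightarrow> s < 1 \<Longrightarrow> g (?h s) = ?s s * (c s - ?k)"
    for t and c g :: "real \<Rightarrow> real"
  proof -
    have "g (?h t) = ?s t * (c t - ?k)" using t by (intro g(2)) auto
    then show ?thesis
      using bridge.boundary_point_global[OF br[OF t, of "c t"] g(1), of c] g(2) t by simp
  qed
  have eq_iff: "c t = ?k + 1 / ?s t * premium g (?h t) (g (?h t)) \<longleftrightarrow> premium g (?h t) (g (?h t)) = g (?h t)"
    if t: "t \<in> {0..<1}" and g: "g (?h t) = ?s t * (c t - ?k)" for t and c g :: "real \<Rightarrow> real"
  proof -
    have s: "0 < ?s t" using t by (intro scale_pos[OF \<gamma>]) auto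
    then have "c t = ?k + 1 / ?s t * g (?h t)" using g by simp
    then show ?thesis using s by auto
  qed
  have bs: "ou_boundary (?h s) = ?s s * (b s - ?k)" if "s \<le> 1" for s
    using scale_pos[OF \<gamma> that] by (simp add: b_def)
  have anti: "antimono_on {0..1} b"
  proof (rule monotone_onI)
    fix s s' :: real assume s: "s \<in> {0..1}" "s' \<in> {0..1}" "s \<le> s'"
    \<comment> \<open>The remaining horizon shrinks with \<open>s\<close>, which lowers the
      numerator, while the scale in the denominator grows.\<close>
    have "ou_boundary (?h s') / ?s s' \<le> ou_boundary (?h s) / ?s s"
      using s scale_pos[OF \<gamma>, of s] scale_mono[OF \<gamma>, of s s'] monoD[OF ou_boundary_mono horizon_antimono[OF \<gamma>, of s s']]
        ou_boundary_nonneg by (intro frac_le) auto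
    then show "b s' \<le> b s" by (simp add: b_def)
  qed
  have sub1: "{0..1} \<subseteq> {..1::real}" by auto
  have bcont: "continuous_on {0..1} b"
  proof -
    have "continuous_on UNIV ou_boundary" by (intro continuous_at_imp_continuous_on) (simp add: ou_boundary_isCont)
    then have "continuous_on {0..1} (\<lambda>s. ou_boundary (?h s))"
      by (rule continuous_on_compose2[OF _ continuous_on_subset[OF horizon_continuous[OF \<gamma>] sub1]]) auto
    moreover have "?s s \<noteq> 0" if "s \<in> {0..1}" for s using scale_pos[OF \<gamma>, of s] that by auto
    ultimately show ?thesis unfolding b_def
      by (intro continuous_intros continuous_on_subset[OF scale_continuous[OF \<gamma>] sub1]) auto
  qed
  have b1: "b 1 = ?k" by (simp add: b_def horizon_1[OF \<gamma>] ou_boundary_nonpos)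
  have region: "continuation_region M Z = {(t, z). t \<in> {0..<1} \<and> z < b t}"
  proof -
    have "value_fun M Z t z > z \<longleftrightarrow> z < b t" if t: "t \<in> {0..<1}" for t z
    proof -
      let ?x = "?s t * (z - ?k)"
      have s: "0 < ?s t" using t by (intro scale_pos[OF \<gamma>]) auto
      have "value_fun M Z t z > z \<longleftrightarrow> z - ?k < 1 / ?s t * ou_value (?h t) ?x" unfolding val[OF t] by linarith
      also have "\<dots> \<longleftrightarrow> ?x < ou_value (?h t) ?x" using s by (simp add: less_divide_eq mult.commute)
      also have "\<dots> \<longleftrightarrow> ?x < ou_boundary (?h t)" using t by (intro ou_value_gt_iff horizon_pos[OF \<gamma>]) auto
      also have "\<dots> \<longleftrightarrow> z < b t" unfolding b_def using s by (simp add: field_simps)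
      finally show ?thesis .
    qed
    then show ?thesis unfolding continuation_region_def by auto
  qed
  have beq: "boundary_equation (normal_prior m \<gamma>) M Z b"
    unfolding boundary_equation_def
  proof
    fix t :: real assume t: "t \<in> {0..<1}"
    have "premium ou_boundary (?h t) (ou_boundary (?h t)) = ou_boundary (?h t)"
      using ou_value_eq_premium[OF horizon_nonneg[OF \<gamma>, of t], of "ou_boundary (?h t)"] t
        ou_value_above_boundary[of "?h t" "ou_boundary (?h t)"] by simp
    then have "b t = ?k + 1 / ?s t * premium ou_boundary (?h t) (ou_boundary (?h t))"
      using eq_iff[of t ou_boundary b] bs[of t] t by auto
    also have "\<dots> = posterior_mean (normal_prior m \<gamma>) t (b t) -
          (LINT u:{0..<1 - t}|lborel.
             (\<integral>\<omega>. drift (normal_prior m \<gamma>) (t + u) (Z t (b t) (t + u) \<omega>) *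
                   indicator {y. y > b (t + u)} (Z t (b t) (t + u) \<omega>) \<partial>M t (b t)))"
      by (rule equation[OF t ou_boundary_measurable bs[OF less_imp_le], symmetric])
    finally show "b t = posterior_mean (normal_prior m \<gamma>) t (b t) -
          (LINT u:{0..<1 - t}|lborel.
             (\<integral>\<omega>. drift (normal_prior m \<gamma>) (t + u) (Z t (b t) (t + u) \<omega>) *
                   indicator {y. y > b (t + u)} (Z t (b t) (t + u) \<omega>) \<partial>M t (b t)))" .
  qed
  have ge: "\<forall>t\<in>{0..1}. ?k \<le> b t"
    using ou_boundary_nonneg scale_pos[OF \<gamma>] by (auto simp: b_def intro!: divide_nonneg_pos)
  have uniq: "\<forall>t\<in>{0..1}. c t = b t"
    if c: "continuous_on {0..1} c" "boundary_equation (normal_prior m \<gamma>) M Z c" "\<forall>t\<in>{0..1}. ?k \<le> c t" for c :: "real \<Rightarrow> real"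
  proof -
    \<comment> \<open>The locale asks for a continuous non-negative function on the whole line;
      clamping the clock to \<open>[0, 1]\<close> extends the rescaled candidate by constants beyond
      the horizons that occur.\<close>
    define p where "p r = max 0 (min 1 (clock \<gamma> r))" for r
    define g where "g r = ?s (p r) * (c (p r) - ?k)" for r
    have p01: "p r \<in> {0..1}" for r by (simp add: p_def)
    have ph: "p (?h s) = s" if "0 \<le> s" "s < 1" for s
      using clock_horizon[OF \<gamma>, of s] that by (simp add: p_def)
    have gh: "g (?h s) = ?s s * (c s - ?k)" if "0 \<le> s" "s < 1" for s
      by (simp add: g_def ph[OF that])
    have gcont: "isCont g r" for r
    proof -
      have "continuous_on UNIV p"
        unfolding p_def by (intro continuous_intros continuous_at_imp_continuous_on) (simp add: clock_isCont[OF \<gamma>])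
      then have "continuous_on UNIV (\<lambda>r. ?s (p r))" "continuous_on UNIV (\<lambda>r. c (p r))"
        using p01 by (auto intro!: continuous_on_compose2[OF scale_continuous[OF \<gamma>]] continuous_on_compose2[OF c(1)])
      then have "continuous_on UNIV g" unfolding g_def by (intro continuous_intros)
      then show ?thesis by (simp add: continuous_on_eq_continuous_at)
    qed
    have gm: "g \<in> borel_measurable borel" by (rule continuous_imp_borel[OF gcont])
    interpret integral_equation_solution g "?h 0"
    proof
      show "isCont g r" for r by (rule gcont)
      show "0 \<le> g r" for r
        using c(3) p01[of r] scale_pos[OF \<gamma>, of "p r"] by (auto simp: g_def intro!: mult_nonneg_nonneg)
      show "0 \<le> ?h 0" by (rule horizon_nonneg[OF \<gamma>]) simp
      fix r assume r: "0 < r" "r \<le> ?h 0"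
      define t where "t = clock \<gamma> r"
      have hr: "?h t = r" unfolding t_def by (rule horizon_clock[OF \<gamma>])
      have "clock \<gamma> (?h 0) \<le> t" unfolding t_def using r by (intro clock_antimono[OF \<gamma>])
      then have t0: "0 \<le> t" using clock_horizon[OF \<gamma>, of 0] by simp
      have "t \<noteq> 1" using hr r horizon_1[OF \<gamma>] by auto
      moreover have "t \<le> 1" unfolding t_def using clock_antimono[OF \<gamma>, of 0 r] clock_0[OF \<gamma>] r by simp
      ultimately have t: "t \<in> {0..<1}" using t0 by simp
      have "c t = ?k + 1 / ?s t * premium g (?h t) (g (?h t))"
        using c(2) t equation[OF t gm gh] unfolding boundary_equation_def by auto
      then show "premium g r (g r) = g r" using eq_iff[of t g c] gh[of t] t hr by auto
    qed
    have lt: "c t = b t" if t: "t \<in> {0..<1}" for t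
    proof -
      have s: "0 < ?s t" using t by (intro scale_pos[OF \<gamma>]) auto
      have "g (?h t) = ou_boundary (?h t)"
        using t horizon_pos[OF \<gamma>, of t] horizon_antimono[OF \<gamma>, of 0 t] by (intro eq_ou_boundary) auto
      then have "?s t * (c t - ?k) = ?s t * (b t - ?k)" using gh[of t] bs[of t] t by auto
      then show ?thesis using s by simp
    qed
    \<comment> \<open>The equation is imposed only for \<open>t < 1\<close>; at 1 the two functions
      agree by continuity.\<close>
    have "c 1 = b 1"
    proof -
      define S where "S n = 1 - 1 / (real n + 2)" for n
      have S: "S n \<in> {0..<1}" for n by (simp add: S_def field_simps)
      have "(\<lambda>n. 1 / (real n + 2)) \<longlonglongrightarrow> 0"
        by (intro tendsto_divide_0[OF tendsto_const] filterlim_at_top_imp_at_infinity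
            filterlim_tendsto_add_at_top[OF tendsto_const filterlim_real_sequentially, of 2, simplified add.commute])
      from tendsto_diff[OF tendsto_const[of 1] this] have S1: "S \<longlonglongrightarrow> 1" by (simp add: S_def[abs_def])
      have ev: "\<forall>\<^sub>F n in sequentially. S n \<in> {0..1}" using S by (intro always_eventually) (auto simp: less_imp_le)
      have "(\<lambda>n. c (S n)) \<longlonglongrightarrow> c 1" "(\<lambda>n. b (S n)) \<longlonglongrightarrow> b 1"
        by (intro continuous_on_tendsto_compose[OF c(1) S1] continuous_on_tendsto_compose[OF bcont S1] ev; simp)+
      then show ?thesis using lt[OF S] LIMSEQ_unique by simp
    qed
    then show ?thesis using lt by (metis atLeastAtMost_iff atLeastLessThan_iff order_le_less)
  qed
  show ?thesis
    by (intro exI[of _ b] conjI anti bcont b1 region beq ge allI impI uniq) auto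
qed

end
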